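(* After reducing by the group of volume-preserving diffeomorphisms (symplectic reduction of $T^*Q$ by $\mathrm{Diff}_{\mathrm{vol}}$ at the momentum value $\mu$ given by the vorticity of $N$ point vortices), the reduced phase space $(T^*Q)_\mu$ is given by $T^*SE(2)\times\mathbb{R}^{2N}$.
   Context: A planar rigid body occupies a circular region $\mathcal{B}_0$ in the reference configuration, and the remainder $\mathcal{F}_0$ of the plane is filled by the fluid, with fixed area element $\eta_0$. $Q$ is the (formal, infinite-dimensional) manifold of pairs $(g,\varphi)$ with $g\in SE(2)$ (acting on $\mathbb{R}^2$ by rotations and translations) and $\varphi:\mathcal{F}_0\hookrightarrow\mathbb{R}^2$ an embedding that is volume-preserving ($\varphi^*(d\mathbf{x})=\eta_0$, $d\mathbf{x}$ the Euclidean area element), approaches the identity at infinity suitably fast, and satisfies $\varphi(\partial\mathcal{F}_0)=g(\partial\mathcal{B}_0)$ as sets. $\mathrm{Diff}_{\mathrm{vol}}$ is the group of volume-preserving diffeomorphisms of $\mathcal{F}_0$, acting on $Q$ from the right by $(g,\varphi)\cdot\phi=(g,\varphi\circ\phi)$ and on $T^*Q$ by cotangent lift, with momentum map $J$. Its Lie algebra $\mathfrak{X}_{\mathrm{vol}}$ consists of the divergence-free vector fields on $\mathcal{F}_0$ parallel to the boundary, with dual $\mathfrak{X}_{\mathrm{vol}}^*=\Omega^1(\mathcal{F}_0)/\mathbf{d}\Omega^0(\mathcal{F}_0)$; since the circulation around the body is assumed to be zero, a class $[\alpha]$ is determined by, and identified with, the vorticity two-form $\mathbf{d}\alpha$. The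 value $\mu$ is the vorticity of $N$ point vortices, $$\mu=\sum_{i=1}^N\Gamma_i\,\delta(\bar{\mathbf{x}}-\bar{\mathbf{x}}_i)\,\mathbf{d}\bar x\wedge\mathbf{d}\bar y,$$ with strengths $\Gamma_i$ and reference locations $\bar{\mathbf{x}}_i\in\mathcal{F}_0$. Its isotropy group $\mathrm{Diff}_{\mathrm{vol},\mu}$ under the co-adjoint action (pull-back) consists of the $\phi\in\mathrm{Diff}_{\mathrm{vol}}$ with $\phi(\bar{\mathbf{x}}_i)=\bar{\mathbf{x}}_i$ for $i=1,\dots,N$. The reduced phase space is $(T^*Q)_\mu=J^{-1}(\mu)/\mathrm{Diff}_{\mathrm{vol},\mu}$. The quotient $Q/\mathrm{Diff}_{\mathrm{vol},\mu}$ is identified with $SE(2)\times\mathbb{R}^{2N}$ through $(g,\varphi)\mapsto(g;\varphi(\bar{\mathbf{x}}_1),\dots,\varphi(\bar{\mathbf{x}}_N))$, and $(T^*Q)_\mu$ is realized, via the symplectic embedding of cotangent bundle reduction, as the subbundle of $T^*(SE(2)\times\mathbb{R}^{2N})$ annihilating the projection to $Q/\mathrm{Diff}_{\mathrm{vol},\mu}$ of the vectors tangent to the $\mathrm{Diff}_{\mathrm{vol}}$-orbits in $Q$.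
   Formalization: Over each g, R^{2N} is replaced by the open dense set of distinct vortex positions outside the moved body, since no configuration in Q lies over other points; the reference vortices are assumed distinct and interior to F_0, and Q nonempty, as the claim fails otherwise. *)

theory Defs
  imports "HOL-Analysis.Analysis" "HOL-Library.Landau_Symbols"
begin

section \<open>Smooth maps and linear functionals\<close>

definition dir_deriv :: "'a \<Rightarrow> ('a::real_normed_vector \<Rightarrow> 'b::real_normed_vector) \<Rightarrow> 'a \<Rightarrow> 'b" where
  "dir_deriv v f = (\<lambda>x. frechet_derivative f (at x) v)"

text \<open>\<open>foldr dir_deriv vs f\<close> is the iterated directional derivative of \<open>f\<close> along the list \<open>vs\<close>.
  On a set with boundary, smoothness means local extendability to a \<open>C\<^sup>\<infinity>\<close> map on an open set.\<close>

definition smooth_on :: "'a set \<Rightarrow> ('a::real_normed_vector \<Rightarrow> 'b::real_normed_vector) \<Rightarrow> bool" where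
  "smooth_on S f \<longleftrightarrow>
     (\<forall>x\<in>S. \<exists>U f'. open U \<and> x \<in> U \<and> (\<forall>vs. foldr dir_deriv vs f' differentiable_on U) \<and>
        (\<forall>y\<in>S \<inter> U. f' y = f y))"

text \<open>Decay at infinity of a map and of all its derivatives at the rate \<open>|x|\<^sup>-\<^sup>s\<close>.\<close>

definition decays :: "real \<Rightarrow> ('a::real_normed_vector \<Rightarrow> 'b::real_normed_vector) \<Rightarrow> bool" where
  "decays s f \<longleftrightarrow>
     (\<forall>vs. (\<lambda>x. norm (foldr dir_deriv vs f x)) \<in> O[at_infinity](\<lambda>x. norm x powr (- s)))"

text \<open>Algebraic dual of a space \<open>V\<close> with given addition and scaling.  Functionals are extensional
  (\<open>undefined\<close> off \<open>V\<close>), so that equality of functionals is equality on \<open>V\<close>.\<close>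

definition dual_space ::
    "('v \<Rightarrow> 'v \<Rightarrow> 'v) \<Rightarrow> (real \<Rightarrow> 'v \<Rightarrow> 'v) \<Rightarrow> 'v set \<Rightarrow> ('v \<Rightarrow> real) set" where
  "dual_space add scl V =
     {p \<in> extensional V. (\<forall>u\<in>V. \<forall>v\<in>V. p (add u v) = p u + p v) \<and> (\<forall>c. \<forall>v\<in>V. p (scl c v) = c * p v)}"


section \<open>The group SE(2)\<close>

type_synonym plane = "real^2"
type_synonym rigid = "(real^2^2) \<times> plane"

definition SE2 :: "rigid set" where
  "SE2 = {(A, c). rotation_matrix A}"

definition act :: "rigid \<Rightarrow> plane \<Rightarrow> plane" where
  "act g x = fst g *v x + snd g"

text \<open>The condition is the linearization of \<open>transpose A ** A = mat 1\<close>; the condition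
  \<open>det A = 1\<close> is locally constant on orthogonal matrices and contributes nothing.\<close>

definition T_SE2 :: "rigid \<Rightarrow> rigid set" where
  "T_SE2 g = {(A', c'). transpose (fst g) ** A' + transpose A' ** fst g = 0}"

definition cotangent_SE2 :: "(rigid \<times> (rigid \<Rightarrow> real)) set" where
  "cotangent_SE2 = {(g, p). g \<in> SE2 \<and> p \<in> dual_space (+) (*\<^sub>R) (T_SE2 g)}"

text \<open>Spatial velocity field \<open>g' g\<^sup>-\<^sup>1\<close> of the rigid motion with velocity \<open>g'\<close> at \<open>g\<close>.\<close>

definition rigid_velocity :: "rigid \<Rightarrow> rigid \<Rightarrow> plane \<Rightarrow> plane" where
  "rigid_velocity g g' y = fst g' *v (transpose (fst g) *v (y - snd g)) + snd g'"


section \<open>The body, the fluid and the configuration space\<close>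

text \<open>The fluid area element is \<open>\<eta>\<^sub>0 = density dx \<and> dy\<close>; \<open>rate\<close> is the exponent of
  the decay conditions at infinity.\<close>

record body_fluid =
  centre :: plane
  radius :: real
  density :: "plane \<Rightarrow> real"
  rate :: real

definition body :: "body_fluid \<Rightarrow> plane set" where
  "body S = cball (centre S) (radius S)"

definition fluid :: "body_fluid \<Rightarrow> plane set" where
  "fluid S = - ball (centre S) (radius S)"

definition jac :: "plane set \<Rightarrow> (plane \<Rightarrow> plane) \<Rightarrow> plane \<Rightarrow> real^2^2" where
  "jac X f x = matrix (frechet_derivative f (at x within X))"

definition divergence :: "plane set \<Rightarrow> (plane \<Rightarrow> plane) \<Rightarrow> plane \<Rightarrow> real" where
  "divergence X u x = trace (jac X u x)"

text \<open>Embeddings and diffeomorphisms of the fluid region are extensional functions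
  (\<open>undefined\<close> off \<open>fluid S\<close>), vector fields on it are \<open>0\<close> off \<open>fluid S\<close>.\<close>

type_synonym conf = "rigid \<times> (plane \<Rightarrow> plane)"

definition Q :: "body_fluid \<Rightarrow> conf set" where
  "Q S = {(g, \<phi>). g \<in> SE2 \<and>
      \<phi> \<in> extensional (fluid S) \<and>
      smooth_on (fluid S) \<phi> \<and>
      (\<exists>\<psi>. homeomorphism (fluid S) (\<phi> ` fluid S) \<phi> \<psi>) \<and>
      (\<forall>x\<in>fluid S. inj (frechet_derivative \<phi> (at x within fluid S))) \<and>
      (\<forall>x\<in>fluid S. det (jac (fluid S) \<phi> x) = density S x) \<and>
      decays (rate S) (\<lambda>x. \<phi> x - x) \<and>
      \<phi> ` frontier (fluid S) = act g ` frontier (body S)}"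

text \<open>Linearization of the conditions defining \<open>Q\<close>: the Eulerian velocity \<open>u = w \<circ> \<phi>\<^sup>-\<^sup>1\<close> is
  divergence free, and on the boundary of the moved body, whose normal at \<open>y\<close> is
  \<open>y - act g (centre S)\<close>, it has the same normal component as the velocity of the body.\<close>

type_synonym conf_vel = "rigid \<times> (plane \<Rightarrow> plane)"

definition TQ :: "body_fluid \<Rightarrow> conf \<Rightarrow> conf_vel set" where
  "TQ S q = (case q of (g, \<phi>) \<Rightarrow>
     {(g', w). g' \<in> T_SE2 g \<and>
        (\<forall>x. x \<notin> fluid S \<longrightarrow> w x = 0) \<and>
        smooth_on (fluid S) w \<and>
        decays (rate S) w \<and>
        (\<forall>y\<in>\<phi> ` fluid S. divergence (\<phi> ` fluid S) (\<lambda>y. w (inv_into (fluid S) \<phi> y)) y = 0) \<and>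
        (\<forall>x\<in>frontier (fluid S).
           (w x - rigid_velocity g g' (\<phi> x)) \<bullet> (\<phi> x - act g (centre S)) = 0)})"

definition vel_add :: "conf_vel \<Rightarrow> conf_vel \<Rightarrow> conf_vel" where
  "vel_add v v' = (fst v + fst v', \<lambda>x. snd v x + snd v' x)"

definition vel_scale :: "real \<Rightarrow> conf_vel \<Rightarrow> conf_vel" where
  "vel_scale c v = (c *\<^sub>R fst v, \<lambda>x. c *\<^sub>R snd v x)"

definition cotangent_Q :: "body_fluid \<Rightarrow> (conf \<times> (conf_vel \<Rightarrow> real)) set" where
  "cotangent_Q S = {(q, \<alpha>). q \<in> Q S \<and> \<alpha> \<in> dual_space vel_add vel_scale (TQ S q)}"


section \<open>Volume-preserving diffeomorphisms and their action\<close>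

definition Diff_vol :: "body_fluid \<Rightarrow> (plane \<Rightarrow> plane) set" where
  "Diff_vol S = {f. f \<in> extensional (fluid S) \<and>
      bij_betw f (fluid S) (fluid S) \<and>
      smooth_on (fluid S) f \<and>
      smooth_on (fluid S) (inv_into (fluid S) f) \<and>
      (\<forall>x\<in>fluid S. density S (f x) * det (jac (fluid S) f x) = density S x) \<and>
      decays (rate S) (\<lambda>x. f x - x)}"

text \<open>Lie algebra of \<open>Diff_vol\<close>; the divergence with respect to \<open>\<eta>\<^sub>0\<close> vanishes iff the
  Euclidean divergence of \<open>density \<cdot> \<xi>\<close> does.\<close>

definition X_vol :: "body_fluid \<Rightarrow> (plane \<Rightarrow> plane) set" where
  "X_vol S = {\<xi>. (\<forall>x. x \<notin> fluid S \<longrightarrow> \<xi> x = 0) \<and>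
      smooth_on (fluid S) \<xi> \<and>
      decays (rate S) \<xi> \<and>
      (\<forall>x\<in>fluid S. divergence (fluid S) (\<lambda>x. density S x *\<^sub>R \<xi> x) x = 0) \<and>
      (\<forall>x\<in>frontier (fluid S). \<xi> x \<bullet> (x - centre S) = 0)}"

definition conf_act :: "body_fluid \<Rightarrow> (plane \<Rightarrow> plane) \<Rightarrow> conf \<Rightarrow> conf" where
  "conf_act S f q = (fst q, compose (fluid S) (snd q) f)"

definition vel_act :: "body_fluid \<Rightarrow> (plane \<Rightarrow> plane) \<Rightarrow> conf_vel \<Rightarrow> conf_vel" where
  "vel_act S f v = (fst v, \<lambda>x. if x \<in> fluid S then snd v (f x) else 0)"

definition diff_inv :: "body_fluid \<Rightarrow> (plane \<Rightarrow> plane) \<Rightarrow> plane \<Rightarrow> plane" where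
  "diff_inv S f = restrict (inv_into (fluid S) f) (fluid S)"

definition cotangent_lift ::
    "body_fluid \<Rightarrow> (plane \<Rightarrow> plane) \<Rightarrow> conf \<times> (conf_vel \<Rightarrow> real) \<Rightarrow> conf \<times> (conf_vel \<Rightarrow> real)" where
  "cotangent_lift S f z =
     (conf_act S f (fst z),
      restrict (\<lambda>v. snd z (vel_act S (diff_inv S f) v)) (TQ S (conf_act S f (fst z))))"

text \<open>The velocity at \<open>q = (g, \<phi>)\<close> of \<open>t \<mapsto> (g, \<phi> \<circ> exp (t \<xi>))\<close>.  The vectors
  tangent to the \<open>Diff_vol\<close>-orbit through \<open>q\<close> are the \<open>generator S \<xi> q\<close> with \<open>\<xi> \<in> X_vol S\<close>.\<close>

definition generator :: "body_fluid \<Rightarrow> (plane \<Rightarrow> plane) \<Rightarrow> conf \<Rightarrow> conf_vel" where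
  "generator S \<xi> q =
     (0, \<lambda>x. if x \<in> fluid S then jac (fluid S) (snd q) x *v \<xi> x else 0)"

definition momentum :: "body_fluid \<Rightarrow> conf \<times> (conf_vel \<Rightarrow> real) \<Rightarrow> (plane \<Rightarrow> plane) \<Rightarrow> real" where
  "momentum S z = restrict (\<lambda>\<xi>. snd z (generator S \<xi> (fst z))) (X_vol S)"

text \<open>Pull-back \<open>f\<^sup>* \<xi>\<close> of a vector field, i.e. the adjoint action of \<open>f\<^sup>-\<^sup>1\<close>, and the dual
  action on the dual of \<open>X_vol\<close>, which on classes of one-forms is pull-back by \<open>f\<^sup>-\<^sup>1\<close>.\<close>

definition pull_field :: "body_fluid \<Rightarrow> (plane \<Rightarrow> plane) \<Rightarrow> (plane \<Rightarrow> plane) \<Rightarrow> plane \<Rightarrow> plane" where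
  "pull_field S f \<xi> =
     (\<lambda>x. if x \<in> fluid S then matrix_inv (jac (fluid S) f x) *v \<xi> (f x) else 0)"

definition coadjoint ::
    "body_fluid \<Rightarrow> (plane \<Rightarrow> plane) \<Rightarrow> ((plane \<Rightarrow> plane) \<Rightarrow> real) \<Rightarrow> (plane \<Rightarrow> plane) \<Rightarrow> real" where
  "coadjoint S f m = restrict (\<lambda>\<xi>. m (pull_field S f \<xi>)) (X_vol S)"


section \<open>Point vortices and the reduced phase space\<close>

text \<open>A one-form \<open>\<alpha> = a$1 dx + a$2 dy\<close> as an element of the dual of \<open>X_vol\<close>:
  the integral over the fluid of \<open>\<alpha>(\<xi>) \<eta>\<^sub>0\<close>.\<close>

definition form_class :: "body_fluid \<Rightarrow> (plane \<Rightarrow> plane) \<Rightarrow> (plane \<Rightarrow> plane) \<Rightarrow> real" where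
  "form_class S a =
     restrict (\<lambda>\<xi>. integral (fluid S) (\<lambda>x. (a x \<bullet> \<xi> x) * density S x)) (X_vol S)"

text \<open>The form \<open>\<alpha>\<close> has vorticity \<open>d\<alpha> = \<Sum>\<^sub>i \<Gamma>\<^sub>i \<delta>(x - x\<^sub>i) dx \<and> dy\<close> in the sense of
  distributions, and no circulation around the body.  For a test function \<open>\<psi>\<close> that is constant
  on the body, Stokes' theorem for \<open>d(\<psi> \<alpha>)\<close> says that the integral of \<open>\<alpha> \<and> d\<psi>\<close> equals
  that of \<open>\<psi> d\<alpha>\<close> plus the value of \<open>\<psi>\<close> on the body times the circulation of \<open>\<alpha>\<close>
  around the body.  As that value may be nonzero, the equation below contains the absence of
  circulation.\<close>

definition has_vortices :: "body_fluid \<Rightarrow> real^'n::finite \<Rightarrow> plane^'n \<Rightarrow> (plane \<Rightarrow> plane) \<Rightarrow> bool" where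
  "has_vortices S \<Gamma> xbar a \<longleftrightarrow>
     (\<forall>K. compact K \<and> K \<subseteq> fluid S \<longrightarrow> a absolutely_integrable_on K) \<and>
     (\<lambda>x. norm (a x)) \<in> O[at_infinity](\<lambda>x. 1 / norm x) \<and>
     (\<forall>\<psi> :: plane \<Rightarrow> real.
        smooth_on UNIV \<psi> \<and> bounded {x. \<psi> x \<noteq> 0} \<and> (\<exists>k. \<forall>x\<in>body S. \<psi> x = k) \<longrightarrow>
        integral (fluid S)
          (\<lambda>x. a x $ 1 * dir_deriv (axis 2 1) \<psi> x - a x $ 2 * dir_deriv (axis 1 1) \<psi> x)
        = (\<Sum>i\<in>UNIV. \<Gamma> $ i * \<psi> (xbar $ i)))"

text \<open>The subgroup fixing every (labelled) vortex.  It is contained in the stabilizer of the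
  vorticity, which can be larger when some strengths coincide or vanish.\<close>

definition Diff_vol_mu :: "body_fluid \<Rightarrow> plane^'n::finite \<Rightarrow> (plane \<Rightarrow> plane) set" where
  "Diff_vol_mu S xbar = {f \<in> Diff_vol S. \<forall>i. f (xbar $ i) = xbar $ i}"

definition momentum_level ::
    "body_fluid \<Rightarrow> ((plane \<Rightarrow> plane) \<Rightarrow> real) \<Rightarrow> (conf \<times> (conf_vel \<Rightarrow> real)) set" where
  "momentum_level S \<mu> = {z \<in> cotangent_Q S. momentum S z = \<mu>}"

definition orbit_rel ::
    "body_fluid \<Rightarrow> plane^'n::finite \<Rightarrow> ((plane \<Rightarrow> plane) \<Rightarrow> real) \<Rightarrow>
     ((conf \<times> (conf_vel \<Rightarrow> real)) \<times> (conf \<times> (conf_vel \<Rightarrow> real))) set" where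
  "orbit_rel S xbar \<mu> =
     {(z, z'). z \<in> momentum_level S \<mu> \<and> z' \<in> momentum_level S \<mu> \<and>
        (\<exists>f\<in>Diff_vol_mu S xbar. z' = cotangent_lift S f z)}"

definition reduced_space ::
    "body_fluid \<Rightarrow> plane^'n::finite \<Rightarrow> ((plane \<Rightarrow> plane) \<Rightarrow> real) \<Rightarrow>
     (conf \<times> (conf_vel \<Rightarrow> real)) set set" where
  "reduced_space S xbar \<mu> = momentum_level S \<mu> // orbit_rel S xbar \<mu>"


section \<open>Cotangent bundle reduction\<close>

text \<open>The map inducing the identification of \<open>Q / Diff_vol_mu\<close> with pairs of a rigid motion
  and vortex positions, and its tangent map.\<close>

definition proj :: "plane^'n::finite \<Rightarrow> conf \<Rightarrow> rigid \<times> (plane^'n)" where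
  "proj xbar q = (fst q, \<chi> i. snd q (xbar $ i))"

definition T_proj :: "plane^'n::finite \<Rightarrow> conf_vel \<Rightarrow> rigid \<times> (plane^'n)" where
  "T_proj xbar v = (fst v, \<chi> i. snd v (xbar $ i))"

definition annihilator_bundle ::
    "body_fluid \<Rightarrow> plane^'n::finite \<Rightarrow> ((rigid \<times> (plane^'n)) \<times> (rigid \<times> (plane^'n) \<Rightarrow> real)) set" where
  "annihilator_bundle S xbar =
     {(m, \<beta>). m \<in> proj xbar ` Q S \<and> \<beta> \<in> dual_space (+) (*\<^sub>R) (T_SE2 (fst m) \<times> UNIV) \<and>
        (\<forall>q\<in>Q S. proj xbar q = m \<longrightarrow> (\<forall>\<xi>\<in>X_vol S. \<beta> (T_proj xbar (generator S \<xi> q)) = 0))}"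

text \<open>\<open>T\<^sup>*SE(2) \<times> \<real>\<^sup>2\<^sup>N\<close>, where over \<open>g\<close> the vortex positions range over the open dense
  set of collision-free configurations outside the moved body.\<close>

definition cotangent_SE2_vortices ::
    "body_fluid \<Rightarrow> ((rigid \<times> (rigid \<Rightarrow> real)) \<times> (plane^'n::finite)) set" where
  "cotangent_SE2_vortices S =
     {((g, p), x). (g, p) \<in> cotangent_SE2 \<and>
        (\<forall>i. x $ i \<notin> act g ` body S) \<and> (\<forall>i j. i \<noteq> j \<longrightarrow> x $ i \<noteq> x $ j)}"

text \<open>The inclusion of \<open>T\<^sup>*SE(2) \<times> \<real>\<^sup>2\<^sup>N\<close> into \<open>T\<^sup>*(SE(2) \<times> \<real>\<^sup>2\<^sup>N)\<close> as the covectors that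
  vanish in the vortex directions.\<close>

definition incl ::
    "(rigid \<times> (rigid \<Rightarrow> real)) \<times> (plane^'n::finite) \<Rightarrow>
     (rigid \<times> (plane^'n)) \<times> (rigid \<times> (plane^'n) \<Rightarrow> real)" where
  "incl z = (case z of ((g, p), x) \<Rightarrow> ((g, x), restrict (\<lambda>v. p (fst v)) (T_SE2 g \<times> UNIV)))"

text \<open>Principal connections on \<open>Q\<close> for the right action of \<open>Diff_vol\<close>.\<close>

definition principal_connection :: "body_fluid \<Rightarrow> (conf \<Rightarrow> conf_vel \<Rightarrow> plane \<Rightarrow> plane) \<Rightarrow> bool" where
  "principal_connection S \<A> \<longleftrightarrow> (\<forall>q\<in>Q S.
     (\<forall>v\<in>TQ S q. \<A> q v \<in> X_vol S) \<and>
     (\<forall>v\<in>TQ S q. \<forall>v'\<in>TQ S q. \<A> q (vel_add v v') = (\<lambda>x. \<A> q v x + \<A> q v' x)) \<and>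
     (\<forall>c. \<forall>v\<in>TQ S q. \<A> q (vel_scale c v) = (\<lambda>x. c *\<^sub>R \<A> q v x)) \<and>
     (\<forall>\<xi>\<in>X_vol S. \<A> q (generator S \<xi> q) = \<xi>) \<and>
     (\<forall>f\<in>Diff_vol S. \<forall>v\<in>TQ S q. \<A> (conf_act S f q) (vel_act S f v) = pull_field S f (\<A> q v)))"

text \<open>\<open>\<Phi>\<close> is induced by the embedding of cotangent bundle reduction: the class of a covector
  \<open>\<alpha>\<close> at \<open>q\<close> goes to the covector \<open>\<beta>\<close> at \<open>proj q\<close> whose pull-back by the tangent map of
  \<open>proj\<close> is \<open>\<alpha> - \<langle>\<mu>, \<A>\<rangle>\<close>.\<close>

definition realizes_reduction ::
    "body_fluid \<Rightarrow> plane^'n::finite \<Rightarrow> ((plane \<Rightarrow> plane) \<Rightarrow> real) \<Rightarrow>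
     (conf \<Rightarrow> conf_vel \<Rightarrow> plane \<Rightarrow> plane) \<Rightarrow>
     ((conf \<times> (conf_vel \<Rightarrow> real)) set \<Rightarrow> (rigid \<times> (rigid \<Rightarrow> real)) \<times> (plane^'n)) \<Rightarrow> bool" where
  "realizes_reduction S xbar \<mu> \<A> \<Phi> \<longleftrightarrow>
     (\<forall>(q, \<alpha>)\<in>momentum_level S \<mu>.
        let (m, \<beta>) = incl (\<Phi> (orbit_rel S xbar \<mu> `` {(q, \<alpha>)}))
        in m = proj xbar q \<and> (\<forall>v\<in>TQ S q. \<beta> (T_proj xbar v) = \<alpha> v - \<mu> (\<A> q v)))"

end

theory Submission
  imports Defs
begin

text \<open>
  Functionals in \<open>T\<^sup>*Q\<close> on the momentum level are compared with covectors of the rigid motion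
  by momentum shifting. Let \<open>\<A>\<close> be a principal connection and \<open>\<alpha>\<close> a covector
  at \<open>q = (g, \<phi>)\<close> with momentum \<open>\<mu>\<close>. The shifted covector \<open>\<alpha> -
  \<langle>\<mu>, \<A>\<rangle>\<close> vanishes on the vectors \<open>generator S \<xi> q\<close>, and these
  are exactly the tangent vectors whose \<open>SE(2)\<close>-component is zero, because a fluid velocity tangent
  to the boundary of the body at rest is the velocity of a relabelling (\<open>generator_TQ\<close>,
  \<open>generator_pull\<close>). So the shifted covector depends on the velocity of the body only and is a
  covector of \<open>SE(2)\<close> at \<open>g\<close> (\<open>shifted_horizontal\<close>). Together with the
  vortex positions \<open>\<phi>(x\<^sub>i)\<close> it is a complete invariant of the
  \<open>Diff_vol_mu\<close>-orbit (\<open>orbit_rel_iff\<close>): two configurations with the same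
  \<open>g\<close> and the same vortex positions differ by the relabelling \<open>\<phi>\<^sub>1\<^sup>-\<^sup>1
  \<circ> \<phi>\<^sub>2\<close>, which fixes the vortices, and \<open>\<langle>\<mu>, \<A>\<rangle>\<close> is
  invariant under \<open>Diff_vol_mu\<close>. All values occur (\<open>reduced_coord_surj\<close>), and the
  resulting bijection realizes the reduction by construction.

  Three analytic facts carry this argument.

  The momentum \<open>\<mu>\<close> is the sum of point evaluations of stream functions
  (\<open>\<mu>_stream\<close>): for \<open>\<xi> \<in> X_vol S\<close> the solenoidal field \<open>density
  \<cdot> \<xi>\<close> has a stream function \<open>\<psi>\<close> that vanishes at infinity and tends to a
  constant at the body, and \<open>\<mu> \<xi> = \<Sum>\<^sub>i \<Gamma>\<^sub>i \<psi>(x\<^sub>i)\<close>. The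
  stream function has unbounded support and is smooth only off the body, so it is approximated by test functions
  to which the definition of the vorticity applies (\<open>vortex_pairing\<close>). Since the stream function of
  \<open>f\<^sup>* \<xi>\<close> is \<open>\<psi> \<circ> f\<close>, the formula shows that \<open>\<mu>\<close>
  is linear and invariant under \<open>Diff_vol_mu\<close>, and testing it on bump functions yields the isotropy
  group (\<open>isotropy_eq\<close>).

  The pairs of a rigid motion and vortex positions that come from \<open>Q\<close> are those for which the
  vortices are distinct and outside the moved body (\<open>proj_Q\<close>). Given one configuration, the others
  are reached by composing it with compactly supported area-preserving maps of the plane, built from rotations
  about a point whose angle depends on the distance (\<open>half_turn\<close>, \<open>move_points\<close>).
  Fields in \<open>X_vol S\<close> take arbitrary values at the vortices
  (\<open>X_vol_prescribed_values\<close>), so the covectors annihilating the projected orbits are those of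
  \<open>SE(2)\<close> (\<open>annihilator_bundle_eq\<close>).

  A principal connection exists: drag the fluid near the body along with it and cut off the stream function of
  this rigid velocity field (\<open>principal_connection_cutoff\<close>).

  All of this takes place on regions with boundary and with decay at infinity. Two tools make this manageable:
  the maps in \<open>Q\<close> and in \<open>Diff_vol\<close> are treated at once as diffeomorphisms
  \<open>near_id\<close> between exteriors of discs whose inverses decay as well (\<open>near_idI\<close>), and
  conditions on divergences are transported along such maps by Piola's identity (\<open>piola\<close>).
\<close>

section \<open>Smooth maps with decay at infinity\<close>

text \<open>The index \<open>None\<close> imposes nothing at infinity and \<open>Some s\<close> the decay rate
  \<open>|x|\<^sup>-\<^sup>s\<close>. With it the calculus of smooth maps and that of smooth maps with decaying
  derivatives need to be developed only once.\<close>

definition bnd :: "real option \<Rightarrow> ('a::real_normed_vector \<Rightarrow> 'b::real_normed_vector) \<Rightarrow> bool" where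
  "bnd w f \<longleftrightarrow> (case w of None \<Rightarrow> True
     | Some s \<Rightarrow> (\<lambda>x. norm (f x)) \<in> O[at_infinity](\<lambda>x. norm x powr (- s)))"

text \<open>The recursion strips the derivative that is taken first. The product and the chain rule then become
  inductions on \<open>n\<close> in which only first derivatives have to be computed.\<close>

primrec Ck :: "nat \<Rightarrow> 'a set \<Rightarrow> real option \<Rightarrow> ('a::real_normed_vector \<Rightarrow> 'b::real_normed_vector) \<Rightarrow> bool" where
  "Ck 0 U w f \<longleftrightarrow> bnd w f"
| "Ck (Suc n) U w f \<longleftrightarrow> bnd w f \<and> f differentiable_on U \<and> (\<forall>v. Ck n U w (dir_deriv v f))"

text \<open>Decay can be read off from the values on \<open>U\<close> only if \<open>U\<close> is a
  neighbourhood of infinity.\<close>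

definition adm :: "'a::real_normed_vector set \<Rightarrow> real option \<Rightarrow> bool" where
  "adm U w \<longleftrightarrow> open U \<and> (w = None \<or> (\<forall>\<^sub>F x in at_infinity. x \<in> U))"

text \<open>Keeps boundedness at infinity but drops the rate: a product decays as soon as one factor does and
  the other one is bounded together with its derivatives.\<close>

abbreviation flat :: "real option \<Rightarrow> real option" where
  "flat w \<equiv> map_option (\<lambda>_. 0) w"

lemma adm_flat [simp]: "adm U (flat w) = adm U w"
  by (auto simp: adm_def)

lemma dir_deriv_eq: "(f has_derivative D) (at x) \<Longrightarrow> dir_deriv v f x = D v"
  unfolding dir_deriv_def by (metis frechet_derivative_at)

lemma dir_deriv_const [simp]: "dir_deriv v (\<lambda>x. c) = (\<lambda>x. 0)"
  by (rule ext, rule dir_deriv_eq[of _ "\<lambda>h. 0", simplified]) simp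

lemma differentiable_has_dir_deriv:
  "f differentiable (at x) \<Longrightarrow> (f has_derivative (\<lambda>v. dir_deriv v f x)) (at x)"
  unfolding dir_deriv_def using frechet_derivative_works by blast

lemma differentiable_on_open_has_dir_deriv:
  "f differentiable_on U \<Longrightarrow> open U \<Longrightarrow> x \<in> U \<Longrightarrow> (f has_derivative (\<lambda>v. dir_deriv v f x)) (at x)"
  by (metis at_within_open differentiable_has_dir_deriv differentiable_on_def)

lemma dir_deriv_cong_open:
  assumes "open U" "x \<in> U" "\<And>y. y \<in> U \<Longrightarrow> f y = g y"
  shows "dir_deriv v f x = dir_deriv v g x"
proof -
  have "(f has_derivative D) (at x) \<longleftrightarrow> (g has_derivative D) (at x)" for D
    using assms has_derivative_transform_within_open[of f D x UNIV U g]
      has_derivative_transform_within_open[of g D x UNIV U f] by auto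
  then show ?thesis unfolding dir_deriv_def frechet_derivative_def by simp
qed

lemma differentiable_on_cong_open:
  assumes "open U" "\<And>y. y \<in> U \<Longrightarrow> f y = g y" "f differentiable_on U"
  shows "g differentiable_on U"
  unfolding differentiable_on_def
proof
  fix x assume "x \<in> U"
  then have "f differentiable (at x)" using assms(1,3) by (metis at_within_open differentiable_on_def)
  then obtain D where "(f has_derivative D) (at x)" by (auto simp: differentiable_def)
  then have "(g has_derivative D) (at x)"
    using has_derivative_transform_within_open assms(1,2) \<open>x \<in> U\<close> by blast
  then show "g differentiable (at x within U)"
    using differentiable_at_withinI differentiable_def by blast
qed

lemma bnd_None [simp]: "bnd None f"
  by (simp add: bnd_def)

lemma bnd_Some: "bnd (Some s) f \<longleftrightarrow> (\<exists>C>0. \<forall>\<^sub>F x in at_infinity. norm (f x) \<le> C * norm x powr (- s))"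
  by (simp add: bnd_def bigo_def)

lemma bnd_SomeI: "\<forall>\<^sub>F x in at_infinity. norm (f x) \<le> C * norm x powr (- s) \<Longrightarrow> bnd (Some s) f"
  unfolding bnd_Some
  by (rule exI[of _ "max C 1"], auto elim!: eventually_mono)
     (meson dual_order.trans max.cobounded1 mult_right_mono powr_ge_zero)

lemma bnd_cong:
  assumes "w = None \<or> (\<forall>\<^sub>F x in at_infinity. f x = g x)" "bnd w f"
  shows "bnd w g"
proof (cases w)
  case (Some s)
  then have "\<forall>\<^sub>F x in at_infinity. norm (f x) = norm (g x)"
    using assms by (auto elim: eventually_mono)
  with Some assms show ?thesis
    by (auto simp: bnd_def dest: landau_o.big.in_cong)
qed auto

lemma bnd_zero [simp]: "bnd w (\<lambda>x. 0)"
  by (cases w) (auto simp: bnd_def)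

lemma bnd_add: "bnd w f \<Longrightarrow> bnd w g \<Longrightarrow> bnd w (\<lambda>x. f x + g x)"
proof (cases w)
  case (Some s)
  assume "bnd w f" "bnd w g"
  then obtain C D where "\<forall>\<^sub>F x in at_infinity. norm (f x) \<le> C * norm x powr (- s)"
      "\<forall>\<^sub>F x in at_infinity. norm (g x) \<le> D * norm x powr (- s)"
    unfolding Some bnd_Some by blast
  then have "\<forall>\<^sub>F x in at_infinity. norm (f x + g x) \<le> (C + D) * norm x powr (- s)"
    by eventually_elim (metis add_mono distrib_right norm_triangle_mono)
  then show ?thesis unfolding Some by (rule bnd_SomeI)
qed auto

lemma bnd_linear:
  assumes "bounded_linear L" "bnd w f"
  shows "bnd w (\<lambda>x. L (f x))"
proof (cases w)
  case (Some s)
  obtain C where C: "\<forall>\<^sub>F x in at_infinity. norm (f x) \<le> C * norm x powr (- s)"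
    using assms unfolding Some bnd_Some by blast
  obtain K where K: "\<And>x. norm (L x) \<le> norm x * K" "K \<ge> 0"
    using bounded_linear.nonneg_bounded[OF assms(1)] by blast
  have "\<forall>\<^sub>F x in at_infinity. norm (L (f x)) \<le> (C * K) * norm x powr (- s)"
    using C by eventually_elim (smt (verit) K mult.assoc mult.commute mult_right_mono)
  then show ?thesis unfolding Some by (rule bnd_SomeI)
qed auto

lemma eventually_at_infinity_norm_ge: "\<forall>\<^sub>F x in at_infinity. norm x \<ge> (M::real)"
  by (auto simp: eventually_at_infinity)

lemma bnd_const_flat: "flat w = w \<Longrightarrow> bnd w (\<lambda>x. c)"
proof (cases w)
  case (Some s)
  assume "flat w = w"
  then have s: "s = 0" using Some by simp
  have "\<forall>\<^sub>F x in at_infinity. norm c \<le> norm c * norm (x::'a) powr (- s)"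
    using eventually_at_infinity_norm_ge[of 1]
    by eventually_elim (auto simp: s)
  then show "bnd w (\<lambda>x::'a. c)"
    unfolding Some by (rule bnd_SomeI)
qed auto

lemma bnd_bilinear:
  assumes "bounded_bilinear B" "bnd w f" "bnd (flat w) g"
  shows "bnd w (\<lambda>x. B (f x) (g x))"
proof (cases w)
  case (Some s)
  obtain C where C: "\<forall>\<^sub>F x in at_infinity. norm (f x) \<le> C * norm x powr (- s)"
    using assms unfolding Some bnd_Some by blast
  obtain D where D: "\<forall>\<^sub>F x in at_infinity. norm (g x) \<le> D * norm x powr (- 0)" "D > 0"
    using assms(3) unfolding Some option.map bnd_Some by blast
  obtain K where K: "\<And>x y. norm (B x y) \<le> norm x * norm y * K" "K \<ge> 0"
    using bounded_bilinear.nonneg_bounded[OF assms(1)] by blast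
  have "\<forall>\<^sub>F x in at_infinity. norm (B (f x) (g x)) \<le> (C * D * K) * norm x powr (- s)"
    using C D(1) eventually_at_infinity_norm_ge[of 1]
  proof eventually_elim
    case (elim x)
    then have "x \<noteq> 0" by auto
    with elim(2) have "norm (g x) \<le> D" by simp
    with elim(1) have "norm (f x) * norm (g x) \<le> (C * norm x powr (- s)) * D"
      by (intro mult_mono) (auto intro: order_trans[OF norm_ge_zero])
    then have "norm (f x) * norm (g x) * K \<le> (C * norm x powr (- s)) * D * K"
      using K(2) by (rule mult_right_mono)
    with K(1)[of "f x" "g x"] show ?case by (simp add: mult_ac)
  qed
  then show ?thesis unfolding Some by (rule bnd_SomeI)
qed auto

lemma bnd_mono: "t \<le> s \<Longrightarrow> bnd (Some s) f \<Longrightarrow> bnd (Some t) f"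
proof -
  assume ts: "t \<le> s" and "bnd (Some s) f"
  then obtain C where C: "\<forall>\<^sub>F x in at_infinity. norm (f x) \<le> C * norm x powr (- s)" "C > 0"
    unfolding bnd_Some by blast
  have "\<forall>\<^sub>F x in at_infinity. norm (f x) \<le> C * norm x powr (- t)"
    using C(1) eventually_at_infinity_norm_ge[of 1]
  proof eventually_elim
    case (elim x)
    have "norm x powr (-s) \<le> norm x powr (-t)" using elim ts by (intro powr_mono) auto
    then show ?case using elim C(2) by (meson mult_left_mono order_trans less_imp_le)
  qed
  then show ?thesis by (rule bnd_SomeI)
qed

text \<open>A bounded displacement changes \<open>norm x\<close> by at most a factor of two far out, which costs
  a constant factor in every power of \<open>norm x\<close>.\<close>

lemma bnd_compose_near_id:
  assumes "bnd (Some 0) (\<lambda>x. h x - x)" "bnd (Some s) F"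
  shows "bnd (Some s) (\<lambda>x. F (h x))"
proof -
  obtain C where C: "\<forall>\<^sub>F x in at_infinity. norm (F x) \<le> C * norm x powr (- s)" "C > 0"
    using assms unfolding bnd_Some by blast
  then obtain M where M: "\<And>x. norm x \<ge> M \<Longrightarrow> norm (F x) \<le> C * norm x powr (- s)"
    unfolding eventually_at_infinity by blast
  obtain D where D: "\<forall>\<^sub>F x in at_infinity. norm (h x - x) \<le> D * norm x powr (- 0)" "D > 0"
    using assms unfolding bnd_Some by blast
  have "\<forall>\<^sub>F x in at_infinity. norm (F (h x)) \<le> (C * 2 powr \<bar>s\<bar>) * norm x powr (- s)"
    using D(1) eventually_at_infinity_norm_ge[of 1] eventually_at_infinity_norm_ge[of "2 * D"]
      eventually_at_infinity_norm_ge[of "2 * M"]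
  proof eventually_elim
    case (elim x)
    then have "x \<noteq> 0" by auto
    with elim(1) have d: "norm (h x - x) \<le> D" by simp
    have lo: "norm (h x) \<ge> norm x / 2"
      using d elim norm_triangle_ineq2[of x "x - h x"] by (simp add: norm_minus_commute)
    have hi: "norm (h x) \<le> 2 * norm x"
      using d elim norm_triangle_ineq[of x "h x - x"] by simp
    have *: "norm (h x) powr (- s) \<le> 2 powr \<bar>s\<bar> * norm x powr (- s)"
    proof (cases "s \<ge> 0")
      case True
      have "norm (h x) powr (- s) \<le> (norm x / 2) powr (- s)"
        using lo True elim by (intro powr_mono2') auto
      also have "\<dots> = 2 powr s * norm x powr (- s)"
        using elim by (simp add: powr_divide powr_minus field_simps)
      finally show ?thesis using True by simp
    next
      case False
      have "norm (h x) powr (- s) \<le> (2 * norm x) powr (- s)"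
        using hi False by (intro powr_mono2) auto
      also have "\<dots> = 2 powr (-s) * norm x powr (- s)"
        by (simp add: powr_mult)
      finally show ?thesis using False by simp
    qed
    have "norm (F (h x)) \<le> C * norm (h x) powr (- s)" using M lo elim by simp
    also have "\<dots> \<le> C * (2 powr \<bar>s\<bar> * norm x powr (- s))"
      using * C(2) by (intro mult_left_mono) auto
    finally show ?case by (simp add: mult.assoc)
  qed
  then show ?thesis by (rule bnd_SomeI)
qed

lemma Ck_mono: "Ck (Suc n) U w f \<Longrightarrow> Ck n U w f"
  by (induction n arbitrary: f) auto

lemma Ck_cong:
  assumes "adm U w" "\<And>x. x \<in> U \<Longrightarrow> f x = g x" "Ck n U w f"
  shows "Ck n U w g"
  using assms(2,3)
proof (induction n arbitrary: f g)
  case 0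
  have "w = None \<or> (\<forall>\<^sub>F x in at_infinity. f x = g x)"
    using assms(1) 0(1) unfolding adm_def by (metis (mono_tags, lifting) eventually_mono)
  then show ?case using 0(2) by (auto intro: bnd_cong)
next
  case (Suc n)
  have U: "open U" using assms(1) by (simp add: adm_def)
  have eq: "\<And>x. x \<in> U \<Longrightarrow> f x = g x" by (fact Suc.prems(1))
  have "w = None \<or> (\<forall>\<^sub>F x in at_infinity. f x = g x)"
    using assms(1) eq unfolding adm_def by (metis (mono_tags, lifting) eventually_mono)
  then have "bnd w g" using Suc.prems(2) by (auto intro: bnd_cong)
  moreover have "g differentiable_on U"
    using differentiable_on_cong_open[OF U eq] Suc.prems(2) by simp
  moreover have "Ck n U w (dir_deriv v g)" for v
  proof (rule Suc.IH)
    show "dir_deriv v f x = dir_deriv v g x" if "x \<in> U" for x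
      using dir_deriv_cong_open[OF U that eq] .
    show "Ck n U w (dir_deriv v f)" using Suc.prems(2) by simp
  qed
  ultimately show ?case by simp
qed

lemma Ck_zero [simp]: "Ck n U w (\<lambda>x. 0)"
  by (induction n) (auto simp: differentiable_on_def)

lemma Ck_const: "flat w = w \<Longrightarrow> Ck n U w (\<lambda>x. c)"
  by (cases n) (auto simp: bnd_const_flat)

lemma Ck_add:
  assumes "adm U w" "Ck n U w f" "Ck n U w g"
  shows "Ck n U w (\<lambda>x. f x + g x)"
  using assms(2,3)
proof (induction n arbitrary: f g)
  case (Suc n)
  have U: "open U" using assms(1) by (simp add: adm_def)
  have "Ck n U w (dir_deriv v (\<lambda>x. f x + g x))" for v
  proof (rule Ck_cong[OF assms(1)])
    show "Ck n U w (\<lambda>x. dir_deriv v f x + dir_deriv v g x)" using Suc by auto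
    show "dir_deriv v f x + dir_deriv v g x = dir_deriv v (\<lambda>x. f x + g x) x" if "x \<in> U" for x
      using Suc.prems U that
      by (intro dir_deriv_eq[symmetric] derivative_intros differentiable_on_open_has_dir_deriv) auto
  qed
  with Suc.prems show ?case by (auto intro: bnd_add differentiable_on_add)
qed (auto intro: bnd_add)

lemma Ck_linear:
  assumes "adm U w" "bounded_linear L" "Ck n U w f"
  shows "Ck n U w (\<lambda>x. L (f x))"
  using assms(3)
proof (induction n arbitrary: f)
  case (Suc n)
  have U: "open U" using assms(1) by (simp add: adm_def)
  have D: "((\<lambda>x. L (f x)) has_derivative (\<lambda>v. L (dir_deriv v f x))) (at x)" if "x \<in> U" for x
    using Suc.prems U that
    by (intro bounded_linear.has_derivative[OF assms(2)] differentiable_on_open_has_dir_deriv) auto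
  have "Ck n U w (dir_deriv v (\<lambda>x. L (f x)))" for v
    by (rule Ck_cong[OF assms(1) _ Suc.IH[of "dir_deriv v f"]])
       (use Suc.prems dir_deriv_eq[OF D] in auto)
  moreover have "(\<lambda>x. L (f x)) differentiable_on U"
    using D by (meson differentiable_at_withinI differentiable_def differentiable_on_def)
  ultimately show ?case using Suc.prems assms(2) by (auto intro: bnd_linear)
qed (use assms in \<open>auto intro: bnd_linear\<close>)

lemma Ck_bilinear:
  assumes "adm U w" "bounded_bilinear B" "Ck n U w f" "Ck n U (flat w) g"
  shows "Ck n U w (\<lambda>x. B (f x) (g x))"
  using assms(3,4)
proof (induction n arbitrary: f g)
  case (Suc n)
  have U: "open U" using assms(1) by (simp add: adm_def)
  have D: "((\<lambda>x. B (f x) (g x)) has_derivative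
      (\<lambda>v. B (f x) (dir_deriv v g x) + B (dir_deriv v f x) (g x))) (at x)" if "x \<in> U" for x
    using Suc.prems U that
    by (intro bounded_bilinear.FDERIV[OF assms(2)] differentiable_on_open_has_dir_deriv) auto
  have "Ck n U w (dir_deriv v (\<lambda>x. B (f x) (g x)))" for v
  proof (rule Ck_cong[OF assms(1)])
    show "Ck n U w (\<lambda>x. B (f x) (dir_deriv v g x) + B (dir_deriv v f x) (g x))"
      using Suc.prems Ck_mono[OF Suc.prems(1)] Ck_mono[OF Suc.prems(2)]
      by (intro Ck_add[OF assms(1)] Suc.IH) auto
  qed (simp add: dir_deriv_eq[OF D])
  moreover have "(\<lambda>x. B (f x) (g x)) differentiable_on U"
    using D by (meson differentiable_at_withinI differentiable_def differentiable_on_def)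
  ultimately show ?case using Suc.prems bnd_bilinear[OF assms(2)] by auto
qed (use assms in \<open>auto intro: bnd_bilinear\<close>)

lemma Ck_sum:
  assumes "adm U w" "\<And>i. i \<in> I \<Longrightarrow> Ck n U w (f i)"
  shows "Ck n U w (\<lambda>x. \<Sum>i\<in>I. f i x)"
  using assms(2) by (induction I rule: infinite_finite_induct) (auto intro: Ck_add[OF assms(1)])

text \<open>In coordinates the derivative of a composition is a sum of products, so that the product rule
  applies to it again.\<close>

lemma euclidean_deriv_compose:
  fixes f :: "'a::euclidean_space \<Rightarrow> 'b::real_normed_vector"
  assumes "(h has_derivative h') (at x)" "(f has_derivative f') (at (h x))"
  shows "((\<lambda>x. f (h x)) has_derivative (\<lambda>v. \<Sum>b\<in>Basis. (h' v \<bullet> b) *\<^sub>R f' b)) (at x)"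
proof -
  have "f' y = (\<Sum>b\<in>Basis. (y \<bullet> b) *\<^sub>R f' b)" for y
    by (metis (no_types, lifting) assms(2) euclidean_representation has_derivative_linear linear.scaleR
        linear_sum sum.cong)
  moreover have "((\<lambda>x. f (h x)) has_derivative (\<lambda>v. f' (h' v))) (at x)"
    using assms has_derivative_compose by blast
  ultimately show ?thesis by (metis (no_types, lifting) ext)
qed

text \<open>Derivatives of \<open>h\<close> enter only up to an order below \<open>n\<close>. This gain of one
  order is what makes bootstrapping possible in \<open>local_inverse_dir_deriv\<close>.\<close>

lemma Ck_compose:
  fixes f :: "'a::euclidean_space \<Rightarrow> 'b::real_normed_vector" and h :: "'c::euclidean_space \<Rightarrow> 'a"
  assumes "adm U w" "open V" "h ` U \<subseteq> V" "h differentiable_on U"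
    and bc: "\<And>F::'a \<Rightarrow> 'b. bnd w F \<Longrightarrow> bnd w (\<lambda>x. F (h x))"
    and "Ck n V w f" "\<And>m v. m < n \<Longrightarrow> Ck m U (flat w) (dir_deriv v h)"
  shows "Ck n U w (\<lambda>x. f (h x))"
  using assms(6,7)
proof (induction n arbitrary: f)
  case (Suc n)
  have U: "open U" using assms(1) by (simp add: adm_def)
  have D: "((\<lambda>x. f (h x)) has_derivative
      (\<lambda>v. \<Sum>b\<in>Basis. (dir_deriv v h x \<bullet> b) *\<^sub>R dir_deriv b f (h x))) (at x)" if "x \<in> U" for x
    using Suc.prems U that assms(2,3,4)
    by (intro euclidean_deriv_compose differentiable_on_open_has_dir_deriv) auto
  have "Ck n U w (dir_deriv v (\<lambda>x. f (h x)))" for v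
  proof (rule Ck_cong[OF assms(1)])
    show "Ck n U w (\<lambda>x. \<Sum>b\<in>Basis. (dir_deriv v h x \<bullet> b) *\<^sub>R dir_deriv b f (h x))"
    proof (intro Ck_sum assms(1))
      fix b :: 'a
      have "Ck n U w (\<lambda>x. dir_deriv b f (h x))" using Suc by simp
      moreover have "Ck n U (flat w) (\<lambda>x. dir_deriv v h x \<bullet> b)"

        by (rule Ck_linear[OF _ bounded_linear_inner_left]) (use assms(1) Suc.prems(2) in auto)
      ultimately show "Ck n U w (\<lambda>x. (dir_deriv v h x \<bullet> b) *\<^sub>R dir_deriv b f (h x))"
        by (rule Ck_bilinear[OF assms(1) bounded_bilinear.flip[OF bounded_bilinear_scaleR]])
    qed
  qed (simp add: dir_deriv_eq[OF D])
  moreover have "(\<lambda>x. f (h x)) differentiable_on U"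
    using D by (meson differentiable_at_withinI differentiable_def differentiable_on_def)
  ultimately show ?case using Suc.prems bc by auto
qed (use bc in auto)

text \<open>The derivative \<open>- f\<^sup>-\<^sup>1 f' f\<^sup>-\<^sup>1\<close> is a product of three
  functions of the class; \<open>flat w = w\<close> excludes a nonzero rate, which would not survive
  inversion.\<close>

lemma Ck_inverse:
  fixes f :: "'a::real_normed_vector \<Rightarrow> real"
  assumes "adm U w" "flat w = w" "Ck n U w f" "\<And>x. x \<in> U \<Longrightarrow> f x \<noteq> 0" "bnd w (\<lambda>x. inverse (f x))"
  shows "Ck n U w (\<lambda>x. inverse (f x))"
  using assms(3)
proof (induction n)
  case (Suc n)
  have U: "open U" using assms(1) by (simp add: adm_def)
  have IH: "Ck n U w (\<lambda>x. inverse (f x))" using Suc Ck_mono by blast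
  have D: "((\<lambda>x. inverse (f x)) has_derivative
      (\<lambda>v. - (inverse (f x) * dir_deriv v f x * inverse (f x)))) (at x)" if "x \<in> U" for x
    using Suc.prems U that assms(4)
    by (intro Deriv.has_derivative_inverse differentiable_on_open_has_dir_deriv) auto
  have "Ck n U w (dir_deriv v (\<lambda>x. inverse (f x)))" for v
  proof (rule Ck_cong[OF assms(1)])
    have "Ck n U w (\<lambda>x. inverse (f x) * dir_deriv v f x)"
      by (rule Ck_bilinear[OF assms(1) bounded_bilinear_mult IH]) (use assms(2) Suc.prems in auto)
    then have "Ck n U w (\<lambda>x. inverse (f x) * dir_deriv v f x * inverse (f x))"
      by (rule Ck_bilinear[OF assms(1) bounded_bilinear_mult]) (use assms(2) IH in auto)
    then show "Ck n U w (\<lambda>x. - (inverse (f x) * dir_deriv v f x * inverse (f x)))"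
      by (rule Ck_linear[OF assms(1) bounded_linear_minus[OF bounded_linear_ident]])
  qed (simp add: dir_deriv_eq[OF D])
  moreover have "(\<lambda>x. inverse (f x)) differentiable_on U"
    using D by (meson differentiable_at_withinI differentiable_def differentiable_on_def)
  ultimately show ?case using assms(5) by auto
qed (use assms in auto)

definition Cinf :: "'a set \<Rightarrow> real option \<Rightarrow> ('a::real_normed_vector \<Rightarrow> 'b::real_normed_vector) \<Rightarrow> bool" where
  "Cinf U w f \<longleftrightarrow> (\<forall>n. Ck n U w f)"

text \<open>The derivative taken first is the last entry of the list, hence the lists are split at their
  end.\<close>

lemma Cinf_iff:
  "Cinf U w f \<longleftrightarrow> (\<forall>vs. foldr dir_deriv vs f differentiable_on U) \<and> (\<forall>vs. bnd w (foldr dir_deriv vs f))"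
proof -
  have "Ck n U w f \<longleftrightarrow> (\<forall>vs. length vs < n \<longrightarrow> foldr dir_deriv vs f differentiable_on U) \<and>
      (\<forall>vs. length vs \<le> n \<longrightarrow> bnd w (foldr dir_deriv vs f))" for n
  proof (induction n arbitrary: f)
    case (Suc n)
    have *: "(\<forall>vs. length vs < Suc k \<longrightarrow> P vs) \<longleftrightarrow> P [] \<and> (\<forall>v vs. length vs < k \<longrightarrow> P (vs @ [v]))"
      for k and P :: "'a list \<Rightarrow> bool"
    proof (intro iffI conjI allI impI)
      fix vs :: "'a list"
      assume "P [] \<and> (\<forall>v vs. length vs < k \<longrightarrow> P (vs @ [v]))" "length vs < Suc k"
      then show "P vs" by (cases vs rule: rev_cases) auto
    qed auto
    show ?case
      using *[of n "\<lambda>vs. foldr dir_deriv vs f differentiable_on U"]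
        *[of "Suc n" "\<lambda>vs. bnd w (foldr dir_deriv vs f)"]
      by (auto simp: Suc less_Suc_eq_le)
  qed auto
  then show ?thesis unfolding Cinf_def by (metis lessI order_refl)
qed

lemma Cinf_dir_deriv: "Cinf U w f \<Longrightarrow> Cinf U w (dir_deriv v f)"
  unfolding Cinf_def by (metis Ck.simps(2))

lemma Cinf_differentiable_on: "Cinf U w f \<Longrightarrow> f differentiable_on U"
  unfolding Cinf_def by (metis Ck.simps(2))

lemma Cinf_bnd: "Cinf U w f \<Longrightarrow> bnd w f"
  unfolding Cinf_def using Ck.simps(1) by blast

lemma Cinf_step:
  assumes "f differentiable_on U" "bnd w f" "\<And>v. Cinf U w (dir_deriv v f)"
  shows "Cinf U w f"
  unfolding Cinf_def
proof
  show "Ck n U w f" for n using assms by (cases n) (auto simp: Cinf_def)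
qed

lemma Cinf_cong: "adm U w \<Longrightarrow> (\<And>x. x \<in> U \<Longrightarrow> f x = g x) \<Longrightarrow> Cinf U w f \<Longrightarrow> Cinf U w g"
  unfolding Cinf_def using Ck_cong by blast

lemma Cinf_const: "flat w = w \<Longrightarrow> Cinf U w (\<lambda>x. c)"
  by (simp add: Cinf_def Ck_const)

lemma Cinf_add: "adm U w \<Longrightarrow> Cinf U w f \<Longrightarrow> Cinf U w g \<Longrightarrow> Cinf U w (\<lambda>x. f x + g x)"
  by (simp add: Cinf_def Ck_add)

lemma Cinf_linear: "adm U w \<Longrightarrow> bounded_linear L \<Longrightarrow> Cinf U w f \<Longrightarrow> Cinf U w (\<lambda>x. L (f x))"
  by (simp add: Cinf_def Ck_linear)

lemma Cinf_bilinear: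
  "adm U w \<Longrightarrow> bounded_bilinear B \<Longrightarrow> Cinf U w f \<Longrightarrow> Cinf U (flat w) g \<Longrightarrow> Cinf U w (\<lambda>x. B (f x) (g x))"
  by (simp add: Cinf_def Ck_bilinear)

lemma Cinf_compose:
  fixes f :: "'a::euclidean_space \<Rightarrow> 'b::real_normed_vector" and h :: "'c::euclidean_space \<Rightarrow> 'a"
  assumes "adm U w" "open V" "h ` U \<subseteq> V" "h differentiable_on U"
    and "\<And>F::'a \<Rightarrow> 'b. bnd w F \<Longrightarrow> bnd w (\<lambda>x. F (h x))"
    and "Cinf V w f" "\<And>v. Cinf U (flat w) (dir_deriv v h)"
  shows "Cinf U w (\<lambda>x. f (h x))"
  unfolding Cinf_def
proof
  show "Ck n U w (\<lambda>x. f (h x))" for n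
    by (rule Ck_compose[OF assms(1-5)]) (use assms(6,7) in \<open>auto simp: Cinf_def\<close>)
qed

lemma Cinf_inverse:
  fixes f :: "'a::real_normed_vector \<Rightarrow> real"
  assumes "adm U w" "flat w = w" "Cinf U w f" "\<And>x. x \<in> U \<Longrightarrow> f x \<noteq> 0" "bnd w (\<lambda>x. inverse (f x))"
  shows "Cinf U w (\<lambda>x. inverse (f x))"
  unfolding Cinf_def
proof
  show "Ck n U w (\<lambda>x. inverse (f x))" for n
    by (rule Ck_inverse[OF assms(1,2) _ assms(4,5)]) (use assms(3) in \<open>auto simp: Cinf_def\<close>)
qed

lemma Ck_weaken:
  assumes "case w' of None \<Rightarrow> True | Some t \<Rightarrow> (case w of None \<Rightarrow> False | Some s \<Rightarrow> t \<le> s)" "U' \<subseteq> U"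
    and "Ck n U w f"
  shows "Ck n U' w' f"
proof -
  have *: "bnd w F \<Longrightarrow> bnd w' F" for F :: "'a \<Rightarrow> 'b"
    using assms(1) bnd_mono by (auto split: option.splits)
  show ?thesis using assms(3)
    by (induction n arbitrary: f) (auto intro: * differentiable_on_subset[OF _ assms(2)])
qed

lemma Cinf_weaken:
  "case w' of None \<Rightarrow> True | Some t \<Rightarrow> (case w of None \<Rightarrow> False | Some s \<Rightarrow> t \<le> s) \<Longrightarrow> U' \<subseteq> U
    \<Longrightarrow> Cinf U w f \<Longrightarrow> Cinf U' w' f"
  unfolding Cinf_def using Ck_weaken by blast

lemma Cinf_None_subset: "Cinf U w f \<Longrightarrow> U' \<subseteq> U \<Longrightarrow> Cinf U' None f"
  by (rule Cinf_weaken[where w=w]) auto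

section \<open>Smooth maps on arbitrary sets\<close>

lemma adm_None [simp]: "adm U None = open U"
  by (simp add: adm_def)

lemma Ck_local:
  assumes "open U" "\<And>x. x \<in> U \<Longrightarrow> \<exists>V. open V \<and> x \<in> V \<and> Ck n V None f"
  shows "Ck n U None f"
  using assms(2)
proof (induction n arbitrary: f)
  case (Suc n)
  have "f differentiable (at x)" if "x \<in> U" for x
    using Suc.prems[OF that] by (auto simp: differentiable_on_def) (metis at_within_open)
  then have "f differentiable_on U"
    using differentiable_at_imp_differentiable_on by blast
  moreover have "Ck n U None (dir_deriv v f)" for v
    by (rule Suc.IH) (use Suc.prems in fastforce)
  ultimately show ?case by simp
qed simp

lemma smooth_onE:
  assumes "smooth_on S f" "x \<in> S"
  obtains U f' where "open U" "x \<in> U" "Cinf U None f'" "\<And>y. y \<in> S \<Longrightarrow> y \<in> U \<Longrightarrow> f' y = f y"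
proof -
  from assms obtain U f' where "open U" "x \<in> U" "\<forall>vs. foldr dir_deriv vs f' differentiable_on U"
      "\<forall>y\<in>S \<inter> U. f' y = f y"
    unfolding smooth_on_def by meson
  then show thesis by (intro that[of U f']) (auto simp: Cinf_iff)
qed

lemma smooth_onI:
  assumes "\<And>x. x \<in> S \<Longrightarrow> \<exists>U f'. open U \<and> x \<in> U \<and> Cinf U None f' \<and> (\<forall>y\<in>S \<inter> U. f' y = f y)"
  shows "smooth_on S f"
  unfolding smooth_on_def
proof
  fix x assume "x \<in> S"
  from assms[OF this] show "\<exists>U f'. open U \<and> x \<in> U \<and> (\<forall>vs. foldr dir_deriv vs f' differentiable_on U) \<and>
        (\<forall>y\<in>S \<inter> U. f' y = f y)"
    by (simp add: Cinf_iff)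
qed

lemma smooth_on_open: "open U \<Longrightarrow> smooth_on U f \<longleftrightarrow> Cinf U None f"
proof
  assume U: "open U" and f: "smooth_on U f"
  show "Cinf U None f"
    unfolding Cinf_def
  proof (intro allI Ck_local[OF U])
    fix n x assume "x \<in> U"
    with f obtain V f' where V: "open V" "x \<in> V" "Cinf V None f'" "\<And>y. y \<in> U \<Longrightarrow> y \<in> V \<Longrightarrow> f' y = f y"
      by (rule smooth_onE) blast
    have "Cinf (V \<inter> U) None f"
      by (rule Cinf_cong[where f=f']) (use V U Cinf_None_subset[OF V(3), of "V \<inter> U"] in auto)
    then show "\<exists>V. open V \<and> x \<in> V \<and> Ck n V None f"
      using U V \<open>x \<in> U\<close> unfolding Cinf_def by (intro exI[of _ "V \<inter> U"]) auto
  qed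
next
  assume "open U" "Cinf U None f"
  then show "smooth_on U f"
    by (intro smooth_onI exI[of _ U] exI[of _ f]) simp
qed

lemma smooth_on_cong: "(\<And>x. x \<in> S \<Longrightarrow> f x = g x) \<Longrightarrow> smooth_on S f \<Longrightarrow> smooth_on S g"
proof (rule smooth_onI)
  fix x assume x: "x \<in> S" and eq: "\<And>x. x \<in> S \<Longrightarrow> f x = g x" and f: "smooth_on S f"
  from f x obtain U f' where "open U" "x \<in> U" "Cinf U None f'" "\<And>y. y \<in> S \<Longrightarrow> y \<in> U \<Longrightarrow> f' y = f y"
    by (rule smooth_onE) blast
  then show "\<exists>U f'. open U \<and> x \<in> U \<and> Cinf U None f' \<and> (\<forall>y\<in>S \<inter> U. f' y = g y)"
    by (intro exI[of _ U] exI[of _ f']) (simp add: eq)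
qed

lemma smooth_on_subset: "smooth_on S f \<Longrightarrow> T \<subseteq> S \<Longrightarrow> smooth_on T f"
proof (rule smooth_onI)
  fix x assume x: "x \<in> T" and f: "smooth_on S f" and T: "T \<subseteq> S"
  then have "x \<in> S" by blast
  from f this obtain U f' where "open U" "x \<in> U" "Cinf U None f'" "\<And>y. y \<in> S \<Longrightarrow> y \<in> U \<Longrightarrow> f' y = f y"
    by (rule smooth_onE) blast
  then show "\<exists>U f'. open U \<and> x \<in> U \<and> Cinf U None f' \<and> (\<forall>y\<in>T \<inter> U. f' y = f y)"
    using T by (intro exI[of _ U] exI[of _ f']) auto
qed

lemma smooth_on_const: "smooth_on S (\<lambda>x. c)"
  by (rule smooth_onI, rule exI[of _ UNIV]) (auto intro!: Cinf_const)

lemma Cinf_id: "open U \<Longrightarrow> Cinf U None (\<lambda>x. x)"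
proof (rule Cinf_step)
  have "dir_deriv v (\<lambda>x::'a. x) = (\<lambda>x. v)" for v
    by (rule ext, rule dir_deriv_eq[OF has_derivative_ident])
  then show "Cinf U None (dir_deriv v (\<lambda>x. x))" for v by (simp add: Cinf_const)
qed (auto simp: differentiable_on_def)

lemma smooth_on_id: "smooth_on S (\<lambda>x. x)"
  by (rule smooth_onI, rule exI[of _ UNIV]) (auto intro: Cinf_id)

lemma smooth_on_linear:
  assumes "bounded_linear L" "smooth_on S f"
  shows "smooth_on S (\<lambda>x. L (f x))"
proof (rule smooth_onI)
  fix x assume "x \<in> S"
  with assms(2) obtain U f' where U: "open U" "x \<in> U" "Cinf U None f'" "\<And>y. y \<in> S \<Longrightarrow> y \<in> U \<Longrightarrow> f' y = f y"
    by (rule smooth_onE) blast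
  then show "\<exists>U f'. open U \<and> x \<in> U \<and> Cinf U None f' \<and> (\<forall>y\<in>S \<inter> U. f' y = L (f y))"
    by (intro exI[of _ U] exI[of _ "\<lambda>x. L (f' x)"]) (auto intro: Cinf_linear[OF _ assms(1)])
qed

lemma smooth_on_bilinear:
  assumes "bounded_bilinear B" "smooth_on S f" "smooth_on S g"
  shows "smooth_on S (\<lambda>x. B (f x) (g x))"
proof (rule smooth_onI)
  fix x assume x: "x \<in> S"
  with assms(2) obtain U f' where U: "open U" "x \<in> U" "Cinf U None f'" "\<And>y. y \<in> S \<Longrightarrow> y \<in> U \<Longrightarrow> f' y = f y"
    by (rule smooth_onE) blast
  from assms(3) x obtain V g' where V: "open V" "x \<in> V" "Cinf V None g'" "\<And>y. y \<in> S \<Longrightarrow> y \<in> V \<Longrightarrow> g' y = g y"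
    by (rule smooth_onE) blast
  have "Cinf (U \<inter> V) None (\<lambda>x. B (f' x) (g' x))"
    by (rule Cinf_bilinear[OF _ assms(1)]) (use U V in \<open>auto elim: Cinf_None_subset\<close>)
  with U V show "\<exists>U f'. open U \<and> x \<in> U \<and> Cinf U None f' \<and> (\<forall>y\<in>S \<inter> U. f' y = B (f y) (g y))"
    by (intro exI[of _ "U \<inter> V"] exI[of _ "\<lambda>x. B (f' x) (g' x)"]) auto
qed

lemma smooth_on_add:
  assumes "smooth_on S f" "smooth_on S g"
  shows "smooth_on S (\<lambda>x. f x + g x)"
proof (rule smooth_onI)
  fix x assume x: "x \<in> S"
  with assms(1) obtain U f' where U: "open U" "x \<in> U" "Cinf U None f'" "\<And>y. y \<in> S \<Longrightarrow> y \<in> U \<Longrightarrow> f' y = f y"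
    by (rule smooth_onE) blast
  from assms(2) x obtain V g' where V: "open V" "x \<in> V" "Cinf V None g'" "\<And>y. y \<in> S \<Longrightarrow> y \<in> V \<Longrightarrow> g' y = g y"
    by (rule smooth_onE) blast
  have "Cinf (U \<inter> V) None (\<lambda>x. f' x + g' x)"
    by (rule Cinf_add) (use U V in \<open>auto elim: Cinf_None_subset\<close>)
  with U V show "\<exists>U f'. open U \<and> x \<in> U \<and> Cinf U None f' \<and> (\<forall>y\<in>S \<inter> U. f' y = f y + g y)"
    by (intro exI[of _ "U \<inter> V"] exI[of _ "\<lambda>x. f' x + g' x"]) auto
qed

lemma smooth_on_minus: "smooth_on S f \<Longrightarrow> smooth_on S (\<lambda>x. - f x)"
  by (rule smooth_on_linear[OF bounded_linear_minus[OF bounded_linear_ident]])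

lemma smooth_on_diff: "smooth_on S f \<Longrightarrow> smooth_on S g \<Longrightarrow> smooth_on S (\<lambda>x. f x - g x)"
  using smooth_on_add[of S f "\<lambda>x. - g x"] smooth_on_minus[of S g] by simp

lemma smooth_on_mult:
  fixes f g :: "'a::real_normed_vector \<Rightarrow> real"
  shows "smooth_on S f \<Longrightarrow> smooth_on S g \<Longrightarrow> smooth_on S (\<lambda>x. f x * g x)"
  by (rule smooth_on_bilinear[OF bounded_bilinear_mult])

lemma smooth_on_scaleR: "smooth_on S f \<Longrightarrow> smooth_on S g \<Longrightarrow> smooth_on S (\<lambda>x. f x *\<^sub>R g x)"
  by (rule smooth_on_bilinear[OF bounded_bilinear_scaleR])

lemma smooth_on_inner: "smooth_on S f \<Longrightarrow> smooth_on S g \<Longrightarrow> smooth_on S (\<lambda>x. f x \<bullet> g x)"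
  by (rule smooth_on_bilinear[OF bounded_bilinear_inner])

lemma Cinf_None_continuous_on: "Cinf U w f \<Longrightarrow> continuous_on U f"
  using Cinf_differentiable_on differentiable_imp_continuous_on by blast

lemma smooth_on_compose:
  fixes f :: "'a::euclidean_space \<Rightarrow> 'b::real_normed_vector" and h :: "'c::euclidean_space \<Rightarrow> 'a"
  assumes "smooth_on T f" "smooth_on S h" "h ` S \<subseteq> T"
  shows "smooth_on S (\<lambda>x. f (h x))"
proof (rule smooth_onI)
  fix x assume x: "x \<in> S"
  with assms(2) obtain U h' where U: "open U" "x \<in> U" "Cinf U None h'" "\<And>y. y \<in> S \<Longrightarrow> y \<in> U \<Longrightarrow> h' y = h y"
    by (rule smooth_onE) blast
  have "h x \<in> T" using x assms(3) by blast
  with assms(1) obtain V f' where V: "open V" "h x \<in> V" "Cinf V None f'" "\<And>y. y \<in> T \<Longrightarrow> y \<in> V \<Longrightarrow> f' y = f y"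
    by (rule smooth_onE) blast
  define W where "W = U \<inter> h' -` V"
  have W: "open W" "W \<subseteq> U" "h' ` W \<subseteq> V"
    using U(1) V(1) Cinf_None_continuous_on[OF U(3)] by (auto simp: W_def continuous_on_open_vimage Int_commute)
  have "Cinf W None (\<lambda>x. f' (h' x))"
  proof (rule Cinf_compose[OF _ V(1) W(3) _ _ V(3)])
    show "h' differentiable_on W"
      using Cinf_differentiable_on[OF U(3)] W(2) differentiable_on_subset by blast
    show "Cinf W (flat None) (dir_deriv v h')" for v
      using Cinf_None_subset[OF Cinf_dir_deriv[OF U(3)] W(2)] by simp
  qed (use W in auto)
  moreover have "x \<in> W" using U V x by (simp add: W_def)
  moreover have "f' (h' y) = f (h y)" if "y \<in> S \<inter> W" for y
    using that U V assms(3) by (auto simp: W_def)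
  ultimately show "\<exists>U f'. open U \<and> x \<in> U \<and> Cinf U None f' \<and> (\<forall>y\<in>S \<inter> U. f' y = f (h y))"
    using W(1) by (intro exI[of _ W] exI[of _ "\<lambda>x. f' (h' x)"]) auto
qed

lemma smooth_on_inverse:
  fixes f :: "'a::real_normed_vector \<Rightarrow> real"
  assumes "smooth_on S f" "\<And>x. x \<in> S \<Longrightarrow> f x \<noteq> 0"
  shows "smooth_on S (\<lambda>x. inverse (f x))"
proof (rule smooth_onI)
  fix x assume x: "x \<in> S"
  with assms(1) obtain U f' where U: "open U" "x \<in> U" "Cinf U None f'" "\<And>y. y \<in> S \<Longrightarrow> y \<in> U \<Longrightarrow> f' y = f y"
    by (rule smooth_onE) blast
  define W where "W = U \<inter> f' -` (- {0})"
  have W: "open W" "W \<subseteq> U"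
    using U(1) Cinf_None_continuous_on[OF U(3)]
    unfolding W_def by (auto intro: continuous_open_preimage)
  have "Cinf W None (\<lambda>x. inverse (f' x))"
    by (rule Cinf_inverse) (use W Cinf_None_subset[OF U(3)] in \<open>auto simp: W_def\<close>)
  moreover have "x \<in> W" using U x assms(2) by (simp add: W_def)
  moreover have "\<forall>y\<in>S \<inter> W. inverse (f' y) = inverse (f y)"
    using U(4) by (auto simp: W_def)
  ultimately show "\<exists>U f'. open U \<and> x \<in> U \<and> Cinf U None f' \<and> (\<forall>y\<in>S \<inter> U. f' y = inverse (f y))"
    using W(1) by blast
qed

lemma smooth_on_continuous_on:
  assumes "smooth_on S f" shows "continuous_on S f"
  unfolding continuous_on_eq_continuous_within
proof
  fix x assume x: "x \<in> S"
  with assms obtain U f' where U: "open U" "x \<in> U" "Cinf U None f'" "\<And>y. y \<in> S \<Longrightarrow> y \<in> U \<Longrightarrow> f' y = f y"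
    by (rule smooth_onE) blast
  have "isCont f' x" using Cinf_None_continuous_on[OF U(3)] U continuous_on_eq_continuous_at by blast
  then have "continuous (at x within S) f'" by (rule continuous_at_imp_continuous_at_within)
  moreover have "\<forall>\<^sub>F y in at x within S. f' y = f y"
    unfolding eventually_at_topological using U x by blast
  ultimately show "continuous (at x within S) f"
    unfolding continuous_within using U(2,4) x tendsto_cong by metis
qed

section \<open>Symmetry of second derivatives\<close>

text \<open>The mean value theorem, first in the direction \<open>u\<close> and then in the direction
  \<open>v\<close>. The left-hand side is symmetric in \<open>u\<close> and \<open>v\<close>, which is the
  source of the symmetry of second derivatives.\<close>

lemma mixed_difference_mean_value:
  fixes f :: "'a::real_normed_vector \<Rightarrow> real"
  assumes "open U" "Cinf U None f" "0 < h"
    and inU: "\<And>s t. 0 \<le> s \<Longrightarrow> s \<le> h \<Longrightarrow> 0 \<le> t \<Longrightarrow> t \<le> h \<Longrightarrow> x + s *\<^sub>R u + t *\<^sub>R v \<in> U"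
  obtains s t where "0 \<le> s" "s \<le> h" "0 \<le> t" "t \<le> h"
    "f (x + h *\<^sub>R u + h *\<^sub>R v) - f (x + h *\<^sub>R u) - f (x + h *\<^sub>R v) + f x
      = h * (h * dir_deriv v (dir_deriv u f) (x + s *\<^sub>R u + t *\<^sub>R v))"
proof -
  have Df: "(F has_derivative (\<lambda>v. dir_deriv v F y)) (at y)" if "Cinf U None F" "y \<in> U" for F :: "'a \<Rightarrow> real" and y
    using that assms(1) Cinf_differentiable_on differentiable_on_open_has_dir_deriv by blast
  have lin: "dir_deriv (c *\<^sub>R w) F y = c * dir_deriv w F y" if "Cinf U None F" "y \<in> U" for F :: "'a \<Rightarrow> real" and y c w
    using has_derivative_linear[OF Df[OF that]] linear_scale[of "\<lambda>v. dir_deriv v F y"] by simp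
  have der: "((\<lambda>s. F (y + s *\<^sub>R w)) has_real_derivative dir_deriv w F (y + s *\<^sub>R w)) (at s)"
    if "Cinf U None F" "y + s *\<^sub>R w \<in> U" for F :: "'a \<Rightarrow> real" and y w s
  proof -
    have "((\<lambda>s. F (y + s *\<^sub>R w)) has_derivative (\<lambda>c. dir_deriv (0 + c *\<^sub>R w) F (y + s *\<^sub>R w))) (at s)"
      by (rule has_derivative_compose[where g=F and f="\<lambda>s. y + s *\<^sub>R w", OF _ Df[OF that]])
        (intro derivative_intros)
    then show ?thesis
      unfolding has_field_derivative_def using lin[OF that] by (simp add: mult_commute_abs)
  qed
  define g where "g s = f (x + h *\<^sub>R v + s *\<^sub>R u) - f (x + s *\<^sub>R u)" for s
  have "(g has_real_derivative (dir_deriv u f (x + h *\<^sub>R v + s *\<^sub>R u) - dir_deriv u f (x + s *\<^sub>R u))) (at s)"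
    if "0 \<le> s" "s \<le> h" for s
    unfolding g_def using inU[of s h] inU[of s 0] that assms(2,3)
    by (intro DERIV_diff der) (auto simp: add_ac)
  from MVT2[OF assms(3) this] obtain s where s: "0 < s" "s < h"
    "g h - g 0 = h * (dir_deriv u f (x + h *\<^sub>R v + s *\<^sub>R u) - dir_deriv u f (x + s *\<^sub>R u))" by auto
  define k where "k t = dir_deriv u f (x + s *\<^sub>R u + t *\<^sub>R v)" for t
  have "(k has_real_derivative dir_deriv v (dir_deriv u f) (x + s *\<^sub>R u + t *\<^sub>R v)) (at t)"
    if "0 \<le> t" "t \<le> h" for t
    unfolding k_def using inU[of s t] s that assms(2) by (intro der Cinf_dir_deriv) auto
  from MVT2[OF assms(3) this] obtain t where t: "0 < t" "t < h"
    "k h - k 0 = h * dir_deriv v (dir_deriv u f) (x + s *\<^sub>R u + t *\<^sub>R v)" by auto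
  show thesis
  proof (rule that[of s t])
    have "dir_deriv u f (x + h *\<^sub>R v + s *\<^sub>R u) - dir_deriv u f (x + s *\<^sub>R u) = k h - k 0"
      by (simp add: k_def add_ac)
    moreover have "g h - g 0 = f (x + h *\<^sub>R u + h *\<^sub>R v) - f (x + h *\<^sub>R u) - f (x + h *\<^sub>R v) + f x"
      by (simp add: g_def add_ac)
    ultimately show "f (x + h *\<^sub>R u + h *\<^sub>R v) - f (x + h *\<^sub>R u) - f (x + h *\<^sub>R v) + f x
      = h * (h * dir_deriv v (dir_deriv u f) (x + s *\<^sub>R u + t *\<^sub>R v))" using s t by simp
  qed (use s t in auto)
qed

text \<open>Both mixed derivatives occur as the same second difference on small parallelograms; by continuity
  they cannot differ at \<open>x\<close>.\<close>

lemma dir_deriv_commute_real: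
  fixes f :: "'a::real_normed_vector \<Rightarrow> real"
  assumes "open U" "Cinf U None f" "x \<in> U"
  shows "dir_deriv u (dir_deriv v f) x = dir_deriv v (dir_deriv u f) x"
proof (rule ccontr)
  let ?a = "dir_deriv u (dir_deriv v f)" and ?b = "dir_deriv v (dir_deriv u f)"
  assume ne: "?a x \<noteq> ?b x"
  define e where "e = \<bar>?a x - ?b x\<bar> / 2"
  have e: "e > 0" using ne by (simp add: e_def)
  have "isCont ?a x" "isCont ?b x"
    using assms Cinf_None_continuous_on[OF Cinf_dir_deriv[OF Cinf_dir_deriv[OF assms(2)]]]
      continuous_on_eq_continuous_at by blast+
  then obtain d1 d2 where d: "d1 > 0" "\<And>y. dist y x < d1 \<Longrightarrow> dist (?a y) (?a x) < e"
      "d2 > 0" "\<And>y. dist y x < d2 \<Longrightarrow> dist (?b y) (?b x) < e"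
    using e unfolding continuous_at_eps_delta by metis
  obtain d3 where d3: "d3 > 0" "ball x d3 \<subseteq> U" using assms openE by blast
  define d where "d = min d1 (min d2 d3)"
  have dpos: "d > 0" using d d3 by (simp add: d_def)
  \<comment> \<open>small enough for the parallelogram spanned by \<open>h *\<^sub>R u\<close> and \<open>h *\<^sub>R v\<close> to fit into the ball of radius \<open>d\<close>\<close>
  define h where "h = d / (norm u + norm v + 1)"
  have h: "h > 0" using dpos by (simp add: h_def add_nonneg_pos)
  have near: "dist (x + s *\<^sub>R u + t *\<^sub>R v) x < d" if "0 \<le> s" "s \<le> h" "0 \<le> t" "t \<le> h" for s t
  proof -
    have "norm (s *\<^sub>R u + t *\<^sub>R v) \<le> s * norm u + t * norm v"
      using norm_triangle_ineq[of "s *\<^sub>R u" "t *\<^sub>R v"] that by simp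
    also have "\<dots> \<le> h * norm u + h * norm v"
      using that by (intro add_mono mult_right_mono) auto
    also have "\<dots> < h * (norm u + norm v + 1)" using h by (simp add: algebra_simps)
    also have "\<dots> = d" unfolding h_def by (smt (verit) norm_ge_zero nonzero_eq_divide_eq)
    finally show ?thesis by (simp add: dist_norm add.assoc)
  qed
  have inU: "x + s *\<^sub>R u + t *\<^sub>R v \<in> U" if "0 \<le> s" "s \<le> h" "0 \<le> t" "t \<le> h" for s t
    using near[OF that] d3 by (auto simp: d_def dist_commute)
  obtain s t where 1: "0 \<le> s" "s \<le> h" "0 \<le> t" "t \<le> h"
    "f (x + h *\<^sub>R u + h *\<^sub>R v) - f (x + h *\<^sub>R u) - f (x + h *\<^sub>R v) + f x = h * (h * ?b (x + s *\<^sub>R u + t *\<^sub>R v))"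
    using mixed_difference_mean_value[OF assms(1,2) h inU] by blast
  have inU': "x + s *\<^sub>R v + t *\<^sub>R u \<in> U" if "0 \<le> s" "s \<le> h" "0 \<le> t" "t \<le> h" for s t
    using inU[OF that(3,4,1,2)] by (simp add: add_ac)
  obtain s' t' where 2: "0 \<le> s'" "s' \<le> h" "0 \<le> t'" "t' \<le> h"
    "f (x + h *\<^sub>R v + h *\<^sub>R u) - f (x + h *\<^sub>R v) - f (x + h *\<^sub>R u) + f x = h * (h * ?a (x + s' *\<^sub>R v + t' *\<^sub>R u))"
    using mixed_difference_mean_value[OF assms(1,2) h inU'] by blast
  have "x + h *\<^sub>R v + h *\<^sub>R u = x + h *\<^sub>R u + h *\<^sub>R v" by simp
  from 2(5)[unfolded this] 1(5)
  have "h * (h * ?a (x + s' *\<^sub>R v + t' *\<^sub>R u)) = h * (h * ?b (x + s *\<^sub>R u + t *\<^sub>R v))"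
    by linarith
  then have "?a (x + s' *\<^sub>R v + t' *\<^sub>R u) = ?b (x + s *\<^sub>R u + t *\<^sub>R v)" using h by simp
  moreover have "dist (?a (x + s' *\<^sub>R v + t' *\<^sub>R u)) (?a x) < e"
    using near[OF 2(3,4,1,2)] by (intro d) (simp add: d_def add_ac)
  moreover have "dist (?b (x + s *\<^sub>R u + t *\<^sub>R v)) (?b x) < e"
    using near[OF 1(1-4)] by (intro d) (simp add: d_def)
  ultimately have "dist (?a x) (?b x) < e + e"
    using dist_triangle3[of "?a x" "?b x" "?b (x + s *\<^sub>R u + t *\<^sub>R v)"] by simp
  then show False by (simp add: e_def dist_real_def)
qed

lemma dir_deriv_linear:
  assumes "bounded_linear L" "f differentiable (at x)"
  shows "dir_deriv v (\<lambda>x. L (f x)) x = L (dir_deriv v f x)"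
  by (rule dir_deriv_eq[OF bounded_linear.has_derivative[OF assms(1) differentiable_has_dir_deriv[OF assms(2)]]])

section \<open>Plane linear algebra\<close>

text \<open>The adjugate matrix. In dimension two it is linear in \<open>A\<close>.\<close>

definition cof :: "real^2^2 \<Rightarrow> real^2^2" where
  "cof A = (\<chi> i j. if i = 1 then if j = 1 then A$2$2 else - A$1$2 else if j = 1 then - A$2$1 else A$1$1)"

lemma cof_nth [simp]:
  "cof A $ 1 $ 1 = A$2$2" "cof A $ 1 $ 2 = - A$1$2" "cof A $ 2 $ 1 = - A$2$1" "cof A $ 2 $ 2 = A$1$1"
  by (simp_all add: cof_def)

lemma mat2_eqI:
  fixes A B :: "real^2^2"
  shows "A$1$1 = B$1$1 \<Longrightarrow> A$1$2 = B$1$2 \<Longrightarrow> A$2$1 = B$2$1 \<Longrightarrow> A$2$2 = B$2$2 \<Longrightarrow> A = B"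
  by (simp add: vec_eq_iff forall_2)

lemma vec2_eqI:
  fixes v w :: "real^2"
  shows "v$1 = w$1 \<Longrightarrow> v$2 = w$2 \<Longrightarrow> v = w"
  by (simp add: vec_eq_iff forall_2)

lemma mm2 [simp]: "((A::real^2^2) ** B) $ i $ j = A$i$1 * B$1$j + A$i$2 * B$2$j"
  by (simp add: matrix_matrix_mult_def sum_2)

lemma mv2 [simp]: "((A::real^2^2) *v v) $ i = A$i$1 * v$1 + A$i$2 * v$2"
  by (simp add: matrix_vector_mult_def sum_2)

lemma mat1_nth [simp]: "(mat 1 :: real^2^2) $ 1 $ 1 = 1" "(mat 1 :: real^2^2) $ 1 $ 2 = 0"
   "(mat 1 :: real^2^2) $ 2 $ 1 = 0" "(mat 1 :: real^2^2) $ 2 $ 2 = 1"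
  by (simp_all add: mat_def)

lemma trace2: "trace (A::real^2^2) = A$1$1 + A$2$2"
  by (simp add: trace_def sum_2)

lemma inner2: "(v::real^2) \<bullet> w = v$1 * w$1 + v$2 * w$2"
  by (simp add: inner_vec_def sum_2)

lemma cof_mult: "A ** cof A = det A *\<^sub>R mat 1" "cof A ** A = det A *\<^sub>R mat 1"
  by (rule mat2_eqI; simp add: det_2 algebra_simps)+

lemma matrix_inv_cof:
  assumes "det (A::real^2^2) \<noteq> 0"
  shows "matrix_inv A = inverse (det A) *\<^sub>R cof A"
proof -
  let ?B = "inverse (det A) *\<^sub>R cof A"
  have B: "A ** ?B = mat 1" "?B ** A = mat 1"
    using assms by (simp_all add: cof_mult matrix_scalar_ac flip: scalar_matrix_assoc)
  have "A ** matrix_inv A = mat 1 \<and> matrix_inv A ** A = mat 1"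
    unfolding matrix_inv_def using B by (intro someI[of "\<lambda>B. A ** B = mat 1 \<and> B ** A = mat 1" ?B] conjI)
  then show ?thesis using B by (metis matrix_mul_assoc matrix_mul_lid matrix_mul_rid)
qed

lemma matrix_inv_mult:
  assumes "det (A::real^2^2) \<noteq> 0"
  shows "A ** matrix_inv A = mat 1" "matrix_inv A ** A = mat 1"
  using assms by (simp_all add: matrix_inv_cof cof_mult matrix_scalar_ac flip: scalar_matrix_assoc)

lemma matrix_inv_vector:
  assumes "det (A::real^2^2) \<noteq> 0"
  shows "A *v (matrix_inv A *v v) = v" "matrix_inv A *v (A *v v) = v"
  using matrix_inv_mult[OF assms] by (simp_all add: matrix_vector_mul_assoc)

lemma matrix_inv_prod:
  assumes "det (A::real^2^2) \<noteq> 0" "det B \<noteq> 0"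
  shows "matrix_inv (A ** B) *v v = matrix_inv B *v (matrix_inv A *v v)"
proof -
  have "det (A ** B) \<noteq> 0" using assms by (simp add: det_mul)
  then have "matrix_inv (A ** B) *v ((A ** B) *v (matrix_inv B *v (matrix_inv A *v v))) = matrix_inv B *v (matrix_inv A *v v)"
    by (rule matrix_inv_vector)
  moreover have "(A ** B) *v (matrix_inv B *v (matrix_inv A *v v)) = v"
    using assms by (simp add: matrix_inv_vector flip: matrix_vector_mul_assoc)
  ultimately show ?thesis by simp
qed

lemma bounded_bilinear_mv: "bounded_bilinear ((*v) :: real^2^2 \<Rightarrow> real^2 \<Rightarrow> real^2)"
  unfolding bilinear_conv_bounded_bilinear[symmetric] bilinear_def
  by (auto intro!: linearI vec2_eqI simp: algebra_simps)

lemma bounded_linear_cof: "bounded_linear cof"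
  unfolding linear_conv_bounded_linear[symmetric]
  by (auto intro!: linearI mat2_eqI)

lemma bounded_linear_entry: "bounded_linear (\<lambda>A::real^2^2. A $ i $ j)"
  using bounded_linear_compose[OF bounded_linear_vec_nth bounded_linear_vec_nth, of i j] .

lemma Cinf_det:
  assumes "adm U w" "flat w = w" "Cinf U w A"
  shows "Cinf U w (\<lambda>x. det (A x :: real^2^2))"
proof -
  have *: "Cinf U w (\<lambda>x. A x $ i $ j)" for i j
    by (rule Cinf_linear[OF assms(1) bounded_linear_entry assms(3)])
  have "Cinf U w (\<lambda>x. A x $ i $ j * A x $ k $ l)" for i j k l
    by (rule Cinf_bilinear[OF assms(1) bounded_bilinear_mult]) (use * assms(2) in auto)
  note 1 = this
  show ?thesis
    unfolding det_2 diff_conv_add_uminus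
    by (intro Cinf_add[OF assms(1)] 1 Cinf_linear[OF assms(1) bounded_linear_minus[OF bounded_linear_ident]])
qed

lemma smooth_on_entry: "smooth_on S A \<Longrightarrow> smooth_on S (\<lambda>x. A x $ i $ j :: real)" for A :: "_ \<Rightarrow> real^2^2"
  by (rule smooth_on_linear[OF bounded_linear_entry])

lemma smooth_on_det: "smooth_on S A \<Longrightarrow> smooth_on S (\<lambda>x. det (A x :: real^2^2))"
  unfolding det_2 by (intro smooth_on_diff smooth_on_mult smooth_on_entry)

text \<open>The inverse is the adjugate, which is linear in the entries, divided by the determinant.\<close>

lemma Cinf_matrix_inv:
  assumes "adm U w" "flat w = w" "Cinf U w A" "\<And>x. x \<in> U \<Longrightarrow> det (A x :: real^2^2) \<noteq> 0"
    "bnd w (\<lambda>x. inverse (det (A x)))"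
  shows "Cinf U w (\<lambda>x. matrix_inv (A x))"
proof (rule Cinf_cong[OF assms(1)])
  show "Cinf U w (\<lambda>x. inverse (det (A x)) *\<^sub>R cof (A x))"
    by (rule Cinf_bilinear[OF assms(1) bounded_bilinear_scaleR])
       (use assms in \<open>auto intro!: Cinf_inverse Cinf_det Cinf_linear[OF _ bounded_linear_cof]\<close>)
qed (use assms in \<open>simp add: matrix_inv_cof\<close>)

lemma smooth_on_matrix_inv:
  assumes "smooth_on S A" "\<And>x. x \<in> S \<Longrightarrow> det (A x :: real^2^2) \<noteq> 0"
  shows "smooth_on S (\<lambda>x. matrix_inv (A x))"
proof (rule smooth_on_cong)
  show "smooth_on S (\<lambda>x. inverse (det (A x)) *\<^sub>R cof (A x))"
    using assms by (intro smooth_on_scaleR smooth_on_inverse smooth_on_det smooth_on_linear[OF bounded_linear_cof])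
qed (use assms in \<open>simp add: matrix_inv_cof\<close>)

lemma smooth_on_mv: "smooth_on S A \<Longrightarrow> smooth_on S v \<Longrightarrow> smooth_on S (\<lambda>x. (A x :: real^2^2) *v v x)"
  by (rule smooth_on_bilinear[OF bounded_bilinear_mv])

text \<open>Assembles a matrix from its columns by linear maps, so that the matrix of a derivative inherits
  smoothness and decay from directional derivatives.\<close>

definition fill_column :: "2 \<Rightarrow> real^2 \<Rightarrow> real^2^2" where
  "fill_column j w = (\<chi> i k. if k = j then w $ i else 0)"

lemma bounded_linear_fill_column: "bounded_linear (fill_column j)"
  unfolding linear_conv_bounded_linear[symmetric]
  by (auto intro!: linearI simp: fill_column_def vec_eq_iff)

lemma matrix_fill_columns:
  "matrix (D :: real^2 \<Rightarrow> real^2) = fill_column 1 (D (axis 1 1)) + fill_column 2 (D (axis 2 1))"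
  by (rule mat2_eqI) (simp_all add: matrix_def fill_column_def)

lemma Cinf_matrix_deriv:
  assumes "adm U w" "Cinf U w f"
  shows "Cinf U w (\<lambda>y. matrix (\<lambda>v. dir_deriv v f y) :: real^2^2)"
  unfolding matrix_fill_columns
  by (intro Cinf_add[OF assms(1)] Cinf_linear[OF assms(1) bounded_linear_fill_column] Cinf_dir_deriv assms(2))

section \<open>Derivatives on exterior regions\<close>

text \<open>The fluid region and the complement of the moved body are of this form, and with an empty ball so is
  the whole plane.\<close>

definition exterior :: "'a::euclidean_space set \<Rightarrow> bool" where
  "exterior X \<longleftrightarrow> (\<exists>c r. X = - ball c r)"

text \<open>A ball is convex, so it cannot contain points on both sides of \<open>x\<close> on a line through a
  point \<open>x\<close> outside it. Hence \<open>x\<close> can be approached within \<open>X\<close> along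
  every line, which determines the derivative.\<close>

lemma exterior_derivative_unique:
  fixes f :: "'a::euclidean_space \<Rightarrow> 'b::real_normed_vector"
  assumes "exterior X" "x \<in> X" "(f has_derivative D) (at x within X)" "(f has_derivative D') (at x within X)"
  shows "D = D'"
proof (rule frechet_derivative_unique_within[OF assms(3,4)])
  fix i :: 'a and e :: real assume "e > 0"
  obtain c r where X: "X = - ball c r" using assms(1) by (auto simp: exterior_def)
  show "\<exists>d. 0 < \<bar>d\<bar> \<and> \<bar>d\<bar> < e \<and> x + d *\<^sub>R i \<in> X"
  proof (rule ccontr)
    assume no: "\<not> ?thesis"
    have "x + (e/2) *\<^sub>R i \<in> ball c r" "x + (- e/2) *\<^sub>R i \<in> ball c r"
      using no \<open>e > 0\<close> unfolding X by (smt (verit) ComplI field_sum_of_halves)+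
    then have "(1/2) *\<^sub>R (x + (e/2) *\<^sub>R i) + (1/2) *\<^sub>R (x + (- e/2) *\<^sub>R i) \<in> ball c r"
      by (intro convexD[OF convex_ball]) auto
    moreover have "(1/2) *\<^sub>R (x + (e/2) *\<^sub>R i) + (1/2) *\<^sub>R (x + (- e/2) *\<^sub>R i) = x"
      by (simp add: algebra_simps flip: scaleR_add_left)
    ultimately show False using assms(2) X by simp
  qed
qed

lemma jac_unique:
  assumes "exterior X" "x \<in> X" "(f has_derivative D) (at x within X)"
  shows "jac X f x = matrix D"
  unfolding jac_def
  by (metis assms differentiableI exterior_derivative_unique frechet_derivative_works)

lemma has_jac:
  assumes "(f has_derivative D) (at x within X)"
  shows "(f has_derivative (\<lambda>h. jac X f x *v h)) (at x within X)"
proof -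
  have *: "(f has_derivative frechet_derivative f (at x within X)) (at x within X)"
    using assms differentiableI frechet_derivative_works by blast
  then have "linear (frechet_derivative f (at x within X))" by (rule has_derivative_linear)
  then show ?thesis using * unfolding jac_def by (simp add: matrix_works)
qed

lemma extension_has_derivative:
  assumes "open U" "x \<in> U" "Cinf U w f'" "\<And>y. y \<in> X \<Longrightarrow> y \<in> U \<Longrightarrow> f' y = f y" "x \<in> X"
  shows "(f has_derivative (\<lambda>v. dir_deriv v f' x)) (at x within X)"
proof -
  have f': "(f' has_derivative (\<lambda>v. dir_deriv v f' x)) (at x within X)"
    by (rule has_derivative_at_withinI[OF differentiable_on_open_has_dir_deriv[OF Cinf_differentiable_on[OF assms(3)] assms(1,2)]])
  obtain d where d: "d > 0" "ball x d \<subseteq> U" using assms(1,2) openE by blast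
  show ?thesis
  proof (rule has_derivative_transform_within[OF f' d(1) assms(5)])
    fix y assume "y \<in> X" "dist y x < d"
    then have "y \<in> U" using d(2) by (metis dist_commute mem_ball subsetD)
    then show "f' y = f y" using assms(4) \<open>y \<in> X\<close> by blast
  qed
qed

text \<open>At boundary points the derivative within \<open>X\<close> is that of any smooth extension.\<close>

lemma jac_extension:
  assumes "exterior X" "open U" "x \<in> U" "Cinf U w f'" "\<And>y. y \<in> X \<Longrightarrow> y \<in> U \<Longrightarrow> f' y = f y" "x \<in> X"
  shows "jac X f x = matrix (\<lambda>v. dir_deriv v f' x)"
  by (rule jac_unique[OF assms(1,6) extension_has_derivative[OF assms(2-6)]])

lemma smooth_on_has_jac:
  assumes "smooth_on X f" "x \<in> X"
  shows "(f has_derivative (\<lambda>h. jac X f x *v h)) (at x within X)"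
proof -
  from assms obtain U f' where U: "open U" "x \<in> U" "Cinf U None f'" "\<And>y. y \<in> X \<Longrightarrow> y \<in> U \<Longrightarrow> f' y = f y"
    by (rule smooth_onE) blast
  show ?thesis by (rule has_jac[OF extension_has_derivative[OF U assms(2)]])
qed

lemma jac_eqI:
  assumes "exterior X" "x \<in> X" "(f has_derivative (\<lambda>h. A *v h)) (at x within X)"
  shows "jac X f x = A"
  using jac_unique[OF assms] by simp

lemma jac_compose:
  assumes "exterior X" "smooth_on X f" "f ` X \<subseteq> Y" "smooth_on Y g" "x \<in> X"
  shows "jac X (\<lambda>x. g (f x)) x = jac Y g (f x) ** jac X f x"
proof (rule jac_eqI[OF assms(1,5)])
  have "(g has_derivative (\<lambda>h. jac Y g (f x) *v h)) (at (f x) within Y)"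
    using assms by (intro smooth_on_has_jac) auto
  then have "(g has_derivative (\<lambda>h. jac Y g (f x) *v h)) (at (f x) within f ` X)"
    using assms(3) by (rule has_derivative_subset)
  from has_derivative_in_compose[OF smooth_on_has_jac[OF assms(2,5)] this]
  show "((\<lambda>x. g (f x)) has_derivative (*v) (jac Y g (f x) ** jac X f x)) (at x within X)"
    by (simp add: matrix_vector_mul_assoc)
qed

lemma smooth_on_jac:
  assumes "exterior X" "smooth_on X f"
  shows "smooth_on X (jac X f)"
proof (rule smooth_onI)
  fix x assume "x \<in> X"
  with assms(2) obtain U f' where U: "open U" "x \<in> U" "Cinf U None f'" "\<And>y. y \<in> X \<Longrightarrow> y \<in> U \<Longrightarrow> f' y = f y"
    by (rule smooth_onE) blast
  have "matrix (\<lambda>v. dir_deriv v f' y) = jac X f y" if "y \<in> X \<inter> U" for y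
    using jac_extension[OF assms(1) U(1) _ U(3,4)] that by (metis IntE)
  then show "\<exists>U f'. open U \<and> x \<in> U \<and> Cinf U None f' \<and> (\<forall>y\<in>X \<inter> U. f' y = jac X f y)"
    using U Cinf_matrix_deriv[OF _ U(3)]
    by (intro exI[of _ U] exI[of _ "\<lambda>y. matrix (\<lambda>v. dir_deriv v f' y)"]) auto
qed

lemma jac_cong:
  assumes "exterior X" "smooth_on X f" "x \<in> X" "\<And>y. y \<in> X \<Longrightarrow> f y = g y"
  shows "jac X g x = jac X f x"
  by (rule jac_eqI[OF assms(1,3)], rule has_derivative_transform[OF assms(3) _ smooth_on_has_jac[OF assms(2,3)]])
     (simp add: assms(4))

lemma jac_id: "exterior X \<Longrightarrow> x \<in> X \<Longrightarrow> jac X (\<lambda>x. x) x = mat 1"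
  by (rule jac_eqI) (auto intro!: derivative_eq_intros)

lemma jac_add:
  assumes "exterior X" "smooth_on X f" "smooth_on X g" "x \<in> X"
  shows "jac X (\<lambda>x. f x + g x) x = jac X f x + jac X g x"
  by (rule jac_eqI[OF assms(1,4)])
     (use has_derivative_add[OF smooth_on_has_jac[OF assms(2,4)] smooth_on_has_jac[OF assms(3,4)]] in
       \<open>simp add: matrix_vector_mult_add_rdistrib\<close>)

lemma jac_scaleR:
  assumes "exterior X" "smooth_on X f" "x \<in> X"
  shows "jac X (\<lambda>x. c *\<^sub>R f x) x = c *\<^sub>R jac X f x"
  by (rule jac_eqI[OF assms(1,3)])
     (use has_derivative_scaleR_right[OF smooth_on_has_jac[OF assms(2,3)], of c] in
       \<open>simp add: scaleR_matrix_vector_assoc\<close>)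

lemma dir_deriv_commute:
  fixes f :: "'a::real_normed_vector \<Rightarrow> 'b::euclidean_space"
  assumes "open U" "Cinf U None f" "x \<in> U"
  shows "dir_deriv u (dir_deriv v f) x = dir_deriv v (dir_deriv u f) x"
proof (rule euclidean_eqI)
  fix b :: 'b
  let ?L = "\<lambda>y. y \<bullet> b"
  have d: "f differentiable (at y)" "\<And>u. dir_deriv u f differentiable (at y)" if "y \<in> U" for y
    using that assms Cinf_differentiable_on[OF assms(2)] Cinf_differentiable_on[OF Cinf_dir_deriv[OF assms(2)]]
    by (metis at_within_open differentiable_on_def)+
  have 1: "dir_deriv u (dir_deriv v f) x \<bullet> b = dir_deriv u (dir_deriv v (\<lambda>y. f y \<bullet> b)) x" for u v
  proof -
    have "dir_deriv u (dir_deriv v f) x \<bullet> b = dir_deriv u (\<lambda>y. dir_deriv v f y \<bullet> b) x"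
      using d assms(3) by (simp add: dir_deriv_linear[OF bounded_linear_inner_left])
    also have "\<dots> = dir_deriv u (dir_deriv v (\<lambda>y. f y \<bullet> b)) x"
      using d by (intro dir_deriv_cong_open[OF assms(1,3)]) (simp add: dir_deriv_linear[OF bounded_linear_inner_left])
    finally show ?thesis .
  qed
  have "Cinf U None (\<lambda>y. f y \<bullet> b)"
    using assms by (intro Cinf_linear[OF _ bounded_linear_inner_left]) auto
  then show "dir_deriv u (dir_deriv v f) x \<bullet> b = dir_deriv v (dir_deriv u f) x \<bullet> b"
    unfolding 1 by (rule dir_deriv_commute_real[OF assms(1) _ assms(3)])
qed

lemma dir_deriv_nth:
  fixes f :: "'a::real_normed_vector \<Rightarrow> real^'n"
  shows "f differentiable (at x) \<Longrightarrow> dir_deriv v (\<lambda>x. f x $ i) x = dir_deriv v f x $ i"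
  by (rule dir_deriv_linear[OF bounded_linear_vec_nth])

text \<open>Expanding the divergence, the terms with second derivatives of \<open>f\<close> cancel by symmetry,
  and the remaining ones form the trace of \<open>cof A ** B ** A\<close>, where \<open>A\<close> and
  \<open>B\<close> are the derivatives of \<open>f\<close> and \<open>V\<close>; this trace is \<open>det
  A\<close> times the trace of \<open>B\<close>.\<close>

lemma piola:
  fixes f V :: "plane \<Rightarrow> plane"
  assumes X: "exterior X" and f: "smooth_on X f" "f ` X \<subseteq> Y" and V: "smooth_on Y V" and x: "x \<in> X"
  shows "divergence X (\<lambda>x. cof (jac X f x) *v V (f x)) x = det (jac X f x) * divergence Y V (f x)"
proof -
  have W: "smooth_on X (\<lambda>x. V (f x))" by (rule smooth_on_compose[OF V f])
  obtain U1 f' where U1: "open U1" "x \<in> U1" "Cinf U1 None f'" "\<And>y. y \<in> X \<Longrightarrow> y \<in> U1 \<Longrightarrow> f' y = f y"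
    using smooth_onE[OF f(1) x] by blast
  obtain U2 w where U2: "open U2" "x \<in> U2" "Cinf U2 None w" "\<And>y. y \<in> X \<Longrightarrow> y \<in> U2 \<Longrightarrow> w y = V (f y)"
    using smooth_onE[OF W x] by blast
  define U where "U = U1 \<inter> U2"
  have U: "open U" "x \<in> U" "Cinf U None f'" "Cinf U None w"
      "\<And>y. y \<in> X \<Longrightarrow> y \<in> U \<Longrightarrow> f' y = f y" "\<And>y. y \<in> X \<Longrightarrow> y \<in> U \<Longrightarrow> w y = V (f y)"
    using U1 U2 by (auto simp: U_def elim: Cinf_None_subset)
  define e1 e2 :: plane where "e1 = axis 1 1" and "e2 = axis 2 1"
  define F where "F y = cof (matrix (\<lambda>v. dir_deriv v f' y)) *v w y" for y
  have F_nth: "F y $ 1 = dir_deriv e2 f' y $ 2 * w y $ 1 - dir_deriv e2 f' y $ 1 * w y $ 2"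
      "F y $ 2 = dir_deriv e1 f' y $ 1 * w y $ 2 - dir_deriv e1 f' y $ 2 * w y $ 1" for y
    by (simp_all add: F_def matrix_def e1_def e2_def)
  have FC: "Cinf U None F"
    unfolding F_def
    by (rule Cinf_bilinear[OF _ bounded_bilinear_mv])
       (use U in \<open>auto intro!: Cinf_linear[OF _ bounded_linear_cof] Cinf_matrix_deriv\<close>)
  have jf: "jac X f y = matrix (\<lambda>v. dir_deriv v f' y)" if "y \<in> X" "y \<in> U" for y
    using jac_extension[OF X U(1) that(2) U(3,5) that(1)] .
  have jw: "jac X (\<lambda>x. V (f x)) x = matrix (\<lambda>v. dir_deriv v w x)"
    using jac_extension[OF X U(1,2,4,6) x] .
  have "jac X (\<lambda>x. cof (jac X f x) *v V (f x)) x = matrix (\<lambda>v. dir_deriv v F x)"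
    by (rule jac_extension[OF X U(1,2) FC _ x]) (simp add: F_def jf U(6))
  then have div: "divergence X (\<lambda>x. cof (jac X f x) *v V (f x)) x = dir_deriv e1 F x $ 1 + dir_deriv e2 F x $ 2"
    by (simp add: divergence_def trace2 matrix_def e1_def e2_def)
  have d: "g differentiable (at x)" if "Cinf U None g" for g :: "plane \<Rightarrow> plane"
    using that U Cinf_differentiable_on by (metis at_within_open differentiable_on_def)
  have hd: "((\<lambda>y. g y $ i) has_derivative (\<lambda>v. dir_deriv v g x $ i)) (at x)" if "Cinf U None g" for g :: "plane \<Rightarrow> plane" and i
    by (intro bounded_linear.has_derivative[OF bounded_linear_vec_nth] differentiable_has_dir_deriv d that)
  note dd = hd[OF Cinf_dir_deriv[OF U(3)]] hd[OF U(4)]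
  have D1: "dir_deriv e1 F x $ 1 = dir_deriv e2 f' x $ 2 * dir_deriv e1 w x $ 1 + dir_deriv e1 (dir_deriv e2 f') x $ 2 * w x $ 1
      - (dir_deriv e2 f' x $ 1 * dir_deriv e1 w x $ 2 + dir_deriv e1 (dir_deriv e2 f') x $ 1 * w x $ 2)"
  proof -
    have "dir_deriv e1 F x $ 1 = dir_deriv e1 (\<lambda>y. F y $ 1) x" using dir_deriv_nth[OF d[OF FC]] by simp
    also have "\<dots> = dir_deriv e2 f' x $ 2 * dir_deriv e1 w x $ 1 + dir_deriv e1 (dir_deriv e2 f') x $ 2 * w x $ 1
      - (dir_deriv e2 f' x $ 1 * dir_deriv e1 w x $ 2 + dir_deriv e1 (dir_deriv e2 f') x $ 1 * w x $ 2)"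
      unfolding F_nth by (rule dir_deriv_eq[OF has_derivative_diff[OF has_derivative_mult[OF dd] has_derivative_mult[OF dd]]])
    finally show ?thesis .
  qed
  have D2: "dir_deriv e2 F x $ 2 = dir_deriv e1 f' x $ 1 * dir_deriv e2 w x $ 2 + dir_deriv e2 (dir_deriv e1 f') x $ 1 * w x $ 2
      - (dir_deriv e1 f' x $ 2 * dir_deriv e2 w x $ 1 + dir_deriv e2 (dir_deriv e1 f') x $ 2 * w x $ 1)"
  proof -
    have "dir_deriv e2 F x $ 2 = dir_deriv e2 (\<lambda>y. F y $ 2) x" using dir_deriv_nth[OF d[OF FC]] by simp
    also have "\<dots> = dir_deriv e1 f' x $ 1 * dir_deriv e2 w x $ 2 + dir_deriv e2 (dir_deriv e1 f') x $ 1 * w x $ 2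
      - (dir_deriv e1 f' x $ 2 * dir_deriv e2 w x $ 1 + dir_deriv e2 (dir_deriv e1 f') x $ 2 * w x $ 1)"
      unfolding F_nth by (rule dir_deriv_eq[OF has_derivative_diff[OF has_derivative_mult[OF dd] has_derivative_mult[OF dd]]])
    finally show ?thesis .
  qed
  have sym: "dir_deriv e2 (dir_deriv e1 f') x = dir_deriv e1 (dir_deriv e2 f') x"
    by (rule dir_deriv_commute[OF U(1,3,2)])
  define A where "A = jac X f x"
  define B where "B = jac Y V (f x)"
  have "matrix (\<lambda>v. dir_deriv v w x) = B ** A"
    unfolding A_def B_def jw[symmetric] by (rule jac_compose[OF X f V x])
  then have w': "dir_deriv e1 w x $ i = (B ** A) $ i $ 1" "dir_deriv e2 w x $ i = (B ** A) $ i $ 2" for i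
    by (simp_all add: matrix_def vec_eq_iff e1_def e2_def)
  have f'': "dir_deriv e1 f' x $ i = A $ i $ 1" "dir_deriv e2 f' x $ i = A $ i $ 2" for i
    using jf[OF x U(2)] by (simp_all add: matrix_def vec_eq_iff e1_def e2_def A_def)
  show ?thesis
    unfolding div D1 D2 sym w' f'' A_def[symmetric]
    by (simp add: divergence_def B_def[symmetric] trace2 det_2 algebra_simps)
qed

section \<open>Decay on exterior regions\<close>

lemma exterior_interior:
  assumes "exterior X" shows "adm (interior X) w"
proof -
  obtain c r where X: "X = - ball c r" using assms by (auto simp: exterior_def)
  have "\<forall>\<^sub>F x in at_infinity. x \<in> interior X"
    using eventually_at_infinity_norm_ge[of "norm c + \<bar>r\<bar> + 1"]
  proof eventually_elim
    case (elim x)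
    have "x \<in> - cball c r" using elim norm_triangle_ineq[of "x - c" c] by (auto simp: dist_norm norm_minus_commute)
    moreover have "- cball c r \<subseteq> interior X" unfolding X by (intro interior_maximal) (auto simp: open_Compl)
    ultimately show ?case by blast
  qed
  then show ?thesis by (simp add: adm_def)
qed

lemma smooth_on_interior: "smooth_on X f \<Longrightarrow> Cinf (interior X) None f"
  using smooth_on_open[of "interior X" f] smooth_on_subset[of X f "interior X"] interior_subset by auto

text \<open>The interior of \<open>X\<close> is a neighbourhood of infinity, and decay depends on nothing
  else.\<close>

lemma decays_iff:
  assumes "smooth_on X f"
  shows "decays s f \<longleftrightarrow> Cinf (interior X) (Some s) f"
  using smooth_on_interior[OF assms] unfolding Cinf_iff decays_def bnd_def by auto

lemma decaysD: "smooth_on X f \<Longrightarrow> decays s f \<Longrightarrow> Cinf (interior X) (Some s) f"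
  using decays_iff by blast

text \<open>Bootstrapping for inverse maps: the derivative of \<open>h\<close> is \<open>M \<circ> h\<close>,
  and for a bound on \<open>n\<close> derivatives of \<open>M \<circ> h\<close> only \<open>n\<close>
  derivatives of \<open>h\<close> are needed, one less than it gives.\<close>

lemma local_inverse_dir_deriv:
  fixes h :: "plane \<Rightarrow> plane" and M :: "plane \<Rightarrow> real^2^2"
  assumes "adm V w" "flat w = w" "open U" "h ` V \<subseteq> U" "h differentiable_on V"
    and bc: "\<And>F::plane \<Rightarrow> real^2^2. bnd w F \<Longrightarrow> bnd w (\<lambda>x. F (h x))"
    and "Cinf U w M" and dh: "\<And>y v. y \<in> V \<Longrightarrow> dir_deriv v h y = M (h y) *v v"
  shows "Cinf V w (dir_deriv v h)"
proof -
  have step: "Ck n V w (dir_deriv v h)" if "Ck n V w (\<lambda>y. M (h y))" for n v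
  proof (rule Ck_cong[OF assms(1)])
    show "Ck n V w (\<lambda>y. M (h y) *v v)"
      by (rule Ck_linear[OF assms(1) bounded_bilinear.bounded_linear_left[OF bounded_bilinear_mv] that])
  qed (simp add: dh)
  have "\<forall>v. Ck n V w (dir_deriv v h)" for n
  proof (induction n rule: less_induct)
    case (less n)
    have "Ck n V w (\<lambda>y. M (h y))"
      by (rule Ck_compose[OF assms(1,3,4,5) bc]) (use assms(2,7) less in \<open>auto simp: Cinf_def\<close>)
    then show ?case using step by blast
  qed
  then show ?thesis by (simp add: Cinf_def)
qed

section \<open>Diffeomorphisms near the identity\<close>

lemma exterior_closed: "exterior X \<Longrightarrow> closed X"
  unfolding exterior_def by (metis closed_Compl open_ball)

lemma jac_interior:
  assumes "exterior X" "smooth_on X f" "x \<in> interior X"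
  shows "jac X f x = matrix (\<lambda>v. dir_deriv v f x)"
  using assms interior_subset[of X]
  by (intro jac_extension[where U="interior X" and w=None]) (auto intro: smooth_on_interior)

lemma bij_inv_matrix:
  assumes "det (A::real^2^2) \<noteq> 0" shows "inv ((*v) A) = (*v) (matrix_inv A)"
  by (rule inv_unique_comp) (auto simp: matrix_inv_vector[OF assms])

text \<open>The inverse function theorem for a smooth extension \<open>f\<close> of \<open>\<phi>\<close> beyond
  the boundary. Continuity of \<open>\<psi>\<close> keeps \<open>\<psi> z\<close> in the neighbourhood on which
  \<open>f\<close> is injective, so the local inverse of \<open>f\<close> extends \<open>\<psi>\<close>.\<close>

lemma smooth_on_homeomorphism_inverse:
  fixes \<phi> :: "plane \<Rightarrow> plane"
  assumes X: "exterior X" and smooth: "smooth_on X \<phi>" and hom: "homeomorphism X Y \<phi> \<psi>"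
    and det: "\<And>x. x \<in> X \<Longrightarrow> det (jac X \<phi> x) \<noteq> 0"
  shows "smooth_on Y \<psi>"
proof (rule smooth_onI)
  fix y assume y: "y \<in> Y"
  define x where "x = \<psi> y"
  have x: "x \<in> X" "\<phi> x = y" using hom y by (auto simp: x_def homeomorphism_def)
  obtain U f where U: "open U" "x \<in> U" "Cinf U None f" "\<And>y. y \<in> X \<Longrightarrow> y \<in> U \<Longrightarrow> f y = \<phi> y"
    using smooth_onE[OF smooth x(1)] by blast
  define M where "M z = (matrix (\<lambda>v. dir_deriv v f z) :: real^2^2)" for z
  have MC: "Cinf U None M" unfolding M_def using U by (intro Cinf_matrix_deriv) auto
  define W where "W = U \<inter> (\<lambda>z. det (M z)) -` (- {0})"
  have "continuous_on U (\<lambda>z. det (M z))"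
    using U MC by (intro Cinf_None_continuous_on[where w=None] Cinf_det) auto
  then have W: "open W" "W \<subseteq> U" "\<And>z. z \<in> W \<Longrightarrow> det (M z) \<noteq> 0"
    unfolding W_def using U(1) by (auto intro: continuous_open_preimage)
  have "M x = jac X \<phi> x" unfolding M_def by (rule jac_extension[OF X U x(1), symmetric])
  then have xW: "x \<in> W" using det[OF x(1)] U(2) by (simp add: W_def)
  have CW: "Cinf W None M" "Cinf W None f" using MC U(3) W(2) by (auto intro: Cinf_None_subset)
  interpret mv: bounded_bilinear "(*v) :: real^2^2 \<Rightarrow> real^2 \<Rightarrow> real^2" by (rule bounded_bilinear_mv)
  have prod: "blinfun_apply (mv.prod_right A) = (*v) A" for A by (rule mv.prod_right.rep_eq)
  have derf: "(f has_derivative blinfun_apply (mv.prod_right (M z))) (at z)" if "z \<in> W" for z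
  proof -
    have *: "(f has_derivative (\<lambda>v. dir_deriv v f z)) (at z)"
      by (rule differentiable_on_open_has_dir_deriv[OF Cinf_differentiable_on[OF CW(2)] W(1) that])
    then have "linear (\<lambda>v. dir_deriv v f z)" by (rule has_derivative_linear)
    then have "(\<lambda>v. dir_deriv v f z) = (*v) (M z)" unfolding M_def by (simp add: matrix_works fun_eq_iff)
    then show ?thesis using * by (simp add: prod)
  qed
  have contf: "continuous_on W (\<lambda>z. mv.prod_right (M z))"
    by (rule bounded_linear.continuous_on[OF mv.bounded_linear_prod_right Cinf_None_continuous_on[OF CW(1)]])
  have invf: "mv.prod_right (matrix_inv (M x)) o\<^sub>L mv.prod_right (M x) = id_blinfun"
    by (rule blinfun_eqI) (simp add: prod matrix_inv_vector[OF W(3)[OF xW]])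
  obtain U' V g g' where g: "open U'" "U' \<subseteq> W" "x \<in> U'" "open V" "f x \<in> V" "homeomorphism U' V f g"
    "\<And>y. y \<in> V \<Longrightarrow> (g has_derivative (g' y)) (at y)"
    "\<And>y. y \<in> V \<Longrightarrow> g' y = inv (blinfun_apply (mv.prod_right (M (g y))))"
    by (rule inverse_function_theorem[OF W(1) derf contf xW invf]) (assumption, blast)
  have gV: "g ` V = U'" using g(6) by (simp add: homeomorphism_def)
  have dg: "dir_deriv v g z = matrix_inv (M (g z)) *v v" if "z \<in> V" for v z
  proof -
    have "det (M (g z)) \<noteq> 0" using gV g(2) W(3) that by blast
    then show ?thesis using dir_deriv_eq[OF g(7)[OF that], of v] g(8)[OF that] by (simp add: prod bij_inv_matrix)
  qed
  have gd: "g differentiable_on V"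
    using g(7) by (meson differentiable_at_withinI differentiable_def differentiable_on_def)
  have "Cinf U' None (\<lambda>z. matrix_inv (M z))"
    using g(1,2) W(3) Cinf_None_subset[OF CW(1) g(2)] by (intro Cinf_matrix_inv) auto
  then have dgC: "Cinf V None (dir_deriv v g)" for v
    using g(4) gV by (intro local_inverse_dir_deriv[OF _ _ g(1) _ gd _ _ dg]) auto
  have gC: "Cinf V None g" by (rule Cinf_step[OF gd bnd_None dgC])
  have "continuous_on Y \<psi>" using hom by (simp add: homeomorphism_def)
  then obtain T where T: "open T" "T \<inter> Y = \<psi> -` U' \<inter> Y"
    using g(1) unfolding continuous_on_open_invariant by (elim allE[of _ U']) blast
  have "y \<in> T" using T y g(3) by (auto simp: x_def)
  moreover have "y \<in> V" using g(5) U(4)[OF x(1) U(2)] x(2) by simp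
  moreover have "g z = \<psi> z" if "z \<in> Y" "z \<in> V" "z \<in> T" for z
  proof -
    have 1: "\<psi> z \<in> U'" using T that by blast
    have "\<psi> z \<in> X" "\<phi> (\<psi> z) = z" using hom that by (auto simp: homeomorphism_def)
    then have "f (\<psi> z) = z" using U(4) 1 g(2) W(2) by (metis subsetD)
    then show ?thesis using g(6) 1 unfolding homeomorphism_def by metis
  qed
  ultimately show "\<exists>U f'. open U \<and> y \<in> U \<and> Cinf U None f' \<and> (\<forall>y\<in>Y \<inter> U. f' y = \<psi> y)"
    using g(4) T(1) Cinf_None_subset[OF gC, of "V \<inter> T"]
    by (intro exI[of _ "V \<inter> T"] exI[of _ g]) auto
qed

lemma bnd_tendsto_0:
  assumes "bnd (Some s) f" "s > 0"
  shows "(f \<longlongrightarrow> 0) at_infinity"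
proof -
  obtain C where C: "\<forall>\<^sub>F x in at_infinity. norm (f x) \<le> C * norm x powr (- s)"
    using assms unfolding bnd_Some by blast
  have "((\<lambda>x. norm (x::'a) powr (- s)) \<longlongrightarrow> 0) at_infinity"
    by (rule tendsto_neg_powr) (use assms filterlim_norm_at_top in auto)
  then have "((\<lambda>x. C * norm (x::'a) powr (- s)) \<longlongrightarrow> 0) at_infinity" by (rule tendsto_mult_right_zero)
  then show ?thesis by (rule Lim_null_comparison[OF C])
qed

lemma smooth_on_shift: "smooth_on X \<phi> \<Longrightarrow> smooth_on X (\<lambda>x. \<phi> x - x)"
  by (intro smooth_on_diff smooth_on_id)

lemma near_id_flat_dir_deriv:
  assumes "exterior X" "smooth_on X \<phi>" "decays s (\<lambda>x. \<phi> x - x)" "s > 0"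
  shows "Cinf (interior X) (Some 0) (dir_deriv v \<phi>)" "((\<lambda>x. dir_deriv v \<phi> x) \<longlongrightarrow> v) at_infinity"
proof -
  let ?d = "\<lambda>x. \<phi> x - x"
  have adm: "adm (interior X) w" for w by (rule exterior_interior[OF assms(1)])
  have dC: "Cinf (interior X) (Some s) ?d" by (rule decaysD[OF smooth_on_shift[OF assms(2)] assms(3)])
  have diff: "dir_deriv v ?d x + v = dir_deriv v \<phi> x" if "x \<in> interior X" for x
  proof -
    have "(\<phi> has_derivative (\<lambda>v. dir_deriv v \<phi> x)) (at x)"
      by (rule differentiable_on_open_has_dir_deriv[OF Cinf_differentiable_on[OF smooth_on_interior[OF assms(2)]] open_interior that])
    from dir_deriv_eq[OF has_derivative_diff[OF this has_derivative_ident]] show ?thesis by simp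
  qed
  have "Cinf (interior X) (Some 0) (dir_deriv v ?d)"
    using assms(4) by (intro Cinf_weaken[OF _ order_refl Cinf_dir_deriv[OF dC]]) auto
  then have "Cinf (interior X) (Some 0) (\<lambda>x. dir_deriv v ?d x + v)"
    by (intro Cinf_add[OF adm] Cinf_const) auto
  then show "Cinf (interior X) (Some 0) (dir_deriv v \<phi>)"
    by (rule Cinf_cong[OF adm, rotated]) (rule diff)
  have "(dir_deriv v ?d \<longlongrightarrow> 0) at_infinity"
    by (rule bnd_tendsto_0[OF Cinf_bnd[OF Cinf_dir_deriv[OF dC]] assms(4)])
  then have "((\<lambda>x. dir_deriv v ?d x + v) \<longlongrightarrow> 0 + v) at_infinity" by (intro tendsto_intros)
  moreover have "\<forall>\<^sub>F x in at_infinity. dir_deriv v ?d x + v = dir_deriv v \<phi> x"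
    using adm[of "Some 0"] diff by (auto simp: adm_def elim: eventually_mono)
  ultimately show "((\<lambda>x. dir_deriv v \<phi> x) \<longlongrightarrow> v) at_infinity"
    using tendsto_cong by force
qed

text \<open>Decay controls the displacement far out and compactness controls it on the rest of
  \<open>X\<close>.\<close>

lemma near_id_bounded_shift:
  assumes "exterior X" "smooth_on X \<phi>" "decays s (\<lambda>x. \<phi> x - x)" "s \<ge> 0"
  obtains B where "\<And>x. x \<in> X \<Longrightarrow> norm (\<phi> x - x) \<le> B"
proof -
  let ?d = "\<lambda>x. \<phi> x - (x::'a)"
  have "bnd (Some 0) ?d"
    using bnd_mono[OF assms(4) Cinf_bnd[OF decaysD[OF smooth_on_shift[OF assms(2)] assms(3)]]] .
  then obtain C where "\<forall>\<^sub>F x in at_infinity. norm (?d x) \<le> C * norm x powr (- 0)"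
    unfolding bnd_Some by blast
  then obtain M where M: "\<And>x. norm x \<ge> M \<Longrightarrow> norm (?d x) \<le> C * norm x powr (- 0)"
    unfolding eventually_at_infinity by blast
  have "compact (X \<inter> cball 0 (max M 1))"
    using exterior_closed[OF assms(1)] by (simp add: closed_Int_compact)
  moreover have "continuous_on (X \<inter> cball 0 (max M 1)) ?d"
    using smooth_on_continuous_on[OF smooth_on_shift[OF assms(2)]] continuous_on_subset by blast
  ultimately have "bounded (?d ` (X \<inter> cball 0 (max M 1)))"
    using compact_continuous_image compact_imp_bounded by blast
  then obtain B where B: "\<And>x. x \<in> X \<Longrightarrow> norm x \<le> max M 1 \<Longrightarrow> norm (?d x) \<le> B"
    unfolding bounded_iff by (metis (no_types, lifting) IntI imageI mem_cball_0)
  have "norm (?d x) \<le> max B C" if "x \<in> X" for x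
  proof (cases "norm x \<le> max M 1")
    case True then show ?thesis using B[OF that] by auto
  next
    case False
    then have "x \<noteq> 0" "norm x \<ge> M" by auto
    then show ?thesis using M[of x] by simp
  qed
  then show thesis by (rule that)
qed

text \<open>Configurations and relabellings are both of this kind. With the inverse \<open>\<psi>\<close> and
  its decay as part of the structure, the notion is symmetric and closed under composition.\<close>

definition near_id :: "real \<Rightarrow> plane set \<Rightarrow> plane set \<Rightarrow> (plane \<Rightarrow> plane) \<Rightarrow> (plane \<Rightarrow> plane) \<Rightarrow> bool" where
  "near_id s X Y \<phi> \<psi> \<longleftrightarrow> s > 0 \<and> exterior X \<and> exterior Y \<and> homeomorphism X Y \<phi> \<psi> \<and>
     \<phi> ` frontier X = frontier Y \<and> smooth_on X \<phi> \<and> smooth_on Y \<psi> \<and>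
     decays s (\<lambda>x. \<phi> x - x) \<and> decays s (\<lambda>y. \<psi> y - y)"

lemma interior_image_of_frontier:
  assumes "closed X" "closed Y" "bij_betw f X Y" "f ` frontier X = frontier Y"
  shows "f ` interior X = interior Y"
proof -
  have "interior X = X - frontier X" "interior Y = Y - frontier Y"
    using assms(1,2) interior_subset by (auto simp: frontier_def)
  moreover have "frontier X \<subseteq> X" using assms(1) frontier_subset_eq by blast
  ultimately show ?thesis
    using assms(3,4) by (metis Diff_subset bij_betw_def inj_on_image_set_diff)
qed

lemma near_idD:
  assumes "near_id s X Y \<phi> \<psi>"
  shows "s > 0" "exterior X" "exterior Y" "homeomorphism X Y \<phi> \<psi>" "smooth_on X \<phi>" "smooth_on Y \<psi>"
    "decays s (\<lambda>x. \<phi> x - x)" "decays s (\<lambda>y. \<psi> y - y)" "\<phi> ` frontier X = frontier Y"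
    "\<phi> ` X = Y" "\<psi> ` Y = X" "\<And>x. x \<in> X \<Longrightarrow> \<psi> (\<phi> x) = x" "\<And>y. y \<in> Y \<Longrightarrow> \<phi> (\<psi> y) = y"
    "\<phi> ` interior X = interior Y"
proof -
  show *: "s > 0" "exterior X" "exterior Y" "homeomorphism X Y \<phi> \<psi>" "smooth_on X \<phi>" "smooth_on Y \<psi>"
    "decays s (\<lambda>x. \<phi> x - x)" "decays s (\<lambda>y. \<psi> y - y)" "\<phi> ` frontier X = frontier Y"
    using assms by (auto simp: near_id_def)
  show **: "\<phi> ` X = Y" "\<psi> ` Y = X" "\<And>x. x \<in> X \<Longrightarrow> \<psi> (\<phi> x) = x" "\<And>y. y \<in> Y \<Longrightarrow> \<phi> (\<psi> y) = y"
    using *(4) by (auto simp: homeomorphism_def)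
  have "bij_betw \<phi> X Y" using ** by (metis bij_betw_def inj_on_inverseI)
  then show "\<phi> ` interior X = interior Y"
    by (rule interior_image_of_frontier[OF exterior_closed[OF *(2)] exterior_closed[OF *(3)] _ *(9)])
qed

lemma near_id_sym:
  assumes "near_id s X Y \<phi> \<psi>" shows "near_id s Y X \<psi> \<phi>"
proof -
  have "\<psi> ` frontier Y = frontier X"
  proof -
    have "(\<lambda>x. \<psi> (\<phi> x)) ` frontier X = (\<lambda>x. x) ` frontier X"
      using near_idD(12)[OF assms] exterior_closed[OF near_idD(2)[OF assms]] frontier_subset_eq[of X]
      by (intro image_cong) auto
    then show ?thesis unfolding near_idD(9)[OF assms, symmetric] image_image by simp
  qed
  then show ?thesis using assms homeomorphism_symD by (auto simp: near_id_def)
qed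

lemma near_id_det:
  assumes "near_id s X Y \<phi> \<psi>" "x \<in> X"
  shows "jac Y \<psi> (\<phi> x) ** jac X \<phi> x = mat 1" "det (jac X \<phi> x) \<noteq> 0"
    "matrix_inv (jac X \<phi> x) = jac Y \<psi> (\<phi> x)"
proof -
  note n = near_idD[OF assms(1)]
  have "jac X (\<lambda>x. \<psi> (\<phi> x)) x = jac Y \<psi> (\<phi> x) ** jac X \<phi> x"
    by (rule jac_compose) (use n assms in auto)
  moreover have "jac X (\<lambda>x. \<psi> (\<phi> x)) x = jac X (\<lambda>x. x) x"
    by (rule jac_cong) (use n assms in \<open>auto intro: smooth_on_id\<close>)
  ultimately show 1: "jac Y \<psi> (\<phi> x) ** jac X \<phi> x = mat 1" using jac_id[OF n(2) assms(2)] by simp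
  then have "det (jac Y \<psi> (\<phi> x)) * det (jac X \<phi> x) = 1" by (metis det_I det_mul)
  then show 2: "det (jac X \<phi> x) \<noteq> 0" by auto
  show "matrix_inv (jac X \<phi> x) = jac Y \<psi> (\<phi> x)"
    by (metis 1 2 matrix_inv_mult(1) matrix_mul_assoc matrix_mul_lid matrix_mul_rid)
qed

lemma near_id_flat_jac:
  assumes "near_id s X Y \<phi> \<psi>" shows "Cinf (interior X) (Some 0) (jac X \<phi>)"
proof (rule Cinf_cong[OF exterior_interior[OF near_idD(2)[OF assms]]])
  note n = near_idD[OF assms]
  show "Cinf (interior X) (Some 0) (\<lambda>y. matrix (\<lambda>v. dir_deriv v \<phi> y))"
    unfolding matrix_fill_columns
    by (intro Cinf_add[OF exterior_interior[OF n(2)]] Cinf_linear[OF exterior_interior[OF n(2)] bounded_linear_fill_column]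
        near_id_flat_dir_deriv[OF n(2,5,7,1)])
qed (use jac_interior near_idD(2,5)[OF assms] in simp)

lemma near_id_bnd_shift:
  assumes "near_id s X Y \<phi> \<psi>"
  shows "bnd (Some 0) (\<lambda>x. \<phi> x - x)"
  using near_idD[OF assms] bnd_mono[of 0 s] Cinf_bnd[OF decaysD[OF smooth_on_shift[OF near_idD(5)[OF assms]] near_idD(7)[OF assms]]]
  by auto

lemma near_id_compose_Cinf:
  assumes "near_id s X Y \<phi> \<psi>" "Cinf (interior Y) (Some t) f"
  shows "Cinf (interior X) (Some t) (\<lambda>x. f (\<phi> x))"
proof -
  note n = near_idD[OF assms(1)]
  show ?thesis
  proof (rule Cinf_compose[OF exterior_interior[OF n(2)] open_interior _ _ _ assms(2)])
    show "Cinf (interior X) (flat (Some t)) (dir_deriv v \<phi>)" for v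
      using near_id_flat_dir_deriv[OF n(2,5,7,1)] by simp
    show "\<phi> differentiable_on interior X"
      using Cinf_differentiable_on[OF smooth_on_interior[OF n(5)]] .
  qed (use n bnd_compose_near_id[OF near_id_bnd_shift[OF assms(1)]] in auto)
qed

lemma decays_compose_near_id:
  assumes "near_id s X Y \<phi> \<psi>" "smooth_on Y f" "decays t f"
  shows "decays t (\<lambda>x. f (\<phi> x))"
proof -
  have "smooth_on X (\<lambda>x. f (\<phi> x))"
    by (rule smooth_on_compose[OF assms(2)]) (use near_idD[OF assms(1)] in auto)
  then show ?thesis
    using decays_iff[of X "\<lambda>x. f (\<phi> x)" t] near_id_compose_Cinf[OF assms(1) decaysD[OF assms(2,3)]] by simp
qed

lemma decays_mv:
  assumes "exterior X" "smooth_on X A" "Cinf (interior X) (Some 0) A" "smooth_on X v" "decays t v"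
  shows "decays t (\<lambda>x. (A x :: real^2^2) *v v x)"
proof -
  have "Cinf (interior X) (Some t) (\<lambda>x. A x *v v x)"
    by (rule Cinf_bilinear[where B="\<lambda>v A. A *v v", OF exterior_interior[OF assms(1)]
          bounded_bilinear.flip[OF bounded_bilinear_mv] decaysD[OF assms(4,5)]])
       (use assms(3) in simp)
  then show ?thesis using decays_iff[OF smooth_on_mv[OF assms(2,4)]] by simp
qed

lemma decays_add:
  assumes "exterior X" "smooth_on X f" "smooth_on X g" "decays s f" "decays s g"
  shows "decays s (\<lambda>x. f x + g x)"
  using decays_iff[OF smooth_on_add[OF assms(2,3)], of s]
    Cinf_add[OF exterior_interior[OF assms(1)] decaysD[OF assms(2,4)] decaysD[OF assms(3,5)]] by simp

lemma decays_scaleR: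
  assumes "exterior X" "smooth_on X f" "decays s f"
  shows "decays s (\<lambda>x. c *\<^sub>R f x)"
  using decays_iff[OF smooth_on_scaleR[OF smooth_on_const assms(2)], of s]
    Cinf_linear[OF exterior_interior[OF assms(1)] bounded_linear_scaleR_right decaysD[OF assms(2,3)]] by simp

lemma decays_cong:
  assumes "exterior X" "smooth_on X f" "decays s f" "\<And>x. x \<in> X \<Longrightarrow> f x = g x"
  shows "decays s g"
proof -
  have "Cinf (interior X) (Some s) g"
    by (rule Cinf_cong[OF exterior_interior[OF assms(1)] _ decaysD[OF assms(2,3)]])
       (use assms(4) interior_subset in blast)
  then show ?thesis using decays_iff[OF smooth_on_cong[OF assms(4,2)]] by simp
qed

lemma decays_bounded_support:
  assumes "exterior X" "smooth_on X f" "bounded {x\<in>X. f x \<noteq> 0}"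
  shows "decays s f"
proof -
  obtain M where M: "\<And>x. x \<in> X \<Longrightarrow> f x \<noteq> 0 \<Longrightarrow> norm x \<le> M"
    using assms(3) unfolding bounded_iff by blast
  have "foldr dir_deriv vs f x = 0" if "x \<in> interior X - cball 0 M" for vs x
    using that
  proof (induction vs arbitrary: x)
    case Nil
    then show ?case using M[of x] interior_subset by fastforce
  next
    case (Cons v vs)
    have "dir_deriv v (foldr dir_deriv vs f) x = dir_deriv v (\<lambda>x. 0) x"
      by (rule dir_deriv_cong_open[OF _ Cons.prems]) (use Cons.IH in \<open>auto intro: open_Diff\<close>)
    then show ?case by simp
  qed
  moreover have "\<forall>\<^sub>F x in at_infinity. x \<in> interior X - cball 0 M"
    using exterior_interior[OF assms(1), of "Some 0"] eventually_at_infinity_norm_ge[of "M + 1"]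
    by (auto simp: adm_def elim!: eventually_elim2)
  ultimately have "\<forall>\<^sub>F x in at_infinity. foldr dir_deriv vs f x = 0" for vs
    by (auto elim: eventually_mono)
  then show ?thesis unfolding decays_def
    by (intro allI bigoI[where c=0]) (auto elim: eventually_mono)
qed

text \<open>The inverse decays by itself. Its displacement \<open>\<psi> y - y = - (\<phi> - id) (\<psi>
  y)\<close> is bounded because that of \<open>\<phi>\<close> is. Its derivative is the inverse of
  \<open>D\<phi>\<close> taken at \<open>\<psi> y\<close>, which is bounded with all derivatives by
  bootstrapping, as \<open>det D\<phi>\<close> tends to \<open>1\<close>. Therefore composition with
  \<open>\<psi>\<close> preserves the decay of \<open>\<phi> - id\<close>.\<close>

lemma near_idI:
  assumes "s > 0" and X: "exterior X" and Y: "exterior Y" and hom: "homeomorphism X Y \<phi> \<psi>"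
    and fr: "\<phi> ` frontier X = frontier Y" and smooth: "smooth_on X \<phi>"
    and det: "\<And>x. x \<in> X \<Longrightarrow> det (jac X \<phi> x) \<noteq> 0" and dec: "decays s (\<lambda>x. \<phi> x - x)"
  shows "near_id s X Y \<phi> \<psi>"
proof -
  have \<psi>: "smooth_on Y \<psi>" by (rule smooth_on_homeomorphism_inverse[OF X smooth hom det])
  have h: "\<phi> ` X = Y" "\<psi> ` Y = X" "\<And>x. x \<in> X \<Longrightarrow> \<psi> (\<phi> x) = x" "\<And>y. y \<in> Y \<Longrightarrow> \<phi> (\<psi> y) = y"
    using hom by (auto simp: homeomorphism_def)
  have "bij_betw \<phi> X Y" using h by (metis bij_betw_def inj_on_inverseI)
  then have int: "\<phi> ` interior X = interior Y"
    by (rule interior_image_of_frontier[OF exterior_closed[OF X] exterior_closed[OF Y] _ fr])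
  have inti: "\<psi> ` interior Y = interior X"
  proof -
    have "(\<lambda>x. \<psi> (\<phi> x)) ` interior X = (\<lambda>x. x) ` interior X"
      using h(3) interior_subset[of X] by (intro image_cong) auto
    then show ?thesis unfolding int[symmetric] image_image by simp
  qed
  \<comment> \<open>from the chain rule for \<open>\<phi> \<circ> \<psi> = id\<close>\<close>
  have inv: "jac Y \<psi> y = matrix_inv (jac X \<phi> (\<psi> y))" if "y \<in> Y" for y
  proof -
    have "jac Y (\<lambda>y. \<phi> (\<psi> y)) y = jac X \<phi> (\<psi> y) ** jac Y \<psi> y"
      by (rule jac_compose) (use h Y smooth \<psi> that in auto)
    moreover have "jac Y (\<lambda>y. \<phi> (\<psi> y)) y = jac Y (\<lambda>y. y) y"
      by (rule jac_cong) (use h Y that in \<open>auto intro: smooth_on_id\<close>)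
    ultimately have "jac X \<phi> (\<psi> y) ** jac Y \<psi> y = mat 1" using jac_id[OF Y that] by simp
    moreover have "det (jac X \<phi> (\<psi> y)) \<noteq> 0" using det h that by blast
    ultimately show ?thesis
      by (metis matrix_inv_mult(2) matrix_mul_assoc matrix_mul_lid matrix_mul_rid)
  qed
  have admX: "adm (interior X) w" and admY: "adm (interior Y) w" for w
    using exterior_interior X Y by auto
  obtain B where B: "\<And>x. x \<in> X \<Longrightarrow> norm (\<phi> x - x) \<le> B"
    using near_id_bounded_shift[OF X smooth dec] assms(1) by auto
  have shift: "bnd (Some 0) (\<lambda>y. \<psi> y - y)"
  proof (rule bnd_SomeI[where C=B])
    have "\<forall>\<^sub>F y in at_infinity. y \<in> interior Y" using admY[of "Some 0"] by (simp add: adm_def)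
    then show "\<forall>\<^sub>F y in at_infinity. norm (\<psi> y - y) \<le> B * norm y powr (- 0)"
      using eventually_at_infinity_norm_ge[of 1]
    proof eventually_elim
      case (elim y)
      then have "y \<in> Y" "y \<noteq> 0" using interior_subset by auto
      then show ?case using B[of "\<psi> y"] h by (auto simp: norm_minus_commute)
    qed
  qed
  define M where "M x = (matrix (\<lambda>v. dir_deriv v \<phi> x) :: real^2^2)" for x
  have MC: "Cinf (interior X) (Some 0) M"
    unfolding M_def matrix_fill_columns
    by (intro Cinf_add[OF admX] Cinf_linear[OF admX bounded_linear_fill_column]
        near_id_flat_dir_deriv[OF X smooth dec assms(1)])
  have Mj: "M x = jac X \<phi> x" if "x \<in> interior X" for x
    unfolding M_def by (rule jac_interior[OF X smooth that, symmetric])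
  \<comment> \<open>the derivative of \<open>\<phi>\<close> tends to the identity, so its determinant is bounded away from zero far out\<close>
  have "((\<lambda>x. det (M x)) \<longlongrightarrow> det (mat 1 :: real^2^2)) at_infinity"
    unfolding det_2 M_def matrix_def
    by (intro tendsto_intros tendsto_vec_nth tendsto_vec_lambda)
       (auto simp: mat_def axis_def intro!: tendsto_eq_intros tendsto_vec_nth near_id_flat_dir_deriv(2)[OF X smooth dec assms(1)])
  then have "\<forall>\<^sub>F x in at_infinity. det (M x) > 1/2"
    by (intro order_tendstoD) auto
  then have "\<forall>\<^sub>F x in at_infinity. norm (inverse (det (M x))) \<le> 2 * norm x powr (- 0)"
    using eventually_at_infinity_norm_ge[of 1]
  proof eventually_elim
    case (elim x)
    then have "x \<noteq> 0" by auto
    then show ?case using elim by (simp add: field_simps)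
  qed
  then have "bnd (Some 0) (\<lambda>x. inverse (det (M x)))" by (rule bnd_SomeI)
  then have MI: "Cinf (interior X) (Some 0) (\<lambda>x. matrix_inv (M x))"
    using det Mj interior_subset[of X] by (intro Cinf_matrix_inv[OF admX _ MC]) auto
  have \<psi>d: "\<psi> differentiable_on interior Y"
    by (rule Cinf_differentiable_on[OF smooth_on_interior[OF \<psi>]])
  have d\<psi>: "Cinf (interior Y) (Some 0) (dir_deriv v \<psi>)" for v
  proof (rule local_inverse_dir_deriv[OF admY _ open_interior[of X] _ \<psi>d _ MI])
    fix y v assume y: "y \<in> interior Y"
    have "linear (\<lambda>v. dir_deriv v \<psi> y)"
      by (rule has_derivative_linear[OF differentiable_on_open_has_dir_deriv[OF \<psi>d open_interior y]])
    then have "dir_deriv v \<psi> y = matrix (\<lambda>v. dir_deriv v \<psi> y) *v v" by (simp add: matrix_works)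
    also have "\<dots> = jac Y \<psi> y *v v" by (simp add: jac_interior[OF Y \<psi> y])
    also have "\<dots> = matrix_inv (M (\<psi> y)) *v v"
    proof -
      have "\<psi> y \<in> interior X" "y \<in> Y" using inti y interior_subset[of Y] by auto
      then show ?thesis by (simp add: inv Mj)
    qed
    finally show "dir_deriv v \<psi> y = matrix_inv (M (\<psi> y)) *v v" .
  qed (use inti bnd_compose_near_id[OF shift] in auto)
  have "Cinf (interior Y) (Some s) (\<lambda>y. (\<lambda>x. \<phi> x - x) (\<psi> y))"
    by (rule Cinf_compose[OF admY open_interior[of X] _ \<psi>d _ decaysD[OF smooth_on_shift[OF smooth] dec]])
       (use inti d\<psi> bnd_compose_near_id[OF shift] in auto)
  then have "Cinf (interior Y) (Some s) (\<lambda>y. - ((\<lambda>x. \<phi> x - x) (\<psi> y)))"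
    by (intro Cinf_linear[OF admY bounded_linear_minus[OF bounded_linear_ident]])
  then have "Cinf (interior Y) (Some s) (\<lambda>y. \<psi> y - y)"
    by (rule Cinf_cong[OF admY, rotated]) (use h interior_subset[of Y] in auto)
  then have "decays s (\<lambda>y. \<psi> y - y)" using decays_iff[OF smooth_on_shift[OF \<psi>]] by simp
  with \<psi> assms show ?thesis by (simp add: near_id_def)
qed

text \<open>The displacement of the composition is \<open>(\<phi>' - id) \<circ> \<phi> + (\<phi> - id)\<close>;
  the inverse is covered by symmetry.\<close>

lemma near_id_compose:
  assumes 1: "near_id s X Y \<phi> \<psi>" and 2: "near_id s Y Z \<phi>' \<psi>'"
  shows "near_id s X Z (\<lambda>x. \<phi>' (\<phi> x)) (\<lambda>z. \<psi> (\<psi>' z))"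
proof -
  note n = near_idD[OF 1] note m = near_idD[OF 2]
  have half: "decays s (\<lambda>x. \<phi>' (\<phi> x) - x)" if 1: "near_id s X Y \<phi> \<psi>" and 2: "near_id s Y Z \<phi>' \<psi>'"
    for X Y Z \<phi> \<psi> \<phi>' \<psi>'
  proof -
    note n = near_idD[OF 1] note m = near_idD[OF 2]
    have s: "smooth_on X (\<lambda>x. \<phi>' (\<phi> x) - \<phi> x)" "smooth_on X (\<lambda>x. \<phi> x - x)"
      using smooth_on_shift[OF n(5)] smooth_on_compose[OF smooth_on_shift[OF m(5)] n(5)] n(10) by auto
    have "decays s (\<lambda>x. (\<phi>' (\<phi> x) - \<phi> x) + (\<phi> x - x))"
      by (rule decays_add[OF n(2) s decays_compose_near_id[OF 1 smooth_on_shift[OF m(5)] m(7)] n(7)])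
    then show ?thesis by simp
  qed
  have "homeomorphism X Z (\<lambda>x. \<phi>' (\<phi> x)) (\<lambda>z. \<psi> (\<psi>' z))"
    using homeomorphism_compose[OF n(4) m(4)] by (simp add: o_def)
  moreover have "(\<lambda>x. \<phi>' (\<phi> x)) ` frontier X = frontier Z"
    using n(9) m(9) by (metis image_image)
  moreover have "smooth_on X (\<lambda>x. \<phi>' (\<phi> x))" "smooth_on Z (\<lambda>z. \<psi> (\<psi>' z))"
    using smooth_on_compose[OF m(5) n(5)] smooth_on_compose[OF n(6) m(6)] n(10) m(11) by auto
  ultimately show ?thesis
    using half[OF 1 2] half[OF near_id_sym[OF 2] near_id_sym[OF 1]] n m by (simp add: near_id_def)
qed

lemma near_id_cong:
  assumes "near_id s X Y \<phi> \<psi>" "\<And>x. x \<in> X \<Longrightarrow> \<phi>' x = \<phi> x" "\<And>y. y \<in> Y \<Longrightarrow> \<psi>' y = \<psi> y"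
  shows "near_id s X Y \<phi>' \<psi>'"
proof -
  note n = near_idD[OF assms(1)]
  have "homeomorphism X Y \<phi>' \<psi>'"
    by (rule homeomorphism_cong[OF n(4) refl refl]) (use assms in auto)
  moreover have "\<phi>' ` frontier X = frontier Y"
    unfolding n(9)[symmetric] using assms(2) frontier_subset_eq[of X] exterior_closed[OF n(2)]
    by (intro image_cong) auto
  moreover have "smooth_on X \<phi>'" "smooth_on Y \<psi>'"
    using n(5,6) assms(2,3) by (auto intro: smooth_on_cong[of _ \<phi>] smooth_on_cong[of _ \<psi>])
  moreover have "decays s (\<lambda>x. \<phi>' x - x)"
    by (rule decays_cong[OF n(2) smooth_on_shift[OF n(5)] n(7)]) (simp add: assms(2))
  moreover have "decays s (\<lambda>x. \<psi>' x - x)"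
    by (rule decays_cong[OF n(3) smooth_on_shift[OF n(6)] n(8)]) (simp add: assms(3))
  ultimately show ?thesis using n(1-3) by (simp add: near_id_def)
qed

section \<open>Tangency and divergence under diffeomorphisms\<close>

definition rot90 :: "plane \<Rightarrow> plane" where
  "rot90 v = vector [- v$2, v$1]"

lemma rot90_nth [simp]: "rot90 v $ 1 = - v$2" "rot90 v $ 2 = v$1"
  by (simp_all add: rot90_def)

lemma orthogonal_rot90:
  assumes "v \<bullet> n = 0" "n \<noteq> 0"
  obtains k where "v = k *\<^sub>R rot90 n"
proof -
  have n: "n$1 ^2 + n$2^2 \<noteq> 0" using assms(2) by (auto simp: sum_power2_eq_zero_iff vec_eq_iff forall_2)
  have o: "v$1 * n$1 = - (v$2 * n$2)" using assms(1) by (simp add: inner2)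
  let ?k = "(v$2 * n$1 - v$1 * n$2) / (n$1 ^2 + n$2^2)"
  have "v$1 * (n$1 ^2 + n$2^2) = - (v$2 * n$1 - v$1 * n$2) * n$2"
    using arg_cong[OF o, of "\<lambda>z. z * n$1"] by (simp add: power2_eq_square algebra_simps)
  moreover have "v$2 * (n$1 ^2 + n$2^2) = (v$2 * n$1 - v$1 * n$2) * n$1"
    using arg_cong[OF o, of "\<lambda>z. z * n$2"] by (simp add: power2_eq_square algebra_simps)
  ultimately have "v = ?k *\<^sub>R rot90 n"
    using n by (intro vec2_eqI) (simp_all add: field_simps)
  then show thesis by (rule that)
qed

lemma exterior_ball [simp]: "exterior (- ball c r)"
  by (auto simp: exterior_def)

lemma interior_exterior_ball: "r > 0 \<Longrightarrow> interior (- ball c r) = - cball (c::'a::real_normed_vector) r"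
  by (simp add: interior_complement closure_ball)

text \<open>A vector tangent to the circle at \<open>x\<close> is the velocity of a rotation
  \<open>\<gamma>\<close> about \<open>c\<close>. As \<open>\<phi> (\<gamma> t)\<close> stays on the image
  circle, its distance from \<open>c'\<close> has zero derivative.\<close>

lemma near_id_tangent_forward:
  assumes n: "near_id s (- ball c r) (- ball c' r') \<phi> \<psi>" and r: "r > 0" "r' > 0" and x: "x \<in> sphere c r"
    and t: "\<xi> \<bullet> (x - c) = 0"
  shows "(jac (- ball c r) \<phi> x *v \<xi>) \<bullet> (\<phi> x - c') = 0"
proof -
  let ?X = "- ball c r"
  define p where "p = x - c"
  have "p \<noteq> 0" using x r by (auto simp: p_def)
  then obtain k where k: "\<xi> = k *\<^sub>R rot90 p" using orthogonal_rot90 t by (metis p_def)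
  \<comment> \<open>the rotation of \<open>x\<close> about \<open>c\<close>, with initial velocity \<open>rot90 p\<close>\<close>
  define \<gamma> where "\<gamma> t = c + (cos t *\<^sub>R p + sin t *\<^sub>R rot90 p)" for t :: real
  have \<gamma>n: "norm (\<gamma> t - c) = r" for t
  proof -
    have gen: "(C *\<^sub>R p + D *\<^sub>R rot90 p) \<bullet> (C *\<^sub>R p + D *\<^sub>R rot90 p) = (C * C + D * D) * (p \<bullet> p)" for C D
      by (simp add: inner2 algebra_simps)
    have "(\<gamma> t - c) \<bullet> (\<gamma> t - c) = p \<bullet> p"
      using gen[of "cos t" "sin t"] by (simp add: \<gamma>_def)
    then show ?thesis using x by (metis dist_commute dist_norm mem_sphere norm_eq_sqrt_inner p_def)
  qed
  then have \<gamma>s: "\<gamma> t \<in> sphere c r" for t by (simp add: dist_norm norm_minus_commute)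
  have \<gamma>X: "\<gamma> t \<in> ?X" for t using \<gamma>s[of t] by auto
  have \<gamma>0: "\<gamma> 0 = x" by (simp add: \<gamma>_def p_def)
  have d\<gamma>: "(\<gamma> has_derivative (\<lambda>h. h *\<^sub>R rot90 p)) (at 0)"
    unfolding \<gamma>_def by (auto intro!: derivative_eq_intros)
  have "(\<phi> has_derivative (\<lambda>h. jac ?X \<phi> x *v h)) (at (\<gamma> 0) within range \<gamma>)"
    unfolding \<gamma>0 using smooth_on_has_jac[OF near_idD(5)[OF n], of x] \<gamma>X \<gamma>0
    by (metis (no_types, lifting) has_derivative_subset image_subsetI)
  then have d1: "((\<lambda>t. \<phi> (\<gamma> t)) has_derivative (\<lambda>h. jac ?X \<phi> x *v (h *\<^sub>R rot90 p))) (at 0)"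
    by (rule has_derivative_in_compose[OF d\<gamma>])
  then have d2: "((\<lambda>t. (\<phi> (\<gamma> t) - c') \<bullet> (\<phi> (\<gamma> t) - c')) has_derivative
      (\<lambda>h. (\<phi> (\<gamma> 0) - c') \<bullet> (jac ?X \<phi> x *v (h *\<^sub>R rot90 p) - 0) + (jac ?X \<phi> x *v (h *\<^sub>R rot90 p) - 0) \<bullet> (\<phi> (\<gamma> 0) - c'))) (at 0)"
    by (intro has_derivative_inner has_derivative_diff has_derivative_const)
  have "\<phi> (\<gamma> t) \<in> sphere c' r'" for t
    using near_idD(9)[OF n] \<gamma>s[of t] r by auto
  then have "(\<phi> (\<gamma> t) - c') \<bullet> (\<phi> (\<gamma> t) - c') = r'\<^sup>2" for t
    by (simp add: dist_norm norm_minus_commute flip: power2_norm_eq_inner)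
  then have "((\<lambda>t. (\<phi> (\<gamma> t) - c') \<bullet> (\<phi> (\<gamma> t) - c')) has_derivative (\<lambda>h. 0)) (at 0)"
    by simp
  from has_derivative_unique[OF d2 this, THEN fun_cong, of k]
  have "(jac ?X \<phi> x *v (k *\<^sub>R rot90 p)) \<bullet> (\<phi> x - c') = 0"
    by (simp add: \<gamma>0 inner_commute)
  then show ?thesis by (simp add: k)
qed

text \<open>The converse direction is the forward one for the inverse map.\<close>

lemma near_id_tangent:
  assumes n: "near_id s (- ball c r) (- ball c' r') \<phi> \<psi>" and r: "r > 0" "r' > 0" and x: "x \<in> sphere c r"
  shows "(jac (- ball c r) \<phi> x *v \<xi>) \<bullet> (\<phi> x - c') = 0 \<longleftrightarrow> \<xi> \<bullet> (x - c) = 0"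
proof
  assume t: "(jac (- ball c r) \<phi> x *v \<xi>) \<bullet> (\<phi> x - c') = 0"
  have xX: "x \<in> - ball c r" using x by auto
  have y: "\<phi> x \<in> sphere c' r'"
    using near_idD(9)[OF n] x r by auto
  from near_id_tangent_forward[OF near_id_sym[OF n] r(2,1) y t]
  show "\<xi> \<bullet> (x - c) = 0"
    using near_id_det(1)[OF n xX] near_idD(12)[OF n xX] by (simp add: matrix_vector_mul_assoc)
qed (rule near_id_tangent_forward[OF assms])

text \<open>The divergence of the Eulerian velocity \<open>w \<circ> \<psi>\<close>, expressed on the reference
  region.\<close>

lemma near_id_divergence:
  assumes n: "near_id s X Y \<phi> \<psi>" and w: "smooth_on X w" and x: "x \<in> X"
  shows "divergence X (\<lambda>x. cof (jac X \<phi> x) *v w x) x = det (jac X \<phi> x) * divergence Y (\<lambda>y. w (\<psi> y)) (\<phi> x)"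
proof -
  note d = near_idD[OF n]
  have V: "smooth_on Y (\<lambda>y. w (\<psi> y))" by (rule smooth_on_compose[OF w d(6)]) (use d in auto)
  have "divergence X (\<lambda>x. cof (jac X \<phi> x) *v w x) x = divergence X (\<lambda>x. cof (jac X \<phi> x) *v w (\<psi> (\<phi> x))) x"
    unfolding divergence_def
    by (rule arg_cong[where f=trace], rule jac_cong[OF d(2) _ x])
       (use d smooth_on_compose[OF V d(5)] in \<open>auto intro!: smooth_on_mv smooth_on_linear[OF bounded_linear_cof] smooth_on_jac\<close>)
  also have "\<dots> = det (jac X \<phi> x) * divergence Y (\<lambda>y. w (\<psi> y)) (\<phi> x)"
    by (rule piola[OF d(2,5) _ V x]) (use d in auto)
  finally show ?thesis .
qed

section \<open>Rigid motions and configurations\<close>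

lemma SE2_orthogonal:
  assumes "g \<in> SE2"
  shows "transpose (fst g) ** fst g = mat 1" "fst g ** transpose (fst g) = mat 1" "norm (fst g *v x) = norm x"
proof -
  have o: "orthogonal_matrix (fst g)" using assms by (auto simp: SE2_def rotation_matrix_def)
  then show "transpose (fst g) ** fst g = mat 1" "fst g ** transpose (fst g) = mat 1"
    by (auto simp: orthogonal_matrix_def)
  have "orthogonal_transformation ((*v) (fst g))"
    using o by (simp add: orthogonal_transformation_matrix matrix_of_matrix_vector_mul)
  then show "norm (fst g *v x) = norm x" by (simp add: orthogonal_transformation_norm)
qed

lemma dist_act: "g \<in> SE2 \<Longrightarrow> dist (act g x) (act g y) = dist x y"
  by (simp add: act_def dist_norm SE2_orthogonal(3) flip: matrix_vector_mult_diff_distrib)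

lemma act_surj: "g \<in> SE2 \<Longrightarrow> act g (transpose (fst g) *v (y - snd g)) = y"
  unfolding act_def matrix_vector_mul_assoc SE2_orthogonal(2) matrix_vector_mul_lid by simp

lemma act_ball_image:
  assumes "g \<in> SE2"
  shows "act g ` sphere c r = sphere (act g c) r" "act g ` cball c r = cball (act g c) r"
proof -
  have "act g ` {x. P (dist c x)} = {y. P (dist (act g c) y)}" for P
  proof (intro subset_antisym subsetI)
    fix y assume "y \<in> {y. P (dist (act g c) y)}"
    then have "transpose (fst g) *v (y - snd g) \<in> {x. P (dist c x)}"
      using dist_act[OF assms, of c "transpose (fst g) *v (y - snd g)"] act_surj[OF assms, of y] by simp
    then show "y \<in> act g ` {x. P (dist c x)}" using act_surj[OF assms, of y] by (metis imageI)
  qed (auto simp: dist_act[OF assms])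
  from this[of "\<lambda>d. d = r"] this[of "\<lambda>d. d \<le> r"]
  show "act g ` sphere c r = sphere (act g c) r" "act g ` cball c r = cball (act g c) r"
    by (simp_all add: sphere_def cball_def)
qed

definition moved_fluid :: "body_fluid \<Rightarrow> rigid \<Rightarrow> plane set" where
  "moved_fluid S g = - ball (act g (centre S)) (radius S)"

lemma fluid_exterior [simp]: "exterior (fluid S)" "exterior (moved_fluid S g)"
  by (simp_all add: fluid_def moved_fluid_def)

lemma frontier_fluid:
  assumes "radius S > 0"
  shows "frontier (fluid S) = sphere (centre S) (radius S)"
    "frontier (moved_fluid S g) = sphere (act g (centre S)) (radius S)"
    "frontier (body S) = sphere (centre S) (radius S)"
    "interior (fluid S) = - cball (centre S) (radius S)"
    "interior (moved_fluid S g) = - cball (act g (centre S)) (radius S)"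
  using assms by (simp_all add: fluid_def moved_fluid_def body_def interior_exterior_ball frontier_cball)

text \<open>The image of the open exterior is open by invariance of domain, misses the image circle, and is
  unbounded because the displacement is bounded; being connected, it lies outside that circle. It is also closed
  there, since preimages of bounded sets are bounded. Hence it is the whole connected exterior.\<close>

lemma exterior_embedding_image:
  fixes \<phi> :: "plane \<Rightarrow> plane"
  assumes r: "r > 0" "r' > 0" and cont: "continuous_on (- ball c r) \<phi>" and inj: "inj_on \<phi> (- ball c r)"
    and fr: "\<phi> ` sphere c r = sphere c' r'" and B: "\<And>x. x \<in> - ball c r \<Longrightarrow> norm (\<phi> x - x) \<le> B"
  shows "\<phi> ` (- ball c r) = - ball c' r'"
proof -
  let ?X = "- ball c r" and ?I = "- cball c r" and ?C = "- cball c' r'"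
  have X: "?X = ?I \<union> sphere c r" by auto
  have IX: "?I \<subseteq> ?X" by auto
  have conn: "connected ?I" "connected ?C"
    by (intro connected_complement_bounded_convex; simp)+
  have "open (\<phi> ` ?I)"
    using cont inj IX by (intro invariance_of_domain) (auto intro: continuous_on_subset inj_on_subset)
  have disj: "\<phi> ` ?I \<inter> sphere c' r' = {}"
  proof -
    have "\<phi> ` ?I \<inter> \<phi> ` sphere c r = \<phi> ` (?I \<inter> sphere c r)"
      by (rule inj_on_image_Int[OF inj, symmetric]) auto
    also have "?I \<inter> sphere c r = {}" by auto
    finally show ?thesis using fr by simp
  qed
  have unb: "\<exists>x\<in>?I. norm (\<phi> x) > M" for M
  proof -
    define t where "t = \<bar>M\<bar> + \<bar>B\<bar> + \<bar>r\<bar> + norm c + 1"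
    define x :: plane where "x = t *\<^sub>R axis 1 1"
    have t: "t > 0" unfolding t_def by (smt (verit) norm_ge_zero)
    then have nx: "norm x = t" by (simp add: x_def norm_axis_1)
    have "norm (x - c) \<ge> t - norm c" using norm_triangle_ineq2[of x c] nx by simp
    then have xI: "x \<in> ?I" by (auto simp: t_def dist_norm norm_minus_commute)
    then have "norm (\<phi> x - x) \<le> B" using B IX by blast
    then have "norm (\<phi> x) \<ge> t - B" using norm_triangle_ineq2[of x "x - \<phi> x"] nx by (simp add: norm_minus_commute)
    then have "norm (\<phi> x) > M" using norm_ge_zero[of c] unfolding t_def by linarith
    then show ?thesis using xI by blast
  qed
  \<comment> \<open>the connected image lies on one side of the circle, and the inner side is bounded\<close>
  have sub: "\<phi> ` ?I \<subseteq> ?C"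
  proof -
    have c: "connected (\<phi> ` ?I)"
      using conn(1) cont IX by (intro connected_continuous_image) (auto intro: continuous_on_subset)
    have cov: "\<phi> ` ?I \<subseteq> ball c' r' \<union> ?C" using disj by fastforce
    have "ball c' r' \<inter> \<phi> ` ?I = {} \<or> ?C \<inter> \<phi> ` ?I = {}"
      by (rule connectedD[OF c]) (use cov in \<open>auto simp: open_Compl\<close>)
    moreover have "?C \<inter> \<phi> ` ?I \<noteq> {}"
    proof -
      obtain x where "x \<in> ?I" "norm (\<phi> x) > norm c' + r'" using unb by blast
      then have "\<phi> x \<in> ?C" using norm_triangle_ineq[of c' "\<phi> x - c'"] by (auto simp: dist_norm norm_minus_commute)
      then show ?thesis using \<open>x \<in> ?I\<close> by blast
    qed
    ultimately show ?thesis using cov by blast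
  qed
  \<comment> \<open>preimages of a convergent sequence are bounded, so a subsequence converges\<close>
  have closed: "closed (\<phi> ` ?X)"
    unfolding closed_sequential_limits
  proof (intro allI impI, elim conjE)
    fix y l assume y: "\<forall>n. y n \<in> \<phi> ` ?X" "y \<longlonglongrightarrow> l"
    have "\<forall>n. \<exists>z. z \<in> ?X \<and> y n = \<phi> z" using y(1) by blast
    then have "\<exists>x. \<forall>n. x n \<in> ?X \<and> y n = \<phi> (x n)" by (rule choice)
    then obtain x where x: "\<And>n. x n \<in> ?X" "\<And>n. y n = \<phi> (x n)" by blast
    have "bounded (range y)" by (rule convergent_imp_bounded[OF y(2)])
    then obtain K where K: "\<And>n. norm (y n) \<le> K" unfolding bounded_iff by blast
    have "norm (x n) \<le> K + B" for n
      using B[OF x(1)[of n]] K[of n] x(2)[of n] norm_triangle_ineq4[of "y n" "y n - x n"] by simp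
    then have "bounded (range x)" by (auto simp: bounded_iff)
    then obtain a \<sigma> where a: "strict_mono \<sigma>" "(x \<circ> \<sigma>) \<longlonglongrightarrow> a" using bounded_imp_convergent_subsequence by blast
    have "closed ?X" by (simp add: closed_Compl)
    then have aX: "a \<in> ?X" using closed_sequentially[of ?X "x \<circ> \<sigma>" a] a(2) x(1) by simp
    have "(\<lambda>n. \<phi> ((x \<circ> \<sigma>) n)) \<longlonglongrightarrow> \<phi> a"
      by (rule continuous_on_tendsto_compose[OF cont a(2) aX]) (use x(1) in auto)
    moreover have "(\<lambda>n. \<phi> ((x \<circ> \<sigma>) n)) = y \<circ> \<sigma>" using x(2) by (auto simp: fun_eq_iff)
    ultimately have "l = \<phi> a" using LIMSEQ_subseq_LIMSEQ[OF y(2) a(1)] LIMSEQ_unique by metis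
    then show "l \<in> \<phi> ` ?X" using aX by blast
  qed
  have eq: "\<phi> ` ?I = \<phi> ` ?X \<inter> ?C"
  proof -
    have "\<phi> ` ?X = \<phi> ` ?I \<union> sphere c' r'" unfolding X image_Un fr ..
    then show ?thesis using sub by auto
  qed
  have "\<phi> ` ?I = ?C"
  proof -
    have "openin (top_of_set ?C) (\<phi> ` ?I)"
      using \<open>open (\<phi> ` ?I)\<close> sub by (simp add: openin_open_eq open_Compl)
    moreover have "closedin (top_of_set ?C) (\<phi> ` ?I)"
      unfolding eq using closed by (metis Int_commute closedin_closed)
    moreover have "\<phi> ` ?I \<noteq> {}" using unb by blast
    ultimately show ?thesis using conn(2) unfolding connected_clopen by blast
  qed
  then show ?thesis unfolding X image_Un fr by auto
qed

lemma homeomorphism_inv_into: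
  assumes "homeomorphism X Y \<phi> \<psi>" shows "homeomorphism X Y \<phi> (inv_into X \<phi>)"
proof (rule homeomorphism_cong[OF assms refl refl])
  have h: "\<phi> ` X = Y" "\<psi> ` Y = X" "\<And>x. x \<in> X \<Longrightarrow> \<psi> (\<phi> x) = x" "\<And>y. y \<in> Y \<Longrightarrow> \<phi> (\<psi> y) = y"
    using assms by (auto simp: homeomorphism_def)
  fix y assume "y \<in> Y"
  then show "inv_into X \<phi> y = \<psi> y" by (metis h inv_into_f_eq inj_onI imageI)
qed simp

text \<open>By definition a configuration only embeds the fluid region; that the image is the complement of the
  moved body comes from \<open>exterior_embedding_image\<close>.\<close>

lemma Q_near_id:
  assumes r: "radius S > 0" "rate S > 0" and d: "\<forall>x\<in>fluid S. density S x > 0" and q: "(g, \<phi>) \<in> Q S"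
  shows "near_id (rate S) (fluid S) (moved_fluid S g) \<phi> (inv_into (fluid S) \<phi>)"
proof (rule near_idI[OF r(2) fluid_exterior])
  have g: "g \<in> SE2" and sm: "smooth_on (fluid S) \<phi>" and dec: "decays (rate S) (\<lambda>x. \<phi> x - x)"
    and det: "\<forall>x\<in>fluid S. det (jac (fluid S) \<phi> x) = density S x"
    and fr: "\<phi> ` frontier (fluid S) = act g ` frontier (body S)"
    and hom: "\<exists>\<psi>. homeomorphism (fluid S) (\<phi> ` fluid S) \<phi> \<psi>"
    using q by (auto simp: Q_def)
  show "smooth_on (fluid S) \<phi>" "decays (rate S) (\<lambda>x. \<phi> x - x)" by fact+
  show "det (jac (fluid S) \<phi> x) \<noteq> 0" if "x \<in> fluid S" for x using det d that by force
  show fr': "\<phi> ` frontier (fluid S) = frontier (moved_fluid S g)"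
    using fr by (simp add: frontier_fluid[OF r(1)] act_ball_image[OF g])
  obtain \<psi> where \<psi>: "homeomorphism (fluid S) (\<phi> ` fluid S) \<phi> \<psi>" using hom by blast
  obtain B where B: "\<And>x. x \<in> fluid S \<Longrightarrow> norm (\<phi> x - x) \<le> B"
    using near_id_bounded_shift[OF fluid_exterior(1) sm dec] r(2) by auto
  have "inj_on \<phi> (fluid S)" using \<psi> by (metis homeomorphism_def inj_on_inverseI)
  then have "\<phi> ` fluid S = moved_fluid S g"
    unfolding moved_fluid_def fluid_def
    by (intro exterior_embedding_image[OF r(1) r(1)])
       (use B fr' smooth_on_continuous_on[OF sm] frontier_fluid[OF r(1)] in \<open>auto simp: fluid_def\<close>)
  then show "homeomorphism (fluid S) (moved_fluid S g) \<phi> (inv_into (fluid S) \<phi>)"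
    using homeomorphism_inv_into[OF \<psi>] by simp
qed

lemma near_id_Q:
  assumes r: "radius S > 0" and d: "\<forall>x\<in>fluid S. density S x > 0" and g: "g \<in> SE2"
    and n: "near_id (rate S) (fluid S) (moved_fluid S g) \<phi> \<psi>" and e: "\<phi> \<in> extensional (fluid S)"
    and det: "\<And>x. x \<in> fluid S \<Longrightarrow> det (jac (fluid S) \<phi> x) = density S x"
  shows "(g, \<phi>) \<in> Q S"
proof -
  note n' = near_idD[OF n]
  have "inj (frechet_derivative \<phi> (at x within fluid S))" if x: "x \<in> fluid S" for x
  proof -
    have "det (jac (fluid S) \<phi> x) \<noteq> 0" using det[OF x] d x by force
    moreover have "frechet_derivative \<phi> (at x within fluid S) = (*v) (jac (fluid S) \<phi> x)"
      by (rule exterior_derivative_unique[OF fluid_exterior(1) x _ smooth_on_has_jac[OF n'(5) x]])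
         (use smooth_on_has_jac[OF n'(5) x] in \<open>meson differentiableI frechet_derivative_works\<close>)
    ultimately show ?thesis by (metis injI matrix_inv_vector(2))
  qed
  moreover have "\<exists>\<psi>. homeomorphism (fluid S) (\<phi> ` fluid S) \<phi> \<psi>" by (rule exI[of _ \<psi>]) (simp add: n')
  moreover have "\<phi> ` frontier (fluid S) = act g ` frontier (body S)"
    using n'(9) by (simp add: frontier_fluid[OF r] act_ball_image[OF g])
  ultimately show ?thesis using g e det n' by (auto simp: Q_def)
qed

text \<open>A relabelling preserves the boundary because, by invariance of domain, it and its inverse preserve
  the interior.\<close>

lemma Diff_vol_near_id:
  assumes r: "radius S > 0" "rate S > 0" and d: "\<forall>x\<in>fluid S. density S x > 0" and f: "f \<in> Diff_vol S"
  shows "near_id (rate S) (fluid S) (fluid S) f (inv_into (fluid S) f)"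
proof (rule near_idI[OF r(2) fluid_exterior(1) fluid_exterior(1)])
  let ?X = "fluid S" and ?h = "inv_into (fluid S) f"
  have bij: "bij_betw f ?X ?X" and sm: "smooth_on ?X f" "smooth_on ?X ?h"
    and det: "\<forall>x\<in>?X. density S (f x) * det (jac ?X f x) = density S x"
    using f by (auto simp: Diff_vol_def)
  show "smooth_on ?X f" "decays (rate S) (\<lambda>x. f x - x)" using f by (auto simp: Diff_vol_def)
  show "det (jac ?X f x) \<noteq> 0" if "x \<in> ?X" for x using det d that by force
  have h: "f ` ?X = ?X" "?h ` ?X = ?X" "\<And>x. x \<in> ?X \<Longrightarrow> ?h (f x) = x" "\<And>x. x \<in> ?X \<Longrightarrow> f (?h x) = x"
    using bij bij_betw_inv_into[OF bij] bij_betw_inv_into_left[OF bij] bij_betw_inv_into_right[OF bij]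
    by (auto simp: bij_betw_def)
  show "homeomorphism ?X ?X f ?h"
    using h smooth_on_continuous_on[OF sm(1)] smooth_on_continuous_on[OF sm(2)] by (auto simp: homeomorphism_def)
  have int: "k ` interior ?X \<subseteq> interior ?X" if "smooth_on ?X k" "inj_on k ?X" "k ` ?X = ?X" for k
  proof (rule interior_maximal)
    show "open (k ` interior ?X)"
      using smooth_on_continuous_on[OF that(1)] that(2) interior_subset
      by (intro invariance_of_domain) (auto intro: continuous_on_subset inj_on_subset)
    show "k ` interior ?X \<subseteq> ?X" using that(3) interior_subset by blast
  qed
  have 1: "f ` interior ?X \<subseteq> interior ?X" using int[OF sm(1)] bij by (auto simp: bij_betw_def)
  have "inj_on ?h ?X" using h(4) by (metis inj_on_inverseI)
  then have 2: "?h ` interior ?X \<subseteq> interior ?X" using int[OF sm(2)] h by blast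
  have fr: "frontier ?X = ?X - interior ?X"
    using exterior_closed[OF fluid_exterior(1), of S] by (simp add: frontier_def)
  show "f ` frontier ?X = frontier ?X"
  proof (intro subset_antisym subsetI)
    fix y assume "y \<in> f ` frontier ?X"
    then obtain x where x: "x \<in> ?X" "x \<notin> interior ?X" "y = f x" unfolding fr by blast
    then show "y \<in> frontier ?X" unfolding fr using 2 h(1,3) by (metis DiffI image_subset_iff imageI)
  next
    fix y assume "y \<in> frontier ?X"
    then have y: "y \<in> ?X" "y \<notin> interior ?X" unfolding fr by auto
    then have "?h y \<in> ?X - interior ?X" using 1 h(2,4) by (metis DiffI image_subset_iff imageI)
    then show "y \<in> f ` frontier ?X" unfolding fr using h(4)[OF y(1)] by (metis imageI)
  qed
qed

lemma near_id_Diff_vol: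
  assumes n: "near_id (rate S) (fluid S) (fluid S) f h" and e: "f \<in> extensional (fluid S)"
    and det: "\<And>x. x \<in> fluid S \<Longrightarrow> density S (f x) * det (jac (fluid S) f x) = density S x"
  shows "f \<in> Diff_vol S"
proof -
  note n' = near_idD[OF n]
  have "inj_on f (fluid S)" by (rule inj_on_inverseI[where g=h]) (rule n'(12))
  then have bij: "bij_betw f (fluid S) (fluid S)" using n'(10) by (simp add: bij_betw_def)
  have "inv_into (fluid S) f x = h x" if "x \<in> fluid S" for x
  proof (rule inv_into_f_eq)
    show "inj_on f (fluid S)" using bij by (simp add: bij_betw_def)
    show "h x \<in> fluid S" "f (h x) = x" using n'(11,13) that by auto
  qed
  then have "smooth_on (fluid S) (inv_into (fluid S) f)"
    by (intro smooth_on_cong[OF _ n'(6)]) simp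
  then show ?thesis using bij e det n' by (auto simp: Diff_vol_def)
qed

section \<open>Velocities and their pull-back\<close>

lemma near_id_inv_jac:
  assumes n: "near_id s X Y \<phi> \<psi>"
  shows "smooth_on X (\<lambda>x. matrix_inv (jac X \<phi> x))" "Cinf (interior X) (Some 0) (\<lambda>x. matrix_inv (jac X \<phi> x))"
proof -
  note d = near_idD[OF n]
  show "smooth_on X (\<lambda>x. matrix_inv (jac X \<phi> x))"
    by (rule smooth_on_matrix_inv[OF smooth_on_jac[OF d(2,5)] near_id_det(2)[OF n]])
  show "Cinf (interior X) (Some 0) (\<lambda>x. matrix_inv (jac X \<phi> x))"
    by (rule Cinf_cong[OF exterior_interior[OF d(2)] _ near_id_compose_Cinf[OF n near_id_flat_jac[OF near_id_sym[OF n]]]])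
       (use near_id_det(3)[OF n] interior_subset[of X] in auto)
qed

lemma cof_matrix_mult: "cof (A ** B) = cof B ** cof A"
  by (rule mat2_eqI) (simp_all add: algebra_simps)

lemma divergence_cong:
  assumes "exterior X" "smooth_on X f" "x \<in> X" "\<And>y. y \<in> X \<Longrightarrow> f y = g y"
  shows "divergence X g x = divergence X f x"
  using jac_cong[OF assms] by (simp add: divergence_def)

lemma smooth_on_cof_mv:
  assumes "exterior X" "smooth_on X \<phi>" "smooth_on X w"
  shows "smooth_on X (\<lambda>x. cof (jac X \<phi> x) *v w x)"
  by (intro smooth_on_mv smooth_on_linear[OF bounded_linear_cof] smooth_on_jac assms)

lemma T_SE2_iff: "v \<in> T_SE2 g \<longleftrightarrow> transpose (fst g) ** fst v + transpose (fst v) ** fst g = 0"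
  by (simp add: T_SE2_def split_beta)

lemma T_SE2_zero: "0 \<in> T_SE2 g"
  unfolding T_SE2_iff by (rule mat2_eqI) (simp_all add: transpose_def)

lemma T_SE2_add: "u \<in> T_SE2 g \<Longrightarrow> v \<in> T_SE2 g \<Longrightarrow> u + v \<in> T_SE2 g"
proof -
  assume "u \<in> T_SE2 g" "v \<in> T_SE2 g"
  then have "(transpose (fst g) ** fst u + transpose (fst u) ** fst g) +
      (transpose (fst g) ** fst v + transpose (fst v) ** fst g) = 0" by (simp add: T_SE2_iff)
  moreover have "(transpose (fst g) ** fst u + transpose (fst u) ** fst g) +
      (transpose (fst g) ** fst v + transpose (fst v) ** fst g) =
      transpose (fst g) ** (fst u + fst v) + transpose (fst u + fst v) ** fst g"
    by (rule mat2_eqI) (simp_all add: transpose_def algebra_simps)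
  ultimately show ?thesis by (simp add: T_SE2_iff)
qed

lemma T_SE2_scale: "v \<in> T_SE2 g \<Longrightarrow> c *\<^sub>R v \<in> T_SE2 g"
proof -
  assume "v \<in> T_SE2 g"
  then have "c *\<^sub>R (transpose (fst g) ** fst v + transpose (fst v) ** fst g) = 0"
    unfolding T_SE2_iff by (metis scaleR_zero_right)
  moreover have "c *\<^sub>R (transpose (fst g) ** fst v + transpose (fst v) ** fst g) =
      transpose (fst g) ** (c *\<^sub>R fst v) + transpose (c *\<^sub>R fst v) ** fst g"
    by (rule mat2_eqI) (simp_all add: transpose_def algebra_simps)
  ultimately show ?thesis by (simp add: T_SE2_iff)
qed

lemma rigid_velocity_linear:
  "rigid_velocity g (u + v) y = rigid_velocity g u y + rigid_velocity g v y"
  "rigid_velocity g (c *\<^sub>R v) y = c *\<^sub>R rigid_velocity g v y"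
  "rigid_velocity g 0 y = 0"
  by (rule vec2_eqI; simp add: rigid_velocity_def algebra_simps)+

locale solid_fluid =
  fixes S :: body_fluid
  assumes radius: "radius S > 0" and rate: "rate S > 1"
    and density_smooth: "smooth_on (fluid S) (density S)"
    and density_pos: "\<forall>x\<in>fluid S. density S x > 0"
begin

lemma rate_pos: "rate S > 0" using rate by simp

lemma near_id_Q_conf: "(g, \<phi>) \<in> Q S \<Longrightarrow> near_id (rate S) (fluid S) (moved_fluid S g) \<phi> (inv_into (fluid S) \<phi>)"
  by (rule Q_near_id[OF radius rate_pos density_pos])

lemma near_id_Diff: "f \<in> Diff_vol S \<Longrightarrow> near_id (rate S) (fluid S) (fluid S) f (inv_into (fluid S) f)"
  by (rule Diff_vol_near_id[OF radius rate_pos density_pos])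

lemma sphere_fluid: "x \<in> sphere (centre S) (radius S) \<Longrightarrow> x \<in> fluid S"
  by (auto simp: fluid_def)

lemma Q_det: "(g, \<phi>) \<in> Q S \<Longrightarrow> x \<in> fluid S \<Longrightarrow> det (jac (fluid S) \<phi> x) = density S x"
  by (auto simp: Q_def)

lemma Q_SE2: "(g, \<phi>) \<in> Q S \<Longrightarrow> g \<in> SE2"
  by (auto simp: Q_def)

lemma Diff_det: "f \<in> Diff_vol S \<Longrightarrow> x \<in> fluid S \<Longrightarrow> density S (f x) * det (jac (fluid S) f x) = density S x"
  by (auto simp: Diff_vol_def)

text \<open>Piola's identity moves the divergence condition from the image of \<open>\<phi>\<close> to the
  reference region, where tangent vectors at different configurations can be compared.\<close>

lemma TQ_iff:
  assumes q: "(g, \<phi>) \<in> Q S"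
  shows "(g', w) \<in> TQ S (g, \<phi>) \<longleftrightarrow> g' \<in> T_SE2 g \<and> (\<forall>x. x \<notin> fluid S \<longrightarrow> w x = 0) \<and> smooth_on (fluid S) w \<and>
    decays (rate S) w \<and> (\<forall>x\<in>fluid S. divergence (fluid S) (\<lambda>x. cof (jac (fluid S) \<phi> x) *v w x) x = 0) \<and>
    (\<forall>x\<in>sphere (centre S) (radius S). (w x - rigid_velocity g g' (\<phi> x)) \<bullet> (\<phi> x - act g (centre S)) = 0)"
proof -
  note n = near_id_Q_conf[OF q] note d = near_idD[OF n]
  have "(\<forall>y\<in>\<phi> ` fluid S. divergence (\<phi> ` fluid S) (\<lambda>y. w (inv_into (fluid S) \<phi> y)) y = 0) \<longleftrightarrow>
     (\<forall>x\<in>fluid S. divergence (fluid S) (\<lambda>x. cof (jac (fluid S) \<phi> x) *v w x) x = 0)"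
    if "smooth_on (fluid S) w"
    unfolding ball_simps d(10)[symmetric]
    using near_id_divergence[OF n that] near_id_det(2)[OF n] d(10) by simp
  then show ?thesis unfolding TQ_def frontier_fluid[OF radius] by auto
qed

lemma near_id_tangent_fluid:
  assumes "near_id s (fluid S) (moved_fluid S g) \<phi> \<psi>" "x \<in> sphere (centre S) (radius S)"
  shows "(jac (fluid S) \<phi> x *v \<xi>) \<bullet> (\<phi> x - act g (centre S)) = 0 \<longleftrightarrow> \<xi> \<bullet> (x - centre S) = 0"
  using near_id_tangent[OF assms(1)[unfolded fluid_def moved_fluid_def] radius radius assms(2)]
  by (simp add: fluid_def)

lemma near_id_tangent_fluid_self:
  assumes "near_id s (fluid S) (fluid S) \<phi> \<psi>" "x \<in> sphere (centre S) (radius S)"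
  shows "(jac (fluid S) \<phi> x *v \<xi>) \<bullet> (\<phi> x - centre S) = 0 \<longleftrightarrow> \<xi> \<bullet> (x - centre S) = 0"
  using near_id_tangent[OF assms(1)[unfolded fluid_def] radius radius assms(2)]
  by (simp add: fluid_def)

lemma X_vol_iff:
  "\<xi> \<in> X_vol S \<longleftrightarrow> (\<forall>x. x \<notin> fluid S \<longrightarrow> \<xi> x = 0) \<and> smooth_on (fluid S) \<xi> \<and> decays (rate S) \<xi> \<and>
     (\<forall>x\<in>fluid S. divergence (fluid S) (\<lambda>x. density S x *\<^sub>R \<xi> x) x = 0) \<and>
     (\<forall>x\<in>sphere (centre S) (radius S). \<xi> x \<bullet> (x - centre S) = 0)"
  by (simp add: X_vol_def frontier_fluid[OF radius])

lemma smooth_density_scale: "smooth_on (fluid S) \<xi> \<Longrightarrow> smooth_on (fluid S) (\<lambda>x. density S x *\<^sub>R \<xi> x)"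
  by (rule smooth_on_scaleR[OF density_smooth])

text \<open>Inverts \<open>\<xi> \<mapsto> generator S \<xi> q\<close>.\<close>

definition pull :: "conf \<Rightarrow> (plane \<Rightarrow> plane) \<Rightarrow> plane \<Rightarrow> plane" where
  "pull q w = (\<lambda>x. if x \<in> fluid S then matrix_inv (jac (fluid S) (snd q) x) *v w x else 0)"

lemma smooth_decays_pull:
  assumes n: "near_id s (fluid S) Y \<phi> \<psi>" and w: "smooth_on (fluid S) w" "decays t w"
  shows "smooth_on (fluid S) (\<lambda>x. if x \<in> fluid S then matrix_inv (jac (fluid S) \<phi> x) *v w x else 0)"
    "decays t (\<lambda>x. if x \<in> fluid S then matrix_inv (jac (fluid S) \<phi> x) *v w x else 0)"
proof -
  have s: "smooth_on (fluid S) (\<lambda>x. matrix_inv (jac (fluid S) \<phi> x) *v w x)"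
    by (rule smooth_on_mv[OF near_id_inv_jac(1)[OF n] w(1)])
  then show "smooth_on (fluid S) (\<lambda>x. if x \<in> fluid S then matrix_inv (jac (fluid S) \<phi> x) *v w x else 0)"
    by (rule smooth_on_cong[rotated]) simp
  have "decays t (\<lambda>x. matrix_inv (jac (fluid S) \<phi> x) *v w x)"
    by (rule decays_mv[OF fluid_exterior(1) near_id_inv_jac[OF n] w])
  then show "decays t (\<lambda>x. if x \<in> fluid S then matrix_inv (jac (fluid S) \<phi> x) *v w x else 0)"
    by (rule decays_cong[OF fluid_exterior(1) s]) simp
qed

text \<open>As \<open>density\<close> is the determinant of \<open>D\<phi>\<close>, the field \<open>density
  \<cdot> pull q w\<close> is \<open>cof (D\<phi>) w\<close>: the two divergence conditions are the same. The
  boundary conditions agree because \<open>\<phi>\<close> maps circle to circle.\<close>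

lemma pull_X_vol:
  assumes q: "(g, \<phi>) \<in> Q S" and v: "(0, w) \<in> TQ S (g, \<phi>)"
  shows "pull (g, \<phi>) w \<in> X_vol S"
proof -
  note n = near_id_Q_conf[OF q]
  have w: "smooth_on (fluid S) w" "decays (rate S) w"
    "\<And>x. x \<in> fluid S \<Longrightarrow> divergence (fluid S) (\<lambda>x. cof (jac (fluid S) \<phi> x) *v w x) x = 0"
    "\<And>x. x \<in> sphere (centre S) (radius S) \<Longrightarrow> w x \<bullet> (\<phi> x - act g (centre S)) = 0"
    using v unfolding TQ_iff[OF q] by (auto simp: rigid_velocity_linear)
  have eq: "cof (jac (fluid S) \<phi> x) *v w x = density S x *\<^sub>R pull (g, \<phi>) w x" if x: "x \<in> fluid S" for x
    using near_id_det(2)[OF n x] x by (simp add: pull_def matrix_inv_cof Q_det[OF q x] flip: scaleR_matrix_vector_assoc)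
  have t: "pull (g, \<phi>) w x \<bullet> (x - centre S) = 0" if x: "x \<in> sphere (centre S) (radius S)" for x
    using near_id_tangent_fluid[OF n x, of "pull (g, \<phi>) w x"] w(4)[OF x] sphere_fluid[OF x]
      matrix_inv_vector(1)[OF near_id_det(2)[OF n]] by (simp add: pull_def)
  have dv: "divergence (fluid S) (\<lambda>x. density S x *\<^sub>R pull (g, \<phi>) w x) x = 0" if x: "x \<in> fluid S" for x
    using divergence_cong[OF fluid_exterior(1) smooth_on_cof_mv[OF fluid_exterior(1) near_idD(5)[OF n] w(1)] x eq] w(3)[OF x]
    by simp
  have "smooth_on (fluid S) (pull (g, \<phi>) w)" "decays (rate S) (pull (g, \<phi>) w)"
    using smooth_decays_pull[OF n w(1,2)] unfolding pull_def snd_conv .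
  then show ?thesis
    unfolding X_vol_iff using t dv by (auto simp: pull_def)
qed

lemma generator_TQ:
  assumes q: "(g, \<phi>) \<in> Q S" and \<xi>: "\<xi> \<in> X_vol S"
  shows "generator S \<xi> (g, \<phi>) \<in> TQ S (g, \<phi>)"
proof -
  note n = near_id_Q_conf[OF q]
  have x: "smooth_on (fluid S) \<xi>" "decays (rate S) \<xi>"
    "\<And>x. x \<in> fluid S \<Longrightarrow> divergence (fluid S) (\<lambda>x. density S x *\<^sub>R \<xi> x) x = 0"
    "\<And>x. x \<in> sphere (centre S) (radius S) \<Longrightarrow> \<xi> x \<bullet> (x - centre S) = 0"
    using \<xi> unfolding X_vol_iff by auto
  define w where "w x = (if x \<in> fluid S then jac (fluid S) \<phi> x *v \<xi> x else 0)" for x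
  have s: "smooth_on (fluid S) (\<lambda>x. jac (fluid S) \<phi> x *v \<xi> x)"
    by (rule smooth_on_mv[OF smooth_on_jac[OF fluid_exterior(1) near_idD(5)[OF n]] x(1)])
  have "decays (rate S) (\<lambda>x. jac (fluid S) \<phi> x *v \<xi> x)"
    by (rule decays_mv[OF fluid_exterior(1) smooth_on_jac[OF fluid_exterior(1) near_idD(5)[OF n]] near_id_flat_jac[OF n] x(1,2)])
  then have "decays (rate S) w"
    by (rule decays_cong[OF fluid_exterior(1) s]) (simp add: w_def)
  moreover have "smooth_on (fluid S) w"
    by (rule smooth_on_cong[OF _ s]) (simp add: w_def)
  moreover have eq: "density S y *\<^sub>R \<xi> y = cof (jac (fluid S) \<phi> y) *v w y" if y: "y \<in> fluid S" for y
    using y by (simp add: w_def matrix_vector_mul_assoc cof_mult Q_det[OF q y] flip: scaleR_matrix_vector_assoc)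
  moreover have "divergence (fluid S) (\<lambda>x. cof (jac (fluid S) \<phi> x) *v w x) y = 0" if y: "y \<in> fluid S" for y
    using divergence_cong[OF fluid_exterior(1) smooth_density_scale[OF x(1)] y eq] x(3)[OF y] by simp
  moreover have "(w y - rigid_velocity g 0 (\<phi> y)) \<bullet> (\<phi> y - act g (centre S)) = 0"
    if y: "y \<in> sphere (centre S) (radius S)" for y
    using near_id_tangent_fluid[OF n y, of "\<xi> y"] x(4)[OF y] sphere_fluid[OF y]
    by (simp add: w_def rigid_velocity_linear)
  ultimately have "(0, w) \<in> TQ S (g, \<phi>)"
    unfolding TQ_iff[OF q] using T_SE2_zero by (auto simp: w_def)
  then show ?thesis unfolding generator_def snd_conv w_def[abs_def] .
qed

lemma generator_pull:
  assumes q: "(g, \<phi>) \<in> Q S" and v: "(0, w) \<in> TQ S (g, \<phi>)"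
  shows "generator S (pull (g, \<phi>) w) (g, \<phi>) = (0, w)"
  using v matrix_inv_vector(1)[OF near_id_det(2)[OF near_id_Q_conf[OF q]]] unfolding TQ_iff[OF q]
  by (auto simp: generator_def pull_def)

lemma pull_jac:
  assumes q: "(g, \<phi>) \<in> Q S" and \<xi>: "\<xi> \<in> X_vol S"
  shows "pull (g, \<phi>) (\<lambda>x. jac (fluid S) \<phi> x *v \<xi> x) = \<xi>"
  using \<xi> matrix_inv_vector(2)[OF near_id_det(2)[OF near_id_Q_conf[OF q]]] unfolding X_vol_iff
  by (auto simp: pull_def)

text \<open>The field \<open>density \<cdot> f\<^sup>* \<xi>\<close> is the Piola transform along
  \<open>f\<close> of \<open>density \<cdot> \<xi>\<close>.\<close>

lemma pull_field_X_vol: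
  assumes f: "f \<in> Diff_vol S" and \<xi>: "\<xi> \<in> X_vol S"
  shows "pull_field S f \<xi> \<in> X_vol S"
proof -
  note n = near_id_Diff[OF f] note d = near_idD[OF n]
  have x: "smooth_on (fluid S) \<xi>" "decays (rate S) \<xi>"
    "\<And>x. x \<in> fluid S \<Longrightarrow> divergence (fluid S) (\<lambda>x. density S x *\<^sub>R \<xi> x) x = 0"
    "\<And>x. x \<in> sphere (centre S) (radius S) \<Longrightarrow> \<xi> x \<bullet> (x - centre S) = 0"
    using \<xi> unfolding X_vol_iff by auto
  have s: "smooth_on (fluid S) (\<lambda>x. \<xi> (f x))"
    by (rule smooth_on_compose[OF x(1) d(5)]) (use d(10) in simp)
  have "smooth_on (fluid S) (pull_field S f \<xi>)" "decays (rate S) (pull_field S f \<xi>)"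
    using smooth_decays_pull[OF n s decays_compose_near_id[OF n x(1,2)]] by (simp_all add: pull_field_def)
  moreover have "pull_field S f \<xi> y \<bullet> (y - centre S) = 0" if y: "y \<in> sphere (centre S) (radius S)" for y
  proof -
    have "f y \<in> sphere (centre S) (radius S)" using d(9) y by (auto simp: frontier_fluid[OF radius])
    then show ?thesis
      using near_id_tangent_fluid_self[OF n y, of "pull_field S f \<xi> y"] x(4) sphere_fluid[OF y]
        matrix_inv_vector(1)[OF near_id_det(2)[OF n]] by (simp add: pull_field_def)
  qed
  moreover have "divergence (fluid S) (\<lambda>x. density S x *\<^sub>R pull_field S f \<xi> x) y = 0" if y: "y \<in> fluid S" for y
  proof -
    have eq: "cof (jac (fluid S) f x) *v (density S (f x) *\<^sub>R \<xi> (f x)) = density S x *\<^sub>R pull_field S f \<xi> x"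
      if "x \<in> fluid S" for x
      using that near_id_det(2)[OF n that] Diff_det[OF f that, symmetric]
      by (simp add: pull_field_def matrix_inv_cof matrix_vector_mult_scaleR flip: scaleR_matrix_vector_assoc)
    have V: "smooth_on (fluid S) (\<lambda>x. density S x *\<^sub>R \<xi> x)" by (rule smooth_density_scale[OF x(1)])
    have "smooth_on (fluid S) (\<lambda>x. density S (f x) *\<^sub>R \<xi> (f x))"
      by (rule smooth_on_compose[OF V d(5)]) (use d(10) in simp)
    note c = smooth_on_cof_mv[OF fluid_exterior(1) d(5) this]
    have "f y \<in> fluid S" using d(10) y by blast
    then show ?thesis
      using divergence_cong[OF fluid_exterior(1) c y eq] piola[OF fluid_exterior(1) d(5) _ V y] d(10) x(3) by simp
  qed
  ultimately show ?thesis unfolding X_vol_iff by (auto simp: pull_field_def)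
qed

lemma TQ_vel_add:
  assumes q: "(g, \<phi>) \<in> Q S" and u: "u \<in> TQ S (g, \<phi>)" and v: "v \<in> TQ S (g, \<phi>)"
  shows "vel_add u v \<in> TQ S (g, \<phi>)"
proof -
  obtain g1 w1 g2 w2 where uv: "u = (g1, w1)" "v = (g2, w2)" by (metis surj_pair)
  note n = near_id_Q_conf[OF q] note d = near_idD[OF n]
  have w1: "smooth_on (fluid S) w1" "decays (rate S) w1" and w2: "smooth_on (fluid S) w2" "decays (rate S) w2"
    using u v unfolding uv TQ_iff[OF q] by auto
  have "divergence (fluid S) (\<lambda>x. cof (jac (fluid S) \<phi> x) *v (w1 x + w2 x)) x =
    divergence (fluid S) (\<lambda>x. cof (jac (fluid S) \<phi> x) *v w1 x) x + divergence (fluid S) (\<lambda>x. cof (jac (fluid S) \<phi> x) *v w2 x) x"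
    if "x \<in> fluid S" for x
    using jac_add[OF fluid_exterior(1) smooth_on_cof_mv[OF fluid_exterior(1) d(5) w1(1)]
        smooth_on_cof_mv[OF fluid_exterior(1) d(5) w2(1)] that]
    by (simp add: divergence_def trace_add matrix_vector_right_distrib)
  then show ?thesis
    using u v smooth_on_add[OF w1(1) w2(1)] decays_add[OF fluid_exterior(1) w1(1) w2(1) w1(2) w2(2)]
    unfolding uv vel_add_def fst_conv snd_conv TQ_iff[OF q]
    by (auto simp: T_SE2_add rigid_velocity_linear inner_diff_left inner_add_left)
qed

lemma TQ_vel_scale:
  assumes q: "(g, \<phi>) \<in> Q S" and v: "v \<in> TQ S (g, \<phi>)"
  shows "vel_scale c v \<in> TQ S (g, \<phi>)"
proof -
  obtain g1 w1 where uv: "v = (g1, w1)" by (metis surj_pair)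
  note n = near_id_Q_conf[OF q] note d = near_idD[OF n]
  have w1: "smooth_on (fluid S) w1" "decays (rate S) w1"
    using v unfolding uv TQ_iff[OF q] by auto
  have "divergence (fluid S) (\<lambda>x. cof (jac (fluid S) \<phi> x) *v (c *\<^sub>R w1 x)) x =
    c * divergence (fluid S) (\<lambda>x. cof (jac (fluid S) \<phi> x) *v w1 x) x"
    if "x \<in> fluid S" for x
    using jac_scaleR[OF fluid_exterior(1) smooth_on_cof_mv[OF fluid_exterior(1) d(5) w1(1)] that, of c]
    by (simp add: divergence_def trace2 matrix_vector_mult_scaleR algebra_simps)
  then show ?thesis
    using v smooth_on_scaleR[OF smooth_on_const w1(1)] decays_scaleR[OF fluid_exterior(1) w1]
    unfolding uv vel_scale_def fst_conv snd_conv TQ_iff[OF q]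
    by (auto simp: T_SE2_scale rigid_velocity_linear simp flip: scaleR_diff_right)
qed

lemma diff_inv_eq: "x \<in> fluid S \<Longrightarrow> diff_inv S f x = inv_into (fluid S) f x"
  by (simp add: diff_inv_def)

lemma conf_act_near_id:
  assumes q: "(g, \<phi>) \<in> Q S" and f: "f \<in> Diff_vol S"
  shows "near_id (rate S) (fluid S) (moved_fluid S g) (compose (fluid S) \<phi> f)
    (\<lambda>y. inv_into (fluid S) f (inv_into (fluid S) \<phi> y))"
    "x \<in> fluid S \<Longrightarrow> jac (fluid S) (compose (fluid S) \<phi> f) x = jac (fluid S) \<phi> (f x) ** jac (fluid S) f x"
proof -
  note n = near_id_Q_conf[OF q] note m = near_id_Diff[OF f]
  show "near_id (rate S) (fluid S) (moved_fluid S g) (compose (fluid S) \<phi> f)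
    (\<lambda>y. inv_into (fluid S) f (inv_into (fluid S) \<phi> y))"
    by (rule near_id_cong[OF near_id_compose[OF m n]]) (simp_all add: compose_eq)
  assume x: "x \<in> fluid S"
  have "jac (fluid S) (compose (fluid S) \<phi> f) x = jac (fluid S) (\<lambda>x. \<phi> (f x)) x"
    by (rule jac_cong[OF fluid_exterior(1) near_idD(5)[OF near_id_compose[OF m n]] x]) (simp add: compose_eq)
  also have "\<dots> = jac (fluid S) \<phi> (f x) ** jac (fluid S) f x"
    by (rule jac_compose[OF fluid_exterior(1) near_idD(5)[OF m] _ near_idD(5)[OF n] x]) (use near_idD(10)[OF m] in simp)
  finally show "jac (fluid S) (compose (fluid S) \<phi> f) x = jac (fluid S) \<phi> (f x) ** jac (fluid S) f x" .
qed

lemma conf_act_Q: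
  assumes q: "(g, \<phi>) \<in> Q S" and f: "f \<in> Diff_vol S"
  shows "(g, compose (fluid S) \<phi> f) \<in> Q S"
proof (rule near_id_Q[OF radius density_pos Q_SE2[OF q] conf_act_near_id(1)[OF q f]])
  show "det (jac (fluid S) (compose (fluid S) \<phi> f) x) = density S x" if "x \<in> fluid S" for x
  proof -
    have "f x \<in> fluid S" using near_idD(10)[OF near_id_Diff[OF f]] that by blast
    then show ?thesis using conf_act_near_id(2)[OF q f that] Diff_det[OF f that] Q_det[OF q] by (simp add: det_mul)
  qed
qed simp

text \<open>Relabelling leaves the Eulerian velocity unchanged. On the reference region this is the
  multiplicativity of cofactors under the chain rule, combined with Piola's identity for
  \<open>f\<close>.\<close>

lemma vel_act_inv_TQ:
  assumes q: "(g, \<phi>) \<in> Q S" and f: "f \<in> Diff_vol S" and v: "v \<in> TQ S (g, compose (fluid S) \<phi> f)"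
  shows "vel_act S (diff_inv S f) v \<in> TQ S (g, \<phi>)" "vel_act S f (vel_act S (diff_inv S f) v) = v"
proof -
  obtain g' w where v': "v = (g', w)" by fastforce
  note n = near_id_Q_conf[OF q] note m = near_id_Diff[OF f] note d = near_idD[OF m]
  have q': "(g, compose (fluid S) \<phi> f) \<in> Q S" by (rule conf_act_Q[OF q f])
  have w: "g' \<in> T_SE2 g" "\<And>x. x \<notin> fluid S \<Longrightarrow> w x = 0" "smooth_on (fluid S) w" "decays (rate S) w"
    "\<And>x. x \<in> fluid S \<Longrightarrow> divergence (fluid S) (\<lambda>x. cof (jac (fluid S) (compose (fluid S) \<phi> f) x) *v w x) x = 0"
    "\<And>x. x \<in> sphere (centre S) (radius S) \<Longrightarrow>
       (w x - rigid_velocity g g' (compose (fluid S) \<phi> f x)) \<bullet> (compose (fluid S) \<phi> f x - act g (centre S)) = 0"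
    using v unfolding v' TQ_iff[OF q'] by auto
  let ?h = "inv_into (fluid S) f"
  define w' where "w' x = (if x \<in> fluid S then w (?h x) else 0)" for x
  have s: "smooth_on (fluid S) (\<lambda>x. w (?h x))" by (rule smooth_on_compose[OF w(3) d(6)]) (use d(11) in simp)
  then have s': "smooth_on (fluid S) w'" by (rule smooth_on_cong[rotated]) (simp add: w'_def)
  have dec: "decays (rate S) w'"
    by (rule decays_cong[OF fluid_exterior(1) s decays_compose_near_id[OF near_id_sym[OF m] w(3,4)]]) (simp add: w'_def)
  have V: "smooth_on (fluid S) (\<lambda>x. cof (jac (fluid S) \<phi> x) *v w' x)"
    by (rule smooth_on_cof_mv[OF fluid_exterior(1) near_idD(5)[OF n] s'])
  have dv: "divergence (fluid S) (\<lambda>x. cof (jac (fluid S) \<phi> x) *v w' x) y = 0" if y: "y \<in> fluid S" for y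
  proof -
    define x where "x = ?h y"
    have x: "x \<in> fluid S" "f x = y" using d(11,13) y by (auto simp: x_def)
    have eq: "cof (jac (fluid S) (compose (fluid S) \<phi> f) x) *v w x =
      cof (jac (fluid S) f x) *v (cof (jac (fluid S) \<phi> (f x)) *v w' (f x))" if "x \<in> fluid S" for x
    proof -
      have "w' (f x) = w x" using d(10,12) that by (auto simp: w'_def)
      then show ?thesis using conf_act_near_id(2)[OF q f that]
        by (simp add: cof_matrix_mult matrix_vector_mul_assoc)
    qed
    have "divergence (fluid S) (\<lambda>x. cof (jac (fluid S) f x) *v (cof (jac (fluid S) \<phi> (f x)) *v w' (f x))) x = 0"
      using divergence_cong[OF fluid_exterior(1) smooth_on_cof_mv[OF fluid_exterior(1) near_idD(5)[OF conf_act_near_id(1)[OF q f]] w(3)] x(1) eq]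
        w(5)[OF x(1)] by simp
    then have "det (jac (fluid S) f x) * divergence (fluid S) (\<lambda>x. cof (jac (fluid S) \<phi> x) *v w' x) (f x) = 0"
      using piola[OF fluid_exterior(1) d(5) _ V x(1)] d(10) by simp
    then show ?thesis using near_id_det(2)[OF m x(1)] x(2) by simp
  qed
  have bd: "(w' y - rigid_velocity g g' (\<phi> y)) \<bullet> (\<phi> y - act g (centre S)) = 0" if y: "y \<in> sphere (centre S) (radius S)" for y
  proof -
    have yX: "y \<in> fluid S" by (rule sphere_fluid[OF y])
    have "?h y \<in> sphere (centre S) (radius S)"
      using near_idD(9)[OF near_id_sym[OF m]] y by (auto simp: frontier_fluid[OF radius])
    from w(6)[OF this] show ?thesis
      using yX d(13)[OF yX] sphere_fluid[OF \<open>?h y \<in> sphere (centre S) (radius S)\<close>] by (simp add: w'_def compose_eq)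
  qed
  have "(g', w') \<in> TQ S (g, \<phi>)"
    unfolding TQ_iff[OF q] using w(1) s' dec dv bd by (auto simp: w'_def)
  moreover have e: "vel_act S (diff_inv S f) v = (g', w')"
    by (auto simp: vel_act_def v' w'_def diff_inv_eq)
  ultimately show "vel_act S (diff_inv S f) v \<in> TQ S (g, \<phi>)" by simp
  have "w' (f x) = w x" if "x \<in> fluid S" for x using d(10,12) that by (auto simp: w'_def)
  then show "vel_act S f (vel_act S (diff_inv S f) v) = v"
    unfolding e using w(2) by (auto simp: v' vel_act_def fun_eq_iff)
qed

end

section \<open>Cut-off functions\<close>

text \<open>The derivatives of \<open>exp (- 1 / t)\<close>, extended by zero, are combinations of these
  functions, so the family is closed under differentiation.\<close>

definition exp_flat :: "nat \<Rightarrow> real \<Rightarrow> real" where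
  "exp_flat k t = (if t \<le> 0 then 0 else inverse t ^ k * exp (- inverse t))"

lemma exp_flat_tendsto_0: "(exp_flat k \<longlongrightarrow> 0) (at 0)"
  unfolding filterlim_at_split
proof
  have "(exp_flat k \<longlongrightarrow> 0) (at_left 0) \<longleftrightarrow> ((\<lambda>t. 0::real) \<longlongrightarrow> 0) (at_left (0::real))"
    by (intro filterlim_cong refl) (auto simp: eventually_at_filter exp_flat_def)
  then show "(exp_flat k \<longlongrightarrow> 0) (at_left 0)" by simp
  have "((\<lambda>t. inverse t ^ k / exp (inverse t)) \<longlongrightarrow> 0) (at_right (0::real))"
    by (rule filterlim_compose[OF tendsto_power_div_exp_0 filterlim_inverse_at_top_right])
  moreover have "(exp_flat k \<longlongrightarrow> 0) (at_right 0) \<longleftrightarrow> ((\<lambda>t. inverse t ^ k / exp (inverse t)) \<longlongrightarrow> 0) (at_right (0::real))"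
    by (intro filterlim_cong refl) (auto simp: eventually_at_filter exp_flat_def exp_minus divide_inverse)
  ultimately show "(exp_flat k \<longlongrightarrow> 0) (at_right 0)" by simp
qed

text \<open>At the origin the difference quotient of \<open>exp_flat k\<close> is \<open>exp_flat (Suc
  k)\<close>, which tends to zero.\<close>

lemma exp_flat_deriv:
  "(exp_flat k has_real_derivative (exp_flat (k + 2) t - of_nat k * exp_flat (k + 1) t)) (at t)"
proof -
  consider "t < 0" | "t = 0" | "t > 0" by linarith
  then show ?thesis
  proof cases
    case 1
    have "((\<lambda>t. 0) has_real_derivative 0) (at t)" by simp
    then have "(exp_flat k has_real_derivative 0) (at t)"
      by (rule has_field_derivative_transform_within_open[where S="{..<0}"]) (use 1 in \<open>auto simp: exp_flat_def\<close>)
    then show ?thesis using 1 by (simp add: exp_flat_def)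
  next
    case 2
    have "((\<lambda>h. (exp_flat k (0 + h) - exp_flat k 0) / h) \<longlongrightarrow> 0) (at 0)"
    proof -
      have "(\<lambda>h. (exp_flat k (0 + h) - exp_flat k 0) / h) = exp_flat (Suc k)"
        by (auto simp: exp_flat_def fun_eq_iff divide_inverse)
      then show ?thesis using exp_flat_tendsto_0 by simp
    qed
    then show ?thesis using 2 by (simp add: DERIV_def exp_flat_def)
  next
    case 3
    have inv: "(inverse has_real_derivative - (inverse t * inverse t)) (at t)"
      using DERIV_inverse[of t UNIV] 3 by (simp add: power2_eq_square)
    have "((\<lambda>t. inverse t ^ k * exp (- inverse t)) has_real_derivative
        (of_nat k * (- (inverse t * inverse t) * inverse t ^ (k - Suc 0)) * exp (- inverse t)
          + exp (- inverse t) * - (- (inverse t * inverse t)) * inverse t ^ k)) (at t)"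
      by (rule DERIV_mult[OF DERIV_power[OF inv] DERIV_fun_exp[OF DERIV_minus[OF inv]]])
    moreover have "of_nat k * (- (inverse t * inverse t) * inverse t ^ (k - Suc 0)) * exp (- inverse t)
          + exp (- inverse t) * - (- (inverse t * inverse t)) * inverse t ^ k
        = exp_flat (k + 2) t - of_nat k * exp_flat (k + 1) t"
      using 3 by (cases k) (simp_all add: exp_flat_def)
    ultimately have "((\<lambda>t. inverse t ^ k * exp (- inverse t)) has_real_derivative
        (exp_flat (k + 2) t - of_nat k * exp_flat (k + 1) t)) (at t)" by simp
    then show ?thesis
      by (rule has_field_derivative_transform_within_open[where S="{0<..}"]) (use 3 in \<open>auto simp: exp_flat_def\<close>)
  qed
qed

lemma dir_deriv_real:
  "(f has_real_derivative d) (at t) \<Longrightarrow> dir_deriv v f t = v * d"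
  by (rule dir_deriv_eq[of _ "\<lambda>v. v * d", simplified]) (simp add: has_field_derivative_def mult_commute_abs)

lemma real_differentiable_onI:
  "(\<And>t. (f has_real_derivative d t) (at t)) \<Longrightarrow> f differentiable_on (U :: real set)"
  by (meson differentiable_at_withinI differentiable_def differentiable_on_def has_field_derivative_def)

lemma Ck_exp_flat: "Ck n UNIV None (exp_flat k)"
proof (induction n arbitrary: k)
  case (Suc n)
  have "Ck n UNIV None (dir_deriv v (exp_flat k))" for v
  proof -
    have "Ck n UNIV None (\<lambda>t. v *\<^sub>R (exp_flat (k + 2) t + (- of_nat k) *\<^sub>R exp_flat (k + 1) t))"
      by (intro Ck_linear[OF _ bounded_linear_scaleR_right] Ck_add Suc) auto
    moreover have "dir_deriv v (exp_flat k) = (\<lambda>t. v *\<^sub>R (exp_flat (k + 2) t + (- of_nat k) *\<^sub>R exp_flat (k + 1) t))"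
      using dir_deriv_real[OF exp_flat_deriv] by auto
    ultimately show ?thesis by simp
  qed
  then show ?case using real_differentiable_onI[OF exp_flat_deriv] by simp
qed simp

lemma smooth_on_exp_flat: "smooth_on UNIV (exp_flat k)"
  using Ck_exp_flat by (simp add: smooth_on_open Cinf_def)

definition smooth_step :: "real \<Rightarrow> real" where
  "smooth_step t = exp_flat 0 t * inverse (exp_flat 0 t + exp_flat 0 (1 - t))"

lemma exp_flat_nonneg: "exp_flat 0 t \<ge> 0" and exp_flat_pos: "t > 0 \<Longrightarrow> exp_flat 0 t > 0"
  by (auto simp: exp_flat_def)

lemma exp_flat_sum_pos: "exp_flat 0 t + exp_flat 0 (1 - t) > 0"
proof (cases "t > 0")
  case True then show ?thesis using exp_flat_pos[of t] exp_flat_nonneg[of "1 - t"] by linarith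
next
  case False then show ?thesis using exp_flat_pos[of "1 - t"] exp_flat_nonneg[of t] by linarith
qed

lemma smooth_on_step: "smooth_on UNIV smooth_step"
proof -
  have "smooth_on UNIV (\<lambda>t. exp_flat 0 (1 - t))"
    by (rule smooth_on_compose[OF smooth_on_exp_flat]) (auto intro: smooth_on_diff smooth_on_const smooth_on_id)
  then show ?thesis
    unfolding smooth_step_def[abs_def]
    by (intro smooth_on_mult smooth_on_inverse smooth_on_add smooth_on_exp_flat less_imp_neq[symmetric] exp_flat_sum_pos)
qed

lemma smooth_step_0: "t \<le> 0 \<Longrightarrow> smooth_step t = 0"
  by (simp add: smooth_step_def exp_flat_def)

lemma smooth_step_1: "t \<ge> 1 \<Longrightarrow> smooth_step t = 1"
  using exp_flat_sum_pos[of t] by (simp add: smooth_step_def exp_flat_def)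

lemma smooth_step_bounds: "0 \<le> smooth_step t" "smooth_step t \<le> 1"
proof -
  show "0 \<le> smooth_step t"
    unfolding smooth_step_def using exp_flat_nonneg[of t] exp_flat_sum_pos[of t] by simp
  show "smooth_step t \<le> 1"
    unfolding smooth_step_def divide_inverse[symmetric] using exp_flat_nonneg[of "1 - t"] exp_flat_sum_pos[of t]
    by (simp add: divide_le_eq_1)
qed

lemma Ck_sin_cos: "Ck n UNIV None (sin :: real \<Rightarrow> real) \<and> Ck n UNIV None (cos :: real \<Rightarrow> real)"
proof (induction n)
  case (Suc n)
  have s: "dir_deriv v sin = (\<lambda>t::real. v *\<^sub>R cos t)" for v
    using dir_deriv_real[OF DERIV_sin] by auto
  have c: "dir_deriv v cos = (\<lambda>t::real. (- v) *\<^sub>R sin t)" for v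
    using dir_deriv_real[OF DERIV_cos] by auto
  have "Ck n UNIV None (dir_deriv v (sin :: real \<Rightarrow> real))" "Ck n UNIV None (dir_deriv v (cos :: real \<Rightarrow> real))" for v
    unfolding s c using Suc by (intro Ck_linear[OF _ bounded_linear_scaleR_right]; simp)+
  then show ?case using real_differentiable_onI[OF DERIV_sin] real_differentiable_onI[OF DERIV_cos] by simp
qed simp

lemma smooth_on_sin_cos: "smooth_on UNIV (sin :: real \<Rightarrow> real)" "smooth_on UNIV (cos :: real \<Rightarrow> real)"
  using Ck_sin_cos by (auto simp: smooth_on_open Cinf_def)

text \<open>A function of the squared distance, which is smooth also at \<open>p\<close>. The normalization
  makes it equal to \<open>1\<close> up to distance \<open>r\<close> and equal to \<open>0\<close> from distance
  \<open>2r\<close> on.\<close>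

definition cutoff :: "'a::real_inner \<Rightarrow> real \<Rightarrow> 'a \<Rightarrow> real" where
  "cutoff p r x = 1 - smooth_step (((x - p) \<bullet> (x - p) - r\<^sup>2) / (3 * r\<^sup>2))"

lemma smooth_on_sq_dist: "smooth_on UNIV (\<lambda>x. (x - p) \<bullet> (x - p) :: real)"
  by (intro smooth_on_inner smooth_on_diff smooth_on_id smooth_on_const)

lemma smooth_on_UNIV_compose:
  fixes f :: "'a::euclidean_space \<Rightarrow> 'b::real_normed_vector" and h :: "'c::euclidean_space \<Rightarrow> 'a"
  shows "smooth_on UNIV f \<Longrightarrow> smooth_on S h \<Longrightarrow> smooth_on S (\<lambda>x. f (h x))"
  by (rule smooth_on_compose) auto

lemma smooth_on_cutoff: "smooth_on UNIV (cutoff (p::'a::euclidean_space) r)"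
  unfolding cutoff_def[abs_def] divide_inverse
  by (intro smooth_on_diff smooth_on_const smooth_on_UNIV_compose[OF smooth_on_step] smooth_on_mult smooth_on_sq_dist)

lemma cutoff_1: "r > 0 \<Longrightarrow> dist p x \<le> r \<Longrightarrow> cutoff p r x = 1"
proof -
  assume r: "r > 0" and d: "dist p x \<le> r"
  have "(x - p) \<bullet> (x - p) \<le> r\<^sup>2"
    using d r by (simp add: dist_norm norm_minus_commute flip: power2_norm_eq_inner)
  then show ?thesis unfolding cutoff_def using r by (subst smooth_step_0) (auto simp: divide_le_0_iff)
qed

lemma cutoff_0: "r > 0 \<Longrightarrow> dist p x \<ge> 2 * r \<Longrightarrow> cutoff p r x = 0"
proof -
  assume r: "r > 0" and d: "dist p x \<ge> 2 * r"
  then have "(2 * r)\<^sup>2 \<le> (norm (x - p))\<^sup>2" by (intro power_mono) (auto simp: dist_norm norm_minus_commute)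
  then have "(x - p) \<bullet> (x - p) \<ge> 4 * r\<^sup>2" by (simp add: power2_norm_eq_inner power_mult_distrib)
  then show ?thesis unfolding cutoff_def using r by (subst smooth_step_1) (auto simp: field_simps)
qed

section \<open>Area-preserving maps of the plane\<close>

definition twist :: "(plane \<Rightarrow> real) \<Rightarrow> plane \<Rightarrow> plane \<Rightarrow> plane" where
  "twist a p x = p + (cos (a x) *\<^sub>R (x - p) + sin (a x) *\<^sub>R rot90 (x - p))"

lemma bounded_linear_rot90: "bounded_linear rot90"
  unfolding linear_conv_bounded_linear[symmetric] by (intro linearI vec2_eqI) auto

lemma smooth_on_twist: "smooth_on UNIV a \<Longrightarrow> smooth_on UNIV (twist a p)"
  unfolding twist_def[abs_def]
  by (intro smooth_on_add smooth_on_const smooth_on_scaleR smooth_on_UNIV_compose[OF smooth_on_sin_cos(1)]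
      smooth_on_UNIV_compose[OF smooth_on_sin_cos(2)] smooth_on_diff smooth_on_id
      smooth_on_linear[OF bounded_linear_rot90])

lemma rotate_sq: "(C *\<^sub>R z + D *\<^sub>R rot90 z) \<bullet> (C *\<^sub>R z + D *\<^sub>R rot90 z) = (C * C + D * D) * (z \<bullet> z)"
  by (simp add: inner2 algebra_simps)

lemma twist_sq_dist: "(twist a p x - p) \<bullet> (twist a p x - p) = (x - p) \<bullet> (x - p)"
  using rotate_sq[of "cos (a x)" "x - p" "sin (a x)"] by (simp add: twist_def)

lemma twist_inverse:
  assumes "a (twist a p x) = a x"
  shows "twist (\<lambda>y. - a y) p (twist a p x) = x"
proof -
  have id: "C *\<^sub>R (C *\<^sub>R z + D *\<^sub>R rot90 z) - D *\<^sub>R rot90 (C *\<^sub>R z + D *\<^sub>R rot90 z) = (C * C + D * D) *\<^sub>R z" for C D z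
    by (rule vec2_eqI) (simp_all add: algebra_simps)
  have "twist (\<lambda>y. - a y) p (twist a p x) =
    p + (cos (a x) *\<^sub>R (twist a p x - p) - sin (a x) *\<^sub>R rot90 (twist a p x - p))"
    unfolding twist_def[of "\<lambda>y. - a y"] assms by simp
  also have "\<dots> = x" using id[of "cos (a x)" "x - p" "sin (a x)"] by (simp add: twist_def)
  finally show ?thesis .
qed

lemma exterior_UNIV: "exterior (UNIV :: plane set)"
  unfolding exterior_def by (rule exI[of _ 0], rule exI[of _ 0]) simp

text \<open>If the angle depends on the distance from \<open>p\<close> only, the twist preserves circles and
  rotates each of them rigidly, so it preserves area.\<close>

lemma twist_det:
  assumes "(b has_real_derivative b') (at ((x - p) \<bullet> (x - p)))"
  shows "det (jac UNIV (twist (\<lambda>x. b ((x - p) \<bullet> (x - p))) p) x) = 1"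
proof -
  define z where "z = x - p"
  define a where "a x = b ((x - p) \<bullet> (x - p))" for x
  define C D where "C = cos (a x)" and "D = sin (a x)"
  let ?da = "\<lambda>h. b' * (z \<bullet> h + h \<bullet> z)"
  have "((\<lambda>x. (x - p) \<bullet> (x - p)) has_derivative (\<lambda>h. z \<bullet> h + h \<bullet> z)) (at x)"
    by (auto intro!: derivative_eq_intros simp: z_def)
  then have a: "(a has_derivative ?da) (at x)"
    unfolding a_def using assms unfolding has_field_derivative_def by (rule has_derivative_compose)
  have rot: "((\<lambda>x. rot90 (x - p)) has_derivative rot90) (at x)"
    by (rule bounded_linear.has_derivative[OF bounded_linear_rot90]) (auto intro!: derivative_eq_intros)
  let ?T = "\<lambda>h. C *\<^sub>R h + (- D * ?da h) *\<^sub>R z + (D *\<^sub>R rot90 h + (C * ?da h) *\<^sub>R rot90 z)"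
  have T: "(twist a p has_derivative ?T) (at x)"
    unfolding twist_def[abs_def]
    by (rule derivative_eq_intros a rot refl)+ (auto simp: C_def D_def z_def fun_eq_iff mult_ac)
  then have j: "jac UNIV (twist a p) x = matrix ?T" by (intro jac_unique exterior_UNIV) auto
  have "det (matrix ?T) = C * C + D * D"
    by (simp add: det_2 matrix_def inner2 axis_def algebra_simps)
  then show ?thesis using j unfolding a_def[abs_def] C_def D_def by simp
qed

text \<open>The inverse \<open>T'\<close> is carried along explicitly; the support is bounded, so composition
  with \<open>T\<close> does not affect decay conditions.\<close>

definition area_move :: "(plane \<Rightarrow> plane) \<Rightarrow> (plane \<Rightarrow> plane) \<Rightarrow> bool" where
  "area_move T T' \<longleftrightarrow> smooth_on UNIV T \<and> smooth_on UNIV T' \<and> (\<forall>x. T' (T x) = x) \<and> (\<forall>x. T (T' x) = x) \<and>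
     (\<forall>x. det (jac UNIV T x) = 1) \<and> bounded {x. T x \<noteq> x}"

text \<open>A twist with angle \<open>\<pi>\<close> on the disc of radius \<open>r\<close> that dies out before
  radius \<open>2r\<close>.\<close>

lemma half_turn:
  assumes r: "r > 0"
  obtains T T' where "area_move T T'" "\<And>x. dist p x \<le> r \<Longrightarrow> T x = 2 *\<^sub>R p - x" "\<And>x. dist p x \<ge> 2 * r \<Longrightarrow> T x = x"
proof -
  define b where "b q = pi * (1 - smooth_step ((q - r\<^sup>2) / (3 * r\<^sup>2)))" for q
  define a where "a x = b ((x - p) \<bullet> (x - p))" for x
  have a: "a x = pi * cutoff p r x" for x by (simp add: a_def b_def cutoff_def)
  have sa: "smooth_on UNIV a" unfolding a[abs_def] by (intro smooth_on_mult smooth_on_const smooth_on_cutoff)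
  have sb: "smooth_on UNIV b"
    unfolding b_def[abs_def] divide_inverse
    by (intro smooth_on_mult smooth_on_diff smooth_on_const smooth_on_UNIV_compose[OF smooth_on_step] smooth_on_id)
  have det: "det (jac UNIV (twist a p) x) = 1" for x
  proof -
    have "b differentiable (at ((x - p) \<bullet> (x - p)))"
      using Cinf_differentiable_on[of UNIV None b] sb by (simp add: smooth_on_open differentiable_on_def)
    then obtain b' where "(b has_real_derivative b') (at ((x - p) \<bullet> (x - p)))"
      using real_differentiable_def by blast
    then show ?thesis using twist_det unfolding a_def[abs_def] by blast
  qed
  have inv: "a (twist a p x) = a x" "- a (twist (\<lambda>y. - a y) p x) = - a x" for x
    unfolding a_def twist_sq_dist by simp_all
  have outside: "twist a p x = x" if "dist p x \<ge> 2 * r" for x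
    using cutoff_0[OF r that] by (simp add: twist_def a)
  show thesis
  proof (rule that[of "twist a p" "twist (\<lambda>y. - a y) p"])
    have "{x. twist a p x \<noteq> x} \<subseteq> ball p (2 * r)" using outside by force
    then have "bounded {x. twist a p x \<noteq> x}" using bounded_ball bounded_subset by blast
    moreover have "twist a p (twist (\<lambda>y. - a y) p x) = x" for x
      using twist_inverse[of "\<lambda>y. - a y" p x] inv(2)[of x] by simp
    ultimately show "area_move (twist a p) (twist (\<lambda>y. - a y) p)"
      using det twist_inverse[OF inv(1)] sa by (simp add: area_move_def smooth_on_twist smooth_on_minus)
    show "twist a p x = 2 *\<^sub>R p - x" if "dist p x \<le> r" for x
      using cutoff_1[OF r that] by (simp add: twist_def a scaleR_2)
  qed (rule outside)
qed

lemma jac_restrict: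
  assumes "exterior Y" "smooth_on UNIV T" "y \<in> Y" shows "jac Y T y = jac UNIV T y"
  by (rule jac_eqI[OF assms(1,3) has_derivative_subset[OF smooth_on_has_jac[OF assms(2) UNIV_I] subset_UNIV]])

lemma area_moveD:
  assumes "area_move T T'"
  shows "smooth_on UNIV T" "smooth_on UNIV T'" "\<And>x. T' (T x) = x" "\<And>x. T (T' x) = x"
    "\<And>x. det (jac UNIV T x) = 1" "bounded {x. T x \<noteq> x}"
  using assms by (auto simp: area_move_def)

lemma area_move_id: "area_move (\<lambda>x. x) (\<lambda>x. x)"
  by (simp add: area_move_def smooth_on_id jac_id[OF exterior_UNIV])

lemma area_move_compose:
  assumes 1: "area_move T T'" and 2: "area_move U U'"
  shows "area_move (\<lambda>x. U (T x)) (\<lambda>x. T' (U' x))"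
proof -
  note d = area_moveD[OF 1] and e = area_moveD[OF 2]
  have "det (jac UNIV (\<lambda>x. U (T x)) x) = 1" for x
    using jac_compose[OF exterior_UNIV d(1) subset_UNIV e(1) UNIV_I] d(5) e(5) by (simp add: det_mul)
  moreover have "bounded {x. U (T x) \<noteq> x}"
    by (rule bounded_subset[OF bounded_Un[THEN iffD2, OF conjI[OF d(6) e(6)]]]) auto
  ultimately show ?thesis
    using d e by (auto simp: area_move_def intro: smooth_on_UNIV_compose)
qed

lemma area_move_sym:
  assumes 1: "area_move T T'" shows "area_move T' T"
proof -
  note d = area_moveD[OF 1]
  have "det (jac UNIV T' x) = 1" for x
  proof -
    have "(\<lambda>x. T (T' x)) = (\<lambda>x. x)" using d(4) by auto
    then have "jac UNIV T (T' x) ** jac UNIV T' x = mat 1"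
      using jac_compose[OF exterior_UNIV d(2) subset_UNIV d(1) UNIV_I, of x] jac_id[OF exterior_UNIV, of x] by simp
    then have "det (jac UNIV T (T' x)) * det (jac UNIV T' x) = 1" by (metis det_I det_mul)
    then show ?thesis using d(5) by simp
  qed
  moreover have "{x. T' x \<noteq> x} = {x. T x \<noteq> x}" using d(3,4) by (metis (no_types))
  ultimately show ?thesis using d by (simp add: area_move_def)
qed

text \<open>Being exchangeable by such a map is an equivalence relation on \<open>U\<close> with open classes,
  because nearby points are exchanged by the half turn about their midpoint. As \<open>U\<close> is connected
  there is only one class.\<close>

lemma move_point:
  assumes U: "open U" "connected U" and ab: "a \<in> U" "b \<in> U"
  obtains T T' where "area_move T T'" "T a = b" "\<And>x. x \<notin> U \<Longrightarrow> T x = x"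
proof -
  define R where "R a b \<longleftrightarrow> (\<exists>T T'. area_move T T' \<and> T a = b \<and> (\<forall>x. x \<notin> U \<longrightarrow> T x = x))" for a b
  have "R a b"
  proof (rule connected_equivalence_relation[OF U(2) ab])
    fix x y assume "R x y"
    then obtain T T' where T: "area_move T T'" "T x = y" "\<forall>x. x \<notin> U \<longrightarrow> T x = x" unfolding R_def by blast
    then have "T' y = x" "\<forall>x. x \<notin> U \<longrightarrow> T' x = x" using area_moveD(3)[OF T(1)] by metis+
    then show "R y x" unfolding R_def using area_move_sym[OF T(1)] by blast
  next
    fix x y z assume "R x y" "R y z"
    then obtain T T' V V' where T: "area_move T T'" "T x = y" "\<forall>x. x \<notin> U \<longrightarrow> T x = x"
      and V: "area_move V V'" "V y = z" "\<forall>x. x \<notin> U \<longrightarrow> V x = x" unfolding R_def by blast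
    then show "R x z" unfolding R_def using area_move_compose[OF T(1) V(1)]
      by (intro exI[of _ "\<lambda>x. V (T x)"] exI[of _ "\<lambda>x. T' (V' x)"]) auto
  next
    fix x assume x: "x \<in> U"
    obtain e where e: "e > 0" "ball x e \<subseteq> U" using U(1) x openE by blast
    have "R x y" if y: "y \<in> ball x (e/2)" for y
    proof (cases "y = x")
      case True then show ?thesis unfolding R_def using area_move_id by blast
    next
      case False
      define p where "p = (1/2) *\<^sub>R (x + y)"
      define r where "r = dist x y / 2"
      have r: "r > 0" using False by (simp add: r_def)
      have "x - p = (1/2) *\<^sub>R (x - y)" by (simp add: p_def algebra_simps flip: scaleR_add_left)
      then have px: "dist p x = r" by (simp add: dist_norm r_def norm_minus_commute[of p])
      obtain T T' where T: "area_move T T'" "\<And>x. dist p x \<le> r \<Longrightarrow> T x = 2 *\<^sub>R p - x" "\<And>x. dist p x \<ge> 2 * r \<Longrightarrow> T x = x"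
        using half_turn[OF r, of p] by blast
      have "T x = y" using T(2)[of x] px by (simp add: p_def)
      moreover have "T z = z" if "z \<notin> U" for z
      proof (rule T(3), rule ccontr)
        assume "\<not> dist p z \<ge> 2 * r"
        then have "dist x z < e" using e(1) px y dist_triangle[of x z p] by (simp add: r_def dist_commute)
        then show False using e(2) that by auto
      qed
      ultimately show ?thesis unfolding R_def using T(1) by blast
    qed
    moreover have "ball x (e/2) \<subseteq> U" using e by auto
    ultimately show "\<exists>T. openin (top_of_set U) T \<and> x \<in> T \<and> (\<forall>y\<in>T. R x y)"
      using e(1) U(1) by (intro exI[of _ "ball x (e/2)"]) (auto simp: openin_open_eq)
  qed
  then show thesis unfolding R_def using that by blast
qed

text \<open>The points are moved one after the other: the exterior of a disc stays connected when finitely many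
  points are removed, so the points that are already in place need not be disturbed.\<close>

lemma move_points:
  fixes x y :: "'i \<Rightarrow> plane"
  assumes "finite I" "inj_on x I" "inj_on y I" "\<And>i. i \<in> I \<Longrightarrow> x i \<notin> cball c r" "\<And>i. i \<in> I \<Longrightarrow> y i \<notin> cball c r"
  shows "\<exists>T T'. area_move T T' \<and> (\<forall>i\<in>I. T (y i) = x i) \<and> (\<forall>z\<in>cball c r. T z = z)"
  using assms
proof (induction I rule: finite_induct)
  case empty
  then show ?case using area_move_id by blast
next
  case (insert k I)
  then obtain T T' where T: "area_move T T'" "\<forall>i\<in>I. T (y i) = x i" "\<forall>z\<in>cball c r. T z = z"
    by (auto simp: inj_on_insert)
  define U where "U = - cball c r - x ` I"
  have inj: "T u = T v \<Longrightarrow> u = v" for u v using area_moveD(3)[OF T(1)] by metis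
  have "open (- cball c r)" "connected (- cball c r)"
    by (simp_all add: open_Compl connected_complement_bounded_convex)
  then have U: "open U" "connected U"
    unfolding U_def using insert.hyps(1)
    by (auto intro!: connected_open_delete_finite open_Diff finite_imp_closed)
  have "x k \<in> U" using insert.prems insert.hyps(2) by (auto simp: U_def inj_on_def)
  moreover have "T (y k) \<in> U"
  proof -
    have "T (y k) \<noteq> x i" if "i \<in> I" for i
    proof
      assume "T (y k) = x i"
      then have "y k = y i" using T(2) that inj by metis
      then show False using insert.prems(2) insert.hyps(2) that by (metis inj_on_def insertI1 insertI2)
    qed
    moreover have "T (y k) \<notin> cball c r"
    proof
      assume a: "T (y k) \<in> cball c r"
      then have "T (T (y k)) = T (y k)" using T(3) by blast
      then have "T (y k) = y k" by (rule inj)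
      then show False using a insert.prems(4) by auto
    qed
    ultimately show ?thesis by (auto simp: U_def)
  qed
  ultimately obtain V V' where V: "area_move V V'" "V (T (y k)) = x k" "\<And>x. x \<notin> U \<Longrightarrow> V x = x"
    using move_point[OF U] by metis
  have "V (T (y i)) = x i" if "i \<in> insert k I" for i
    using that V(2,3) T(2) by (auto simp: U_def)
  moreover have "V (T z) = z" if "z \<in> cball c r" for z
    using that V(3) T(3) by (auto simp: U_def)
  ultimately show ?case using area_move_compose[OF T(1) V(1)] by blast
qed

section \<open>Transitivity on body and vortex positions\<close>

context solid_fluid begin

text \<open>Composition on the left with an area-preserving map respects the determinant condition; the position
  of the body changes with its boundary circle.\<close>

lemma Q_move:
  assumes q: "(g, \<phi>) \<in> Q S" and T: "area_move T T'" and h: "h \<in> SE2"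
    and sph: "T ` sphere (act g (centre S)) (radius S) = sphere (act h (centre S)) (radius S)"
  shows "(h, restrict (\<lambda>x. T (\<phi> x)) (fluid S)) \<in> Q S"
proof -
  note n = near_id_Q_conf[OF q] and d = area_moveD[OF T]
  have sm: "smooth_on Y T" "smooth_on Y T'" for Y using d(1,2) smooth_on_subset by blast+
  have injT: "inj_on T Y" for Y using d(3) by (metis inj_on_inverseI)
  obtain B where B: "\<And>x. T x \<noteq> x \<Longrightarrow> norm x \<le> B" using d(6) unfolding bounded_iff by blast
  have cT: "continuous_on UNIV T" "continuous_on UNIV T'" by (rule smooth_on_continuous_on; fact d)+
  have dec: "decays (rate S) (\<lambda>x. T x - x)" if "exterior Y" for Y :: "plane set"
  proof (rule decays_bounded_support[OF that smooth_on_shift[OF sm(1)]])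
    show "bounded {x \<in> Y. T x - x \<noteq> 0}" by (rule bounded_subset[OF d(6)]) auto
  qed
  obtain B' where B': "\<And>x. norm (T x - x) \<le> B'"
    using near_id_bounded_shift[OF exterior_UNIV d(1) dec[OF exterior_UNIV]] rate_pos by auto
  have img: "T ` moved_fluid S g = moved_fluid S h"
    unfolding moved_fluid_def
    by (rule exterior_embedding_image[OF radius radius _ injT sph B']) (rule continuous_on_subset[OF cT(1) subset_UNIV])
  have "homeomorphism (moved_fluid S g) (moved_fluid S h) T T'"
    using img d(3,4) continuous_on_subset[OF cT(1) subset_UNIV] continuous_on_subset[OF cT(2) subset_UNIV]
    unfolding homeomorphism_def by (metis (no_types, lifting) image_image image_cong image_ident)
  then have m: "near_id (rate S) (moved_fluid S g) (moved_fluid S h) T T'"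
    by (rule near_idI[OF rate_pos fluid_exterior(2) fluid_exterior(2) _ _ sm(1) _ dec[OF exterior_UNIV]])
       (use sph d(5) in \<open>auto simp: frontier_fluid[OF radius] jac_restrict[OF fluid_exterior(2) d(1)]\<close>)
  note c = near_id_compose[OF n m]
  have r: "near_id (rate S) (fluid S) (moved_fluid S h) (restrict (\<lambda>x. T (\<phi> x)) (fluid S)) (\<lambda>z. inv_into (fluid S) \<phi> (T' z))"
    by (rule near_id_cong[OF c]) auto
  show ?thesis
  proof (rule near_id_Q[OF radius density_pos h r])
    fix x assume x: "x \<in> fluid S"
    then have y: "\<phi> x \<in> moved_fluid S g" using near_idD(10)[OF n] by blast
    have "jac (fluid S) (restrict (\<lambda>x. T (\<phi> x)) (fluid S)) x = jac (fluid S) (\<lambda>x. T (\<phi> x)) x"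
      by (rule jac_cong[OF fluid_exterior(1) near_idD(5)[OF c] x]) simp
    also have "\<dots> = jac (moved_fluid S g) T (\<phi> x) ** jac (fluid S) \<phi> x"
      by (rule jac_compose[OF fluid_exterior(1) near_idD(5)[OF n] _ sm(1) x]) (use near_idD(10)[OF n] in simp)
    finally show "det (jac (fluid S) (restrict (\<lambda>x. T (\<phi> x)) (fluid S)) x) = density S x"
      using d(5) Q_det[OF q x] by (simp add: det_mul jac_restrict[OF fluid_exterior(2) d(1) y])
  qed simp
qed

lemma interior_fluid_point:
  assumes q: "(g, \<phi>) \<in> Q S" and z: "z \<in> interior (fluid S)"
  shows "\<phi> z \<notin> act g ` body S"
  using near_idD(14)[OF near_id_Q_conf[OF q]] z
  by (auto simp: body_def act_ball_image(2)[OF Q_SE2[OF q]] frontier_fluid[OF radius])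

lemma Q_inj: "(g, \<phi>) \<in> Q S \<Longrightarrow> x \<in> fluid S \<Longrightarrow> y \<in> fluid S \<Longrightarrow> \<phi> x = \<phi> y \<Longrightarrow> x = y"
  using near_idD(12)[OF near_id_Q_conf] by metis

text \<open>The boundary condition on \<open>\<phi>\<close> involves the circle only as a set, so any
  \<open>g\<close> is admissible once the body is at its place. A half turn about the midpoint between the
  present and the desired centre brings the body there, and then the vortices are moved outside it.\<close>

lemma proj_Q:
  fixes xbar :: "plane^'n::finite"
  assumes ne: "Q S \<noteq> {}" and xb: "\<forall>i. xbar $ i \<in> interior (fluid S)" "\<forall>i j. i \<noteq> j \<longrightarrow> xbar $ i \<noteq> xbar $ j"
  shows "(g, x) \<in> proj xbar ` Q S \<longleftrightarrow>
    g \<in> SE2 \<and> (\<forall>i. x $ i \<notin> act g ` body S) \<and> (\<forall>i j. i \<noteq> j \<longrightarrow> x $ i \<noteq> x $ j)"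
proof
  have xf: "xbar $ i \<in> fluid S" for i using xb(1) interior_subset by blast
  {
    assume "(g, x) \<in> proj xbar ` Q S"
    then obtain \<phi> where q: "(g, \<phi>) \<in> Q S" "x = (\<chi> i. \<phi> (xbar $ i))" by (auto simp: proj_def)
    then show "g \<in> SE2 \<and> (\<forall>i. x $ i \<notin> act g ` body S) \<and> (\<forall>i j. i \<noteq> j \<longrightarrow> x $ i \<noteq> x $ j)"
      using Q_SE2[OF q(1)] interior_fluid_point[OF q(1)] xb(1) Q_inj[OF q(1) xf xf] xb(2) unfolding q(2) vec_lambda_beta
      by blast
  next
    assume a: "g \<in> SE2 \<and> (\<forall>i. x $ i \<notin> act g ` body S) \<and> (\<forall>i j. i \<noteq> j \<longrightarrow> x $ i \<noteq> x $ j)"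
    then have g: "g \<in> SE2" by simp
    obtain g0 \<phi>0 where q0: "(g0, \<phi>0) \<in> Q S" using ne by auto
    let ?d = "act g0 (centre S)" and ?c = "act g (centre S)" and ?R = "radius S"
    define p where "p = (1/2) *\<^sub>R (?d + ?c)"
    \<comment> \<open>large enough for the disc about \<open>p\<close> to contain the present position of the body\<close>
    define r where "r = dist ?d p + ?R"
    have "r > 0" using radius by (simp add: r_def add_nonneg_pos)
    then obtain T T' where T: "area_move T T'" "\<And>x. dist p x \<le> r \<Longrightarrow> T x = 2 *\<^sub>R p - x"
      using half_turn by metis
    have "T ` sphere ?d ?R = (\<lambda>x. 2 *\<^sub>R p - x) ` sphere ?d ?R"
    proof (rule image_cong[OF refl])
      fix x assume "x \<in> sphere ?d ?R"
      then have "dist p x \<le> r" using dist_triangle[of p x ?d] by (simp add: r_def dist_commute)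
      then show "T x = 2 *\<^sub>R p - x" by (rule T(2))
    qed
    also have "\<dots> = sphere ?c ?R"
    proof -
      have iff: "2 *\<^sub>R p - x \<in> sphere ?c ?R \<longleftrightarrow> x \<in> sphere ?d ?R" for x
        by (simp add: p_def dist_norm scaleR_2 norm_minus_commute)
      show ?thesis
      proof (intro subset_antisym subsetI)
        fix y assume "y \<in> sphere ?c ?R"
        then have "2 *\<^sub>R p - y \<in> sphere ?d ?R" using iff[of "2 *\<^sub>R p - y"] by simp
        then have "2 *\<^sub>R p - (2 *\<^sub>R p - y) \<in> (\<lambda>x. 2 *\<^sub>R p - x) ` sphere ?d ?R" by (rule imageI)
        then show "y \<in> (\<lambda>x. 2 *\<^sub>R p - x) ` sphere ?d ?R" by simp
      qed (use iff in blast)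
    qed
    finally have q1: "(g, restrict (\<lambda>x. T (\<phi>0 x)) (fluid S)) \<in> Q S" (is "(g, ?\<phi>1) \<in> _")
      by (rule Q_move[OF q0 T(1) g])
    define y where "y i = ?\<phi>1 (xbar $ i)" for i
    have body: "act g ` body S = cball ?c ?R" by (simp add: body_def act_ball_image(2)[OF g])
    have "inj y"
    proof (rule injI)
      show "i = j" if "y i = y j" for i j
        using Q_inj[OF q1 xf xf that[unfolded y_def]] xb(2) by blast
    qed
    moreover have "inj (\<lambda>i. x $ i)" using a by (auto simp: inj_on_def)
    moreover have "y i \<notin> cball ?c ?R" for i
      unfolding y_def body[symmetric] by (rule interior_fluid_point[OF q1]) (use xb in blast)
    moreover have "x $ i \<notin> cball ?c ?R" for i using a unfolding body by blast
    ultimately obtain V V' where V: "area_move V V'" "\<And>i. V (y i) = x $ i" "\<And>z. z \<in> cball ?c ?R \<Longrightarrow> V z = z"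
      using move_points[of UNIV "\<lambda>i. x $ i" y ?c ?R] by auto
    have "V ` sphere ?c ?R = sphere ?c ?R"
    proof -
      have "V ` sphere ?c ?R = (\<lambda>z. z) ` sphere ?c ?R" by (rule image_cong[OF refl]) (use V(3) in auto)
      then show ?thesis by simp
    qed
    then have q2: "(g, restrict (\<lambda>x. V (?\<phi>1 x)) (fluid S)) \<in> Q S" by (rule Q_move[OF q1 V(1) g])
    have "proj xbar (g, restrict (\<lambda>x. V (?\<phi>1 x)) (fluid S)) = (g, x)"
      using V(2) xf unfolding proj_def y_def by (simp add: vec_eq_iff)
    then show "(g, x) \<in> proj xbar ` Q S" using q2 by (metis imageI)
  }
qed

end

section \<open>Fields with a stream function\<close>

text \<open>The field with stream function \<open>\<psi>\<close>.\<close>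

definition curl :: "(plane \<Rightarrow> real) \<Rightarrow> plane \<Rightarrow> plane" where
  "curl \<psi> x = vector [dir_deriv (axis 2 1) \<psi> x, - dir_deriv (axis 1 1) \<psi> x]"

lemma curl_nth [simp]: "curl \<psi> x $ 1 = dir_deriv (axis 2 1) \<psi> x" "curl \<psi> x $ 2 = - dir_deriv (axis 1 1) \<psi> x"
  by (simp_all add: curl_def)

lemma curl_cong_open: "open U \<Longrightarrow> x \<in> U \<Longrightarrow> (\<And>y. y \<in> U \<Longrightarrow> f y = g y) \<Longrightarrow> curl f x = curl g x"
  unfolding curl_def using dir_deriv_cong_open[of U x f g] by simp

lemma curl_const [simp]: "curl (\<lambda>x. c) x = 0"
  by (rule vec2_eqI) simp_all

lemma curl_eq:
  assumes "(\<psi> has_derivative D) (at x)" shows "curl \<psi> x = vector [D (axis 2 1), - D (axis 1 1)]"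
  unfolding curl_def dir_deriv_eq[OF assms] ..

lemma smooth_UNIV_derivative:
  "smooth_on UNIV \<psi> \<Longrightarrow> (\<psi> has_derivative (\<lambda>v. dir_deriv v \<psi> x)) (at x)"
  using differentiable_on_open_has_dir_deriv[OF Cinf_differentiable_on] by (metis UNIV_I open_UNIV smooth_on_open)

lemma curl_add:
  assumes "smooth_on UNIV f" "smooth_on UNIV g"
  shows "curl (\<lambda>x. f x + g x) x = curl f x + curl g x"
  unfolding curl_eq[OF has_derivative_add[OF smooth_UNIV_derivative smooth_UNIV_derivative], OF assms]
  by (rule vec2_eqI) simp_all

lemma curl_scale:
  assumes "smooth_on UNIV f" shows "curl (\<lambda>x. c * f x) x = c *\<^sub>R curl f x"
  unfolding curl_eq[OF has_derivative_mult_right[OF smooth_UNIV_derivative], OF assms]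
  by (rule vec2_eqI) simp_all

definition as_vec2 :: "real \<Rightarrow> real \<Rightarrow> plane" where "as_vec2 a b = a *\<^sub>R axis 1 1 + b *\<^sub>R axis 2 1"

lemma Cinf_curl:
  assumes "adm U w" "Cinf U w \<psi>" shows "Cinf U w (curl \<psi>)"
proof -
  have "Cinf U w (\<lambda>x. dir_deriv (axis 2 1) \<psi> x *\<^sub>R axis 1 1 + (- dir_deriv (axis 1 1) \<psi> x) *\<^sub>R (axis 2 1 :: plane))"
    by (intro Cinf_add[OF assms(1)] Cinf_linear[OF assms(1) bounded_linear_scaleR_left]
        Cinf_linear[OF assms(1) bounded_linear_minus[OF bounded_linear_ident]] Cinf_dir_deriv assms(2))
  moreover have "(\<lambda>x. dir_deriv (axis 2 1) \<psi> x *\<^sub>R axis 1 1 + (- dir_deriv (axis 1 1) \<psi> x) *\<^sub>R (axis 2 1 :: plane)) = curl \<psi>"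
    by (rule ext, rule vec2_eqI) (simp_all add: axis_def)
  ultimately show ?thesis by simp
qed

lemma smooth_on_curl: "smooth_on UNIV \<psi> \<Longrightarrow> smooth_on UNIV (curl \<psi>)"
  using Cinf_curl[of UNIV None \<psi>] by (simp add: smooth_on_open)

lemma divergence_curl:
  assumes "exterior X" "smooth_on UNIV \<psi>" "x \<in> X" shows "divergence X (curl \<psi>) x = 0"
proof -
  have C: "Cinf UNIV None \<psi>" "Cinf UNIV None (curl \<psi>)" using assms(2) smooth_on_curl by (simp_all add: smooth_on_open)
  have dc: "curl \<psi> differentiable (at x)" using Cinf_differentiable_on[OF C(2)] by (simp add: differentiable_on_def)
  have dd: "dir_deriv v \<psi> differentiable (at x)" for v
    using Cinf_differentiable_on[OF Cinf_dir_deriv[OF C(1)]] by (simp add: differentiable_on_def)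
  have "jac X (curl \<psi>) x = matrix (\<lambda>v. dir_deriv v (curl \<psi>) x)"
    by (rule jac_extension[OF assms(1) open_UNIV UNIV_I C(2) _ assms(3)]) simp
  then have "divergence X (curl \<psi>) x = dir_deriv (axis 1 1) (curl \<psi>) x $ 1 + dir_deriv (axis 2 1) (curl \<psi>) x $ 2"
    by (simp add: divergence_def trace2 matrix_def)
  also have "\<dots> = dir_deriv (axis 1 1) (dir_deriv (axis 2 1) \<psi>) x + dir_deriv (axis 2 1) (\<lambda>x. - dir_deriv (axis 1 1) \<psi> x) x"
    unfolding dir_deriv_nth[OF dc, symmetric] curl_nth by (simp add: eta_contract_eq)
  also have "dir_deriv (axis 2 1) (\<lambda>x. - dir_deriv (axis 1 1) \<psi> x) x = - dir_deriv (axis 2 1) (dir_deriv (axis 1 1) \<psi>) x"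
    by (rule dir_deriv_linear[OF bounded_linear_minus[OF bounded_linear_ident] dd])
  finally show ?thesis using dir_deriv_commute[OF open_UNIV C(1) UNIV_I] by simp
qed

lemma bounded_curl_support:
  assumes "bounded {x. \<psi> x \<noteq> 0}" shows "bounded {x. curl \<psi> x \<noteq> 0}"
proof (rule bounded_subset[OF bounded_closure[OF assms]], rule subsetI, rule ccontr)
  fix x assume x: "x \<in> {x. curl \<psi> x \<noteq> 0}" and "x \<notin> closure {x. \<psi> x \<noteq> 0}"
  then have "curl \<psi> x = curl (\<lambda>x. 0) x"
    by (intro curl_cong_open[of "- closure {x. \<psi> x \<noteq> 0}"]) (use closure_subset in \<open>force simp: open_Compl\<close>)+
  then show False using x by simp
qed

lemma smooth_on_nth: "smooth_on X (\<lambda>x::plane. x $ i)"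
  by (rule smooth_on_linear[OF bounded_linear_vec_nth smooth_on_id])

lemma smooth_on_sum: "(\<And>i. i \<in> I \<Longrightarrow> smooth_on X (f i)) \<Longrightarrow> smooth_on X (\<lambda>x. \<Sum>i\<in>I. f i x)"
  by (induction I rule: infinite_finite_induct) (auto intro: smooth_on_add smooth_on_const)

lemma bounded_cutoff_support: "r > 0 \<Longrightarrow> bounded {x. cutoff p r x \<noteq> 0}"
  by (rule bounded_subset[OF bounded_ball[of p "2 * r"]]) (use cutoff_0 in force)

section \<open>A principal connection\<close>

text \<open>An infinitesimal rigid motion is a rotation about \<open>snd g\<close> with the skew matrix
  \<open>g' g\<^sup>-\<^sup>1\<close> plus a translation; both have quadratic or linear stream
  functions.\<close>

definition rigid_stream :: "rigid \<Rightarrow> rigid \<Rightarrow> plane \<Rightarrow> real" where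
  "rigid_stream g g' y = (fst g' ** transpose (fst g)) $ 1 $ 2 * (((y - snd g) \<bullet> (y - snd g)) * (1/2))
     + (snd g' $ 1 * y $ 2 + (- snd g' $ 2) * y $ 1)"

lemma smooth_on_rigid_stream: "smooth_on UNIV (rigid_stream g g')"
  unfolding rigid_stream_def[abs_def]
  by (intro smooth_on_add smooth_on_mult smooth_on_const smooth_on_sq_dist smooth_on_nth)

lemma curl_rigid_stream:
  assumes g: "g \<in> SE2" and g': "g' \<in> T_SE2 g"
  shows "curl (rigid_stream g g') y = rigid_velocity g g' y"
proof -
  let ?A = "fst g" and ?A' = "fst g'"
  define M where "M = ?A' ** transpose ?A"
  have "?A ** (transpose ?A ** ?A' + transpose ?A' ** ?A) ** transpose ?A = 0"
    using g' unfolding T_SE2_iff by (simp add: vec_eq_iff forall_2)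
  moreover have "?A ** (transpose ?A ** ?A' + transpose ?A' ** ?A) ** transpose ?A =
      (?A ** transpose ?A) ** (?A' ** transpose ?A) + (?A ** transpose ?A') ** (?A ** transpose ?A)"
    by (rule mat2_eqI) (simp_all add: algebra_simps)
  ultimately have "M + transpose M = 0"
    unfolding M_def matrix_transpose_mul transpose_transpose SE2_orthogonal[OF g] by simp
  then have M: "M $ 1 $ 1 = 0" "M $ 2 $ 2 = 0" "M $ 2 $ 1 = - M $ 1 $ 2"
    by (auto simp: vec_eq_iff forall_2 transpose_def)
  have "(rigid_stream g g' has_derivative (\<lambda>h. M $ 1 $ 2 * (((y - snd g) \<bullet> h + h \<bullet> (y - snd g)) * (1/2))
     + (snd g' $ 1 * h $ 2 + (- snd g' $ 2) * h $ 1))) (at y)"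
  proof -
    have sq: "((\<lambda>y. (y - snd g) \<bullet> (y - snd g)) has_derivative (\<lambda>h. (y - snd g) \<bullet> h + h \<bullet> (y - snd g))) (at y)"
      by (auto intro!: derivative_eq_intros)
    have lin: "((\<lambda>y::plane. y $ i) has_derivative (\<lambda>h. h $ i)) (at y)" for i
      by (rule bounded_linear_imp_has_derivative[OF bounded_linear_vec_nth])
    show ?thesis
      unfolding rigid_stream_def[abs_def] M_def
      by (rule has_derivative_add[OF has_derivative_mult_right[OF has_derivative_mult_left[OF sq]]
          has_derivative_add[OF has_derivative_mult_right[OF lin] has_derivative_mult_right[OF lin]]])
  qed
  note c = curl_eq[OF this]
  have "rigid_velocity g g' y = M *v (y - snd g) + snd g'"
    unfolding rigid_velocity_def M_def by (simp only: matrix_vector_mul_assoc)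
  also have "\<dots> = curl (rigid_stream g g') y"
    unfolding c by (rule vec2_eqI) (simp_all add: M inner2 axis_def algebra_simps)
  finally show ?thesis ..
qed

context solid_fluid begin

text \<open>The cut-off equals \<open>1\<close> up to twice the radius of the body, so that the field is rigid
  in a neighbourhood of the body.\<close>

definition lift_stream :: "rigid \<Rightarrow> rigid \<Rightarrow> plane \<Rightarrow> real" where
  "lift_stream g g' y = cutoff (act g (centre S)) (2 * radius S) y * rigid_stream g g' y"

definition lift_field :: "rigid \<Rightarrow> rigid \<Rightarrow> plane \<Rightarrow> plane" where
  "lift_field g g' = curl (lift_stream g g')"

text \<open>The horizontal lift of \<open>g'\<close>. Its Eulerian velocity depends on \<open>g\<close> and not
  on \<open>\<phi>\<close>, hence is invariant under relabelling.\<close>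

definition lift_vel :: "conf \<Rightarrow> rigid \<Rightarrow> conf_vel" where
  "lift_vel q g' = (g', \<lambda>x. if x \<in> fluid S then lift_field (fst q) g' (snd q x) else 0)"

lemma smooth_on_lift_stream: "smooth_on UNIV (lift_stream g g')"
  unfolding lift_stream_def[abs_def] by (intro smooth_on_mult smooth_on_cutoff smooth_on_rigid_stream)

lemma lift_field_linear:
  "lift_field g (u + v) y = lift_field g u y + lift_field g v y"
  "lift_field g (c *\<^sub>R v) y = c *\<^sub>R lift_field g v y"
  "lift_field g 0 y = 0"
proof -
  have "lift_stream g (u + v) = (\<lambda>y. lift_stream g u y + lift_stream g v y)"
    by (auto simp: lift_stream_def rigid_stream_def fun_eq_iff algebra_simps)
  then show "lift_field g (u + v) y = lift_field g u y + lift_field g v y"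
    unfolding lift_field_def by (simp add: curl_add smooth_on_lift_stream)
  have s: "lift_stream g (c *\<^sub>R v) = (\<lambda>y. c * lift_stream g v y)" for c
    by (auto simp: lift_stream_def rigid_stream_def fun_eq_iff algebra_simps)
  then show *: "lift_field g (c *\<^sub>R v) y = c *\<^sub>R lift_field g v y" for c
    unfolding lift_field_def by (simp add: curl_scale smooth_on_lift_stream)
  show "lift_field g 0 y = 0" using *[of 0] by simp
qed

lemma lift_field_near_body:
  assumes "g \<in> SE2" "g' \<in> T_SE2 g" "dist (act g (centre S)) y < 2 * radius S"
  shows "lift_field g g' y = rigid_velocity g g' y"
proof -
  have "lift_field g g' y = curl (rigid_stream g g') y"
    unfolding lift_field_def
    by (rule curl_cong_open[of "ball (act g (centre S)) (2 * radius S)"])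
       (use assms radius in \<open>auto simp: lift_stream_def cutoff_1\<close>)
  then show ?thesis using curl_rigid_stream[OF assms(1,2)] by simp
qed

text \<open>The fluid velocity is a field with a stream function of bounded support that agrees with the
  velocity of the body on its boundary.\<close>

lemma lift_vel_TQ:
  assumes q: "(g, \<phi>) \<in> Q S" and g': "g' \<in> T_SE2 g"
  shows "lift_vel (g, \<phi>) g' \<in> TQ S (g, \<phi>)"
proof -
  note n = near_id_Q_conf[OF q] note d = near_idD[OF n]
  let ?V = "lift_field g g'"
  define w where "w x = (if x \<in> fluid S then ?V (\<phi> x) else 0)" for x
  have V: "smooth_on Y ?V" for Y
    unfolding lift_field_def using smooth_on_curl[OF smooth_on_lift_stream] smooth_on_subset by blast
  have "{x. lift_stream g g' x \<noteq> 0} \<subseteq> ball (act g (centre S)) (2 * (2 * radius S))"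
    using radius cutoff_0[of "2 * radius S" "act g (centre S)"] by (force simp: lift_stream_def)
  then have "bounded {x. lift_stream g g' x \<noteq> 0}" using bounded_ball bounded_subset by blast
  then have "bounded {x. ?V x \<noteq> 0}" unfolding lift_field_def by (rule bounded_curl_support)
  then have "bounded {x \<in> moved_fluid S g. ?V x \<noteq> 0}" by (rule bounded_subset) auto
  then have dV: "decays (rate S) ?V" by (rule decays_bounded_support[OF fluid_exterior(2) V])
  have s: "smooth_on (fluid S) (\<lambda>x. ?V (\<phi> x))" by (rule smooth_on_UNIV_compose[OF V d(5)])
  have sw: "smooth_on (fluid S) w" by (rule smooth_on_cong[OF _ s]) (simp add: w_def)
  have dw: "decays (rate S) w"
    by (rule decays_cong[OF fluid_exterior(1) s decays_compose_near_id[OF n V dV]]) (simp add: w_def)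
  have "divergence (fluid S) (\<lambda>x. cof (jac (fluid S) \<phi> x) *v w x) x = 0" if x: "x \<in> fluid S" for x
  proof -
    have y: "\<phi> x \<in> moved_fluid S g" using d(10) x by blast
    have "divergence (fluid S) (\<lambda>x. cof (jac (fluid S) \<phi> x) *v w x) x =
      divergence (fluid S) (\<lambda>x. cof (jac (fluid S) \<phi> x) *v ?V (\<phi> x)) x"
      by (rule divergence_cong[OF fluid_exterior(1) smooth_on_cof_mv[OF fluid_exterior(1) d(5) s] x]) (simp add: w_def)
    also have "\<dots> = det (jac (fluid S) \<phi> x) * divergence (moved_fluid S g) ?V (\<phi> x)"
      by (rule piola[OF fluid_exterior(1) d(5) _ V x]) (use d(10) in simp)
    also have "\<dots> = 0"
      using divergence_curl[OF fluid_exterior(2) smooth_on_lift_stream y] by (simp add: lift_field_def)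
    finally show ?thesis .
  qed
  moreover have "w x - rigid_velocity g g' (\<phi> x) = 0" if x: "x \<in> sphere (centre S) (radius S)" for x
  proof -
    have "dist (act g (centre S)) (\<phi> x) = radius S" using d(9) x by (auto simp: frontier_fluid[OF radius])
    then show ?thesis using lift_field_near_body[OF Q_SE2[OF q] g'] radius sphere_fluid[OF x] by (simp add: w_def)
  qed
  ultimately have "(g', w) \<in> TQ S (g, \<phi>)"
    unfolding TQ_iff[OF q] using g' sw dw by (auto simp: w_def)
  then show ?thesis unfolding lift_vel_def fst_conv snd_conv w_def[abs_def] .
qed

definition vertical :: "conf \<Rightarrow> conf_vel \<Rightarrow> conf_vel" where
  "vertical q v = vel_add v (vel_scale (- 1) (lift_vel q (fst v)))"

text \<open>The connection whose horizontal vectors are the lifts.\<close>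

definition cutoff_connection :: "conf \<Rightarrow> conf_vel \<Rightarrow> plane \<Rightarrow> plane" where
  "cutoff_connection q v = pull q (snd (vertical q v))"

lemma TQ_T_SE2: "(g, \<phi>) \<in> Q S \<Longrightarrow> v \<in> TQ S (g, \<phi>) \<Longrightarrow> fst v \<in> T_SE2 g"
  by (cases v) (simp add: TQ_iff)

lemma vertical_TQ:
  assumes q: "(g, \<phi>) \<in> Q S" and v: "v \<in> TQ S (g, \<phi>)"
  shows "vertical (g, \<phi>) v \<in> TQ S (g, \<phi>)" "fst (vertical (g, \<phi>) v) = 0"
proof -
  show "vertical (g, \<phi>) v \<in> TQ S (g, \<phi>)"
    unfolding vertical_def by (intro TQ_vel_add[OF q] v TQ_vel_scale[OF q] lift_vel_TQ[OF q] TQ_T_SE2[OF q v])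
  show "fst (vertical (g, \<phi>) v) = 0" by (simp add: vertical_def vel_add_def vel_scale_def lift_vel_def)
qed

lemma vertical_nth:
  "x \<in> fluid S \<Longrightarrow> snd (vertical q v) x = snd v x - lift_field (fst q) (fst v) (snd q x)"
  by (simp add: vertical_def vel_add_def vel_scale_def lift_vel_def)

text \<open>A generator has no rigid part, so nothing is subtracted from it and \<open>pull\<close> recovers its
  field. Equivariance is the chain rule, as the subtracted Eulerian field is invariant.\<close>

lemma principal_connection_cutoff: "principal_connection S cutoff_connection"
  unfolding principal_connection_def
proof (intro ballI)
  fix q assume "q \<in> Q S"
  then obtain g \<phi> where q: "q = (g, \<phi>)" "(g, \<phi>) \<in> Q S" by (metis surj_pair)
  note n = near_id_Q_conf[OF q(2)]
  have "cutoff_connection q v \<in> X_vol S" if "v \<in> TQ S q" for v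
    using vertical_TQ[OF q(2)] that pull_X_vol[OF q(2)] unfolding q(1) cutoff_connection_def by (metis prod.collapse)
  moreover have "cutoff_connection q (vel_add v v') = (\<lambda>x. cutoff_connection q v x + cutoff_connection q v' x)" for v v'
    by (rule ext) (simp add: cutoff_connection_def pull_def vertical_nth vel_add_def lift_field_linear matrix_vector_right_distrib
        matrix_vector_mult_diff_distrib)
  moreover have "cutoff_connection q (vel_scale c v) = (\<lambda>x. c *\<^sub>R cutoff_connection q v x)" for c v
    by (rule ext) (simp add: cutoff_connection_def pull_def vertical_nth vel_scale_def lift_field_linear
        matrix_vector_mult_scaleR matrix_vector_mult_diff_distrib scaleR_diff_right)
  moreover have "cutoff_connection q (generator S \<xi> q) = \<xi>" if \<xi>: "\<xi> \<in> X_vol S" for \<xi>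
  proof -
    have "cutoff_connection q (generator S \<xi> q) x = pull q (\<lambda>x. jac (fluid S) \<phi> x *v \<xi> x) x" for x
      by (simp add: cutoff_connection_def pull_def vertical_nth generator_def lift_field_linear q(1))
    then show ?thesis using pull_jac[OF q(2) \<xi>] q(1) by (metis ext)
  qed
  moreover have "cutoff_connection (conf_act S f q) (vel_act S f v) = pull_field S f (cutoff_connection q v)"
    if f: "f \<in> Diff_vol S" for f v
  proof (rule ext)
    fix x
    show "cutoff_connection (conf_act S f q) (vel_act S f v) x = pull_field S f (cutoff_connection q v) x"
    proof (cases "x \<in> fluid S")
      case True
      then have fx: "f x \<in> fluid S" using near_idD(10)[OF near_id_Diff[OF f]] by blast
      have "cutoff_connection (conf_act S f q) (vel_act S f v) x =
        matrix_inv (jac (fluid S) \<phi> (f x) ** jac (fluid S) f x) *v (snd v (f x) - lift_field g (fst v) (\<phi> (f x)))"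
        using True conf_act_near_id(2)[OF q(2) f True]
        by (simp add: cutoff_connection_def pull_def vertical_nth conf_act_def vel_act_def q(1) compose_eq)
      also have "\<dots> = matrix_inv (jac (fluid S) f x) *v (matrix_inv (jac (fluid S) \<phi> (f x)) *v (snd v (f x) - lift_field g (fst v) (\<phi> (f x))))"
        by (rule matrix_inv_prod[OF near_id_det(2)[OF n fx] near_id_det(2)[OF near_id_Diff[OF f] True]])
      also have "\<dots> = pull_field S f (cutoff_connection q v) x"
        using True fx by (simp add: pull_field_def cutoff_connection_def pull_def vertical_nth q(1))
      finally show ?thesis .
    qed (simp add: cutoff_connection_def pull_def pull_field_def)
  qed
  ultimately show "(\<forall>v\<in>TQ S q. cutoff_connection q v \<in> X_vol S) \<and>
     (\<forall>v\<in>TQ S q. \<forall>v'\<in>TQ S q. cutoff_connection q (vel_add v v') = (\<lambda>x. cutoff_connection q v x + cutoff_connection q v' x)) \<and>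
     (\<forall>c. \<forall>v\<in>TQ S q. cutoff_connection q (vel_scale c v) = (\<lambda>x. c *\<^sub>R cutoff_connection q v x)) \<and>
     (\<forall>\<xi>\<in>X_vol S. cutoff_connection q (generator S \<xi> q) = \<xi>) \<and>
     (\<forall>f\<in>Diff_vol S. \<forall>v\<in>TQ S q. cutoff_connection (conf_act S f q) (vel_act S f v) = pull_field S f (cutoff_connection q v))"
    by blast
qed

section \<open>Relabelling velocities with compact support\<close>

definition density_curl :: "(plane \<Rightarrow> real) \<Rightarrow> plane \<Rightarrow> plane" where
  "density_curl \<psi> x = (if x \<in> fluid S then inverse (density S x) *\<^sub>R curl \<psi> x else 0)"

text \<open>The factor \<open>inverse (density S x)\<close> makes the field divergence free with respect to the
  area element \<open>\<eta>\<^sub>0\<close>.\<close>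

lemma density_curl_X_vol:
  assumes \<psi>: "smooth_on UNIV \<psi>" "bounded {x. \<psi> x \<noteq> 0}"
    and 0: "\<And>x. x \<in> body S \<Longrightarrow> \<exists>U. open U \<and> x \<in> U \<and> (\<forall>y\<in>U. \<psi> y = 0)"
  shows "density_curl \<psi> \<in> X_vol S"
proof -
  have c: "smooth_on Y (curl \<psi>)" for Y using smooth_on_curl[OF \<psi>(1)] smooth_on_subset by blast
  have "smooth_on (fluid S) (\<lambda>x. inverse (density S x) *\<^sub>R curl \<psi> x)"
    using density_pos by (intro smooth_on_scaleR smooth_on_inverse density_smooth c) force
  then have s: "smooth_on (fluid S) (density_curl \<psi>)"
    by (rule smooth_on_cong[rotated]) (simp add: density_curl_def)
  moreover have "decays (rate S) (density_curl \<psi>)"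
  proof (rule decays_bounded_support[OF fluid_exterior(1) s])
    show "bounded {x \<in> fluid S. density_curl \<psi> x \<noteq> 0}"
      by (rule bounded_subset[OF bounded_curl_support[OF \<psi>(2)]]) (auto simp: density_curl_def)
  qed
  moreover have "divergence (fluid S) (\<lambda>x. density S x *\<^sub>R density_curl \<psi> x) y = 0" if y: "y \<in> fluid S" for y
  proof -
    have "divergence (fluid S) (\<lambda>x. density S x *\<^sub>R density_curl \<psi> x) y = divergence (fluid S) (curl \<psi>) y"
      by (rule divergence_cong[OF fluid_exterior(1) c y]) (use density_pos in \<open>auto simp: density_curl_def\<close>)
    then show ?thesis using divergence_curl[OF fluid_exterior(1) \<psi>(1) y] by simp
  qed
  moreover have "density_curl \<psi> y = 0" if y: "y \<in> sphere (centre S) (radius S)" for y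
  proof -
    have "y \<in> body S" using y by (simp add: body_def)
    then obtain U where "open U" "y \<in> U" "\<forall>y\<in>U. \<psi> y = 0" using 0 by blast
    then have "curl \<psi> y = curl (\<lambda>x. 0) y" by (intro curl_cong_open) auto
    then show ?thesis by (simp add: density_curl_def)
  qed
  ultimately show ?thesis unfolding X_vol_iff by (auto simp: density_curl_def)
qed

lemma cutoff_zero_near_body:
  assumes "r > 0" "ball p (3 * r) \<subseteq> interior (fluid S)" "x \<in> body S"
  shows "\<exists>U. open U \<and> x \<in> U \<and> (\<forall>y\<in>U. cutoff p r y = 0)"
proof (intro exI[of _ "- cball p (2 * r)"] conjI ballI)
  have "x \<notin> interior (fluid S)" using assms(3) frontier_fluid[OF radius] by (auto simp: body_def)
  moreover have "cball p (2 * r) \<subseteq> ball p (3 * r)" using assms(1) by auto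
  ultimately show "x \<in> - cball p (2 * r)" using assms(2) by blast
qed (auto simp: open_Compl intro!: cutoff_0[OF assms(1)])

text \<open>A constant field has a linear stream function. Cutting these off near each of the points and adding
  them up gives a stream function with the prescribed curl.\<close>

lemma X_vol_prescribed_values:
  fixes xbar u :: "plane^'n::finite"
  assumes xb: "\<forall>i. xbar $ i \<in> interior (fluid S)" "\<forall>i j. i \<noteq> j \<longrightarrow> xbar $ i \<noteq> xbar $ j"
  obtains \<xi> where "\<xi> \<in> X_vol S" "\<And>i. \<xi> (xbar $ i) = u $ i"
proof -
  \<comment> \<open>\<open>r\<close> will be so small that the discs of radius \<open>2r\<close> lie in the fluid and contain no other point\<close>
  define F where "F = (\<lambda>i. {e. e > 0 \<and> ball (xbar $ i) e \<subseteq> interior (fluid S) \<and> (\<forall>j. j \<noteq> i \<longrightarrow> e \<le> dist (xbar $ i) (xbar $ j))})"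
  have "\<exists>e. e \<in> F i" for i
  proof -
    obtain e where e: "e > 0" "ball (xbar $ i) e \<subseteq> interior (fluid S)" using xb(1) open_interior openE by metis
    have "finite (range (\<lambda>j. xbar $ j) - {xbar $ i})" by simp
    from finite_set_avoid[OF this, of "xbar $ i"] obtain d where d: "d > 0"
      "\<forall>z\<in>range (\<lambda>j. xbar $ j) - {xbar $ i}. z \<noteq> xbar $ i \<longrightarrow> d \<le> dist (xbar $ i) z" by blast
    have "min e d \<in> F i"
      unfolding F_def using e d xb(2) by (auto simp: min_le_iff_disj)
    then show ?thesis by blast
  qed
  then obtain e where e: "\<And>i. e i \<in> F i" by metis
  define r where "r = Min (range e) / 3"
  have re: "3 * r \<le> e i" for i unfolding r_def by (simp add: Min_le)
  have "Min (range e) \<in> range e" by (intro Min_in) auto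
  then have r: "r > 0" unfolding r_def using e by (auto simp: F_def)
  have r1: "ball (xbar $ i) (3 * r) \<subseteq> interior (fluid S)" for i
  proof -
    have "ball (xbar $ i) (e i) \<subseteq> interior (fluid S)" using e[of i] by (simp add: F_def)
    then show ?thesis using subset_ball[OF re[of i], of "xbar $ i"] by (rule subset_trans[rotated])
  qed
  have r2: "3 * r \<le> dist (xbar $ i) (xbar $ j)" if "j \<noteq> i" for i j
  proof -
    have "e i \<le> dist (xbar $ i) (xbar $ j)" using e[of i] that by (simp add: F_def)
    then show ?thesis using re[of i] by linarith
  qed
  \<comment> \<open>the linear stream function of the constant field \<open>density \<cdot> u i\<close>, with the density taken at the point\<close>
  define L where "L i x = density S (xbar $ i) * (u $ i $ 1 * x $ 2 + (- u $ i $ 2) * x $ 1)" for i and x :: plane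
  define \<psi> where "\<psi> x = (\<Sum>i\<in>UNIV. cutoff (xbar $ i) r x * L i x)" for x
  have L: "smooth_on UNIV (L i)" for i
    unfolding L_def[abs_def] by (intro smooth_on_mult smooth_on_const smooth_on_add smooth_on_nth)
  have "smooth_on UNIV \<psi>" unfolding \<psi>_def[abs_def] by (intro smooth_on_sum smooth_on_mult L smooth_on_cutoff)
  moreover have "bounded {x. \<psi> x \<noteq> 0}"
  proof (rule bounded_subset)
    show "bounded (\<Union>i\<in>UNIV. {x. cutoff (xbar $ i) r x \<noteq> 0})" using bounded_cutoff_support[OF r] by (intro bounded_UN) auto
    show "{x. \<psi> x \<noteq> 0} \<subseteq> (\<Union>i\<in>UNIV. {x. cutoff (xbar $ i) r x \<noteq> 0})"
    proof (rule subsetI, rule ccontr)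
      fix x assume "x \<in> {x. \<psi> x \<noteq> 0}" and "x \<notin> (\<Union>i\<in>UNIV. {x. cutoff (xbar $ i) r x \<noteq> 0})"
      then show False by (simp add: \<psi>_def)
    qed
  qed
  moreover have "\<exists>U. open U \<and> x \<in> U \<and> (\<forall>y\<in>U. \<psi> y = 0)" if x: "x \<in> body S" for x
  proof -
    have "\<exists>U. open U \<and> x \<in> U \<and> (\<forall>y\<in>U. cutoff (xbar $ i) r y = 0)" for i
      by (rule cutoff_zero_near_body[OF r r1 x])
    then obtain U where U: "\<And>i. open (U i)" "\<And>i. x \<in> U i" "\<And>i y. y \<in> U i \<Longrightarrow> cutoff (xbar $ i) r y = 0" by metis
    show ?thesis
      by (rule exI[of _ "\<Inter>i. U i"]) (use U in \<open>auto simp: \<psi>_def intro!: sum.neutral\<close>)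
  qed
  ultimately have "density_curl \<psi> \<in> X_vol S" by (rule density_curl_X_vol)
  moreover have "density_curl \<psi> (xbar $ i) = u $ i" for i
  proof -
    have xf: "xbar $ i \<in> fluid S" using xb(1) interior_subset by blast
    have "\<psi> y = L i y" if y: "y \<in> ball (xbar $ i) r" for y
    proof -
      have "cutoff (xbar $ j) r y = 0" if "j \<noteq> i" for j
        using r2[of j i] that y dist_triangle[of "xbar $ i" "xbar $ j" y] by (intro cutoff_0[OF r]) (auto simp: dist_commute)
      then have "\<psi> y = cutoff (xbar $ i) r y * L i y"
        unfolding \<psi>_def by (subst sum.remove[of _ i]) (auto intro!: sum.neutral)
      then show ?thesis using cutoff_1[OF r, of "xbar $ i" y] y by simp
    qed
    then have "curl \<psi> (xbar $ i) = curl (L i) (xbar $ i)"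
      using r by (intro curl_cong_open[of "ball (xbar $ i) r"]) auto
    also have "\<dots> = density S (xbar $ i) *\<^sub>R u $ i"
    proof -
      have "(L i has_derivative (\<lambda>h. density S (xbar $ i) * (u $ i $ 1 * h $ 2 + (- u $ i $ 2) * h $ 1))) (at (xbar $ i))"
        unfolding L_def[abs_def]
        by (intro derivative_intros bounded_linear.has_derivative[OF bounded_linear_vec_nth])
      from curl_eq[OF this] show ?thesis by (auto intro!: vec2_eqI simp: axis_def)
    qed
    finally show ?thesis using xf density_pos by (auto simp: density_curl_def)
  qed
  ultimately show thesis by (rule that)
qed

end

section \<open>The stream function of a decaying solenoidal field\<close>

lemma norm_rot90 [simp]: "norm (rot90 w) = norm w"
  by (simp add: norm_eq_sqrt_inner inner2)

lemma curl_rot90: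
  assumes "(\<psi> has_derivative (\<lambda>h. rot90 w \<bullet> h)) (at x)" shows "curl \<psi> x = w"
  unfolding curl_eq[OF assms] by (rule vec2_eqI) (simp_all add: inner2 axis_def)

text \<open>For a quarter turn \<open>J\<close>, the matrix \<open>J A\<close> is symmetric if and only if
  \<open>A\<close> is traceless. This is how vanishing divergence enters the construction of the stream
  function: it makes \<open>J v\<close> curl free.\<close>

lemma traceless_symmetry:
  fixes A :: "real^2^2"
  assumes "trace A = 0" shows "rot90 (A *v h) \<bullet> z = rot90 (A *v z) \<bullet> h"
proof -
  have "A$2$2 = - A$1$1" using assms by (simp add: trace2)
  then show ?thesis by (simp add: inner2 algebra_simps)
qed

text \<open>For \<open>\<xi>\<close> in the Lie algebra, \<open>v\<close> will be the field \<open>density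
  \<cdot> \<xi>\<close>.\<close>

locale solenoidal_exterior =
  fixes v :: "plane \<Rightarrow> plane" and c :: plane and R s C :: real
  assumes R: "R > 0" and s: "s > 1" and v_smooth: "smooth_on (- ball c R) v"
    and div0: "\<forall>x\<in>- ball c R. divergence (- ball c R) v x = 0"
    and v_bound: "\<forall>x\<in>- ball c R. norm (v x) \<le> C * dist c x powr (- s)"
begin

abbreviation "I \<equiv> - cball c R"
abbreviation "V \<equiv> jac (- ball c R) v"

lemma I_sub: "I \<subseteq> - ball c R" by auto

lemma open_I: "open I" by (simp add: open_Compl)

lemma ray_exterior: "x \<in> I \<Longrightarrow> t \<ge> 1 \<Longrightarrow> c + t *\<^sub>R (x - c) \<in> I" "dist c (c + t *\<^sub>R (x - c)) = \<bar>t\<bar> * dist c x"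
proof -
  show *: "dist c (c + t *\<^sub>R (x - c)) = \<bar>t\<bar> * dist c x" for t by (simp add: dist_norm norm_minus_commute)
  assume "x \<in> I" "t \<ge> 1"
  then show "c + t *\<^sub>R (x - c) \<in> I" using mult_right_mono[of 1 t "dist c x"] by (auto simp: *)
qed

lemma v_derivative: "x \<in> I \<Longrightarrow> (v has_derivative (\<lambda>h. V x *v h)) (at x)"
proof -
  assume x: "x \<in> I"
  have "at x within - ball c R = at x"
    using x by (intro at_within_interior) (simp add: interior_exterior_ball[OF R])
  then show ?thesis using smooth_on_has_jac[OF v_smooth, of x] x by auto
qed

lemma C_nonneg: "C \<ge> 0"
proof -
  define y where "y = c + R *\<^sub>R axis 1 1"
  have "dist c y = R" using R by (simp add: y_def dist_norm norm_axis_1)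
  then have y: "y \<in> - ball c R" "dist c y powr (- s) > 0" using R by auto
  have "0 \<le> C * dist c y powr (- s)" using v_bound y(1) norm_ge_zero order_trans by blast
  then show ?thesis using y(2) by (simp add: zero_le_mult_iff)
qed

text \<open>The integrand of the line integral of the curl free field \<open>rot90 v\<close> along the ray from
  \<open>x\<close> to infinity; its negative integral is the potential that vanishes at infinity.\<close>

definition kern :: "plane \<Rightarrow> real \<Rightarrow> real" where
  "kern x t = rot90 (v (c + t *\<^sub>R (x - c))) \<bullet> (x - c)"

text \<open>This is at once the gradient of \<open>kern x t\<close> in \<open>x\<close>
  (\<open>kern_derivative\<close>) and the derivative of \<open>t *\<^sub>R rot90 (v (c + t *\<^sub>R (x -
  c)))\<close> in \<open>t\<close> (\<open>radial_derivative\<close>).\<close>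

definition grad_kern :: "plane \<Rightarrow> real \<Rightarrow> plane" where
  "grad_kern x t = t *\<^sub>R rot90 (V (c + t *\<^sub>R (x - c)) *v (x - c)) + rot90 (v (c + t *\<^sub>R (x - c)))"

text \<open>The derivative in the direction \<open>h\<close> is an inner product with \<open>h\<close> by
  \<open>traceless_symmetry\<close>.\<close>

lemma kern_derivative:
  assumes "x \<in> I" "t \<ge> 1"
  shows "((\<lambda>x. kern x t) has_derivative (\<lambda>h. grad_kern x t \<bullet> h)) (at x)"
proof -
  define y where "y = c + t *\<^sub>R (x - c)"
  have y: "y \<in> I" using ray_exterior(1)[OF assms] by (simp add: y_def)
  have "((\<lambda>x. c + t *\<^sub>R (x - c)) has_derivative (\<lambda>h. t *\<^sub>R h)) (at x)"
    by (auto intro!: derivative_eq_intros)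
  then have "((\<lambda>x. v (c + t *\<^sub>R (x - c))) has_derivative (\<lambda>h. V y *v (t *\<^sub>R h))) (at x)"
    by (rule has_derivative_compose) (use v_derivative[OF y] in \<open>simp add: y_def\<close>)
  then have r: "((\<lambda>x. rot90 (v (c + t *\<^sub>R (x - c)))) has_derivative (\<lambda>h. rot90 (V y *v (t *\<^sub>R h)))) (at x)"
    by (rule bounded_linear.has_derivative[OF bounded_linear_rot90])
  have "((\<lambda>x. x - c) has_derivative (\<lambda>h. h)) (at x)" by (auto intro!: derivative_eq_intros)
  from has_derivative_inner[OF r this]
  have D: "((\<lambda>x. kern x t) has_derivative (\<lambda>h. rot90 (v y) \<bullet> h + rot90 (V y *v (t *\<^sub>R h)) \<bullet> (x - c))) (at x)"
    unfolding kern_def[abs_def] by (simp add: y_def)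
  have "trace (V y) = 0" using div0 y I_sub unfolding divergence_def by blast
  from traceless_symmetry[OF this]
  have "rot90 (V y *v (t *\<^sub>R h)) \<bullet> (x - c) = (t *\<^sub>R rot90 (V y *v (x - c))) \<bullet> h" for h
    by (simp add: linear_scale[OF bounded_linear.linear[OF bounded_linear_rot90]] matrix_vector_mult_scaleR)
  then have "(\<lambda>h. rot90 (v y) \<bullet> h + rot90 (V y *v (t *\<^sub>R h)) \<bullet> (x - c)) = (\<lambda>h. grad_kern x t \<bullet> h)"
    by (simp add: fun_eq_iff grad_kern_def y_def inner_add_left)
  then show ?thesis using D by simp
qed

lemma radial_derivative:
  assumes "x \<in> I" "t \<ge> 1"
  shows "((\<lambda>t. t *\<^sub>R rot90 (v (c + t *\<^sub>R (x - c)))) has_vector_derivative grad_kern x t) (at t)"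
proof -
  define y where "y = c + t *\<^sub>R (x - c)"
  have y: "y \<in> I" using ray_exterior(1)[OF assms] by (simp add: y_def)
  have "((\<lambda>t. c + t *\<^sub>R (x - c)) has_derivative (\<lambda>h. h *\<^sub>R (x - c))) (at t)"
    by (auto intro!: derivative_eq_intros)
  then have "((\<lambda>t. v (c + t *\<^sub>R (x - c))) has_derivative (\<lambda>h. V y *v (h *\<^sub>R (x - c)))) (at t)"
    by (rule has_derivative_compose) (use v_derivative[OF y] in \<open>simp add: y_def\<close>)
  then have "((\<lambda>t. rot90 (v (c + t *\<^sub>R (x - c)))) has_derivative (\<lambda>h. rot90 (V y *v (h *\<^sub>R (x - c))))) (at t)"
    by (rule bounded_linear.has_derivative[OF bounded_linear_rot90])
  from has_derivative_scaleR[OF has_derivative_ident this]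
  have "((\<lambda>t. t *\<^sub>R rot90 (v (c + t *\<^sub>R (x - c)))) has_derivative
      (\<lambda>h. t *\<^sub>R rot90 (V y *v (h *\<^sub>R (x - c))) + h *\<^sub>R rot90 (v y))) (at t)"
    by (simp add: y_def)
  then show ?thesis
    unfolding has_vector_derivative_def grad_kern_def y_def
    by (rule has_derivative_eq_rhs)
       (simp add: fun_eq_iff linear_scale[OF bounded_linear.linear[OF bounded_linear_rot90]] matrix_vector_mult_scaleR scaleR_add_right
          mult.commute)
qed

lemma continuous_on_ray: "continuous_on ((I::plane set) \<times> {1..}) (\<lambda>(x, t). F (c + t *\<^sub>R (x - c)) :: 'b::real_normed_vector)"
  if "continuous_on I F" for F
  unfolding split_beta
proof (rule continuous_on_compose2[OF that])
  show "continuous_on (I \<times> {1..}) (\<lambda>p. c + snd p *\<^sub>R (fst p - c))" by (intro continuous_intros)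
  show "(\<lambda>p. c + snd p *\<^sub>R (fst p - c)) ` (I \<times> {1..}) \<subseteq> I"
  proof (rule image_subsetI)
    fix p :: "plane \<times> real" assume "p \<in> I \<times> {1..}"
    then have "fst p \<in> I" "snd p \<ge> 1" by (simp_all only: mem_Times_iff atLeast_iff)
    then show "c + snd p *\<^sub>R (fst p - c) \<in> I" by (rule ray_exterior(1))
  qed
qed

lemma continuous_v: "continuous_on I v" "continuous_on I V"
  using smooth_on_continuous_on[OF v_smooth] smooth_on_continuous_on[OF smooth_on_jac[OF exterior_ball v_smooth]]
    continuous_on_subset[OF _ I_sub] by blast+

lemma continuous_rot90: "continuous_on A f \<Longrightarrow> continuous_on A (\<lambda>x. rot90 (f x))"
  by (rule bounded_linear.continuous_on[OF bounded_linear_rot90])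

lemma continuous_kern: "continuous_on (I \<times> {1..}) (\<lambda>(x, t). kern x t)"
proof -
  have "continuous_on (I \<times> {1..}) (\<lambda>p. rot90 (v (c + snd p *\<^sub>R (fst p - c))) \<bullet> (fst p - c))"
    using continuous_on_ray[OF continuous_v(1)] unfolding split_beta
    by (intro continuous_intros continuous_rot90)
  then show ?thesis by (simp add: kern_def split_beta)
qed

lemma continuous_grad_kern: "continuous_on (I \<times> {1..}) (\<lambda>(x, t). grad_kern x t)"
proof -
  have "continuous_on (I \<times> {1..}) (\<lambda>p. snd p *\<^sub>R rot90 (V (c + snd p *\<^sub>R (fst p - c)) *v (fst p - c))
      + rot90 (v (c + snd p *\<^sub>R (fst p - c))))"
    using continuous_on_ray[OF continuous_v(1)] continuous_on_ray[OF continuous_v(2)] unfolding split_beta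
    by (intro continuous_intros continuous_rot90 bounded_bilinear.continuous_on[OF bounded_bilinear_mv])
  then show ?thesis by (simp add: grad_kern_def split_beta)
qed

text \<open>The line integral is cut into unit intervals: differentiation under the integral sign is available
  on compact intervals, and the pieces are summed as a series.\<close>

definition piece :: "nat \<Rightarrow> plane \<Rightarrow> real" where
  "piece n x = - integral {real n + 1..real n + 2} (kern x)"

lemma kern_integrable: "x \<in> I \<Longrightarrow> kern x integrable_on {real n + 1..real n + 2}"
proof (rule integrable_continuous_interval)
  assume "x \<in> I"
  then show "continuous_on {real n + 1..real n + 2} (kern x)"
    by (intro continuous_on_compose2[OF continuous_kern, of _ "\<lambda>t. (x, t)", unfolded split_conv] continuous_intros) auto
qed

text \<open>The gradient of the integrand is a derivative in \<open>t\<close>, so it integrates to boundary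
  terms.\<close>

lemma piece_derivative:
  assumes x: "x \<in> I"
  shows "(piece n has_derivative (\<lambda>h. ((real n + 1) *\<^sub>R rot90 (v (c + (real n + 1) *\<^sub>R (x - c)))
     - (real n + 2) *\<^sub>R rot90 (v (c + (real n + 2) *\<^sub>R (x - c)))) \<bullet> h)) (at x)"
proof -
  obtain e where e: "e > 0" "ball x e \<subseteq> I" using open_I x openE by blast
  define U where "U = ball x e"
  have U: "convex U" "x \<in> U" "open U" "U \<subseteq> I" using e by (auto simp: U_def)
  let ?T = "cbox (real n + 1) (real n + 2)"
  let ?W = "(real n + 2) *\<^sub>R rot90 (v (c + (real n + 2) *\<^sub>R (x - c))) - (real n + 1) *\<^sub>R rot90 (v (c + (real n + 1) *\<^sub>R (x - c)))"
  have cont: "continuous_on (U \<times> ?T) (\<lambda>(x, t). blinfun_inner_right (grad_kern x t))"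
    unfolding split_beta
    by (rule bounded_linear.continuous_on[OF bounded_linear_blinfun_inner_right])
       (rule continuous_on_subset[OF continuous_grad_kern, unfolded split_beta]; use U(4) in \<open>auto simp del: mem_cball\<close>)
  have "((\<lambda>x. integral ?T (kern x)) has_derivative integral ?T (\<lambda>t. blinfun_inner_right (grad_kern x t))) (at x within U)"
  proof (rule leibniz_rule[OF _ _ cont U(2,1)])
    show "((\<lambda>x. kern x t) has_derivative blinfun_inner_right (grad_kern y t)) (at y within U)"
      if "y \<in> U" "t \<in> ?T" for y t
    proof -
      have "((\<lambda>x. kern x t) has_derivative blinfun_inner_right (grad_kern y t)) (at y)"
        using kern_derivative[of y t] that U(4) by auto
      then show ?thesis by (rule has_derivative_at_withinI)
    qed
    show "kern y integrable_on ?T" if "y \<in> U" for y using kern_integrable[of y n] that U(4) by auto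
  qed
  moreover have "integral ?T (\<lambda>t. blinfun_inner_right (grad_kern x t)) = blinfun_inner_right ?W"
  proof -
    have "(grad_kern x has_integral ?W) {real n + 1..real n + 2}"
    proof (rule fundamental_theorem_of_calculus)
      show "((\<lambda>t. t *\<^sub>R rot90 (v (c + t *\<^sub>R (x - c)))) has_vector_derivative grad_kern x t) (at t within {real n + 1..real n + 2})"
        if "t \<in> {real n + 1..real n + 2}" for t
      proof (rule has_vector_derivative_at_within)
        show "((\<lambda>t. t *\<^sub>R rot90 (v (c + t *\<^sub>R (x - c)))) has_vector_derivative grad_kern x t) (at t)"
          using radial_derivative[OF x, of t] that by simp
      qed
    qed simp
    from has_integral_linear[OF this bounded_linear_blinfun_inner_right] show ?thesis
      by (intro integral_unique) (simp add: o_def)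
  qed
  ultimately have "((\<lambda>x. integral ?T (kern x)) has_derivative blinfun_inner_right ?W) (at x)"
    unfolding at_within_open[OF U(2,3)] by metis
  then have "((\<lambda>x. integral ?T (kern x)) has_derivative (\<lambda>h. ?W \<bullet> h)) (at x)"
    unfolding blinfun_inner_right.rep_eq .
  from has_derivative_minus[OF this] show ?thesis
    unfolding piece_def[abs_def] by (simp flip: inner_minus_left)
qed

lemma v_ray_bound: "x \<in> I \<Longrightarrow> t \<ge> 1 \<Longrightarrow> norm (v (c + t *\<^sub>R (x - c))) \<le> C * (t * dist c x) powr (- s)"
proof -
  assume "x \<in> I" "t \<ge> 1"
  then have "c + t *\<^sub>R (x - c) \<in> - ball c R" using ray_exterior(1)[of x t] I_sub by blast
  from bspec[OF v_bound this] show ?thesis using \<open>t \<ge> 1\<close> unfolding ray_exterior(2)[of t x] by simp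
qed

lemma piece_bound:
  assumes x: "x \<in> I"
  shows "norm (piece n x) \<le> (C * dist c x powr (1 - s)) * (real n + 1) powr (- s)"
proof -
  have d: "dist c x > 0" using x R by auto
  have "norm (integral (cbox (real n + 1) (real n + 2)) (kern x))
      \<le> ((C * dist c x powr (1 - s)) * (real n + 1) powr (- s)) * measure lborel (cbox (real n + 1) (real n + 2))"
  proof (rule has_integral_bound)
    show "(kern x has_integral integral (cbox (real n + 1) (real n + 2)) (kern x)) (cbox (real n + 1) (real n + 2))"
      using kern_integrable[OF x] by (simp add: has_integral_integral[symmetric])
    show "0 \<le> (C * dist c x powr (1 - s)) * (real n + 1) powr (- s)" using C_nonneg by simp
    fix t assume t: "t \<in> cbox (real n + 1) (real n + 2)"
    have "norm (kern x t) \<le> norm (v (c + t *\<^sub>R (x - c))) * dist c x"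
      unfolding kern_def using Cauchy_Schwarz_ineq2[of "rot90 (v (c + t *\<^sub>R (x - c)))" "x - c"]
      by (simp add: dist_norm norm_minus_commute[of c])
    also have "\<dots> \<le> (C * (t * dist c x) powr (- s)) * dist c x"
      using v_ray_bound[OF x, of t] t by (intro mult_right_mono) auto
    also have "\<dots> = C * t powr (- s) * dist c x powr (1 - s)"
      using d t by (simp add: powr_mult powr_diff powr_minus field_simps)
    also have "\<dots> \<le> C * (real n + 1) powr (- s) * dist c x powr (1 - s)"
      using t s C_nonneg by (intro mult_right_mono mult_left_mono powr_mono2') auto
    finally show "norm (kern x t) \<le> (C * dist c x powr (1 - s)) * (real n + 1) powr (- s)" by (simp add: mult_ac)
  qed
  then show ?thesis by (simp add: piece_def)
qed

lemma summable_rate: "summable (\<lambda>n. (real n + 1) powr (- s))"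
proof -
  have "summable (\<lambda>n. real n powr (- s))" using s by (simp add: summable_real_powr_iff)
  then have "summable (\<lambda>n. real (Suc n) powr (- s))" by (subst summable_Suc_iff)
  then show ?thesis by (simp add: add.commute)
qed

definition stream :: "plane \<Rightarrow> real" where "stream x = (\<Sum>n. piece n x)"

lemma stream_bound: "x \<in> I \<Longrightarrow> \<bar>stream x\<bar> \<le> (C * (\<Sum>n. (real n + 1) powr (- s))) * dist c x powr (1 - s)"
proof -
  assume x: "x \<in> I"
  have "norm (suminf (\<lambda>n. piece n x)) \<le> (\<Sum>n. (C * dist c x powr (1 - s)) * (real n + 1) powr (- s))"
    by (rule norm_suminf_le[OF piece_bound[OF x] summable_mult[OF summable_rate]])
  then show ?thesis unfolding stream_def suminf_mult[OF summable_rate] by (simp add: mult_ac)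
qed

text \<open>The gradients of the pieces telescope to \<open>rot90 (v x)\<close> up to a boundary term of order
  \<open>n\<^sup>1\<^sup>-\<^sup>s\<close>, which vanishes locally uniformly as \<open>s > 1\<close>.\<close>

lemma stream_derivative:
  assumes x: "x \<in> I" shows "(stream has_derivative (\<lambda>h. rot90 (v x) \<bullet> h)) (at x)"
proof -
  obtain e where e: "e > 0" "ball x e \<subseteq> I" using open_I x openE by blast
  define U where "U = ball x e"
  have U: "convex U" "x \<in> U" "open U" "U \<subseteq> I" using e by (auto simp: U_def)
  \<comment> \<open>the gradient of \<open>piece n\<close> is \<open>W (n + 1) - W (n + 2)\<close>\<close>
  define W where "W n x = real n *\<^sub>R rot90 (v (c + real n *\<^sub>R (x - c)))" for n x
  have tele: "(\<Sum>i<n. (W (i + 1) y - W (i + 2) y) \<bullet> h) = (W 1 y - W (n + 1) y) \<bullet> h" for n y h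
    by (induction n) (simp_all add: inner_diff_left algebra_simps)
  have W1: "W 1 y = rot90 (v y)" for y by (simp add: W_def)
  have "\<exists>g. \<forall>y\<in>U. (\<lambda>n. piece n y) sums g y \<and> (g has_derivative (\<lambda>h. rot90 (v y) \<bullet> h)) (at y within U)"
  proof (rule has_derivative_series[OF U(1) _ _ U(2)])
    show "(piece n has_derivative (\<lambda>h. (W (n + 1) y - W (n + 2) y) \<bullet> h)) (at y within U)" if "y \<in> U" for n y
      using has_derivative_at_withinI[OF piece_derivative[of y n]] that U(4) by (auto simp: W_def add_ac)
    show "(\<lambda>n. piece n x) sums suminf (\<lambda>n. piece n x)"
      by (rule summable_sums, rule summable_comparison_test[OF _ summable_mult[OF summable_rate]])
         (use piece_bound[OF x] in blast)
    fix e' :: real assume e': "e' > 0"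
    have "filterlim (\<lambda>n. real (n + 1)) at_top sequentially"
      using filterlim_sequentially_Suc[THEN iffD2, OF filterlim_real_sequentially] by simp
    then have "(\<lambda>n. real (n + 1) powr (1 - s)) \<longlonglongrightarrow> 0" using s by (intro tendsto_neg_powr) auto
    then have "(\<lambda>n. C * R powr (- s) * real (n + 1) powr (1 - s)) \<longlonglongrightarrow> C * R powr (- s) * 0"
      by (intro tendsto_mult_left)
    then have "\<forall>\<^sub>F n in sequentially. C * R powr (- s) * real (n + 1) powr (1 - s) < e'"
      using e' by (intro order_tendstoD) auto
    then show "\<forall>\<^sub>F n in sequentially. \<forall>y\<in>U. \<forall>h. norm ((\<Sum>i<n. (W (i + 1) y - W (i + 2) y) \<bullet> h) - rot90 (v y) \<bullet> h) \<le> e' * norm h"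
    proof eventually_elim
      case (elim n)
      show ?case
      proof (intro ballI allI)
        fix y h assume y: "y \<in> U"
        then have yI: "y \<in> I" using U(4) by blast
        then have d: "dist c y > R" by auto
        have "norm (W (n + 1) y) = real (n + 1) * norm (v (c + real (n + 1) *\<^sub>R (y - c)))" by (simp add: W_def)
        also have "\<dots> \<le> real (n + 1) * (C * (real (n + 1) * dist c y) powr (- s))"
          using v_ray_bound[OF yI, of "real (n + 1)"] by (intro mult_left_mono) auto
        also have "\<dots> \<le> real (n + 1) * (C * (real (n + 1) * R) powr (- s))"
          using d s R C_nonneg by (intro mult_left_mono powr_mono2') auto
        also have "\<dots> = C * R powr (- s) * real (n + 1) powr (1 - s)"
        proof -
          have "(real (n + 1) * R) powr (- s) = real (n + 1) powr (- s) * R powr (- s)"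
            using R by (intro powr_mult)
          moreover have "real (n + 1) * real (n + 1) powr (- s) = real (n + 1) powr (1 - s)"
            using powr_mult_base[of "real (n + 1)" "- s"] by simp
          ultimately show ?thesis by (metis mult.assoc mult.commute)
        qed
        finally have "norm (W (n + 1) y) \<le> e'" using elim by linarith
        then have "norm (W (n + 1) y \<bullet> h) \<le> e' * norm h"
          using Cauchy_Schwarz_ineq2[of "W (n + 1) y" h] by (simp add: mult_right_mono order_trans)
        then show "norm ((\<Sum>i<n. (W (i + 1) y - W (i + 2) y) \<bullet> h) - rot90 (v y) \<bullet> h) \<le> e' * norm h"
          unfolding tele W1 by (simp add: inner_diff_left)
      qed
    qed
  qed
  then obtain g where g: "\<And>y. y \<in> U \<Longrightarrow> (\<lambda>n. piece n y) sums g y"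
      "(g has_derivative (\<lambda>h. rot90 (v x) \<bullet> h)) (at x within U)" using U(2) by blast
  have "stream y = g y" if "y \<in> U" for y using sums_unique[OF g(1)[OF that]] by (simp add: stream_def)
  then have eq: "g y = stream y" if "y \<in> U" for y using that by simp
  have "(g has_derivative (\<lambda>h. rot90 (v x) \<bullet> h)) (at x)" using g(2) unfolding at_within_open[OF U(2,3)] .
  then show ?thesis by (rule has_derivative_transform_within_open[OF _ U(3,2) eq])
qed

lemma stream_curl: "x \<in> I \<Longrightarrow> curl stream x = v x"
  by (rule curl_rot90[OF stream_derivative])

text \<open>The first derivatives of the stream function are linear in \<open>v\<close>, hence smooth.\<close>

lemma stream_smooth: "Cinf I None stream"
proof (rule Cinf_step)
  show "stream differentiable_on I"
    using stream_derivative by (meson differentiable_at_withinI differentiable_def differentiable_on_def)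
  show "Cinf I None (dir_deriv h stream)" for h
  proof (rule Cinf_cong)
    have "smooth_on I (\<lambda>x. rot90 (v x) \<bullet> h)"
      by (intro smooth_on_inner smooth_on_linear[OF bounded_linear_rot90] smooth_on_const smooth_on_subset[OF v_smooth I_sub])
    then show "Cinf I None (\<lambda>x. rot90 (v x) \<bullet> h)" using smooth_on_open[OF open_I] by blast
  qed (use open_I dir_deriv_eq[OF stream_derivative] in auto)
qed simp

end

section \<open>Approximation of the stream function by test functions\<close>

lemma curl_mult:
  assumes "(f has_derivative F) (at x)" "(g has_derivative G) (at x)"
  shows "curl (\<lambda>x. f x * g x) x = f x *\<^sub>R curl g x + g x *\<^sub>R curl f x"
  unfolding curl_eq[OF has_derivative_mult[OF assms]] curl_eq[OF assms(1)] curl_eq[OF assms(2)]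
  by (rule vec2_eqI) (simp_all add: algebra_simps)

lemma curl_compose_real:
  assumes "(g has_derivative G) (at x)" "(f has_real_derivative d) (at (g x))"
  shows "curl (\<lambda>x. f (g x)) x = d *\<^sub>R curl g x" "((\<lambda>x. f (g x)) has_derivative (\<lambda>h. d * G h)) (at x)"
proof -
  show D: "((\<lambda>x. f (g x)) has_derivative (\<lambda>h. d * G h)) (at x)"
    using has_derivative_compose[OF assms(1)] assms(2) unfolding has_field_derivative_def by blast
  show "curl (\<lambda>x. f (g x)) x = d *\<^sub>R curl g x"
    unfolding curl_eq[OF D] curl_eq[OF assms(1)] by (rule vec2_eqI) simp_all
qed

lemma sq_dist_derivative: "((\<lambda>x. (x - c) \<bullet> (x - c)) has_derivative (\<lambda>h. 2 * ((x - c) \<bullet> h))) (at (x::plane))"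
  by (auto intro!: derivative_eq_intros simp: inner_commute)

lemma norm_curl_sq_dist: "norm (curl (\<lambda>x. (x - c) \<bullet> (x - c)) x) = 2 * dist c x"
proof -
  have "curl (\<lambda>x. (x - c) \<bullet> (x - c)) x = 2 *\<^sub>R (- rot90 (x - c))"
    unfolding curl_eq[OF sq_dist_derivative] by (rule vec2_eqI) (simp_all add: inner2 axis_def)
  then show ?thesis by (simp add: dist_norm norm_minus_commute[of c x])
qed

text \<open>A bound on the derivative that is uniform in \<open>t\<close> comes from compactness, since the
  derivative vanishes off \<open>{0..1}\<close>.\<close>

lemma smooth_step_derivative:
  obtains B where "B \<ge> 0" "\<And>t. \<exists>d. (smooth_step has_real_derivative d) (at t) \<and> \<bar>d\<bar> \<le> B \<and> (t < 0 \<or> t > 1 \<longrightarrow> d = 0)"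
proof -
  have C: "Cinf UNIV None smooth_step" using smooth_on_step by (simp add: smooth_on_open)
  define d where "d = dir_deriv 1 smooth_step"
  have der: "(smooth_step has_real_derivative d t) (at t)" for t
  proof -
    have D: "(smooth_step has_derivative (\<lambda>v. dir_deriv v smooth_step t)) (at t)"
      by (rule differentiable_on_open_has_dir_deriv[OF Cinf_differentiable_on[OF C]]) auto
    have "dir_deriv v smooth_step t = d t * v" for v
      using linear_scale[OF has_derivative_linear[OF D], of v 1] by (simp add: d_def)
    then have "(\<lambda>v. dir_deriv v smooth_step t) = (*) (d t)" by (simp add: fun_eq_iff)
    then show ?thesis using D by (simp add: has_field_derivative_def)
  qed
  have z: "d t = 0" if "t < 0 \<or> t > 1" for t
  proof -
    have "((\<lambda>t. if t < 0 then 0 else 1) has_real_derivative 0) (at t)" if "t < 0 \<or> t > 1"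
      using that
    proof
      assume t: "t < 0"
      show ?thesis by (rule has_field_derivative_transform_within_open[of "\<lambda>_. 0" _ _ "{..<0}"]) (use t in auto)
    next
      assume t: "t > 1"
      show ?thesis by (rule has_field_derivative_transform_within_open[of "\<lambda>_. 1" _ _ "{1<..}"]) (use t in auto)
    qed
    note f = this[OF that]
    have "(smooth_step has_real_derivative 0) (at t)"
      by (rule has_field_derivative_transform_within_open[OF f, of "{..<0} \<union> {1<..}"])
         (use that in \<open>auto simp: smooth_step_0 smooth_step_1\<close>)
    then show ?thesis using der DERIV_unique by blast
  qed
  have "continuous_on {0..1} d"
    unfolding d_def by (rule continuous_on_subset[OF Cinf_None_continuous_on[OF Cinf_dir_deriv[OF C]] subset_UNIV])
  then have "bounded (d ` {0..1})" using compact_continuous_image compact_imp_bounded by blast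
  then obtain B where "\<forall>y\<in>d ` {0..1}. norm y \<le> B" unfolding bounded_iff by blast
  then have B: "\<And>t. t \<in> {0..1} \<Longrightarrow> \<bar>d t\<bar> \<le> B" by simp
  show thesis
  proof (rule that[of "max B 0"])
    show "\<exists>d. (smooth_step has_real_derivative d) (at t) \<and> \<bar>d\<bar> \<le> max B 0 \<and> (t < 0 \<or> t > 1 \<longrightarrow> d = 0)" for t
      using der[of t] z[of t] B[of t] by (intro exI[of _ "d t"]) force
  qed simp
qed

text \<open>If \<open>v\<close> is tangent to the circle, the circle is a streamline.\<close>

locale tangent_solenoidal = solenoidal_exterior +
  assumes tangent: "\<forall>x\<in>sphere c R. v x \<bullet> (x - c) = 0"
begin

definition unit_dir :: "real \<Rightarrow> plane" where "unit_dir \<alpha> = as_vec2 (cos \<alpha>) (sin \<alpha>)"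

definition polar :: "real \<Rightarrow> real \<Rightarrow> plane" where "polar r \<alpha> = c + r *\<^sub>R unit_dir \<alpha>"

lemma unit_dir_nth [simp]: "unit_dir \<alpha> $ 1 = cos \<alpha>" "unit_dir \<alpha> $ 2 = sin \<alpha>"
  by (simp_all add: unit_dir_def as_vec2_def axis_def)

lemma norm_unit_dir [simp]: "norm (unit_dir \<alpha>) = 1"
  by (simp add: norm_eq_sqrt_inner inner2)

lemma dist_polar [simp]: "dist c (polar r \<alpha>) = \<bar>r\<bar>"
  by (simp add: polar_def dist_norm)

lemma polar_I: "r > R \<Longrightarrow> polar r \<alpha> \<in> I" using R by simp

lemma polar_coordinates:
  assumes "x \<noteq> c" obtains \<alpha> where "0 \<le> \<alpha>" "\<alpha> \<le> 2 * pi" "x = polar (dist c x) \<alpha>"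
proof -
  define d where "d = dist c x"
  have d: "d > 0" using assms by (simp add: d_def)
  have "(x - c) \<bullet> (x - c) = d\<^sup>2" by (simp add: d_def dist_norm norm_minus_commute[of c x] power2_norm_eq_inner)
  then have "(((x - c) $ 1) / d)\<^sup>2 + (((x - c) $ 2) / d)\<^sup>2 = 1"
    using d by (simp add: inner2 power_divide power2_eq_square add_divide_distrib[symmetric])
  then obtain t where t: "0 \<le> t" "t < 2 * pi" "(x - c) $ 1 / d = cos t" "(x - c) $ 2 / d = sin t"
    using sincos_total_2pi by metis
  have "x - c = d *\<^sub>R unit_dir t" using t(3,4) d by (intro vec2_eqI) (simp_all add: field_simps)
  then have "x = polar d t" unfolding polar_def by (metis add.commute diff_add_cancel)
  then show thesis using that[of t] t unfolding d_def by simp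
qed

definition "speed_bound = C * R powr (- s)"

lemma v_le_speed_bound: "x \<in> - ball c R \<Longrightarrow> norm (v x) \<le> speed_bound"
proof -
  assume x: "x \<in> - ball c R"
  have "norm (v x) \<le> C * dist c x powr (- s)" using v_bound x by blast
  also have "\<dots> \<le> speed_bound" unfolding speed_bound_def using x R s C_nonneg by (intro mult_left_mono powr_mono2') auto
  finally show ?thesis .
qed

lemma speed_bound_nonneg: "speed_bound \<ge> 0" using C_nonneg by (simp add: speed_bound_def)

lemma radial_lipschitz:
  assumes "R < r'" "r' \<le> r" shows "\<bar>stream (polar r \<alpha>) - stream (polar r' \<alpha>)\<bar> \<le> speed_bound * (r - r')"
proof (cases "r' = r")
  case False
  then have lt: "r' < r" using assms by simp
  have D: "((\<lambda>r. stream (polar r \<alpha>)) has_real_derivative rot90 (v (polar t \<alpha>)) \<bullet> unit_dir \<alpha>) (at t)" if "t > R" for t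
  proof -
    have "((\<lambda>r. polar r \<alpha>) has_derivative (\<lambda>h. h *\<^sub>R unit_dir \<alpha>)) (at t)"
      unfolding polar_def by (auto intro!: derivative_eq_intros)
    from has_derivative_compose[OF this stream_derivative[OF polar_I[OF that]]]
    show ?thesis by (simp add: has_field_derivative_def mult_commute_abs)
  qed
  from MVT2[OF lt D] assms obtain z where z: "r' < z" "z < r"
    "stream (polar r \<alpha>) - stream (polar r' \<alpha>) = (r - r') * (rot90 (v (polar z \<alpha>)) \<bullet> unit_dir \<alpha>)" by force
  have "\<bar>rot90 (v (polar z \<alpha>)) \<bullet> unit_dir \<alpha>\<bar> \<le> norm (v (polar z \<alpha>))"
    using Cauchy_Schwarz_ineq2[of "rot90 (v (polar z \<alpha>))" "unit_dir \<alpha>"] by simp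
  also have "\<dots> \<le> speed_bound" using z(1) assms(1) R by (intro v_le_speed_bound) auto
  finally show ?thesis unfolding z(3) using lt by (simp add: abs_mult mult.commute mult_left_mono)
qed simp

lemma angular_bound:
  assumes r: "r > R" and \<omega>: "\<And>\<beta>. \<bar>v (polar r \<beta>) \<bullet> unit_dir \<beta>\<bar> \<le> \<omega>" and \<alpha>: "0 \<le> \<alpha>" "\<alpha> \<le> 2 * pi"
  shows "\<bar>stream (polar r \<alpha>) - stream (polar r 0)\<bar> \<le> r * \<omega> * (2 * pi)"
proof -
  have \<omega>0: "\<omega> \<ge> 0" using \<omega>[of 0] by linarith
  have D: "((\<lambda>\<alpha>. stream (polar r \<alpha>)) has_real_derivative r * (v (polar r t) \<bullet> unit_dir t)) (at t)" for t
  proof -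
    have "((\<lambda>\<alpha>. polar r \<alpha>) has_derivative (\<lambda>h. h *\<^sub>R (r *\<^sub>R rot90 (unit_dir t)))) (at t)"
      unfolding polar_def unit_dir_def as_vec2_def
      by (auto intro!: derivative_eq_intros vec2_eqI simp: axis_def fun_eq_iff)
    from has_derivative_compose[OF this stream_derivative[OF polar_I[OF r]]]
    have "((\<lambda>\<alpha>. stream (polar r \<alpha>)) has_derivative (\<lambda>h. rot90 (v (polar r t)) \<bullet> (h *\<^sub>R (r *\<^sub>R rot90 (unit_dir t))))) (at t)" .
    moreover have "(\<lambda>h. rot90 (v (polar r t)) \<bullet> (h *\<^sub>R (r *\<^sub>R rot90 (unit_dir t)))) = (*) (r * (v (polar r t) \<bullet> unit_dir t))"
      by (auto simp: fun_eq_iff inner2 algebra_simps)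
    ultimately show ?thesis by (simp add: has_field_derivative_def)
  qed
  show ?thesis
  proof (cases "\<alpha> = 0")
    case False
    then have "0 < \<alpha>" using \<alpha> by simp
    from MVT2[OF this D] obtain z where z:
      "stream (polar r \<alpha>) - stream (polar r 0) = (\<alpha> - 0) * (r * (v (polar r z) \<bullet> unit_dir z))" by blast
    have "\<bar>(\<alpha> - 0) * (r * (v (polar r z) \<bullet> unit_dir z))\<bar> = \<alpha> * (r * \<bar>v (polar r z) \<bullet> unit_dir z\<bar>)"
      using \<alpha> r R by (simp add: abs_mult)
    also have "\<dots> \<le> 2 * pi * (r * \<omega>)"
      using \<alpha> r R \<omega>[of z] by (intro mult_mono) auto
    finally show ?thesis unfolding z by (simp add: mult_ac)
  qed (use \<omega>0 r R in simp)
qed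

lemma normal_component_small:
  assumes "\<epsilon> > 0"
  obtains \<delta> where "\<delta> > 0" "\<And>r \<beta>. R < r \<Longrightarrow> r < R + \<delta> \<Longrightarrow> \<bar>v (polar r \<beta>) \<bullet> unit_dir \<beta>\<bar> \<le> \<epsilon>"
proof -
  let ?K = "cball c (2 * R) - ball c R"
  have "continuous_on ?K v" by (rule continuous_on_subset[OF smooth_on_continuous_on[OF v_smooth]]) auto
  moreover have "compact ?K" by (rule compact_diff) auto
  ultimately have "uniformly_continuous_on ?K v" by (rule compact_uniformly_continuous)
  then obtain d where d: "d > 0" "\<And>x y. x \<in> ?K \<Longrightarrow> y \<in> ?K \<Longrightarrow> dist y x < d \<Longrightarrow> dist (v y) (v x) < \<epsilon>"
    using assms unfolding uniformly_continuous_on_def by metis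
  show thesis
  proof (rule that[of "min d R"])
    show "min d R > 0" using d R by simp
    fix r \<beta> assume r: "R < r" "r < R + min d R"
    have "polar r \<beta> \<in> ?K" "polar R \<beta> \<in> ?K" using r R by auto
    moreover have "dist (polar r \<beta>) (polar R \<beta>) < d"
    proof -
      have "polar r \<beta> - polar R \<beta> = (r - R) *\<^sub>R unit_dir \<beta>" by (simp add: polar_def algebra_simps)
      then show ?thesis using r by (simp add: dist_norm)
    qed
    ultimately have "dist (v (polar r \<beta>)) (v (polar R \<beta>)) < \<epsilon>" using d(2) by blast
    moreover have "v (polar R \<beta>) \<bullet> unit_dir \<beta> = 0"
    proof -
      have "v (polar R \<beta>) \<bullet> (polar R \<beta> - c) = 0" using tangent R by simp
      then show ?thesis using R by (simp add: polar_def)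
    qed
    then have "v (polar r \<beta>) \<bullet> unit_dir \<beta> = (v (polar r \<beta>) - v (polar R \<beta>)) \<bullet> unit_dir \<beta>" by (simp add: inner_diff_left)
    ultimately show "\<bar>v (polar r \<beta>) \<bullet> unit_dir \<beta>\<bar> \<le> \<epsilon>"
      using Cauchy_Schwarz_ineq2[of "v (polar r \<beta>) - v (polar R \<beta>)" "unit_dir \<beta>"] by (simp add: dist_norm)
  qed
qed

text \<open>The stream function is Lipschitz in radial direction, so it has a limit at the circle along one ray.
  The limit does not depend on the ray, because the variation along a circle of radius \<open>r\<close> is
  controlled by the normal component of \<open>v\<close>, which tends to zero as \<open>r\<close> tends to
  \<open>R\<close>.\<close>

lemma stream_boundary_value:
  obtains k where "\<And>x. x \<in> I \<Longrightarrow> \<bar>stream x - k\<bar> \<le> speed_bound * (dist c x - R)"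
proof -
  \<comment> \<open>radii decreasing to \<open>R\<close>\<close>
  define r where "r n = R + R * inverse (real (Suc n))" for n
  have rR: "R < r n" "r n \<le> 2 * R" for n
    using R by (auto simp: r_def field_simps)
  have "r \<longlonglongrightarrow> R + R * 0" unfolding r_def by (intro tendsto_intros LIMSEQ_inverse_real_of_nat)
  then have rlim: "r \<longlonglongrightarrow> R" by simp
  define f where "f n = stream (polar (r n) 0)" for n
  have lip: "\<bar>f m - f n\<bar> \<le> speed_bound * \<bar>r m - r n\<bar>" for m n
    using radial_lipschitz[OF rR(1), of n "r m" 0] radial_lipschitz[OF rR(1), of m "r n" 0]
    by (cases "r n \<le> r m") (auto simp: f_def abs_minus_commute)
  have "Cauchy f"
  proof (rule metric_CauchyI)
    fix e :: real assume e: "e > 0"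
    have "Cauchy r" using rlim LIMSEQ_imp_Cauchy by blast
    then obtain M where M: "\<And>m n. m \<ge> M \<Longrightarrow> n \<ge> M \<Longrightarrow> dist (r m) (r n) < e / (speed_bound + 1)"
      using metric_CauchyD[of r "e / (speed_bound + 1)"] e speed_bound_nonneg by auto
    have "dist (f m) (f n) < e" if "m \<ge> M" "n \<ge> M" for m n
    proof -
      have "dist (f m) (f n) \<le> speed_bound * dist (r m) (r n)" using lip by (simp add: dist_real_def)
      also have "\<dots> \<le> speed_bound * (e / (speed_bound + 1))" using M[OF that] speed_bound_nonneg by (intro mult_left_mono) auto
      also have "\<dots> < e" using e speed_bound_nonneg by (simp add: field_simps)
      finally show ?thesis .
    qed
    then show "\<exists>M. \<forall>m\<ge>M. \<forall>n\<ge>M. dist (f m) (f n) < e" by blast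
  qed
  then obtain k where k: "f \<longlonglongrightarrow> k" using Cauchy_convergent convergent_def by blast
  show thesis
  proof (rule that[of k])
    fix x assume x: "x \<in> I"
    define d where "d = dist c x"
    have d: "d > R" using x by (simp add: d_def)
    then have "x \<noteq> c" using R by (auto simp: d_def)
    then obtain \<alpha> where \<alpha>: "0 \<le> \<alpha>" "\<alpha> \<le> 2 * pi" "x = polar d \<alpha>" unfolding d_def by (rule polar_coordinates)
    show "\<bar>stream x - k\<bar> \<le> speed_bound * (dist c x - R)"
    proof (rule field_le_epsilon)
      fix e :: real assume e: "e > 0"
      define \<epsilon> where "\<epsilon> = e / (4 * R * pi)"
      have "\<epsilon> > 0" using e R by (simp add: \<epsilon>_def)
      then obtain \<delta> where \<delta>: "\<delta> > 0" "\<And>r \<beta>. R < r \<Longrightarrow> r < R + \<delta> \<Longrightarrow> \<bar>v (polar r \<beta>) \<bullet> unit_dir \<beta>\<bar> \<le> \<epsilon>"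
        using normal_component_small by blast
      have ev: "\<forall>\<^sub>F n in sequentially. r n < min d (R + \<delta>)"
        using d \<delta>(1) by (intro order_tendstoD(2)[OF rlim]) auto
      have "\<forall>\<^sub>F n in sequentially. \<bar>stream x - f n\<bar> \<le> speed_bound * (d - r n) + e"
        using ev
      proof eventually_elim
        case (elim n)
        have "\<bar>stream (polar d \<alpha>) - stream (polar (r n) \<alpha>)\<bar> \<le> speed_bound * (d - r n)"
          using elim by (intro radial_lipschitz rR) auto
        moreover have "\<bar>stream (polar (r n) \<alpha>) - stream (polar (r n) 0)\<bar> \<le> r n * \<epsilon> * (2 * pi)"
          using \<delta>(2)[OF rR(1)] elim by (intro angular_bound[OF rR(1) _ \<alpha>(1,2)]) auto
        moreover have "r n * \<epsilon> * (2 * pi) \<le> 2 * R * \<epsilon> * (2 * pi)"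
          using rR(2) \<open>\<epsilon> > 0\<close> by (intro mult_right_mono) auto
        moreover have "2 * R * \<epsilon> * (2 * pi) = e" using R by (simp add: \<epsilon>_def)
        ultimately show ?case unfolding f_def \<alpha>(3) by linarith
      qed
      moreover have "(\<lambda>n. \<bar>stream x - f n\<bar>) \<longlonglongrightarrow> \<bar>stream x - k\<bar>" by (intro tendsto_intros k)
      moreover have "(\<lambda>n. speed_bound * (d - r n) + e) \<longlonglongrightarrow> speed_bound * (d - R) + e" by (intro tendsto_intros rlim)
      ultimately show "\<bar>stream x - k\<bar> \<le> speed_bound * (dist c x - R) + e"
        unfolding d_def[symmetric] by (intro tendsto_le[OF sequentially_bot]) auto
    qed
  qed
qed

text \<open>It is \<open>0\<close> where \<open>dist\<^sup>2 \<le> R\<^sup>2 (1 + 1 / n)\<close> and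
  \<open>1\<close> where \<open>dist\<^sup>2 \<ge> R\<^sup>2 (1 + 2 / n)\<close>, so the transition takes place
  at a positive distance from the circle.\<close>

definition inner_cut :: "nat \<Rightarrow> plane \<Rightarrow> real" where
  "inner_cut n x = smooth_step (real n * ((x - c) \<bullet> (x - c) / R\<^sup>2 - 1) - 1)"

definition boundary_value :: real where
  "boundary_value = (SOME k. \<forall>x\<in>I. \<bar>stream x - k\<bar> \<le> speed_bound * (dist c x - R))"

lemma boundary_value: "x \<in> I \<Longrightarrow> \<bar>stream x - boundary_value\<bar> \<le> speed_bound * (dist c x - R)"
proof -
  have "\<exists>k. \<forall>x\<in>I. \<bar>stream x - k\<bar> \<le> speed_bound * (dist c x - R)" using stream_boundary_value by metis
  then have "\<forall>x\<in>I. \<bar>stream x - boundary_value\<bar> \<le> speed_bound * (dist c x - R)" unfolding boundary_value_def by (rule someI_ex)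
  then show "x \<in> I \<Longrightarrow> ?thesis" by blast
qed

text \<open>A smooth function with bounded support that is constant on the body and agrees with the stream
  function on an annulus; the annuli exhaust the exterior as \<open>n\<close> grows. The value on the body is in
  general not zero, so such functions are admissible in the vorticity equation only because there is no
  circulation around the body.\<close>

definition test_fun :: "nat \<Rightarrow> plane \<Rightarrow> real" where
  "test_fun n x = cutoff c (real n) x * (boundary_value + inner_cut n x * (stream x - boundary_value))"

lemma sq_dist: "(x - c) \<bullet> (x - c) = (dist c x)\<^sup>2"
  by (simp add: dist_norm norm_minus_commute[of c x] power2_norm_eq_inner)

lemma smooth_on_inner_cut: "smooth_on UNIV (inner_cut n)"
  unfolding inner_cut_def[abs_def] divide_inverse
  by (intro smooth_on_UNIV_compose[OF smooth_on_step] smooth_on_diff smooth_on_mult smooth_on_const smooth_on_sq_dist)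

lemma inner_cut_0: "(dist c x)\<^sup>2 \<le> R\<^sup>2 * (1 + inverse (real n)) \<Longrightarrow> n > 0 \<Longrightarrow> inner_cut n x = 0"
  unfolding inner_cut_def sq_dist using R by (intro smooth_step_0) (simp add: field_simps)

lemma inner_cut_1: "(dist c x)\<^sup>2 \<ge> R\<^sup>2 * (1 + 2 * inverse (real n)) \<Longrightarrow> n > 0 \<Longrightarrow> inner_cut n x = 1"
  unfolding inner_cut_def sq_dist using R by (intro smooth_step_1) (simp add: field_simps)

lemma smooth_on_test_fun:
  assumes n: "n > 0" shows "smooth_on UNIV (test_fun n)"
proof (rule smooth_onI)
  fix x :: plane
  have cut: "smooth_on U (cutoff c (real n))" "smooth_on U (inner_cut n)" for U
    using smooth_on_cutoff smooth_on_inner_cut smooth_on_subset by blast+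
  show "\<exists>U f'. open U \<and> x \<in> U \<and> Cinf U None f' \<and> (\<forall>y\<in>UNIV \<inter> U. f' y = test_fun n y)"
  proof (cases "x \<in> I")
    case True
    have st: "smooth_on I stream" using stream_smooth smooth_on_open[OF open_I] by blast
    have "smooth_on I (test_fun n)"
      unfolding test_fun_def[abs_def]
      by (intro smooth_on_mult smooth_on_add smooth_on_diff smooth_on_const cut st)
    then show ?thesis using True open_I smooth_on_open[OF open_I] by blast
  next
    case False
    define U where "U = {y. (dist c y)\<^sup>2 < R\<^sup>2 * (1 + inverse (real n))}"
    have oU: "open U" unfolding U_def by (intro open_Collect_less continuous_intros)
    have "(dist c x)\<^sup>2 \<le> R\<^sup>2" using False by (intro power_mono) auto
    also have "\<dots> < R\<^sup>2 * (1 + inverse (real n))" using R n by (simp add: field_simps)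
    finally have "x \<in> U" by (simp add: U_def)
    moreover have "test_fun n y = cutoff c (real n) y * boundary_value" if "y \<in> U" for y
      using inner_cut_0[OF _ n, of y] that by (simp add: test_fun_def U_def)
    moreover have "Cinf U None (\<lambda>y. cutoff c (real n) y * boundary_value)"
      using smooth_on_mult[OF cut(1)[of U] smooth_on_const] smooth_on_open[OF oU] by blast
    ultimately show ?thesis using oU by (intro exI[of _ U] exI[of _ "\<lambda>y. cutoff c (real n) y * boundary_value"]) auto
  qed
qed

lemma bounded_test_fun: "n > 0 \<Longrightarrow> bounded {x. test_fun n x \<noteq> 0}"
  by (rule bounded_subset[OF bounded_cutoff_support[of "real n" c]]) (auto simp: test_fun_def)

lemma test_fun_body: "real n \<ge> R \<Longrightarrow> n > 0 \<Longrightarrow> x \<in> cball c R \<Longrightarrow> test_fun n x = boundary_value"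
proof -
  assume n: "real n \<ge> R" "n > 0" and x: "x \<in> cball c R"
  have "(dist c x)\<^sup>2 \<le> R\<^sup>2" using x by (intro power_mono) auto
  also have "\<dots> \<le> R\<^sup>2 * (1 + inverse (real n))" by (simp add: field_simps)
  finally have "inner_cut n x = 0" using n(2) by (rule inner_cut_0)
  moreover have "cutoff c (real n) x = 1" using n x by (intro cutoff_1) auto
  ultimately show ?thesis by (simp add: test_fun_def)
qed

lemma test_fun_eventually:
  assumes x: "x \<in> I"
  shows "\<forall>\<^sub>F n in sequentially. test_fun n x = stream x \<and> curl (test_fun n) x = v x"
proof -
  define d where "d = (dist c x)\<^sup>2"
  have d: "d > R\<^sup>2" unfolding d_def using x R by (intro power_strict_mono) auto
  have "(\<lambda>n. R\<^sup>2 * (1 + 2 * inverse (real n))) \<longlonglongrightarrow> R\<^sup>2 * (1 + 2 * 0)"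
    by (intro tendsto_intros lim_inverse_n)
  then have "\<forall>\<^sub>F n in sequentially. R\<^sup>2 * (1 + 2 * inverse (real n)) < d" using d by (intro order_tendstoD) auto
  moreover have "\<forall>\<^sub>F n in sequentially. real n > dist c x" by (rule eventually_gt_at_top[THEN eventually_compose_filterlim, OF filterlim_real_sequentially])
  ultimately show ?thesis using eventually_gt_at_top[of 0]
  proof eventually_elim
    case (elim n)
    define U where "U = {y. R\<^sup>2 * (1 + 2 * inverse (real n)) < (dist c y)\<^sup>2 \<and> dist c y < real n}"
    have oU: "open U" unfolding U_def by (intro open_Collect_conj open_Collect_less continuous_intros)
    have xU: "x \<in> U" using elim by (simp add: U_def d_def)
    have eq: "test_fun n y = stream y" if "y \<in> U" for y
      using that inner_cut_1[of n y] cutoff_1[of "real n" c y] elim by (simp add: test_fun_def U_def)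
    then show ?case using xU curl_cong_open[OF oU xU eq] stream_curl[OF x] by simp
  qed
qed

lemma curl_step_bound:
  obtains B where "B \<ge> 0"
    "\<And>a b x. \<exists>F. ((\<lambda>x. smooth_step (a * ((x - c) \<bullet> (x - c)) + b)) has_derivative F) (at x)"
    "\<And>a b x. norm (curl (\<lambda>x. smooth_step (a * ((x - c) \<bullet> (x - c)) + b)) x) \<le> B * \<bar>a\<bar> * (2 * dist c x)"
    "\<And>a b x. a * (dist c x)\<^sup>2 + b < 0 \<or> a * (dist c x)\<^sup>2 + b > 1 \<Longrightarrow> curl (\<lambda>x. smooth_step (a * ((x - c) \<bullet> (x - c)) + b)) x = 0"
proof -
  obtain B where B: "B \<ge> 0" "\<And>t. \<exists>d. (smooth_step has_real_derivative d) (at t) \<and> \<bar>d\<bar> \<le> B \<and> (t < 0 \<or> t > 1 \<longrightarrow> d = 0)"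
    using smooth_step_derivative by blast
  define g where "g a b x = a * ((x - c) \<bullet> (x - c)) + b" for a b and x :: plane
  have Dg: "(g a b has_derivative (\<lambda>h. a * (2 * ((x - c) \<bullet> h)))) (at x)" for a b x
    unfolding g_def using has_derivative_add[OF has_derivative_mult_right[OF sq_dist_derivative] has_derivative_const] by simp
  have cg: "curl (g a b) x = a *\<^sub>R curl (\<lambda>x. (x - c) \<bullet> (x - c)) x" for a b x
    unfolding curl_eq[OF Dg] curl_eq[OF sq_dist_derivative] by (rule vec2_eqI) simp_all
  have main: "\<exists>F. ((\<lambda>x. smooth_step (g a b x)) has_derivative F) (at x) \<and>
      norm (curl (\<lambda>x. smooth_step (g a b x)) x) \<le> B * \<bar>a\<bar> * (2 * dist c x) \<and>
      (g a b x < 0 \<or> g a b x > 1 \<longrightarrow> curl (\<lambda>x. smooth_step (g a b x)) x = 0)" for a b x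
  proof -
    obtain d where d: "(smooth_step has_real_derivative d) (at (g a b x))" "\<bar>d\<bar> \<le> B" "g a b x < 0 \<or> g a b x > 1 \<longrightarrow> d = 0"
      using B(2) by blast
    note cc = curl_compose_real[OF Dg d(1)]
    have "norm (curl (\<lambda>x. smooth_step (g a b x)) x) = \<bar>d\<bar> * (\<bar>a\<bar> * (2 * dist c x))"
      unfolding cc(1) cg by (simp add: norm_curl_sq_dist abs_mult)
    also have "\<dots> \<le> B * (\<bar>a\<bar> * (2 * dist c x))" using d(2) by (intro mult_right_mono) auto
    finally show ?thesis using cc(2) d(3) cc(1) by (auto simp: mult.assoc)
  qed
  show thesis
  proof (rule that[OF B(1)])
    fix a b :: real and x :: plane
    note m = main[of a b x, unfolded g_def]
    show "\<exists>F. ((\<lambda>x. smooth_step (a * ((x - c) \<bullet> (x - c)) + b)) has_derivative F) (at x)"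
      "norm (curl (\<lambda>x. smooth_step (a * ((x - c) \<bullet> (x - c)) + b)) x) \<le> B * \<bar>a\<bar> * (2 * dist c x)"
      using m by blast+
    assume "a * (dist c x)\<^sup>2 + b < 0 \<or> a * (dist c x)\<^sup>2 + b > 1"
    then have "a * ((x - c) \<bullet> (x - c)) + b < 0 \<or> a * ((x - c) \<bullet> (x - c)) + b > 1" unfolding sq_dist .
    then show "curl (\<lambda>x. smooth_step (a * ((x - c) \<bullet> (x - c)) + b)) x = 0" using m by blast
  qed
qed

text \<open>The cut-offs do no harm. In the inner layer, of width \<open>O(1/n)\<close>, the gradient of the
  cut-off is \<open>O(n)\<close> but the stream function differs from its boundary value by
  \<open>O(1/n)\<close>. In the outer layer, at distance about \<open>n\<close>, the gradient is
  \<open>O(1/n)\<close> and the stream function is \<open>O(n\<^sup>1\<^sup>-\<^sup>s)\<close>. So both error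
  terms obey the same decay as \<open>v\<close>.\<close>

lemma test_fun_curl_bound:
  obtains D N where "\<And>n x. n \<ge> N \<Longrightarrow> x \<in> I \<Longrightarrow> norm (curl (test_fun n) x) \<le> D * dist c x powr (- s)"
proof -
  obtain B where B: "B \<ge> 0"
    "\<And>a b x. \<exists>F. ((\<lambda>x. smooth_step (a * ((x - c) \<bullet> (x - c)) + b)) has_derivative F) (at x)"
    "\<And>a b x. norm (curl (\<lambda>x. smooth_step (a * ((x - c) \<bullet> (x - c)) + b)) x) \<le> B * \<bar>a\<bar> * (2 * dist c x)"
    "\<And>a b x. a * (dist c x)\<^sup>2 + b < 0 \<or> a * (dist c x)\<^sup>2 + b > 1 \<Longrightarrow> curl (\<lambda>x. smooth_step (a * ((x - c) \<bullet> (x - c)) + b)) x = 0"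
    using curl_step_bound by blast
  define Ks where "Ks = C * (\<Sum>n. (real n + 1) powr (- s))"
  have Ks0: "Ks \<ge> 0" unfolding Ks_def using C_nonneg summable_rate by (intro mult_nonneg_nonneg suminf_nonneg) auto
  \<comment> \<open>one summand for the field itself and one for each layer, see \<open>t1\<close>, \<open>t2\<close> and \<open>t3\<close> below\<close>
  define D where "D = C + 8 * speed_bound * B * (2 * R) powr s + 3 * Ks * B"
  \<comment> \<open>from here on the inner layer ends before the outer one begins\<close>
  define N where "N = nat \<lceil>2 * R\<rceil> + 2"
  show thesis
  proof (rule that[of N D])
    fix n x assume n: "n \<ge> N" and x: "x \<in> I"
    define \<rho> where "\<rho> = dist c x"
    have \<rho>: "\<rho> > R" using x by (simp add: \<rho>_def)
    have nR: "real n \<ge> 2 * R" "n \<ge> 2" using n unfolding N_def by linarith+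
    have n0: "real n > 0" using nR by simp
    define A E where "A x = cutoff c (real n) x" and "E x = inner_cut n x" for x
    let ?k = boundary_value
    have A_eq: "A = (\<lambda>x. 1 - smooth_step ((1 / (3 * (real n)\<^sup>2)) * ((x - c) \<bullet> (x - c)) + (- 1 / 3)))"
      using n0 by (auto simp: A_def cutoff_def fun_eq_iff diff_divide_distrib)
    have E_eq: "E = (\<lambda>x. smooth_step ((real n / R\<^sup>2) * ((x - c) \<bullet> (x - c)) + (- real n - 1)))"
    proof -
      have "real n * (q / R\<^sup>2 - 1) - 1 = (real n / R\<^sup>2) * q + (- real n - 1)" for q
        by (simp add: right_diff_distrib)
      then show ?thesis unfolding E_def[abs_def] inner_cut_def by presburger
    qed
    obtain FE where FE: "(E has_derivative FE) (at x)" unfolding E_eq using B(2) by blast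
    obtain FA' where FA': "((\<lambda>x. smooth_step ((1 / (3 * (real n)\<^sup>2)) * ((x - c) \<bullet> (x - c)) + (- 1 / 3))) has_derivative FA') (at x)"
      using B(2) by blast
    have FA: "(A has_derivative (\<lambda>h. - FA' h)) (at x)"
      unfolding A_eq using has_derivative_diff[OF has_derivative_const FA'] by simp
    have cA: "curl A x = - curl (\<lambda>x. smooth_step ((1 / (3 * (real n)\<^sup>2)) * ((x - c) \<bullet> (x - c)) + (- 1 / 3))) x"
      unfolding curl_eq[OF FA] curl_eq[OF FA'] by (rule vec2_eqI) simp_all
    have st: "((\<lambda>x. stream x - ?k) has_derivative (\<lambda>h. rot90 (v x) \<bullet> h)) (at x)"
      using has_derivative_diff[OF stream_derivative[OF x] has_derivative_const] by simp
    have prod: "((\<lambda>x. E x * (stream x - ?k)) has_derivative (\<lambda>h. E x * (rot90 (v x) \<bullet> h) + FE h * (stream x - ?k))) (at x)"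
      by (rule has_derivative_mult[OF FE st])
    have FB: "((\<lambda>x. ?k + E x * (stream x - ?k)) has_derivative (\<lambda>h. E x * (rot90 (v x) \<bullet> h) + FE h * (stream x - ?k))) (at x)"
      using has_derivative_add[OF has_derivative_const prod] by simp
    have "curl (\<lambda>x. ?k + E x * (stream x - ?k)) x = curl (\<lambda>x. E x * (stream x - ?k)) x"
      unfolding curl_eq[OF FB] curl_eq[OF prod] ..
    also have "\<dots> = E x *\<^sub>R v x + (stream x - ?k) *\<^sub>R curl E x"
      unfolding curl_mult[OF FE st] curl_rot90[OF st] ..
    finally have cB: "curl (\<lambda>x. ?k + E x * (stream x - ?k)) x = E x *\<^sub>R v x + (stream x - ?k) *\<^sub>R curl E x" .
    have tf: "curl (test_fun n) x = A x *\<^sub>R (E x *\<^sub>R v x + (stream x - ?k) *\<^sub>R curl E x)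
        + (?k + E x * (stream x - ?k)) *\<^sub>R curl A x"
      unfolding test_fun_def[abs_def] A_def[symmetric] E_def[symmetric] curl_mult[OF FA FB] cB ..
    have A01: "\<bar>A x\<bar> \<le> 1" "\<bar>E x\<bar> \<le> 1"
      unfolding A_def E_def cutoff_def inner_cut_def using smooth_step_bounds by (auto simp: abs_le_iff)
    have t1: "norm (E x *\<^sub>R v x) \<le> C * \<rho> powr (- s)"
    proof -
      have "norm (E x *\<^sub>R v x) \<le> 1 * norm (v x)" unfolding norm_scaleR by (intro mult_right_mono A01) auto
      moreover have "x \<in> - ball c R" using x by auto
      from bspec[OF v_bound this] have "norm (v x) \<le> C * \<rho> powr (- s)" unfolding \<rho>_def .
      ultimately show ?thesis by simp
    qed
    have t2: "norm ((stream x - ?k) *\<^sub>R curl E x) \<le> 8 * speed_bound * B * (2 * R) powr s * \<rho> powr (- s)"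
    proof (cases "curl E x = 0")
      case False
      have "\<not> ((real n / R\<^sup>2) * \<rho>\<^sup>2 + (- real n - 1) > 1)" using B(4) False unfolding E_eq \<rho>_def by blast
      then have "\<rho>\<^sup>2 * real n \<le> R\<^sup>2 * (real n + 2)" using R by (simp add: field_simps)
      then have q: "(\<rho>\<^sup>2 - R\<^sup>2) * real n \<le> 2 * R\<^sup>2" by (simp add: algebra_simps)
      also have "\<dots> \<le> R\<^sup>2 * real n" using nR R by simp
      finally have "\<rho>\<^sup>2 - R\<^sup>2 \<le> R\<^sup>2" using n0 by simp
      moreover have "(2 * R)\<^sup>2 = 4 * R\<^sup>2" by (simp add: power_mult_distrib)
      ultimately have "\<rho>\<^sup>2 \<le> (2 * R)\<^sup>2" using zero_le_power2[of R] by linarith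
      then have \<rho>2: "\<rho> \<le> 2 * R" by (rule power2_le_imp_le) (use R in simp)
      have "(\<rho> - R) * R \<le> (\<rho> - R) * (\<rho> + R)" using \<rho> R by (intro mult_left_mono) auto
      also have "\<dots> = \<rho>\<^sup>2 - R\<^sup>2" by (simp add: power2_eq_square algebra_simps)
      finally have "(\<rho> - R) * R * real n \<le> 2 * R\<^sup>2" using q n0 by (meson mult_right_mono order_trans less_imp_le)
      then have rn: "(\<rho> - R) * real n \<le> 2 * R" using R by (simp add: power2_eq_square)
      have "norm ((stream x - ?k) *\<^sub>R curl E x) = \<bar>stream x - ?k\<bar> * norm (curl E x)" by simp
      also have "\<dots> \<le> (speed_bound * (\<rho> - R)) * (B * \<bar>real n / R\<^sup>2\<bar> * (2 * \<rho>))"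
        unfolding \<rho>_def E_eq by (intro mult_mono boundary_value x B(3)) (use \<rho> speed_bound_nonneg in \<open>auto simp: \<rho>_def\<close>)
      also have "\<dots> = (2 * speed_bound * B / R\<^sup>2) * \<rho> * ((\<rho> - R) * real n)" using n0 by simp
      also have "\<dots> \<le> (2 * speed_bound * B / R\<^sup>2) * (2 * R) * (2 * R)"
        by (rule mult_mono[OF mult_left_mono[OF \<rho>2] rn]) (use \<rho> R speed_bound_nonneg B(1) in auto)
      also have "\<dots> = 8 * speed_bound * B" using R by (simp add: power2_eq_square)
      also have "\<dots> \<le> 8 * speed_bound * B * ((2 * R) powr s * \<rho> powr (- s))"
      proof -
        have "(2 * R) powr (- s) \<le> \<rho> powr (- s)" using \<rho>2 \<rho> R s by (intro powr_mono2') auto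
        then have "(2 * R) powr s * (2 * R) powr (- s) \<le> (2 * R) powr s * \<rho> powr (- s)" by (intro mult_left_mono) auto
        then have "1 \<le> (2 * R) powr s * \<rho> powr (- s)" using R by (simp add: powr_add[symmetric])
        then show ?thesis using speed_bound_nonneg B(1) mult_left_mono[of 1 "(2 * R) powr s * \<rho> powr (- s)" "8 * speed_bound * B"] by simp
      qed
      finally show ?thesis by (simp add: mult.assoc)
    qed (use speed_bound_nonneg B(1) in simp)
    have t3: "norm ((?k + E x * (stream x - ?k)) *\<^sub>R curl A x) \<le> 3 * Ks * B * \<rho> powr (- s)"
    proof (cases "curl A x = 0")
      case False
      have "curl (\<lambda>x. smooth_step ((1 / (3 * (real n)\<^sup>2)) * ((x - c) \<bullet> (x - c)) + (- 1 / 3))) x \<noteq> 0"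
        using False unfolding cA neg_equal_0_iff_equal .
      then have ne: "\<not> ((1 / (3 * (real n)\<^sup>2)) * \<rho>\<^sup>2 + (- 1 / 3) < 0)" "\<not> ((1 / (3 * (real n)\<^sup>2)) * \<rho>\<^sup>2 + (- 1 / 3) > 1)"
        using B(4)[of "1 / (3 * (real n)\<^sup>2)" x "- 1 / 3"] unfolding \<rho>_def by blast+
      have lo: "(real n)\<^sup>2 \<le> \<rho>\<^sup>2" and hi: "\<rho>\<^sup>2 \<le> 4 * (real n)\<^sup>2" using ne n0 by (simp_all add: field_simps)
      have "(2 * R)\<^sup>2 \<le> (real n)\<^sup>2" using nR R by (intro power_mono) auto
      then have r4: "4 * R\<^sup>2 \<le> \<rho>\<^sup>2" using lo by (simp add: power_mult_distrib)
      have "E x = 1" unfolding E_def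
      proof (rule inner_cut_1)
        have "2 * inverse (real n) \<le> 1" using nR by (simp add: field_simps)
        then have "R\<^sup>2 * (1 + 2 * inverse (real n)) \<le> R\<^sup>2 * 4" by (intro mult_left_mono) auto
        then show "R\<^sup>2 * (1 + 2 * inverse (real n)) \<le> (dist c x)\<^sup>2" using r4 unfolding \<rho>_def by linarith
      qed (use nR in simp)
      then have "norm ((?k + E x * (stream x - ?k)) *\<^sub>R curl A x) = \<bar>stream x\<bar> * norm (curl A x)" by simp
      also have "\<dots> \<le> (Ks * \<rho> powr (1 - s)) * (B * \<bar>1 / (3 * (real n)\<^sup>2)\<bar> * (2 * \<rho>))"
        unfolding \<rho>_def Ks_def cA norm_minus_cancel
        by (intro mult_mono stream_bound x B(3)) (use Ks0 in \<open>auto simp: Ks_def\<close>)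
      also have "\<dots> \<le> (Ks * \<rho> powr (1 - s)) * (B * (3 / \<rho>))"
      proof -
        have "\<rho> * \<rho> * 2 \<le> 9 * (real n)\<^sup>2" using hi zero_le_power2[of "real n"] unfolding power2_eq_square by linarith
        then have "\<bar>1 / (3 * (real n)\<^sup>2)\<bar> * (2 * \<rho>) \<le> 3 / \<rho>" using n0 \<rho> R by (simp add: field_simps power2_eq_square)
        then have "B * (\<bar>1 / (3 * (real n)\<^sup>2)\<bar> * (2 * \<rho>)) \<le> B * (3 / \<rho>)" using B(1) by (rule mult_left_mono)
        then show ?thesis using Ks0 by (intro mult_left_mono) (auto simp: mult.assoc)
      qed
      also have "\<dots> = 3 * Ks * B * \<rho> powr (- s)"
        using \<rho> R by (simp add: powr_diff powr_minus field_simps)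
      finally show ?thesis .
    qed (use Ks0 B(1) in simp)
    have "norm (A x *\<^sub>R (E x *\<^sub>R v x + (stream x - ?k) *\<^sub>R curl E x)) \<le> 1 * norm (E x *\<^sub>R v x + (stream x - ?k) *\<^sub>R curl E x)"
      unfolding norm_scaleR[of "A x"] by (intro mult_right_mono A01) auto
    then have "norm (curl (test_fun n) x) \<le> norm (E x *\<^sub>R v x + (stream x - ?k) *\<^sub>R curl E x) + norm ((?k + E x * (stream x - ?k)) *\<^sub>R curl A x)"
      unfolding tf by (intro norm_triangle_mono) auto
    also have "\<dots> \<le> C * \<rho> powr (- s) + 8 * speed_bound * B * (2 * R) powr s * \<rho> powr (- s) + 3 * Ks * B * \<rho> powr (- s)"
      by (intro add_mono norm_triangle_mono t1 t2 t3)
    also have "\<dots> = D * dist c x powr (- s)" by (simp add: D_def \<rho>_def algebra_simps)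
    finally show "norm (curl (test_fun n) x) \<le> D * dist c x powr (- s)" .
  qed
qed

end

section \<open>The pairing of point vortices with solenoidal fields\<close>

lemma dyadic_scale:
  fixes y :: real assumes "y \<ge> 1" obtains j where "2 ^ j \<le> y" "y < 2 ^ Suc j"
proof -
  obtain n where n: "y < 2 ^ n" using real_arch_pow[of 2 y] by auto
  define k where "k = (LEAST n. y < 2 ^ n)"
  have k: "y < 2 ^ k" unfolding k_def by (rule LeastI[of _ n]) (rule n)
  then have "k \<noteq> 0" using assms by (cases k) auto
  then obtain j where j: "k = Suc j" by (cases k) auto
  have "\<not> y < 2 ^ j" using not_less_Least[of j "\<lambda>n. y < 2 ^ n"] j unfolding k_def by simp
  then show thesis using that[of j] k j by simp
qed

text \<open>On dyadic annuli the area grows by a factor \<open>4\<close> and the integrand shrinks by a factor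
  \<open>2\<^sup>-\<^sup>p < 1/4\<close>, so the function is dominated by a convergent sum over discs.\<close>

lemma integrable_power_decay:
  fixes c :: plane
  assumes M: "M > 0" and p: "p > 2"
  shows "integrable lborel (\<lambda>x. indicator (- ball c M) x * dist c x powr (- p))"
proof -
  \<comment> \<open>constant on discs: on the annulus between \<open>2\<^sup>j M\<close> and \<open>2\<^sup>j\<^sup>+\<^sup>1 M\<close> the function is at most \<open>f j\<close>\<close>
  define f where "f j x = indicator (cball c (2 ^ Suc j * M)) x * ((2 ^ j * M) powr (- p))" for j :: nat and x :: plane
  define \<theta> where "\<theta> = (2::real) powr (- p)"
  have \<theta>: "0 < \<theta>" "4 * \<theta> < 1"
  proof -
    have "\<theta> < 2 powr (- 2)" unfolding \<theta>_def using p by (intro powr_less_mono) auto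
    also have "(2::real) powr (- 2) = 1/4" by (simp add: powr_minus)
    finally show "4 * \<theta> < 1" by simp
  qed (simp add: \<theta>_def)
  have pw: "(2 ^ j * M) powr (- p) = \<theta> ^ j * M powr (- p)" for j :: nat
    using M by (simp add: powr_mult \<theta>_def powr_power powr_powr mult.commute flip: powr_realpow)
  have int: "integrable lborel (f j)" for j
    unfolding f_def by (intro integrable_mult_left) (rule integrable_real_indicator, simp, rule emeasure_lborel_cball_finite)
  have norm_int: "(\<integral>x. norm (f j x) \<partial>lborel) = (4 * \<theta>) ^ j * (unit_ball_vol 2 * 4 * M\<^sup>2 * M powr (- p))" for j
  proof -
    have "(\<integral>x. norm (f j x) \<partial>lborel) = (\<integral>x. indicator (cball c (2 ^ Suc j * M)) x * ((2 ^ j * M) powr (- p)) \<partial>lborel)"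
      by (intro Bochner_Integration.integral_cong) (auto simp: f_def indicator_def)
    also have "\<dots> = measure lborel (cball c (2 ^ Suc j * M)) * ((2 ^ j * M) powr (- p))" by simp
    also have "measure lborel (cball c (2 ^ Suc j * M)) = unit_ball_vol 2 * (2 ^ Suc j * M) ^ 2"
      using M by (subst content_cball) auto
    finally have "(\<integral>x. norm (f j x) \<partial>lborel) = unit_ball_vol 2 * (2 ^ Suc j * M) ^ 2 * (\<theta> ^ j * M powr (- p))"
      unfolding pw .
    moreover have "(2 ^ Suc j * M) ^ 2 = 4 ^ j * (4 * M\<^sup>2)"
    proof -
      have "(2 ^ j)\<^sup>2 = (4::real) ^ j" by (simp add: power2_eq_square flip: power_mult_distrib)
      then show ?thesis by (simp add: power_mult_distrib)
    qed
    ultimately show ?thesis by (simp add: power_mult_distrib mult_ac)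
  qed
  have "summable (\<lambda>j. (\<integral>x. norm (f j x) \<partial>lborel))"
    unfolding norm_int using \<theta> by (intro summable_mult2 summable_geometric) auto
  moreover have sumf: "summable (\<lambda>j. norm (f j x))" for x
  proof (rule summable_comparison_test)
    show "\<exists>N. \<forall>n\<ge>N. norm (norm (f n x)) \<le> \<theta> ^ n * M powr (- p)"
      using \<theta>(1) by (intro exI[of _ 0]) (auto simp: f_def pw indicator_def)
    show "summable (\<lambda>n. \<theta> ^ n * M powr (- p))" using \<theta> by (intro summable_mult2 summable_geometric) auto
  qed
  ultimately have F: "integrable lborel (\<lambda>x. \<Sum>j. f j x)"
    using int by (intro integrable_suminf) auto
  show ?thesis
  proof (rule Bochner_Integration.integrable_bound[OF F])
    show "(\<lambda>x. indicator (- ball c M) x * dist c x powr (- p)) \<in> borel_measurable lborel"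
      by measurable
    show "AE x in lborel. norm (indicator (- ball c M) x * dist c x powr (- p)) \<le> norm (\<Sum>j. f j x)"
    proof (rule AE_I2)
      fix x :: plane
      have pos: "0 \<le> f j x" for j by (simp add: f_def)
      have s: "summable (\<lambda>j. f j x)" by (rule summable_norm_cancel[OF sumf])
      show "norm (indicator (- ball c M) x * dist c x powr (- p)) \<le> norm (\<Sum>j. f j x)"
      proof (cases "dist c x \<ge> M")
        case True
        then obtain j where j: "2 ^ j \<le> dist c x / M" "dist c x / M < 2 ^ Suc j"
          using dyadic_scale[of "dist c x / M"] M by auto
        have "dist c x powr (- p) \<le> (2 ^ j * M) powr (- p)"
          using j(1) M p by (intro powr_mono2') (auto simp: field_simps)
        also have "\<dots> = f j x" using j(2) M by (simp add: f_def indicator_def field_simps)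
        also have "\<dots> \<le> (\<Sum>j. f j x)" using sum_le_suminf[OF s, of "{j}"] pos by simp
        finally show ?thesis using suminf_nonneg[OF s pos] by (simp add: indicator_def)
      qed (use s pos in \<open>simp add: indicator_def\<close>)
    qed
  qed
qed

context solid_fluid begin

abbreviation "ctr \<equiv> centre S"
abbreviation "rad \<equiv> radius S"

text \<open>A multiple of this dominates the integrands in \<open>vortex_pairing\<close>.\<close>

definition weight :: "(plane \<Rightarrow> plane) \<Rightarrow> plane \<Rightarrow> real" where
  "weight a x = norm (indicator (fluid S) x *\<^sub>R a x) * dist ctr x powr (- rate S)"

lemma vortex_form_measurable:
  assumes a: "has_vortices S \<Gamma> xbar a"
  shows "(\<lambda>x. indicator (fluid S) x *\<^sub>R a x) \<in> borel_measurable lebesgue"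
proof (rule borel_measurable_LIMSEQ_metric)
  fix m :: nat
  have "compact (fluid S \<inter> cball ctr (real m))"
    using exterior_closed[OF fluid_exterior(1)] by (simp add: closed_Int_compact)
  then have "set_integrable lebesgue (fluid S \<inter> cball ctr (real m)) a"
    using a unfolding has_vortices_def by auto
  then show "(\<lambda>x. indicator (fluid S \<inter> cball ctr (real m)) x *\<^sub>R a x) \<in> borel_measurable lebesgue"
    unfolding set_integrable_def by (rule borel_measurable_integrable)
next
  fix x :: plane
  obtain N :: nat where N: "dist ctr x \<le> real N" using real_arch_simple by blast
  have "\<forall>\<^sub>F m in sequentially. indicator (fluid S \<inter> cball ctr (real m)) x *\<^sub>R a x = indicator (fluid S) x *\<^sub>R a x"
    using eventually_ge_at_top[of N] by eventually_elim (use N in \<open>auto simp: indicator_def\<close>)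
  then show "(\<lambda>m. indicator (fluid S \<inter> cball ctr (real m)) x *\<^sub>R a x) \<longlonglongrightarrow> indicator (fluid S) x *\<^sub>R a x"
    by (rule tendsto_eventually)
qed

lemma dist_powr_measurable: "(\<lambda>x. dist ctr x powr p) \<in> borel_measurable lebesgue"
  by (rule measurable_completion) measurable

text \<open>Near the body this is the local integrability of \<open>a\<close>. Far out the integrand decays like
  \<open>|x|\<close> to the power \<open>- 1 - rate\<close>, which is integrable in the plane because
  \<open>rate > 1\<close>.\<close>

lemma integrable_weight:
  assumes a: "has_vortices S \<Gamma> xbar a"
  shows "integrable lebesgue (weight a)"
proof -
  let ?s = "rate S"
  have "(\<lambda>x. norm (a x)) \<in> O[at_infinity](\<lambda>x. 1 / norm x)" using a by (simp add: has_vortices_def)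
  then obtain K where K: "K > 0" "\<forall>\<^sub>F x in at_infinity. norm (norm (a x)) \<le> K * norm (1 / norm x)"
    by (rule landau_o.bigE)
  then obtain M1 where M1: "\<And>x. norm x \<ge> M1 \<Longrightarrow> norm (a x) \<le> K / norm x"
    unfolding eventually_at_infinity by auto
  define M where "M = \<bar>M1\<bar> + 2 * norm ctr + rad + 1"
  have M: "M > 0" using radius by (auto simp: M_def intro: add_nonneg_pos add_pos_pos)
  let ?A = "fluid S \<inter> cball ctr M"
  have "compact ?A" using exterior_closed[OF fluid_exterior(1)] by (simp add: closed_Int_compact)
  then have "set_integrable lebesgue ?A a" using a unfolding has_vortices_def by auto
  then have i1: "integrable lebesgue (\<lambda>x. rad powr (- ?s) * norm (indicator ?A x *\<^sub>R a x))"
    unfolding set_integrable_def by (intro integrable_mult_right integrable_norm)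
  have "integrable lborel (\<lambda>x. indicator (- ball ctr M) x * dist ctr x powr (- (1 + ?s)))"
    using rate M by (intro integrable_power_decay) auto
  then have "integrable lebesgue (\<lambda>x. indicator (- ball ctr M) x * dist ctr x powr (- (1 + ?s)))"
    by (subst integrable_completion) auto
  then have i2: "integrable lebesgue (\<lambda>x. (2 * K) * (indicator (- ball ctr M) x * dist ctr x powr (- (1 + ?s))))"
    by (rule integrable_mult_right)
  show ?thesis
  proof (rule Bochner_Integration.integrable_bound[OF Bochner_Integration.integrable_add[OF i1 i2]])
    show "weight a \<in> borel_measurable lebesgue"
      unfolding weight_def[abs_def]
      by (intro borel_measurable_times measurable_compose[OF vortex_form_measurable[OF a] borel_measurable_norm] dist_powr_measurable)
    show "AE x in lebesgue. norm (weight a x) \<le> norm (rad powr (- ?s) * norm (indicator ?A x *\<^sub>R a x)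
        + 2 * K * (indicator (- ball ctr M) x * dist ctr x powr (- (1 + ?s))))"
    proof (rule AE_I2)
      fix x :: plane
      have nn: "0 \<le> rad powr (- ?s) * norm (indicator ?A x *\<^sub>R a x)" "0 \<le> 2 * K * (indicator (- ball ctr M) x * dist ctr x powr (- (1 + ?s)))"
        using K(1) by auto
      have w0: "weight a x \<ge> 0" by (simp add: weight_def)
      have "weight a x \<le> rad powr (- ?s) * norm (indicator ?A x *\<^sub>R a x) + 2 * K * (indicator (- ball ctr M) x * dist ctr x powr (- (1 + ?s)))"
      proof (cases "x \<in> fluid S")
        case xf: True
        then have xr: "dist ctr x \<ge> rad" by (simp add: fluid_def)
        show ?thesis
        proof (cases "dist ctr x \<le> M")
          case True
          have "weight a x = norm (a x) * dist ctr x powr (- ?s)" using xf by (simp add: weight_def)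
          also have "\<dots> \<le> norm (a x) * rad powr (- ?s)"
            using xr radius rate by (intro mult_left_mono powr_mono2') auto
          also have "\<dots> = rad powr (- ?s) * norm (indicator ?A x *\<^sub>R a x)" using True xf by simp
          finally show ?thesis using nn by linarith
        next
          case False
          then have far: "dist ctr x > M" by simp
          have "norm x \<ge> dist ctr x - norm ctr" using norm_triangle_ineq4[of ctr x] by (simp add: dist_norm)
          then have nx: "norm x \<ge> dist ctr x / 2" "norm x \<ge> M1" using far unfolding M_def
            using radius norm_ge_zero[of ctr] by linarith+
          have d0: "dist ctr x > 0" using xr radius by linarith
          have "norm (a x) \<le> K / norm x" using M1 nx(2) .
          also have "\<dots> \<le> K / (dist ctr x / 2)"
          proof (rule divide_left_mono)
            have "norm x > 0" using nx(1) d0 by linarith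
            then show "0 < norm x * (dist ctr x / 2)" using d0 by simp
          qed (use nx(1) K(1) in auto)
          finally have "norm (a x) * dist ctr x powr (- ?s) \<le> (K / (dist ctr x / 2)) * dist ctr x powr (- ?s)"
            by (rule mult_right_mono) simp
          then have "weight a x \<le> (K / (dist ctr x / 2)) * dist ctr x powr (- ?s)"
            using xf by (simp add: weight_def)
          also have "\<dots> = 2 * K * (indicator (- ball ctr M) x * dist ctr x powr (- (1 + ?s)))"
            using far d0 by (simp add: indicator_def powr_diff powr_minus field_simps)
          finally show ?thesis using nn by linarith
        qed
      qed (use nn in \<open>simp add: weight_def\<close>)
      then show "norm (weight a x) \<le> norm (rad powr (- ?s) * norm (indicator ?A x *\<^sub>R a x)
        + 2 * K * (indicator (- ball ctr M) x * dist ctr x powr (- (1 + ?s))))" using w0 by simp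
    qed
  qed
qed

text \<open>Dominated convergence, applied to the vorticity equation for the test functions that approximate the
  stream function. The circle itself, where the approximation fails, is a null set.\<close>

lemma vortex_pairing:
  assumes a: "has_vortices S \<Gamma> xbar a" and v: "tangent_solenoidal v ctr rad (rate S) C"
    and xb: "\<forall>i. xbar $ i \<in> interior (fluid S)"
  shows "integral (fluid S) (\<lambda>x. a x \<bullet> v x) = (\<Sum>i\<in>UNIV. \<Gamma> $ i * solenoidal_exterior.stream v ctr (xbar $ i))"
proof -
  interpret tangent_solenoidal v ctr rad "rate S" C by (rule v)
  have xI: "xbar $ i \<in> I" for i using xb frontier_fluid(4)[OF radius] by simp
  obtain D N0 where D0: "\<And>n x. n \<ge> N0 \<Longrightarrow> x \<in> I \<Longrightarrow> norm (curl (test_fun n) x) \<le> D * dist ctr x powr (- rate S)"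
    by (rule test_fun_curl_bound) (rule that, blast)
  \<comment> \<open>the shift by \<open>N\<close> makes all the test functions admissible\<close>
  define N where "N = max N0 (nat \<lceil>rad\<rceil> + 1)"
  have N: "n + N > 0" "real (n + N) \<ge> rad" for n unfolding N_def by linarith+
  have D: "norm (curl (test_fun (n + N)) x) \<le> D * dist ctr x powr (- rate S)" if "x \<in> I" for n x
    using D0[OF _ that, of "n + N"] by (simp add: N_def)
  define s where "s n x = (indicator (fluid S) x *\<^sub>R a x) \<bullet> curl (test_fun (n + N)) x" for n x
  define f where "f x = (indicator (fluid S) x *\<^sub>R a x) \<bullet> (indicator I x *\<^sub>R v x)" for x
  have ms: "s n \<in> borel_measurable lebesgue" for n
  proof -
    have "continuous_on UNIV (curl (test_fun (n + N)))"
      by (rule smooth_on_continuous_on[OF smooth_on_curl[OF smooth_on_test_fun[OF N(1)]]])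
    then have "curl (test_fun (n + N)) \<in> borel_measurable lebesgue"
      by (intro measurable_completion) (simp add: borel_measurable_continuous_onI)
    then show ?thesis unfolding s_def by (intro borel_measurable_inner vortex_form_measurable[OF a])
  qed
  have mf: "f \<in> borel_measurable lebesgue"
  proof -
    have "I \<in> sets borel" using open_I by (rule borel_open)
    then have "(\<lambda>x. indicator I x *\<^sub>R v x) \<in> borel_measurable borel"
      by (rule borel_measurable_continuous_on_indicator[OF _ continuous_v(1)])
    then have "(\<lambda>x. indicator I x *\<^sub>R v x) \<in> borel_measurable lebesgue"
      by (intro measurable_completion) simp
    then show ?thesis unfolding f_def[abs_def] by (intro borel_measurable_inner vortex_form_measurable[OF a])
  qed
  have iw: "integrable lebesgue (\<lambda>x. D * weight a x)" by (rule integrable_mult_right[OF integrable_weight[OF a]])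
  have ns: "sphere ctr rad \<in> null_sets lebesgue" using negligible_sphere negligible_iff_null_sets by blast
  have split: "x \<in> I \<or> x \<notin> fluid S" if "x \<notin> sphere ctr rad" for x using that by (auto simp: fluid_def)
  have lim: "AE x in lebesgue. (\<lambda>n. s n x) \<longlonglongrightarrow> f x"
  proof (rule AE_I'[OF ns], rule subsetI, rule ccontr)
    fix x assume x: "x \<in> {x \<in> space lebesgue. \<not> (\<lambda>n. s n x) \<longlonglongrightarrow> f x}" "x \<notin> sphere ctr rad"
    from split[OF x(2)] have "(\<lambda>n. s n x) \<longlonglongrightarrow> f x"
    proof
      assume xI: "x \<in> I"
      have "\<forall>\<^sub>F n in sequentially. test_fun (n + N) x = stream x \<and> curl (test_fun (n + N)) x = v x"
        using test_fun_eventually[OF xI] by (rule eventually_sequentially_seg[THEN iffD2])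
      then have "\<forall>\<^sub>F n in sequentially. s n x = f x"
        by eventually_elim (use xI in \<open>simp add: s_def f_def\<close>)
      then show ?thesis by (rule tendsto_eventually)
    qed (simp add: s_def f_def)
    then show False using x(1) by simp
  qed
  have bound: "AE x in lebesgue. norm (s n x) \<le> D * weight a x" for n
  proof (rule AE_I'[OF ns], rule subsetI, rule ccontr)
    fix x assume x: "x \<in> {x \<in> space lebesgue. \<not> norm (s n x) \<le> D * weight a x}" "x \<notin> sphere ctr rad"
    from split[OF x(2)] have "norm (s n x) \<le> D * weight a x"
    proof
      assume xI: "x \<in> I"
      have "norm (s n x) \<le> norm (indicator (fluid S) x *\<^sub>R a x) * norm (curl (test_fun (n + N)) x)"
        unfolding s_def real_norm_def by (rule Cauchy_Schwarz_ineq2)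
      also have "\<dots> \<le> norm (indicator (fluid S) x *\<^sub>R a x) * (D * dist ctr x powr (- rate S))"
        by (intro mult_left_mono D xI) simp
      finally show ?thesis by (simp add: weight_def mult_ac)
    qed (simp add: s_def weight_def)
    then show False using x(1) by simp
  qed
  have fi: "integrable lebesgue f" by (rule integrable_dominated_convergence[OF mf ms iw lim bound])
  have si: "integrable lebesgue (s n)" for n by (rule integrable_dominated_convergence2[OF mf ms iw lim bound])
  have conv: "(\<lambda>n. integral\<^sup>L lebesgue (s n)) \<longlonglongrightarrow> integral\<^sup>L lebesgue f"
    by (rule integral_dominated_convergence[OF mf ms iw lim bound])
  have fluidI: "negligible {x \<in> fluid S - I. g x \<noteq> 0}" "negligible {x \<in> I - fluid S. g x \<noteq> 0}" for g :: "plane \<Rightarrow> real"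
    by (rule negligible_subset[OF negligible_sphere[of ctr rad]], force simp: fluid_def)+
  have sint: "integral\<^sup>L lebesgue (s n) = (\<Sum>i\<in>UNIV. \<Gamma> $ i * test_fun (n + N) (xbar $ i))" for n
  proof -
    have eq: "s n = (\<lambda>x. indicator (fluid S) x *\<^sub>R (a x \<bullet> curl (test_fun (n + N)) x))"
      by (auto simp: s_def fun_eq_iff)
    have "set_integrable lebesgue (fluid S) (\<lambda>x. a x \<bullet> curl (test_fun (n + N)) x)"
      using si[of n] unfolding set_integrable_def eq .
    then have "integral\<^sup>L lebesgue (s n) = integral (fluid S) (\<lambda>x. a x \<bullet> curl (test_fun (n + N)) x)"
      using set_lebesgue_integral_eq_integral(2) unfolding eq set_lebesgue_integral_def by blast
    also have "\<dots> = integral (fluid S) (\<lambda>x. a x $ 1 * dir_deriv (axis 2 1) (test_fun (n + N)) x - a x $ 2 * dir_deriv (axis 1 1) (test_fun (n + N)) x)"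
      by (simp add: inner2)
    also have "\<dots> = (\<Sum>i\<in>UNIV. \<Gamma> $ i * test_fun (n + N) (xbar $ i))"
      using a smooth_on_test_fun[OF N(1), of n] bounded_test_fun[OF N(1), of n] test_fun_body[OF N(2)[of n] N(1)[of n]]
      unfolding has_vortices_def body_def by blast
    finally show ?thesis .
  qed
  have "(\<lambda>n. test_fun (n + N) (xbar $ i)) \<longlonglongrightarrow> stream (xbar $ i)" for i
  proof (rule tendsto_eventually)
    have "\<forall>\<^sub>F n in sequentially. test_fun (n + N) (xbar $ i) = stream (xbar $ i) \<and> curl (test_fun (n + N)) (xbar $ i) = v (xbar $ i)"
      using test_fun_eventually[OF xI] by (rule eventually_sequentially_seg[THEN iffD2])
    then show "\<forall>\<^sub>F n in sequentially. test_fun (n + N) (xbar $ i) = stream (xbar $ i)" by eventually_elim simp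
  qed
  then have "(\<lambda>n. integral\<^sup>L lebesgue (s n)) \<longlonglongrightarrow> (\<Sum>i\<in>UNIV. \<Gamma> $ i * stream (xbar $ i))"
    unfolding sint by (intro tendsto_intros)
  then have "integral\<^sup>L lebesgue f = (\<Sum>i\<in>UNIV. \<Gamma> $ i * stream (xbar $ i))" using conv LIMSEQ_unique by blast
  moreover have "integral\<^sup>L lebesgue f = integral (fluid S) (\<lambda>x. a x \<bullet> v x)"
  proof -
    have eq: "f = (\<lambda>x. indicator I x *\<^sub>R (a x \<bullet> v x))"
      using I_sub by (auto simp: f_def fun_eq_iff indicator_def fluid_def)
    have "set_integrable lebesgue I (\<lambda>x. a x \<bullet> v x)" using fi unfolding set_integrable_def eq .
    then have "integral\<^sup>L lebesgue f = integral I (\<lambda>x. a x \<bullet> v x)"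
      using set_lebesgue_integral_eq_integral(2) unfolding eq set_lebesgue_integral_def by blast
    also have "\<dots> = integral (fluid S) (\<lambda>x. a x \<bullet> v x)"
      by (rule integral_spike_set[OF fluidI(2,1)])
    finally show ?thesis .
  qed
  ultimately show ?thesis by simp
qed

end

section \<open>Momentum and isotropy of point vortices\<close>

context solid_fluid begin

text \<open>The hypotheses on the density do not bound it at infinity; but it is the Jacobian determinant of any
  configuration, hence bounded.\<close>

lemma X_vol_tangent_solenoidal:
  assumes ne: "Q S \<noteq> {}" and \<xi>: "\<xi> \<in> X_vol S"
  obtains C where "tangent_solenoidal (\<lambda>x. density S x *\<^sub>R \<xi> x) ctr rad (rate S) C"
proof -
  obtain g \<phi> where q: "(g, \<phi>) \<in> Q S" using ne by auto
  note n = near_id_Q_conf[OF q]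
  have \<xi>s: "smooth_on (fluid S) \<xi>" "decays (rate S) \<xi>"
    "\<forall>x\<in>fluid S. divergence (fluid S) (\<lambda>x. density S x *\<^sub>R \<xi> x) x = 0"
    "\<forall>x\<in>sphere ctr rad. \<xi> x \<bullet> (x - ctr) = 0"
    using \<xi> unfolding X_vol_iff by auto
  define F where "F x = density S x *\<^sub>R \<xi> x" for x
  have Fs: "smooth_on (fluid S) F" unfolding F_def[abs_def] by (rule smooth_density_scale[OF \<xi>s(1)])
  have adm: "adm (interior (fluid S)) w" for w by (rule exterior_interior[OF fluid_exterior(1)])
  have "Cinf (interior (fluid S)) (Some 0) (\<lambda>x. det (jac (fluid S) \<phi> x))"
    by (rule Cinf_det[OF adm _ near_id_flat_jac[OF n]]) simp
  then have "Cinf (interior (fluid S)) (Some 0) (density S)"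
    by (rule Cinf_cong[OF adm, rotated]) (use Q_det[OF q] interior_subset in blast)
  then have "Cinf (interior (fluid S)) (Some (rate S)) F"
    unfolding F_def[abs_def]
    by (intro Cinf_bilinear[OF adm bounded_bilinear.flip[OF bounded_bilinear_scaleR] decaysD[OF \<xi>s(1,2)]]) simp
  then have "bnd (Some (rate S)) F" by (rule Cinf_bnd)
  then have "bnd (Some (rate S)) (\<lambda>z. F (z + ctr))"
    by (rule bnd_compose_near_id[rotated]) (simp add: bnd_const_flat)
  then obtain K where "K > 0" "\<forall>\<^sub>F z in at_infinity. norm (F (z + ctr)) \<le> K * norm z powr (- rate S)"
    unfolding bnd_Some by blast
  then obtain M where K: "K > 0" "\<And>z. norm z \<ge> M \<Longrightarrow> norm (F (z + ctr)) \<le> K * norm z powr (- rate S)"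
    unfolding eventually_at_infinity by blast
  define M' where "M' = max M rad"
  have M': "M' > 0" using radius by (simp add: M'_def)
  let ?A = "fluid S \<inter> cball ctr M'"
  have "compact ?A" using exterior_closed[OF fluid_exterior(1)] by (simp add: closed_Int_compact)
  moreover have "continuous_on ?A F" by (rule continuous_on_subset[OF smooth_on_continuous_on[OF Fs]]) auto
  ultimately have "bounded (F ` ?A)" using compact_continuous_image compact_imp_bounded by blast
  then obtain L where "\<forall>y\<in>F ` ?A. norm y \<le> L" unfolding bounded_iff by blast
  then have L: "\<And>x. x \<in> ?A \<Longrightarrow> norm (F x) \<le> \<bar>L\<bar>" by (meson abs_ge_self imageI order_trans)
  define C where "C = K + \<bar>L\<bar> * M' powr (rate S)"
  have "norm (F x) \<le> C * dist ctr x powr (- rate S)" if x: "x \<in> fluid S" for x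
  proof (cases "dist ctr x \<le> M'")
    case True
    have d: "dist ctr x > 0" using x radius by (auto simp: fluid_def)
    have "M' powr (- rate S) \<le> dist ctr x powr (- rate S)" using True d rate by (intro powr_mono2') auto
    then have "M' powr rate S * M' powr (- rate S) \<le> M' powr rate S * dist ctr x powr (- rate S)"
      by (intro mult_left_mono) auto
    then have 1: "1 \<le> M' powr rate S * dist ctr x powr (- rate S)" using M' by (simp add: powr_add[symmetric])
    have "norm (F x) \<le> \<bar>L\<bar> * 1" using L x True by simp
    also have "\<dots> \<le> \<bar>L\<bar> * (M' powr rate S * dist ctr x powr (- rate S))" using 1 by (intro mult_left_mono) auto
    also have "\<dots> \<le> C * dist ctr x powr (- rate S)" using K(1) by (simp add: C_def algebra_simps)
    finally show ?thesis .
  next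
    case False
    have "norm (F ((x - ctr) + ctr)) \<le> K * norm (x - ctr) powr (- rate S)"
      using False by (intro K(2)) (auto simp: M'_def dist_norm norm_minus_commute)
    then have "norm (F x) \<le> K * dist ctr x powr (- rate S)" by (simp add: dist_norm norm_minus_commute)
    also have "\<dots> \<le> C * dist ctr x powr (- rate S)" by (intro mult_right_mono) (auto simp: C_def)
    finally show ?thesis .
  qed
  then have "tangent_solenoidal F ctr rad (rate S) C"
    using radius rate Fs \<xi>s(3,4) unfolding F_def[abs_def] fluid_def by unfold_locales auto
  then show thesis using that unfolding F_def[abs_def] by blast
qed

text \<open>The condition at infinity fixes the additive constant.\<close>

definition is_stream :: "(plane \<Rightarrow> real) \<Rightarrow> (plane \<Rightarrow> plane) \<Rightarrow> bool" where
  "is_stream \<psi> \<xi> \<longleftrightarrow> (\<forall>x\<in>interior (fluid S). (\<psi> has_derivative (\<lambda>h. rot90 (density S x *\<^sub>R \<xi> x) \<bullet> h)) (at x)) \<and>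
     (\<psi> \<longlongrightarrow> 0) at_infinity"

lemma stream_exists:
  assumes "tangent_solenoidal (\<lambda>x. density S x *\<^sub>R \<xi> x) ctr rad (rate S) C"
  shows "is_stream (solenoidal_exterior.stream (\<lambda>x. density S x *\<^sub>R \<xi> x) ctr) \<xi>"
proof -
  interpret tangent_solenoidal "\<lambda>x. density S x *\<^sub>R \<xi> x" ctr rad "rate S" C by (rule assms)
  define K where "K = C * (\<Sum>n. (real n + 1) powr (- rate S))"
  have I: "interior (fluid S) = I" by (rule frontier_fluid(4)[OF radius])
  have "\<forall>\<^sub>F x in at_infinity. x \<in> interior (fluid S)"
    using exterior_interior[OF fluid_exterior(1), of _ "Some 0"] by (simp add: adm_def)
  then have 1: "\<forall>\<^sub>F x in at_infinity. norm (stream x) \<le> K * dist ctr x powr (1 - rate S)"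
    by eventually_elim (use stream_bound in \<open>simp add: I K_def\<close>)
  have "filterlim (\<lambda>x. dist ctr x) at_top at_infinity"
  proof (rule filterlim_at_top_mono)
    show "filterlim (\<lambda>x::plane. - norm ctr + norm x) at_top at_infinity"
      by (rule filterlim_tendsto_add_at_top[OF tendsto_const filterlim_norm_at_top])
    show "\<forall>\<^sub>F x in at_infinity. - norm ctr + norm x \<le> dist ctr x"
    proof (rule always_eventually, rule allI)
      show "- norm ctr + norm x \<le> dist ctr x" for x
        using norm_triangle_ineq2[of x ctr] by (simp add: dist_norm norm_minus_commute)
    qed
  qed
  then have "((\<lambda>x. dist ctr x powr (1 - rate S)) \<longlongrightarrow> 0) at_infinity" using rate by (intro tendsto_neg_powr) auto
  then have "((\<lambda>x. K * dist ctr x powr (1 - rate S)) \<longlongrightarrow> 0) at_infinity" by (rule tendsto_mult_right_zero)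
  then have "(stream \<longlongrightarrow> 0) at_infinity" by (rule Lim_null_comparison[OF 1])
  then show ?thesis unfolding is_stream_def I using stream_derivative by blast
qed

lemma stream_unique:
  assumes 1: "is_stream \<psi> \<xi>" and 2: "is_stream \<psi>' \<xi>" and x: "x \<in> interior (fluid S)"
  shows "\<psi> x = \<psi>' x"
proof -
  let ?I = "interior (fluid S)" and ?d = "\<lambda>x. \<psi> x - \<psi>' x"
  have D: "(?d has_derivative (\<lambda>h. 0)) (at y)" if "y \<in> ?I" for y
    using has_derivative_diff[of \<psi> _ "at y" \<psi>'] 1 2 that unfolding is_stream_def by fastforce
  have "connected ?I" unfolding frontier_fluid(4)[OF radius] by (rule connected_complement_bounded_convex) auto
  moreover have "continuous_on ?I ?d"
    using D has_derivative_continuous continuous_at_imp_continuous_on by blast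
  ultimately have "?d constant_on ?I"
    using D by (intro has_derivative_zero_connected_constant_on[of _ "{}"]) (auto intro: has_derivative_at_withinI)
  then obtain k where k: "\<And>y. y \<in> ?I \<Longrightarrow> ?d y = k" unfolding constant_on_def by blast
  have "(?d \<longlongrightarrow> 0 - 0) at_infinity" using 1 2 unfolding is_stream_def by (intro tendsto_diff) auto
  moreover have "\<forall>\<^sub>F y in at_infinity. ?d y = k"
  proof -
    have "\<forall>\<^sub>F y in at_infinity. y \<in> ?I" using exterior_interior[OF fluid_exterior(1), of _ "Some 0"] by (simp add: adm_def)
    then show ?thesis by eventually_elim (rule k)
  qed
  ultimately have "((\<lambda>y::plane. k) \<longlongrightarrow> 0) at_infinity" using tendsto_cong by force
  then have "k = 0" using tendsto_unique[OF trivial_limit_at_infinity tendsto_const] by blast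
  then show ?thesis using k[OF x] by simp
qed

lemma is_stream_add: "is_stream \<psi> \<xi> \<Longrightarrow> is_stream \<psi>' \<xi>' \<Longrightarrow> is_stream (\<lambda>x. \<psi> x + \<psi>' x) (\<lambda>x. \<xi> x + \<xi>' x)"
  unfolding is_stream_def
proof (intro conjI ballI)
  assume a: "(\<forall>x\<in>interior (fluid S). (\<psi> has_derivative (\<lambda>h. rot90 (density S x *\<^sub>R \<xi> x) \<bullet> h)) (at x)) \<and> (\<psi> \<longlongrightarrow> 0) at_infinity"
    "(\<forall>x\<in>interior (fluid S). (\<psi>' has_derivative (\<lambda>h. rot90 (density S x *\<^sub>R \<xi>' x) \<bullet> h)) (at x)) \<and> (\<psi>' \<longlongrightarrow> 0) at_infinity"
  show "((\<lambda>x. \<psi> x + \<psi>' x) \<longlongrightarrow> 0) at_infinity" using tendsto_add[of \<psi> 0 _ \<psi>' 0] a by simp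
  fix x assume "x \<in> interior (fluid S)"
  then have "((\<lambda>x. \<psi> x + \<psi>' x) has_derivative (\<lambda>h. rot90 (density S x *\<^sub>R \<xi> x) \<bullet> h + rot90 (density S x *\<^sub>R \<xi>' x) \<bullet> h)) (at x)"
    using a by (intro has_derivative_add) auto
  then show "((\<lambda>x. \<psi> x + \<psi>' x) has_derivative (\<lambda>h. rot90 (density S x *\<^sub>R (\<xi> x + \<xi>' x)) \<bullet> h)) (at x)"
    by (rule has_derivative_eq_rhs) (simp add: fun_eq_iff inner2 algebra_simps)
qed

lemma is_stream_scale: "is_stream \<psi> \<xi> \<Longrightarrow> is_stream (\<lambda>x. k * \<psi> x) (\<lambda>x. k *\<^sub>R \<xi> x)"
  unfolding is_stream_def
proof (intro conjI ballI)
  assume a: "(\<forall>x\<in>interior (fluid S). (\<psi> has_derivative (\<lambda>h. rot90 (density S x *\<^sub>R \<xi> x) \<bullet> h)) (at x)) \<and> (\<psi> \<longlongrightarrow> 0) at_infinity"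
  show "((\<lambda>x. k * \<psi> x) \<longlongrightarrow> 0) at_infinity" using tendsto_mult_right_zero a by blast
  fix x assume "x \<in> interior (fluid S)"
  then have "((\<lambda>x. k * \<psi> x) has_derivative (\<lambda>h. k * (rot90 (density S x *\<^sub>R \<xi> x) \<bullet> h))) (at x)"
    using a by (intro has_derivative_mult_right) auto
  then show "((\<lambda>x. k * \<psi> x) has_derivative (\<lambda>h. rot90 (density S x *\<^sub>R k *\<^sub>R \<xi> x) \<bullet> h)) (at x)"
    by (rule has_derivative_eq_rhs) (simp add: fun_eq_iff inner2 algebra_simps)
qed

text \<open>By the chain rule the gradient of \<open>\<psi> \<circ> f\<close> is the transposed derivative of
  \<open>f\<close> applied to that of \<open>\<psi>\<close>, and rotated by a quarter turn a transposed matrix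
  becomes the cofactor matrix of the Piola transform.\<close>

lemma is_stream_pull_field:
  assumes f: "f \<in> Diff_vol S" and \<psi>: "is_stream \<psi> \<xi>"
  shows "is_stream (\<lambda>x. \<psi> (f x)) (pull_field S f \<xi>)"
  unfolding is_stream_def
proof (intro conjI ballI)
  note n = near_id_Diff[OF f] note d = near_idD[OF n]
  fix x assume x: "x \<in> interior (fluid S)"
  then have xf: "x \<in> fluid S" using interior_subset by blast
  have fx: "f x \<in> interior (fluid S)" using d(14) x by blast
  let ?v = "density S (f x) *\<^sub>R \<xi> (f x)" and ?J = "jac (fluid S) f x"
  have "at x within fluid S = at x" by (rule at_within_interior[OF x])
  then have "(f has_derivative (\<lambda>h. ?J *v h)) (at x)" using smooth_on_has_jac[OF d(5) xf] by simp
  moreover have "(\<psi> has_derivative (\<lambda>h. rot90 ?v \<bullet> h)) (at (f x))" using \<psi> fx unfolding is_stream_def by blast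
  ultimately have "((\<lambda>x. \<psi> (f x)) has_derivative (\<lambda>h. rot90 ?v \<bullet> (?J *v h))) (at x)" by (rule has_derivative_compose)
  moreover have "rot90 ?v \<bullet> (?J *v h) = rot90 (density S x *\<^sub>R pull_field S f \<xi> x) \<bullet> h" for h
  proof -
    have det: "det ?J \<noteq> 0" by (rule near_id_det(2)[OF n xf])
    have "density S x *\<^sub>R pull_field S f \<xi> x = cof ?J *v ?v"
      using xf det Diff_det[OF f xf, symmetric]
      by (simp add: pull_field_def matrix_inv_cof matrix_vector_mult_scaleR flip: scaleR_matrix_vector_assoc)
    then show ?thesis by (simp add: inner2 algebra_simps)
  qed
  ultimately show "((\<lambda>x. \<psi> (f x)) has_derivative (\<lambda>h. rot90 (density S x *\<^sub>R pull_field S f \<xi> x) \<bullet> h)) (at x)" by simp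
next
  note n = near_id_Diff[OF f] note d = near_idD[OF n]
  have "filterlim f at_infinity at_infinity"
  proof -
    obtain B where B: "\<And>x. x \<in> fluid S \<Longrightarrow> norm (f x - x) \<le> B"
      using near_id_bounded_shift[OF d(2,5,7)] d(1) by auto
    have "\<forall>\<^sub>F x in at_infinity. x \<in> interior (fluid S)"
      using exterior_interior[OF fluid_exterior(1), of _ "Some 0"] by (simp add: adm_def)
    then have ev: "\<forall>\<^sub>F x in at_infinity. norm x + (- B) \<le> norm (f x)"
    proof eventually_elim
      case (elim x)
      then have "norm (f x - x) \<le> B" using B interior_subset by blast
      then show ?case using norm_triangle_ineq2[of x "x - f x"] by (simp add: norm_minus_commute)
    qed
    have "filterlim (\<lambda>x::plane. - B + norm x) at_top at_infinity"
      by (rule filterlim_tendsto_add_at_top[OF tendsto_const filterlim_norm_at_top])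
    then have "filterlim (\<lambda>x. norm (f x)) at_top at_infinity"
      by (rule filterlim_at_top_mono) (use ev in \<open>simp add: add.commute\<close>)
    then show ?thesis by (simp add: filterlim_at_infinity_conv_norm_at_top)
  qed
  then show "((\<lambda>x. \<psi> (f x)) \<longlongrightarrow> 0) at_infinity"
    using \<psi> unfolding is_stream_def by (blast intro: filterlim_compose)
qed

lemma is_stream_density_curl:
  assumes "smooth_on UNIV \<psi>" "bounded {x. \<psi> x \<noteq> 0}" shows "is_stream \<psi> (density_curl \<psi>)"
  unfolding is_stream_def
proof (intro conjI ballI)
  fix x assume "x \<in> interior (fluid S)"
  then have x: "x \<in> fluid S" using interior_subset by blast
  have D: "(\<psi> has_derivative (\<lambda>h. dir_deriv h \<psi> x)) (at x)" by (rule smooth_UNIV_derivative[OF assms(1)])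
  have "density S x *\<^sub>R density_curl \<psi> x = curl \<psi> x" using x density_pos by (auto simp: density_curl_def)
  moreover have "dir_deriv h \<psi> x = rot90 (curl \<psi> x) \<bullet> h" for h
  proof -
    have l: "linear (\<lambda>h. dir_deriv h \<psi> x)" by (rule has_derivative_linear[OF D])
    have "h = h $ 1 *\<^sub>R axis 1 1 + h $ 2 *\<^sub>R axis 2 1" by (rule vec2_eqI) (simp_all add: axis_def)
    then have "dir_deriv h \<psi> x = h $ 1 * dir_deriv (axis 1 1) \<psi> x + h $ 2 * dir_deriv (axis 2 1) \<psi> x"
      using linear_add[OF l] linear_scale[OF l] by (metis real_scaleR_def)
    then show ?thesis by (simp add: inner2)
  qed
  ultimately show "(\<psi> has_derivative (\<lambda>h. rot90 (density S x *\<^sub>R density_curl \<psi> x) \<bullet> h)) (at x)" using D by simp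
next
  obtain M where M: "\<And>x. \<psi> x \<noteq> 0 \<Longrightarrow> norm x \<le> M" using assms(2) unfolding bounded_iff by blast
  have "\<forall>\<^sub>F x in at_infinity. \<psi> x = 0"
    using eventually_at_infinity_norm_ge[of "M + 1"] by eventually_elim (use M in force)
  then show "(\<psi> \<longlongrightarrow> 0) at_infinity" by (rule tendsto_eventually)
qed

end

locale vortex_setting = solid_fluid +
  fixes \<Gamma> :: "real^'n::finite" and xbar :: "plane^'n" and a :: "plane \<Rightarrow> plane"
    and \<mu> :: "(plane \<Rightarrow> plane) \<Rightarrow> real"
  assumes Q_nonempty: "Q S \<noteq> {}"
    and xbar_interior: "\<forall>i. xbar $ i \<in> interior (fluid S)"
    and xbar_distinct: "\<forall>i j. i \<noteq> j \<longrightarrow> xbar $ i \<noteq> xbar $ j"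
    and vortices: "has_vortices S \<Gamma> xbar a"
    and \<mu>_eq: "\<mu> = form_class S a"
begin

lemma xbar_fluid: "xbar $ i \<in> fluid S"
  using xbar_interior interior_subset by blast

text \<open>Stream functions vanishing at infinity are unique, so any of them computes the pairing.\<close>

lemma \<mu>_stream:
  assumes \<xi>: "\<xi> \<in> X_vol S" and \<psi>: "is_stream \<psi> \<xi>"
  shows "\<mu> \<xi> = (\<Sum>i\<in>UNIV. \<Gamma> $ i * \<psi> (xbar $ i))"
proof -
  obtain C where t: "tangent_solenoidal (\<lambda>x. density S x *\<^sub>R \<xi> x) ctr rad (rate S) C"
    using X_vol_tangent_solenoidal[OF Q_nonempty \<xi>] .
  have "\<mu> \<xi> = integral (fluid S) (\<lambda>x. a x \<bullet> (density S x *\<^sub>R \<xi> x))"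
    using \<xi> by (simp add: \<mu>_eq form_class_def mult.commute)
  also have "\<dots> = (\<Sum>i\<in>UNIV. \<Gamma> $ i * solenoidal_exterior.stream (\<lambda>x. density S x *\<^sub>R \<xi> x) ctr (xbar $ i))"
    by (rule vortex_pairing[OF vortices t xbar_interior])
  also have "\<dots> = (\<Sum>i\<in>UNIV. \<Gamma> $ i * \<psi> (xbar $ i))"
    using stream_unique[OF stream_exists[OF t] \<psi>] xbar_interior by simp
  finally show ?thesis .
qed

lemma X_vol_stream: assumes "\<xi> \<in> X_vol S" obtains \<psi> where "is_stream \<psi> \<xi>"
  using X_vol_tangent_solenoidal[OF Q_nonempty assms] stream_exists by metis

lemma \<mu>_add:
  assumes "\<xi> \<in> X_vol S" "\<xi>' \<in> X_vol S" "(\<lambda>x. \<xi> x + \<xi>' x) \<in> X_vol S"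
  shows "\<mu> (\<lambda>x. \<xi> x + \<xi>' x) = \<mu> \<xi> + \<mu> \<xi>'"
proof -
  obtain \<psi> \<psi>' where \<psi>: "is_stream \<psi> \<xi>" "is_stream \<psi>' \<xi>'" using X_vol_stream assms by metis
  show ?thesis
    unfolding \<mu>_stream[OF assms(1) \<psi>(1)] \<mu>_stream[OF assms(2) \<psi>(2)] \<mu>_stream[OF assms(3) is_stream_add[OF \<psi>]]
    by (simp add: distrib_left sum.distrib)
qed

lemma \<mu>_scale:
  assumes "\<xi> \<in> X_vol S" "(\<lambda>x. k *\<^sub>R \<xi> x) \<in> X_vol S"
  shows "\<mu> (\<lambda>x. k *\<^sub>R \<xi> x) = k * \<mu> \<xi>"
proof -
  obtain \<psi> where \<psi>: "is_stream \<psi> \<xi>" using X_vol_stream assms by metis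
  show ?thesis
    unfolding \<mu>_stream[OF assms(1) \<psi>] \<mu>_stream[OF assms(2) is_stream_scale[OF \<psi>]]
    by (simp add: sum_distrib_left mult_ac)
qed

lemma \<mu>_pull_field:
  assumes f: "f \<in> Diff_vol S" and \<xi>: "\<xi> \<in> X_vol S" and \<psi>: "is_stream \<psi> \<xi>"
  shows "\<mu> (pull_field S f \<xi>) = (\<Sum>i\<in>UNIV. \<Gamma> $ i * \<psi> (f (xbar $ i)))"
  by (rule \<mu>_stream[OF pull_field_X_vol[OF f \<xi>] is_stream_pull_field[OF f \<psi>]])

lemma Diff_vol_mu_iff: "f \<in> Diff_vol_mu S xbar \<longleftrightarrow> f \<in> Diff_vol S \<and> (\<forall>i. f (xbar $ i) = xbar $ i)"
  by (simp add: Diff_vol_mu_def)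

lemma \<mu>_invariant:
  assumes f: "f \<in> Diff_vol_mu S xbar" and \<xi>: "\<xi> \<in> X_vol S"
  shows "\<mu> (pull_field S f \<xi>) = \<mu> \<xi>"
proof -
  obtain \<psi> where \<psi>: "is_stream \<psi> \<xi>" using X_vol_stream \<xi> by metis
  show ?thesis using f \<mu>_pull_field[OF _ \<xi> \<psi>] \<mu>_stream[OF \<xi> \<psi>] unfolding Diff_vol_mu_iff by simp
qed

lemma isotropy_contains: "Diff_vol_mu S xbar \<subseteq> {f \<in> Diff_vol S. coadjoint S f \<mu> = \<mu>}"
proof
  fix f assume f: "f \<in> Diff_vol_mu S xbar"
  have "coadjoint S f \<mu> = restrict \<mu> (X_vol S)"
    unfolding coadjoint_def by (rule restrict_ext) (rule \<mu>_invariant[OF f])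
  also have "\<dots> = \<mu>" by (simp add: \<mu>_eq form_class_def)
  finally show "f \<in> {f \<in> Diff_vol S. coadjoint S f \<mu> = \<mu>}" using f by (simp add: Diff_vol_mu_iff)
qed

text \<open>The pairing of \<open>\<mu>\<close> with the field of a bump function at \<open>x\<^sub>i\<close> is
  \<open>\<Gamma>\<^sub>i\<close>. If \<open>f\<close> preserves \<open>\<mu>\<close> it is also the strength of
  the vortex that \<open>f\<close> brings to \<open>x\<^sub>i\<close>, if there is one. As strengths are nonzero
  there is one, and as they are distinct it is the vortex at \<open>x\<^sub>i\<close> itself.\<close>

lemma isotropy_eq:
  assumes \<Gamma>: "\<forall>i. \<Gamma> $ i \<noteq> 0" "\<forall>i j. i \<noteq> j \<longrightarrow> \<Gamma> $ i \<noteq> \<Gamma> $ j"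
  shows "Diff_vol_mu S xbar = {f \<in> Diff_vol S. coadjoint S f \<mu> = \<mu>}"
proof (rule subset_antisym[OF isotropy_contains], rule subsetI)
  fix f assume "f \<in> {f \<in> Diff_vol S. coadjoint S f \<mu> = \<mu>}"
  then have f: "f \<in> Diff_vol S" and co: "coadjoint S f \<mu> = \<mu>" by auto
  have "f (xbar $ i) = xbar $ i" for i
  proof -
    define p where "p = xbar $ i"
    define P where "P = range (\<lambda>j. xbar $ j) \<union> range (\<lambda>j. f (xbar $ j))"
    have "finite P" unfolding P_def by simp
    from finite_set_avoid[OF this, of p] obtain d where d: "d > 0" "\<forall>z\<in>P. z \<noteq> p \<longrightarrow> d \<le> dist p z" by blast
    obtain e where e: "e > 0" "ball p e \<subseteq> interior (fluid S)"
      using xbar_interior open_interior openE unfolding p_def by metis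
    \<comment> \<open>the bump function of radius \<open>r\<close> at \<open>p\<close> vanishes near the body, at the other vortices and at their images different from \<open>p\<close>\<close>
    define r where "r = min d e / 3"
    have r: "r > 0" "2 * r \<le> d" "3 * r \<le> e" using d e by (auto simp: r_def)
    have r1: "ball p (3 * r) \<subseteq> interior (fluid S)" using e r subset_ball by blast
    let ?\<psi> = "cutoff p r"
    have val: "?\<psi> z = (if z = p then 1 else 0)" if "z \<in> P" for z
      using d(2) that r cutoff_1[OF r(1), of p z] cutoff_0[OF r(1), of p z] by force
    have X: "density_curl ?\<psi> \<in> X_vol S"
      using cutoff_zero_near_body[OF r(1) r1] by (intro density_curl_X_vol smooth_on_cutoff bounded_cutoff_support[OF r(1)])
    have st: "is_stream ?\<psi> (density_curl ?\<psi>)"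
      by (rule is_stream_density_curl[OF smooth_on_cutoff bounded_cutoff_support[OF r(1)]])
    have "\<mu> (density_curl ?\<psi>) = (\<Sum>j\<in>UNIV. \<Gamma> $ j * (if xbar $ j = p then 1 else 0))"
      unfolding \<mu>_stream[OF X st] using val by (simp add: P_def)
    also have "\<dots> = (\<Sum>j\<in>UNIV. if j = i then \<Gamma> $ j else 0)"
      using xbar_distinct unfolding p_def by (intro sum.cong) auto
    finally have 1: "\<mu> (density_curl ?\<psi>) = \<Gamma> $ i" by simp
    have "\<mu> (density_curl ?\<psi>) = coadjoint S f \<mu> (density_curl ?\<psi>)" unfolding co ..
    also have "\<dots> = \<mu> (pull_field S f (density_curl ?\<psi>))" using X by (simp add: coadjoint_def)
    also have "\<dots> = (\<Sum>j\<in>UNIV. \<Gamma> $ j * (if f (xbar $ j) = p then 1 else 0))"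
      unfolding \<mu>_pull_field[OF f X st] using val by (simp add: P_def)
    finally have 2: "\<Gamma> $ i = (\<Sum>j\<in>UNIV. \<Gamma> $ j * (if f (xbar $ j) = p then 1 else 0))" unfolding 1 .
    obtain j where j: "f (xbar $ j) = p"
    proof (rule ccontr)
      assume "\<not> thesis"
      then have "\<And>j. f (xbar $ j) \<noteq> p" using that by blast
      then show False using 2 \<Gamma>(1) by simp
    qed
    have uniq: "f (xbar $ k) = p \<longleftrightarrow> k = j" for k
    proof
      assume "f (xbar $ k) = p"
      then have "xbar $ k = xbar $ j" using j near_idD(12)[OF near_id_Diff[OF f] xbar_fluid] by metis
      then show "k = j" using xbar_distinct by blast
    qed (use j in simp)
    have "\<Gamma> $ i = \<Gamma> $ j" using 2 unfolding uniq by (simp add: if_distrib cong: if_cong)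
    then have "i = j" using \<Gamma>(2) by blast
    then show ?thesis using j by (simp add: p_def)
  qed
  then show "f \<in> Diff_vol_mu S xbar" using f by (simp add: Diff_vol_mu_iff)
qed

end

section \<open>The annihilator of the vortex directions\<close>

lemma dual_spaceD:
  assumes "p \<in> dual_space add scl V"
  shows "p \<in> extensional V" "\<And>u v. u \<in> V \<Longrightarrow> v \<in> V \<Longrightarrow> p (add u v) = p u + p v"
    "\<And>c v. v \<in> V \<Longrightarrow> p (scl c v) = c * p v"
  using assms by (auto simp: dual_space_def)

lemma dual_spaceI:
  assumes "p \<in> extensional V" "\<And>u v. u \<in> V \<Longrightarrow> v \<in> V \<Longrightarrow> p (add u v) = p u + p v"
    "\<And>c v. v \<in> V \<Longrightarrow> p (scl c v) = c * p v"
  shows "p \<in> dual_space add scl V"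
  using assms by (auto simp: dual_space_def)

lemma incl_simp: "incl ((g, p), x) = ((g, x), restrict (\<lambda>v. p (fst v)) (T_SE2 g \<times> UNIV))"
  by (simp add: incl_def)

lemma inj_on_incl: "inj_on incl (cotangent_SE2_vortices S :: (_ \<times> (plane^'n::finite)) set)"
proof (rule inj_onI)
  fix z z' :: "(rigid \<times> (rigid \<Rightarrow> real)) \<times> (plane^'n)"
  assume z: "z \<in> cotangent_SE2_vortices S" "z' \<in> cotangent_SE2_vortices S" and eq: "incl z = incl z'"
  obtain g p x g' p' x' where zz: "z = ((g, p), x)" "z' = ((g', p'), x')" by (metis surj_pair)
  have gx: "g' = g" "x' = x" using eq unfolding zz incl_simp by auto
  have e: "p \<in> extensional (T_SE2 g)" "p' \<in> extensional (T_SE2 g)"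
    using z unfolding zz gx by (auto simp: cotangent_SE2_vortices_def cotangent_SE2_def dual_space_def)
  have R: "restrict (\<lambda>v. p (fst v)) (T_SE2 g \<times> (UNIV :: (plane^'n) set)) = restrict (\<lambda>v. p' (fst v)) (T_SE2 g \<times> UNIV)"
    using eq unfolding zz gx incl_simp by simp
  have "p v = p' v" if "v \<in> T_SE2 g" for v
    using fun_cong[OF R, of "(v, 0)"] that by simp
  then have "p = p'" using e extensionalityI by blast
  then show "z = z'" unfolding zz gx by simp
qed

context vortex_setting begin

text \<open>The projected generators are all the vectors \<open>(0, w)\<close>: relabelling velocities take
  arbitrary values at the vortices, and the derivative of \<open>\<phi>\<close> is invertible there.\<close>

lemma annihilator_bundle_eq: "annihilator_bundle S xbar = incl ` cotangent_SE2_vortices S"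
proof (intro subset_antisym subsetI)
  note proj_iff = proj_Q[OF Q_nonempty xbar_interior xbar_distinct]
  fix y :: "(rigid \<times> (plane^'n)) \<times> (rigid \<times> (plane^'n) \<Rightarrow> real)"
  assume yA: "y \<in> annihilator_bundle S xbar"
  obtain g x \<beta> where y: "y = ((g, x), \<beta>)" by (metis surj_pair)
  have m: "(g, x) \<in> proj xbar ` Q S" and \<beta>: "\<beta> \<in> dual_space (+) (*\<^sub>R) (T_SE2 g \<times> UNIV)"
    and ann: "\<And>q \<xi>. q \<in> Q S \<Longrightarrow> proj xbar q = (g, x) \<Longrightarrow> \<xi> \<in> X_vol S \<Longrightarrow> \<beta> (T_proj xbar (generator S \<xi> q)) = 0"
    using yA unfolding y annihilator_bundle_def by simp_all
  note b = dual_spaceD[OF \<beta>]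
  from m obtain \<phi> where q: "(g, \<phi>) \<in> Q S" "proj xbar (g, \<phi>) = (g, x)" by (auto simp: proj_def)
  note n = near_id_Q_conf[OF q(1)]
  have zero: "\<beta> (0, w) = 0" for w
  proof -
    define u where "u = (\<chi> i. matrix_inv (jac (fluid S) \<phi> (xbar $ i)) *v w $ i)"
    obtain \<xi> where \<xi>: "\<xi> \<in> X_vol S" "\<And>i. \<xi> (xbar $ i) = u $ i"
      using X_vol_prescribed_values[OF xbar_interior xbar_distinct, of u] by blast
    have "jac (fluid S) \<phi> (xbar $ i) *v \<xi> (xbar $ i) = w $ i" for i
      unfolding \<xi>(2) u_def vec_lambda_beta by (rule matrix_inv_vector(1)[OF near_id_det(2)[OF n xbar_fluid]])
    then have "T_proj xbar (generator S \<xi> (g, \<phi>)) = (0, w)"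
      using xbar_fluid by (simp add: T_proj_def generator_def vec_eq_iff)
    then show ?thesis using ann[OF q \<xi>(1)] by simp
  qed
  define p where "p = restrict (\<lambda>v. \<beta> (v, 0)) (T_SE2 g)"
  have "\<beta> = restrict (\<lambda>v. p (fst v)) (T_SE2 g \<times> UNIV)"
  proof (rule extensionalityI[OF b(1) restrict_extensional])
    fix v assume v: "v \<in> T_SE2 g \<times> (UNIV :: (plane^'n) set)"
    then have "\<beta> ((fst v, 0) + (0, snd v)) = \<beta> (fst v, 0) + \<beta> (0, snd v)"
      by (intro b(2)) (auto simp: T_SE2_zero)
    then show "\<beta> v = restrict (\<lambda>v. p (fst v)) (T_SE2 g \<times> UNIV) v" using v zero by (auto simp: p_def)
  qed
  moreover have "p \<in> dual_space (+) (*\<^sub>R) (T_SE2 g)"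
  proof (rule dual_spaceI)
    show "p \<in> extensional (T_SE2 g)" by (simp add: p_def)
    show "p (u + v) = p u + p v" if "u \<in> T_SE2 g" "v \<in> T_SE2 g" for u v
      using b(2)[of "(u, 0)" "(v, 0)"] that T_SE2_add by (simp add: p_def)
    show "p (c *\<^sub>R v) = c * p v" if "v \<in> T_SE2 g" for c v
      using b(3)[of "(v, 0)" c] that T_SE2_scale by (simp add: p_def)
  qed
  ultimately have "y = incl ((g, p), x)" "((g, p), x) \<in> cotangent_SE2_vortices S"
    using m unfolding proj_iff by (auto simp: y incl_simp cotangent_SE2_vortices_def cotangent_SE2_def)
  then show "y \<in> incl ` cotangent_SE2_vortices S" by blast
next
  note proj_iff = proj_Q[OF Q_nonempty xbar_interior xbar_distinct]
  fix y :: "(rigid \<times> (plane^'n)) \<times> (rigid \<times> (plane^'n) \<Rightarrow> real)" assume "y \<in> incl ` cotangent_SE2_vortices S"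
  then obtain g p x where y: "y = incl ((g, p), x)" and c: "((g, p), x) \<in> cotangent_SE2_vortices S" by (metis imageE surj_pair)
  have m: "(g, x) \<in> proj xbar ` Q S" unfolding proj_iff
    using c by (auto simp: cotangent_SE2_vortices_def cotangent_SE2_def)
  have p: "p \<in> dual_space (+) (*\<^sub>R) (T_SE2 g)" using c by (auto simp: cotangent_SE2_vortices_def cotangent_SE2_def)
  note pd = dual_spaceD[OF p]
  have p0: "p 0 = 0" using pd(3)[OF T_SE2_zero, of 0] by simp
  have "restrict (\<lambda>v. p (fst v)) (T_SE2 g \<times> (UNIV :: (plane^'n) set)) \<in> dual_space (+) (*\<^sub>R) (T_SE2 g \<times> UNIV)"
    by (rule dual_spaceI) (simp_all add: mem_Times_iff pd T_SE2_add T_SE2_scale)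
  moreover have "restrict (\<lambda>v. p (fst v)) (T_SE2 g \<times> (UNIV :: (plane^'n) set)) (T_proj xbar (generator S \<xi> q)) = 0" for \<xi> q
    by (simp add: T_proj_def generator_def T_SE2_zero p0)
  ultimately show "y \<in> annihilator_bundle S xbar"
    unfolding y incl_simp annihilator_bundle_def using m by auto
qed

section \<open>Momentum shifting and the reduced space\<close>

definition shifted :: "(conf \<Rightarrow> conf_vel \<Rightarrow> plane \<Rightarrow> plane) \<Rightarrow> conf \<times> (conf_vel \<Rightarrow> real) \<Rightarrow> conf_vel \<Rightarrow> real" where
  "shifted \<A> z v = snd z v - \<mu> (\<A> (fst z) v)"

text \<open>The shifted covector is read off from the horizontal lifts with respect to the connection of
  \<open>lift_vel\<close>, whatever \<open>\<A>\<close> is.\<close>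

definition reduced_coord :: "(conf \<Rightarrow> conf_vel \<Rightarrow> plane \<Rightarrow> plane) \<Rightarrow> conf \<times> (conf_vel \<Rightarrow> real) \<Rightarrow>
    (rigid \<times> (rigid \<Rightarrow> real)) \<times> (plane^'n)" where
  "reduced_coord \<A> z = ((fst (fst z), restrict (\<lambda>g'. shifted \<A> z (lift_vel (fst z) g')) (T_SE2 (fst (fst z)))),
     snd (proj xbar (fst z)))"

lemma connectionD:
  assumes "principal_connection S \<A>" "q \<in> Q S"
  shows "\<And>v. v \<in> TQ S q \<Longrightarrow> \<A> q v \<in> X_vol S"
    "\<And>v v'. v \<in> TQ S q \<Longrightarrow> v' \<in> TQ S q \<Longrightarrow> \<A> q (vel_add v v') = (\<lambda>x. \<A> q v x + \<A> q v' x)"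
    "\<And>c v. v \<in> TQ S q \<Longrightarrow> \<A> q (vel_scale c v) = (\<lambda>x. c *\<^sub>R \<A> q v x)"
    "\<And>\<xi>. \<xi> \<in> X_vol S \<Longrightarrow> \<A> q (generator S \<xi> q) = \<xi>"
    "\<And>f v. f \<in> Diff_vol S \<Longrightarrow> v \<in> TQ S q \<Longrightarrow> \<A> (conf_act S f q) (vel_act S f v) = pull_field S f (\<A> q v)"
  using assms unfolding principal_connection_def by blast+

lemma levelD:
  assumes "((g, \<phi>), \<alpha>) \<in> momentum_level S \<mu>"
  shows "(g, \<phi>) \<in> Q S" "\<alpha> \<in> dual_space vel_add vel_scale (TQ S (g, \<phi>))"
    "\<And>\<xi>. \<xi> \<in> X_vol S \<Longrightarrow> \<alpha> (generator S \<xi> (g, \<phi>)) = \<mu> \<xi>"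
proof -
  show "(g, \<phi>) \<in> Q S" "\<alpha> \<in> dual_space vel_add vel_scale (TQ S (g, \<phi>))"
    using assms by (auto simp: momentum_level_def cotangent_Q_def)
  have "momentum S ((g, \<phi>), \<alpha>) = \<mu>" using assms by (simp add: momentum_level_def)
  then show "\<alpha> (generator S \<xi> (g, \<phi>)) = \<mu> \<xi>" if "\<xi> \<in> X_vol S" for \<xi>
    using that unfolding momentum_def by (metis (no_types, lifting) fst_conv restrict_apply' snd_conv)
qed

lemma shifted_linear:
  assumes pc: "principal_connection S \<A>" and z: "((g, \<phi>), \<alpha>) \<in> momentum_level S \<mu>"
  shows "u \<in> TQ S (g, \<phi>) \<Longrightarrow> v \<in> TQ S (g, \<phi>) \<Longrightarrow>
      shifted \<A> ((g, \<phi>), \<alpha>) (vel_add u v) = shifted \<A> ((g, \<phi>), \<alpha>) u + shifted \<A> ((g, \<phi>), \<alpha>) v"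
    "v \<in> TQ S (g, \<phi>) \<Longrightarrow> shifted \<A> ((g, \<phi>), \<alpha>) (vel_scale c v) = c * shifted \<A> ((g, \<phi>), \<alpha>) v"
proof -
  note l = levelD[OF z] note a = dual_spaceD[OF l(2)] note co = connectionD[OF pc l(1)]
  show "shifted \<A> ((g, \<phi>), \<alpha>) (vel_add u v) = shifted \<A> ((g, \<phi>), \<alpha>) u + shifted \<A> ((g, \<phi>), \<alpha>) v"
    if uv: "u \<in> TQ S (g, \<phi>)" "v \<in> TQ S (g, \<phi>)"
    using a(2)[OF uv] \<mu>_add[OF co(1)[OF uv(1)] co(1)[OF uv(2)]] co(1)[OF TQ_vel_add[OF l(1) uv]]
    unfolding shifted_def fst_conv snd_conv co(2)[OF uv] by simp
  show "shifted \<A> ((g, \<phi>), \<alpha>) (vel_scale c v) = c * shifted \<A> ((g, \<phi>), \<alpha>) v" if v: "v \<in> TQ S (g, \<phi>)"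
    using a(3)[OF v] \<mu>_scale[OF co(1)[OF v]] co(1)[OF TQ_vel_scale[OF l(1) v]]
    unfolding shifted_def fst_conv snd_conv co(3)[OF v] by (simp add: right_diff_distrib)
qed

text \<open>A tangent vector differs from the lift of its rigid part by a generator, on which
  \<open>\<alpha>\<close> and \<open>\<langle>\<mu>, \<A>\<rangle>\<close> both equal
  \<open>\<mu>\<close>.\<close>

lemma shifted_horizontal:
  assumes pc: "principal_connection S \<A>" and z: "((g, \<phi>), \<alpha>) \<in> momentum_level S \<mu>" and v: "v \<in> TQ S (g, \<phi>)"
  shows "shifted \<A> ((g, \<phi>), \<alpha>) v = shifted \<A> ((g, \<phi>), \<alpha>) (lift_vel (g, \<phi>) (fst v))"
proof -
  note l = levelD[OF z] note co = connectionD[OF pc l(1)]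
  let ?s = "shifted \<A> ((g, \<phi>), \<alpha>)" and ?l = "lift_vel (g, \<phi>) (fst v)"
  have lT: "?l \<in> TQ S (g, \<phi>)" by (rule lift_vel_TQ[OF l(1) TQ_T_SE2[OF l(1) v]])
  obtain w where w: "vertical (g, \<phi>) v = (0, w)" using vertical_TQ(2)[OF l(1) v] by (metis prod.collapse)
  have wT: "(0, w) \<in> TQ S (g, \<phi>)" using vertical_TQ(1)[OF l(1) v] unfolding w .
  have X: "pull (g, \<phi>) w \<in> X_vol S" by (rule pull_X_vol[OF l(1) wT])
  have "?s (0, w) = 0"
    using l(3)[OF X] co(4)[OF X] unfolding generator_pull[OF l(1) wT] by (simp add: shifted_def)
  moreover have "?s (vertical (g, \<phi>) v) = ?s v + (- 1) * ?s ?l"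
    unfolding vertical_def shifted_linear(1)[OF pc z v TQ_vel_scale[OF l(1) lT]] shifted_linear(2)[OF pc z lT] ..
  ultimately show ?thesis unfolding w by simp
qed

lemma lift_vel_linear:
  "lift_vel q (u + v) = vel_add (lift_vel q u) (lift_vel q v)" "lift_vel q (c *\<^sub>R v) = vel_scale c (lift_vel q v)"
  by (auto simp: lift_vel_def vel_add_def vel_scale_def lift_field_linear fun_eq_iff)

lemma fst_lift_vel [simp]: "fst (lift_vel q g') = g'"
  by (simp add: lift_vel_def)

lemma reduced_coord_in:
  assumes pc: "principal_connection S \<A>" and z: "z \<in> momentum_level S \<mu>"
  shows "reduced_coord \<A> z \<in> cotangent_SE2_vortices S"
proof -
  obtain g \<phi> \<alpha> where zz: "z = ((g, \<phi>), \<alpha>)" by (metis surj_pair)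
  note z' = z[unfolded zz] note l = levelD[OF z']
  have "restrict (\<lambda>g'. shifted \<A> z (lift_vel (g, \<phi>) g')) (T_SE2 g) \<in> dual_space (+) (*\<^sub>R) (T_SE2 g)"
    unfolding zz
    by (rule dual_spaceI)
       (simp_all add: T_SE2_add T_SE2_scale lift_vel_linear shifted_linear[OF pc z'] lift_vel_TQ[OF l(1)])
  moreover have "(g, snd (proj xbar (g, \<phi>))) \<in> proj xbar ` Q S"
    using l(1) by (metis (no_types, lifting) fst_conv image_eqI proj_def snd_conv)
  ultimately show ?thesis
    unfolding proj_Q[OF Q_nonempty xbar_interior xbar_distinct] zz
    by (auto simp: reduced_coord_def cotangent_SE2_vortices_def cotangent_SE2_def)
qed

text \<open>Any configuration over the given position will do, with the covector \<open>\<alpha> = p +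
  \<langle>\<mu>, \<A>\<rangle>\<close>.\<close>

lemma reduced_coord_surj:
  assumes pc: "principal_connection S \<A>" and y: "y \<in> cotangent_SE2_vortices S"
  obtains z where "z \<in> momentum_level S \<mu>" "reduced_coord \<A> z = y"
proof -
  obtain g p x where yy: "y = ((g, p), x)" by (metis surj_pair)
  have p: "p \<in> dual_space (+) (*\<^sub>R) (T_SE2 g)" using y by (auto simp: yy cotangent_SE2_vortices_def cotangent_SE2_def)
  note pd = dual_spaceD[OF p]
  have p0: "p 0 = 0" using pd(3)[OF T_SE2_zero, of 0] by simp
  have "(g, x) \<in> proj xbar ` Q S"
    unfolding proj_Q[OF Q_nonempty xbar_interior xbar_distinct]
    using y by (auto simp: yy cotangent_SE2_vortices_def cotangent_SE2_def)
  then obtain \<phi> where q: "(g, \<phi>) \<in> Q S" "proj xbar (g, \<phi>) = (g, x)" by (auto simp: proj_def)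
  note co = connectionD[OF pc q(1)]
  define \<alpha> where "\<alpha> = restrict (\<lambda>v. p (fst v) + \<mu> (\<A> (g, \<phi>) v)) (TQ S (g, \<phi>))"
  have T: "fst v \<in> T_SE2 g" if "v \<in> TQ S (g, \<phi>)" for v by (rule TQ_T_SE2[OF q(1) that])
  have "\<alpha> \<in> dual_space vel_add vel_scale (TQ S (g, \<phi>))"
  proof (rule dual_spaceI)
    show "\<alpha> \<in> extensional (TQ S (g, \<phi>))" by (simp add: \<alpha>_def)
    show "\<alpha> (vel_add u v) = \<alpha> u + \<alpha> v" if uv: "u \<in> TQ S (g, \<phi>)" "v \<in> TQ S (g, \<phi>)" for u v
    proof -
      have "\<A> (g, \<phi>) (vel_add u v) \<in> X_vol S" by (rule co(1)[OF TQ_vel_add[OF q(1) uv]])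
      then have "\<mu> (\<A> (g, \<phi>) (vel_add u v)) = \<mu> (\<A> (g, \<phi>) u) + \<mu> (\<A> (g, \<phi>) v)"
        unfolding co(2)[OF uv] by (rule \<mu>_add[OF co(1)[OF uv(1)] co(1)[OF uv(2)]])
      then show ?thesis using uv TQ_vel_add[OF q(1) uv] pd(2)[OF T[OF uv(1)] T[OF uv(2)]] by (simp add: \<alpha>_def vel_add_def)
    qed
    show "\<alpha> (vel_scale c v) = c * \<alpha> v" if v: "v \<in> TQ S (g, \<phi>)" for c v
    proof -
      have "\<A> (g, \<phi>) (vel_scale c v) \<in> X_vol S" by (rule co(1)[OF TQ_vel_scale[OF q(1) v]])
      then have "\<mu> (\<A> (g, \<phi>) (vel_scale c v)) = c * \<mu> (\<A> (g, \<phi>) v)"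
        unfolding co(3)[OF v] by (rule \<mu>_scale[OF co(1)[OF v]])
      then show ?thesis using v TQ_vel_scale[OF q(1) v] pd(3)[OF T[OF v]] by (simp add: \<alpha>_def vel_scale_def distrib_left)
    qed
  qed
  moreover have "momentum S ((g, \<phi>), \<alpha>) = \<mu>"
  proof -
    have "\<alpha> (generator S \<xi> (g, \<phi>)) = \<mu> \<xi>" if "\<xi> \<in> X_vol S" for \<xi>
      using generator_TQ[OF q(1) that] co(4)[OF that] p0 by (simp add: \<alpha>_def) (simp add: generator_def)
    then have "momentum S ((g, \<phi>), \<alpha>) = restrict \<mu> (X_vol S)"
      unfolding momentum_def fst_conv snd_conv by (rule restrict_ext)
    then show ?thesis by (simp add: \<mu>_eq form_class_def)
  qed
  ultimately have z: "((g, \<phi>), \<alpha>) \<in> momentum_level S \<mu>" using q(1) by (simp add: momentum_level_def cotangent_Q_def)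
  have "restrict (\<lambda>g'. shifted \<A> ((g, \<phi>), \<alpha>) (lift_vel (g, \<phi>) g')) (T_SE2 g) = p"
  proof (rule extensionalityI[OF restrict_extensional pd(1)])
    fix g' assume "g' \<in> T_SE2 g"
    then show "restrict (\<lambda>g'. shifted \<A> ((g, \<phi>), \<alpha>) (lift_vel (g, \<phi>) g')) (T_SE2 g) g' = p g'"
      using lift_vel_TQ[OF q(1)] by (simp add: shifted_def \<alpha>_def)
  qed
  then have "reduced_coord \<A> ((g, \<phi>), \<alpha>) = y" using q(2) by (simp add: reduced_coord_def yy)
  with z show thesis by (rule that)
qed

text \<open>The relabelling is \<open>\<phi>1\<^sup>-\<^sup>1 \<circ> \<phi>2\<close>.\<close>

lemma relabelling:
  assumes q1: "(g, \<phi>1) \<in> Q S" and q2: "(g, \<phi>2) \<in> Q S" and pos: "\<And>i. \<phi>1 (xbar $ i) = \<phi>2 (xbar $ i)"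
  obtains f where "f \<in> Diff_vol_mu S xbar" "compose (fluid S) \<phi>1 f = \<phi>2"
proof -
  note n1 = near_id_Q_conf[OF q1] and n2 = near_id_Q_conf[OF q2]
  note c = near_id_compose[OF n2 near_id_sym[OF n1]]
  let ?g = "\<lambda>x. inv_into (fluid S) \<phi>1 (\<phi>2 x)"
  define f where "f = restrict ?g (fluid S)"
  have nf: "near_id (rate S) (fluid S) (fluid S) f (\<lambda>z. inv_into (fluid S) \<phi>2 (\<phi>1 z))"
    by (rule near_id_cong[OF c]) (auto simp: f_def)
  have \<phi>f: "\<phi>1 (f x) = \<phi>2 x" if "x \<in> fluid S" for x
    using near_idD(13)[OF n1] near_idD(10)[OF n2] that by (auto simp: f_def)
  have "f \<in> Diff_vol S"
  proof (rule near_id_Diff_vol[OF nf])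
    fix x assume x: "x \<in> fluid S"
    have fx: "f x \<in> fluid S" using near_idD(10)[OF nf] x by blast
    have "jac (fluid S) (\<lambda>x. \<phi>1 (f x)) x = jac (fluid S) \<phi>1 (f x) ** jac (fluid S) f x"
      by (rule jac_compose[OF fluid_exterior(1) near_idD(5)[OF nf] _ near_idD(5)[OF n1] x]) (use near_idD(10)[OF nf] in simp)
    moreover have "jac (fluid S) (\<lambda>x. \<phi>1 (f x)) x = jac (fluid S) \<phi>2 x"
      by (rule jac_cong[OF fluid_exterior(1) near_idD(5)[OF n2] x]) (simp add: \<phi>f)
    ultimately show "density S (f x) * det (jac (fluid S) f x) = density S x"
      using Q_det[OF q1 fx] Q_det[OF q2 x] by (metis det_mul)
  qed (simp add: f_def)
  moreover have "f (xbar $ i) = xbar $ i" for i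
    using near_idD(12)[OF n1 xbar_fluid] xbar_fluid pos[of i] by (simp add: f_def flip: pos)
  ultimately have "f \<in> Diff_vol_mu S xbar" by (simp add: Diff_vol_mu_iff)
  moreover have "compose (fluid S) \<phi>1 f = \<phi>2"
  proof (rule extensionalityI[OF compose_extensional])
    show "\<phi>2 \<in> extensional (fluid S)" using q2 by (auto simp: Q_def)
  qed (simp add: compose_eq \<phi>f)
  ultimately show thesis by (rule that)
qed

text \<open>Along an orbit the shifted covector is transported unchanged, by equivariance of \<open>\<A>\<close>
  and invariance of \<open>\<mu>\<close>. Conversely, equal coordinates give a relabelling between the
  configurations, and the covectors match because they are determined by their shifts.\<close>

lemma orbit_rel_iff:
  assumes pc: "principal_connection S \<A>" and z: "z \<in> momentum_level S \<mu>" and z': "z' \<in> momentum_level S \<mu>"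
  shows "(z, z') \<in> orbit_rel S xbar \<mu> \<longleftrightarrow> reduced_coord \<A> z = reduced_coord \<A> z'"
proof -
  obtain g \<phi> \<alpha> h \<phi>' \<alpha>' where zz: "z = ((g, \<phi>), \<alpha>)" "z' = ((h, \<phi>'), \<alpha>')" by (metis surj_pair)
  note l = levelD[OF z[unfolded zz]] and l' = levelD[OF z'[unfolded zz]]
  note a = dual_spaceD[OF l(2)] and a' = dual_spaceD[OF l'(2)]
  have transport: "shifted \<A> z (vel_act S (diff_inv S f) v) = \<alpha> (vel_act S (diff_inv S f) v) - \<mu> (\<A> (g, compose (fluid S) \<phi> f) v)"
    if f: "f \<in> Diff_vol_mu S xbar" and v: "v \<in> TQ S (g, compose (fluid S) \<phi> f)" for f v
  proof -
    have fD: "f \<in> Diff_vol S" using f by (simp add: Diff_vol_mu_iff)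
    note w = vel_act_inv_TQ[OF l(1) fD v]
    have "\<A> (g, compose (fluid S) \<phi> f) v = pull_field S f (\<A> (g, \<phi>) (vel_act S (diff_inv S f) v))"
      using connectionD(5)[OF pc l(1) fD w(1)] unfolding w(2) by (simp add: conf_act_def)
    then show ?thesis using \<mu>_invariant[OF f connectionD(1)[OF pc l(1) w(1)]] by (simp add: zz shifted_def)
  qed
  have fst_act: "fst (vel_act S f v) = fst v" for f v by (simp add: vel_act_def)
  show ?thesis
  proof
    assume "(z, z') \<in> orbit_rel S xbar \<mu>"
    then obtain f where f: "f \<in> Diff_vol_mu S xbar" "z' = cotangent_lift S f z" by (auto simp: orbit_rel_def)
    have fD: "f \<in> Diff_vol S" using f(1) by (simp add: Diff_vol_mu_iff)
    have e: "h = g" "\<phi>' = compose (fluid S) \<phi> f"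
      "\<alpha>' = restrict (\<lambda>v. \<alpha> (vel_act S (diff_inv S f) v)) (TQ S (g, compose (fluid S) \<phi> f))"
      using f(2) by (auto simp: zz cotangent_lift_def conf_act_def)
    have "shifted \<A> z (lift_vel (g, \<phi>) g') = shifted \<A> z' (lift_vel (g, \<phi>') g')" if g': "g' \<in> T_SE2 g" for g'
    proof -
      let ?v = "lift_vel (g, \<phi>') g'"
      have v: "?v \<in> TQ S (g, compose (fluid S) \<phi> f)" using lift_vel_TQ[OF l'(1)] g' unfolding e(1,2) by blast
      have "shifted \<A> z' ?v = \<alpha> (vel_act S (diff_inv S f) ?v) - \<mu> (\<A> (g, compose (fluid S) \<phi> f) ?v)"
        using v unfolding zz e shifted_def by simp
      also have "\<dots> = shifted \<A> z (vel_act S (diff_inv S f) ?v)" using transport[OF f(1) v] by simp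
      also have "\<dots> = shifted \<A> z (lift_vel (g, \<phi>) g')"
        using shifted_horizontal[OF pc z[unfolded zz] vel_act_inv_TQ(1)[OF l(1) fD v]] unfolding zz fst_act by simp
      finally show ?thesis ..
    qed
    then have "restrict (\<lambda>g'. shifted \<A> z (lift_vel (g, \<phi>) g')) (T_SE2 g) = restrict (\<lambda>g'. shifted \<A> z' (lift_vel (g, \<phi>') g')) (T_SE2 g)"
      by (rule restrict_ext)
    moreover have "snd (proj xbar (g, \<phi>)) = snd (proj xbar (g, \<phi>'))"
      using f(1) xbar_fluid by (simp add: proj_def e(2) compose_eq Diff_vol_mu_iff)
    ultimately show "reduced_coord \<A> z = reduced_coord \<A> z'" using e(1) by (simp add: reduced_coord_def zz)
  next
    assume eq: "reduced_coord \<A> z = reduced_coord \<A> z'"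
    have hg: "h = g" using eq by (simp add: reduced_coord_def zz)
    have R: "restrict (\<lambda>g'. shifted \<A> z (lift_vel (g, \<phi>) g')) (T_SE2 g) = restrict (\<lambda>g'. shifted \<A> z' (lift_vel (g, \<phi>') g')) (T_SE2 g)"
      using eq by (simp add: reduced_coord_def zz hg)
    have pos: "\<phi> (xbar $ i) = \<phi>' (xbar $ i)" for i
      using eq by (simp add: reduced_coord_def zz proj_def vec_eq_iff)
    obtain f where f: "f \<in> Diff_vol_mu S xbar" "compose (fluid S) \<phi> f = \<phi>'"
      using relabelling[OF l(1) l'(1)[unfolded hg] pos] by blast
    have fD: "f \<in> Diff_vol S" using f(1) by (simp add: Diff_vol_mu_iff)
    have "\<alpha>' = restrict (\<lambda>v. \<alpha> (vel_act S (diff_inv S f) v)) (TQ S (g, \<phi>'))"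
    proof (rule extensionalityI[OF a'(1)[unfolded hg] restrict_extensional])
      fix v assume v: "v \<in> TQ S (g, \<phi>')"
      have g': "fst v \<in> T_SE2 g" by (rule TQ_T_SE2[OF l'(1)[unfolded hg] v])
      have "\<alpha>' v - \<mu> (\<A> (g, \<phi>') v) = shifted \<A> z' v" by (simp add: shifted_def zz hg)
      also have "\<dots> = shifted \<A> z' (lift_vel (g, \<phi>') (fst v))"
        using shifted_horizontal[OF pc z'[unfolded zz hg] v] unfolding zz hg .
      also have "\<dots> = shifted \<A> z (lift_vel (g, \<phi>) (fst v))" using fun_cong[OF R, of "fst v"] g' by simp
      also have "\<dots> = shifted \<A> z (vel_act S (diff_inv S f) v)"
        using shifted_horizontal[OF pc z[unfolded zz] vel_act_inv_TQ(1)[OF l(1) fD v[folded f(2)]]] unfolding zz fst_act by simp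
      also have "\<dots> = \<alpha> (vel_act S (diff_inv S f) v) - \<mu> (\<A> (g, \<phi>') v)" using transport[OF f(1) v[folded f(2)]] unfolding f(2) .
      finally show "\<alpha>' v = restrict (\<lambda>v. \<alpha> (vel_act S (diff_inv S f) v)) (TQ S (g, \<phi>')) v" using v by simp
    qed
    then have "z' = cotangent_lift S f z" by (simp add: zz cotangent_lift_def conf_act_def hg f(2))
    then show "(z, z') \<in> orbit_rel S xbar \<mu>" using z z' f(1) by (auto simp: orbit_rel_def)
  qed
qed

text \<open>By \<open>orbit_rel_iff\<close> the orbits are the fibres of \<open>reduced_coord\<close>, so it
  descends to a bijection.\<close>

lemma reduction_exists:
  assumes pc: "principal_connection S \<A>"
  shows "\<exists>\<Phi>. bij_betw \<Phi> (reduced_space S xbar \<mu>) (cotangent_SE2_vortices S) \<and> realizes_reduction S xbar \<mu> \<A> \<Phi>"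
proof -
  let ?r = "orbit_rel S xbar \<mu>" and ?L = "momentum_level S \<mu>"
  define \<Phi> where "\<Phi> C = reduced_coord \<A> (SOME z. z \<in> C)" for C
  have cls: "?r `` {z} = {z' \<in> ?L. reduced_coord \<A> z' = reduced_coord \<A> z}" if "z \<in> ?L" for z
  proof -
    have "?r `` {z} \<subseteq> ?L" by (auto simp: orbit_rel_def)
    then show ?thesis using orbit_rel_iff[OF pc that] by auto
  qed
  have \<Phi>: "\<Phi> (?r `` {z}) = reduced_coord \<A> z" if "z \<in> ?L" for z
  proof -
    have "(SOME y. y \<in> ?r `` {z}) \<in> ?r `` {z}" by (rule someI[of _ z]) (use cls[OF that] that in simp)
    then show ?thesis unfolding \<Phi>_def using cls[OF that] by blast
  qed
  have "bij_betw \<Phi> (reduced_space S xbar \<mu>) (cotangent_SE2_vortices S)"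
    unfolding bij_betw_def
  proof
    show "inj_on \<Phi> (reduced_space S xbar \<mu>)"
    proof (rule inj_onI)
      fix C C' assume C: "C \<in> reduced_space S xbar \<mu>" "C' \<in> reduced_space S xbar \<mu>" and eq: "\<Phi> C = \<Phi> C'"
      obtain z where z: "z \<in> ?L" "C = ?r `` {z}" using C(1) unfolding reduced_space_def by (rule quotientE)
      obtain z' where z': "z' \<in> ?L" "C' = ?r `` {z'}" using C(2) unfolding reduced_space_def by (rule quotientE)
      have "reduced_coord \<A> z = reduced_coord \<A> z'" using eq unfolding z(2) z'(2) \<Phi>[OF z(1)] \<Phi>[OF z'(1)] .
      then show "C = C'" unfolding z(2) z'(2) cls[OF z(1)] cls[OF z'(1)] by simp
    qed
    show "\<Phi> ` reduced_space S xbar \<mu> = cotangent_SE2_vortices S"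
    proof (intro subset_antisym subsetI)
      fix y assume "y \<in> \<Phi> ` reduced_space S xbar \<mu>"
      then obtain C where C: "C \<in> ?L // ?r" "y = \<Phi> C" unfolding reduced_space_def by (elim imageE)
      obtain z where "z \<in> ?L" "C = ?r `` {z}" using C(1) by (rule quotientE)
      with C(2) show "y \<in> cotangent_SE2_vortices S" using \<Phi> reduced_coord_in[OF pc] by simp
    next
      fix y :: "(rigid \<times> (rigid \<Rightarrow> real)) \<times> (plane^'n)" assume "y \<in> cotangent_SE2_vortices S"
      then obtain z where z: "z \<in> ?L" "reduced_coord \<A> z = y" using reduced_coord_surj[OF pc] by blast
      then have "y = \<Phi> (?r `` {z})" "?r `` {z} \<in> reduced_space S xbar \<mu>"
        using \<Phi> by (auto simp: reduced_space_def quotientI)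
      then show "y \<in> \<Phi> ` reduced_space S xbar \<mu>" by blast
    qed
  qed
  moreover have "realizes_reduction S xbar \<mu> \<A> \<Phi>"
    unfolding realizes_reduction_def
  proof (intro ballI, clarify)
    fix g \<phi> \<alpha> assume z: "((g, \<phi>), \<alpha>) \<in> ?L"
    have "restrict (\<lambda>v. restrict (\<lambda>g'. shifted \<A> ((g, \<phi>), \<alpha>) (lift_vel (g, \<phi>) g')) (T_SE2 g) (fst v)) (T_SE2 g \<times> UNIV) (T_proj xbar v)
        = \<alpha> v - \<mu> (\<A> (g, \<phi>) v)" if v: "v \<in> TQ S (g, \<phi>)" for v
      using TQ_T_SE2[OF levelD(1)[OF z] v] shifted_horizontal[OF pc z v] by (simp add: T_proj_def shifted_def)
    then show "let (m, \<beta>) = incl (\<Phi> (?r `` {((g, \<phi>), \<alpha>)})) in m = proj xbar (g, \<phi>) \<and>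
        (\<forall>v\<in>TQ S (g, \<phi>). \<beta> (T_proj xbar v) = \<alpha> v - \<mu> (\<A> (g, \<phi>) v))"
      unfolding \<Phi>[OF z] reduced_coord_def fst_conv incl_simp by (simp add: proj_def)
  qed
  ultimately show ?thesis by blast
qed

end

theorem proposition4p3:
  fixes S :: body_fluid and \<Gamma> :: "real^'n::finite" and xbar :: "plane^'n" and a :: "plane \<Rightarrow> plane"
    and \<mu> :: "(plane \<Rightarrow> plane) \<Rightarrow> real"
  assumes "radius S > 0" and "rate S > 1"
    and "smooth_on (fluid S) (density S)" and "\<forall>x\<in>fluid S. density S x > 0"
    and "Q S \<noteq> {}"
    and "\<forall>i. xbar $ i \<in> interior (fluid S)" and "\<forall>i j. i \<noteq> j \<longrightarrow> xbar $ i \<noteq> xbar $ j"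
    and "has_vortices S \<Gamma> xbar a" and "\<mu> = form_class S a"
  shows "Diff_vol_mu S xbar \<subseteq> {f \<in> Diff_vol S. coadjoint S f \<mu> = \<mu>} \<and>
     ((\<forall>i. \<Gamma> $ i \<noteq> 0) \<and> (\<forall>i j. i \<noteq> j \<longrightarrow> \<Gamma> $ i \<noteq> \<Gamma> $ j) \<longrightarrow>
       Diff_vol_mu S xbar = {f \<in> Diff_vol S. coadjoint S f \<mu> = \<mu>}) \<and>
     inj_on incl (cotangent_SE2_vortices S :: (_ \<times> (plane^'n)) set) \<and>
     annihilator_bundle S xbar = incl ` cotangent_SE2_vortices S \<and>
     (\<exists>\<A>. principal_connection S \<A>) \<and>
     (\<forall>\<A>. principal_connection S \<A> \<longrightarrow>
       (\<exists>\<Phi>. bij_betw \<Phi> (reduced_space S xbar \<mu>) (cotangent_SE2_vortices S) \<and>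
             realizes_reduction S xbar \<mu> \<A> \<Phi>))"
proof -
  interpret vortex_setting S \<Gamma> xbar a \<mu> by unfold_locales (use assms in blast)+
  show ?thesis
    using isotropy_contains isotropy_eq inj_on_incl annihilator_bundle_eq principal_connection_cutoff reduction_exists by blast
qed

end
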